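(* Let $\kappa=(10\log(nd))^{2000}$. Assume there exists an algorithm for robust mean testing in $\mathbb{R}^d$ under $\kappa$-friendly oblivious $\varepsilon$-contamination that uses $n=f(d,\alpha,\varepsilon)$ samples and succeeds with probability $p>2/3$. Assume $n\le(1.1)^d$. Then there exists an algorithm for robust mean testing in $\mathbb{R}^d$ under (arbitrary) oblivious $\varepsilon/2$-contamination that succeeds with probability $p-0.01$ and uses $n\cdot\mathrm{poly}(\log(nd))$ samples.
   Context: Robust mean testing: distinguish the null hypothesis that the uncorrupted samples are i.i.d. $\mathcal{N}(0,I_d)$ from the alternative that they are i.i.d. $\mathcal{N}(\mu,I_d)$ with $\|\mu\|_2\ge\alpha$. Obliviously $\varepsilon$-contaminated samples: first $Y_1,\dots,Y_{\varepsilon n}$ are chosen adversarially (without seeing the data), then $Y_{\varepsilon n+1},\dots,Y_n$ are drawn i.i.d. from the distribution, and $Y_1,\dots,Y_n$ are randomly permuted to give $X_1,\dots,X_n$. A dataset $X_1,\dots,X_n\in\mathbb{R}^d$ is $\kappa$-friendly (w.r.t. $\varepsilon$) if: (1) for any disjoint $S,T\subset[n]$ of sizes $k_1,k_2\le\varepsilon n$, $\left|\left\langle\sum_{i\in S}X_i,\sum_{i\in T}X_i\right\rangle\right|\le\kappa\sqrt{k_1k_2}\max(\sqrt{\varepsilon nd},\varepsilon n)$; (2) for all distinct $i,j$, $|\langle X_i,X_j\rangle|\le\kappa\sqrt d$; (3) for all $i$, $\|X_i\|_2^2\in[d-\kappa\sqrt d,d+\kappa\sqrt d]$. An algorithm solves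 robust mean testing under $\kappa$-friendly oblivious $\varepsilon$-contamination with success probability $p$ if, for every oblivious adversary and under either hypothesis, with probability at least $p$ either the contaminated dataset is not $\kappa$-friendly or the algorithm outputs the correct hypothesis.
   Formalization: The formal theorem assumes α>0, 0<ε<1 and nd≥2; this excludes n=d=1, where log(nd)=0 gives κ=0, no Gaussian sample is κ-friendly, the assumption holds vacuously and the claim fails for small α. *)

theory Defs
  imports
    "HOL-Probability.Probability"
    "HOL-Combinatorics.Permutations"
    "HOL-Computational_Algebra.Polynomial"
begin

text \<open>
  The constants hidden in \<open>poly(log(nd))\<close> must not depend on the dimension, so \<open>d\<close> is quantified
  inside the statement and cannot be a type. A point of \<open>\<real>\<^sup>d\<close> is therefore an extensional function
  on \<open>{..<d}\<close>, and a dataset of \<open>n\<close> points is an extensional family on \<open>{..<n}\<close>.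
\<close>

definition point_space :: "nat \<Rightarrow> (nat \<Rightarrow> real) measure" where
  "point_space d = Pi\<^sub>M {..<d} (\<lambda>_. borel)"

definition data_space :: "nat \<Rightarrow> nat \<Rightarrow> (nat \<Rightarrow> nat \<Rightarrow> real) measure" where
  "data_space d n = Pi\<^sub>M {..<n} (\<lambda>_. point_space d)"

definition dot :: "nat \<Rightarrow> (nat \<Rightarrow> real) \<Rightarrow> (nat \<Rightarrow> real) \<Rightarrow> real" where
  "dot d u v = (\<Sum>j<d. u j * v j)"

definition norm2 :: "nat \<Rightarrow> (nat \<Rightarrow> real) \<Rightarrow> real" where
  "norm2 d u = L2_set u {..<d}"

text \<open>The law \<open>N(\<mu>, I\<^sub>d)\<close>.\<close>

definition gaussian :: "nat \<Rightarrow> (nat \<Rightarrow> real) \<Rightarrow> (nat \<Rightarrow> real) measure" where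
  "gaussian d \<mu> = Pi\<^sub>M {..<d} (\<lambda>j. density lborel (\<lambda>x. ennreal (normal_density (\<mu> j) 1 x)))"

text \<open>The number \<open>\<epsilon>n\<close> of corrupted points, rounded down to an integer.\<close>

definition num_corrupt :: "real \<Rightarrow> nat \<Rightarrow> nat" where
  "num_corrupt \<epsilon> n = nat \<lfloor>\<epsilon> * real n\<rfloor>"

definition adversaries :: "nat \<Rightarrow> real \<Rightarrow> nat \<Rightarrow> (nat \<Rightarrow> nat \<Rightarrow> real) set" where
  "adversaries d \<epsilon> n = {..<num_corrupt \<epsilon> n} \<rightarrow> space (point_space d)"

text \<open>
  The law of the dataset \<open>X\<close>: the points with index below \<open>num_corrupt \<epsilon> n\<close> are the adversary's
  \<open>y\<close>, fixed before anything is drawn; the remaining points \<open>z\<close> are i.i.d. from \<open>N(\<mu>, I\<^sub>d)\<close>; and a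
  uniformly random permutation \<open>\<sigma>\<close> is applied.
\<close>

definition contaminated ::
  "nat \<Rightarrow> real \<Rightarrow> nat \<Rightarrow> (nat \<Rightarrow> real) \<Rightarrow> (nat \<Rightarrow> nat \<Rightarrow> real) \<Rightarrow> (nat \<Rightarrow> nat \<Rightarrow> real) measure"
where
  "contaminated d \<epsilon> n \<mu> y =
     distr
       (Pi\<^sub>M {num_corrupt \<epsilon> n..<n} (\<lambda>_. gaussian d \<mu>)
          \<Otimes>\<^sub>M uniform_count_measure {\<sigma>. \<sigma> permutes {..<n}})
       (data_space d n)
       (\<lambda>(z, \<sigma>). \<lambda>i\<in>{..<n}. if \<sigma> i < num_corrupt \<epsilon> n then y (\<sigma> i) else z (\<sigma> i))"

definition friendly :: "nat \<Rightarrow> real \<Rightarrow> nat \<Rightarrow> real \<Rightarrow> (nat \<Rightarrow> nat \<Rightarrow> real) \<Rightarrow> bool" where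
  "friendly d \<epsilon> n \<kappa> X \<longleftrightarrow>
     (\<forall>S T. S \<subseteq> {..<n} \<and> T \<subseteq> {..<n} \<and> S \<inter> T = {} \<and>
            real (card S) \<le> \<epsilon> * real n \<and> real (card T) \<le> \<epsilon> * real n \<longrightarrow>
        \<bar>dot d (\<lambda>j. \<Sum>i\<in>S. X i j) (\<lambda>j. \<Sum>i\<in>T. X i j)\<bar>
          \<le> \<kappa> * sqrt (real (card S) * real (card T))
              * max (sqrt (\<epsilon> * real n * real d)) (\<epsilon> * real n)) \<and>
     (\<forall>i<n. \<forall>j<n. i \<noteq> j \<longrightarrow> \<bar>dot d (X i) (X j)\<bar> \<le> \<kappa> * sqrt (real d)) \<and>
     (\<forall>i<n. (norm2 d (X i))\<^sup>2 \<in> {real d - \<kappa> * sqrt (real d) .. real d + \<kappa> * sqrt (real d)})"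

datatype hypothesis = Null | Alternative

text \<open>
  An algorithm may use internal randomness: it maps a dataset to the distribution of its output
  (a Markov kernel from datasets to the two hypotheses).
\<close>

definition algorithms :: "nat \<Rightarrow> nat \<Rightarrow> ((nat \<Rightarrow> nat \<Rightarrow> real) \<Rightarrow> hypothesis pmf) set" where
  "algorithms d n = {A. \<forall>h. (\<lambda>X. pmf (A X) h) \<in> borel_measurable (data_space d n)}"

text \<open>
  The probability, over \<open>X\<close> drawn from \<open>D\<close> and the algorithm's own randomness, that \<open>X\<close> violates
  the promise \<open>G\<close> or the output is the correct hypothesis \<open>h\<close>.
\<close>

definition success_prob ::
  "((nat \<Rightarrow> nat \<Rightarrow> real) \<Rightarrow> bool) \<Rightarrow> ((nat \<Rightarrow> nat \<Rightarrow> real) \<Rightarrow> hypothesis pmf) \<Rightarrow>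
   (nat \<Rightarrow> nat \<Rightarrow> real) measure \<Rightarrow> hypothesis \<Rightarrow> real"
where
  "success_prob G A D h = (\<integral>X. measure_pmf.prob (A X) {b. \<not> G X \<or> b = h} \<partial>D)"

definition solves_mean_testing ::
  "nat \<Rightarrow> real \<Rightarrow> real \<Rightarrow> nat \<Rightarrow> ((nat \<Rightarrow> nat \<Rightarrow> real) \<Rightarrow> bool) \<Rightarrow> real \<Rightarrow>
   ((nat \<Rightarrow> nat \<Rightarrow> real) \<Rightarrow> hypothesis pmf) \<Rightarrow> bool"
where
  "solves_mean_testing d \<alpha> \<epsilon> n G p A \<longleftrightarrow>
     A \<in> algorithms d n \<and>
     (\<forall>y \<in> adversaries d \<epsilon> n.
        success_prob G A (contaminated d \<epsilon> n (\<lambda>_. 0) y) Null \<ge> p \<and>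
        (\<forall>\<mu>. norm2 d \<mu> \<ge> \<alpha> \<longrightarrow>
           success_prob G A (contaminated d \<epsilon> n \<mu> y) Alternative \<ge> p))"

definition solves_friendly ::
  "nat \<Rightarrow> real \<Rightarrow> real \<Rightarrow> real \<Rightarrow> nat \<Rightarrow> real \<Rightarrow>
   ((nat \<Rightarrow> nat \<Rightarrow> real) \<Rightarrow> hypothesis pmf) \<Rightarrow> bool"
where
  "solves_friendly d \<alpha> \<epsilon> \<kappa> n p A \<longleftrightarrow> solves_mean_testing d \<alpha> \<epsilon> n (friendly d \<epsilon> n \<kappa>) p A"

definition solves_oblivious ::
  "nat \<Rightarrow> real \<Rightarrow> real \<Rightarrow> nat \<Rightarrow> real \<Rightarrow>
   ((nat \<Rightarrow> nat \<Rightarrow> real) \<Rightarrow> hypothesis pmf) \<Rightarrow> bool"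
where
  "solves_oblivious d \<alpha> \<epsilon> n p A \<longleftrightarrow> solves_mean_testing d \<alpha> \<epsilon> n (\<lambda>_. True) p A"

end

theory Submission
 imports Defs
begin

text \<open>
  Write \<open>h = 10 log(nd)\<close> and \<open>f = \<lfloor>\<epsilon>n\<rfloor>\<close>; at most \<open>4n\<close> samples are needed. There are three regimes.

  If \<open>2f \<ge> n\<close>, half of the points \<open>N(\<mu>, I)\<close> and half \<open>N(0, I)\<close> is a possible dataset under both hypotheses, and it is
  friendly with high probability unless \<open>\<parallel>\<mu>\<parallel>\<^sup>2\<close> exceeds \<open>sqrt(d/n) + 1\<close> by a power of \<open>h\<close>. For such large means a direct test
  works: look for a subset of the size of the genuine sample in which every point is aligned with the sum of the others.

  Otherwise the data are screened and the given algorithm is run on the surviving points. The screening must not bias the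
  genuine points: on typical data it has to coincide with an ideal screening that never looks at the genuine points it
  keeps. If \<open>\<epsilon>n \<le> h^20\<close>, removing pairs with large inner product suffices, with a random threshold. If \<open>\<epsilon>n > h^20\<close>, small
  random subsets of the sample are sacrificed to find test directions, and points with a large inner product with a test
  direction are discarded. If two disjoint sets of surviving points had too large a correlation, a random part of one of
  them would be a test that discards many points of the other. Hence each round of tests halves the maximal correlation,
  and logarithmically many rounds make the survivors friendly. If most fresh points fail a test, the mean is nonzero.
\<close>

text \<open>The friendliness bound ranges over exponentially many pairs of sets. Deleting the
  violating sets would use the genuine points, and the survivors would no longer be an oblivious
  contamination. What can be afforded are polynomially many test directions computed from sacrificed
  points only: a fresh Gaussian point has, up to its mean, a small inner product with each of them,
  and the mean enters all fresh points alike, so that they pass or fail together. The difficulty is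
  to show that so few tests suffice. A test made of k points is charged k + 1 and has to discard
  points in proportion to its charge; this makes the union bound over all families of tests converge
  and limits the number of tests in use. In the case of many corrupted points the sample size 4n
  leaves the necessary room: \<epsilon>/2-contamination of 4n points means at most 2\<epsilon>n
  corrupted ones, and a random selection at rate 2/5 contains, with high probability, at most
  \<epsilon>n of these but still n genuine points that were not sacrificed.\<close>

abbreviation (input) rcard :: "'a set => real" where "rcard S \<equiv> real (card S)"

abbreviation (input) pprob :: "'a pmf => 'a set => real" where "pprob p \<equiv> measure_pmf.prob p"

section \<open>Averages over random subsets, first-moment method and Chernoff bounds\<close>

text \<open>The expectation of \<open>F\<close> over a random subset of \<open>A\<close> that
  contains each element independently with probability \<open>q\<close>. As a finite sum it yields
  to induction over \<open>A\<close>; \<open>random_subset\<close> is the same law as a pmf, and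
  \<open>expectation_random_subset\<close> connects the two.\<close>

definition subset_avg :: "real => 'a set => ('a set => real) => real" where
 "subset_avg q A F = (\<Sum>b\<in>Pow A. q ^ card b * (1 - q) ^ card (A - b) * F b)"

lemma subset_avg_empty [simp]: "subset_avg q {} F = F {}"
 by (simp add: subset_avg_def)

lemma subset_avg_insert:
 assumes "finite A" "x \<notin> A"
 shows "subset_avg q (insert x A) F = (1 - q) * subset_avg q A F + q * subset_avg q A (%b. F (insert x b))"
proof -
 let ?w = "%b. q ^ card b * (1 - q) ^ card (insert x A - b) * F b"
 have inj: "inj_on (insert x) (Pow A)"
  using assms(2) by (auto simp: inj_on_def)
 have "subset_avg q (insert x A) F = (\<Sum>b\<in>Pow A. ?w b) + (\<Sum>b\<in>insert x ` Pow A. ?w b)"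
  unfolding subset_avg_def Pow_insert
  by (rule sum.union_disjoint) (use assms in auto)
 also have "(\<Sum>b\<in>insert x ` Pow A. ?w b) = (\<Sum>b\<in>Pow A. ?w (insert x b))"
  by (simp add: sum.reindex[OF inj])
 also have "... = q * subset_avg q A (%b. F (insert x b))"
  unfolding subset_avg_def sum_distrib_left
 proof (rule sum.cong)
  fix b assume b: "b \<in> Pow A"
  hence "finite b" "x \<notin> b" using assms by (auto intro: finite_subset)
  hence "card (insert x b) = Suc (card b)" "insert x A - insert x b = A - b"
   using assms by auto
  thus "?w (insert x b) = q * (q ^ card b * (1 - q) ^ card (A - b) * F (insert x b))"
   by simp
 qed simp
 also have "(\<Sum>b\<in>Pow A. ?w b) = (1 - q) * subset_avg q A F"
  unfolding subset_avg_def sum_distrib_left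
 proof (rule sum.cong)
  fix b assume b: "b \<in> Pow A"
  hence "insert x A - b = insert x (A - b)" using assms by auto
  hence "card (insert x A - b) = Suc (card (A - b))"
   using assms by simp
  thus "?w b = (1 - q) * (q ^ card b * (1 - q) ^ card (A - b) * F b)"
   by simp
 qed simp
 finally show ?thesis by simp
qed

lemma subset_avg_add: "subset_avg q A (%b. F b + H b) = subset_avg q A F + subset_avg q A H"
 by (simp add: subset_avg_def algebra_simps sum.distrib)

lemma subset_avg_cmult: "subset_avg q A (%b. c * F b) = c * subset_avg q A F"
 by (simp add: subset_avg_def algebra_simps sum_distrib_left)

lemma subset_avg_divide: "subset_avg q A (%b. F b / c) = subset_avg q A F / c"
 using subset_avg_cmult[of q A "1/c" F] by simp

lemma subset_avg_diff: "subset_avg q A (%b. F b - H b) = subset_avg q A F - subset_avg q A H"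
 by (simp add: subset_avg_def algebra_simps sum_subtractf)

lemma subset_avg_sum: "subset_avg q A (%b. \<Sum>i\<in>I. F i b) = (\<Sum>i\<in>I. subset_avg q A (F i))"
 unfolding subset_avg_def sum_distrib_left by (rule sum.swap)

lemma subset_avg_const: "finite A ==> subset_avg q A (%_. c) = c"
 by (induction A rule: finite_induct) (auto simp: subset_avg_insert algebra_simps)

lemma subset_avg_mono:
 assumes "0 <= q" "q <= 1" "\<And>b. b <= A ==> F b <= H b"
 shows "subset_avg q A F <= subset_avg q A H"
 unfolding subset_avg_def using assms by (intro sum_mono mult_left_mono) auto

lemma subset_avg_cong: "(\<And>b. b <= A ==> F b = H b) ==> subset_avg q A F = subset_avg q A H"
 unfolding subset_avg_def by (intro sum.cong) auto

text \<open>First-moment method: the minimum is at most the average.\<close>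

lemma subset_avg_exists_le:
 assumes "finite A" "0 <= q" "q <= 1" "subset_avg q A F <= c"
 shows "\<exists>b\<subseteq>A. F b <= c"
proof (rule ccontr)
 assume "~ (\<exists>b\<subseteq>A. F b <= c)"
 hence gt: "\<And>b. b \<in> Pow A ==> F b > c" by (metis PowD not_less)
 have "Min (F ` Pow A) \<in> F ` Pow A" using assms(1) by (intro Min_in) auto
 hence "Min (F ` Pow A) > c" using gt by auto
 moreover have "subset_avg q A (%_. Min (F ` Pow A)) <= subset_avg q A F"
  using assms by (intro subset_avg_mono) auto
 ultimately show False using assms by (simp add: subset_avg_const)
qed

lemma subset_avg_sum_elements:
 assumes "finite A"
 shows "subset_avg q A (%b. \<Sum>y\<in>b. w y) = q * (\<Sum>y\<in>A. w y)"
 using assms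
proof (induction A rule: finite_induct)
 case (insert x A)
 have "subset_avg q A (%b. \<Sum>y\<in>insert x b. w y) = subset_avg q A (%b. w x + (\<Sum>y\<in>b. w y))"
  using insert.hyps by (intro subset_avg_cong) (subst sum.insert, auto intro: finite_subset)
 thus ?case using insert
  by (simp add: subset_avg_insert subset_avg_add subset_avg_const algebra_simps)
qed simp

lemma subset_avg_quadratic:
 assumes "finite A"
 shows "subset_avg q A (%b. \<Sum>i\<in>b. \<Sum>j\<in>b. G i j) =
  q\<^sup>2 * (\<Sum>i\<in>A. \<Sum>j\<in>A. G i j) + q * (1 - q) * (\<Sum>i\<in>A. G i i)"
 using assms
proof (induction A rule: finite_induct)
 case (insert x A)
 have exp: "(\<Sum>i\<in>insert x b. \<Sum>j\<in>insert x b. G i j) =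
  G x x + (\<Sum>y\<in>b. G x y + G y x) + (\<Sum>i\<in>b. \<Sum>j\<in>b. G i j)" if "b <= A" for b
 proof -
  have "finite b" "x \<notin> b" using that insert.hyps by (auto intro: finite_subset)
  thus ?thesis by (simp add: sum.distrib algebra_simps)
 qed
 have "subset_avg q A (%b. \<Sum>i\<in>insert x b. \<Sum>j\<in>insert x b. G i j) =
   subset_avg q A (%b. G x x + (\<Sum>y\<in>b. G x y + G y x) + (\<Sum>i\<in>b. \<Sum>j\<in>b. G i j))"
  by (rule subset_avg_cong) (rule exp)
 also have "... = G x x + q * (\<Sum>y\<in>A. G x y + G y x) + subset_avg q A (%b. \<Sum>i\<in>b. \<Sum>j\<in>b. G i j)"
  using insert.hyps by (simp add: subset_avg_add subset_avg_const subset_avg_sum_elements)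
 finally have *: "subset_avg q A (%b. \<Sum>i\<in>insert x b. \<Sum>j\<in>insert x b. G i j) =
  G x x + q * (\<Sum>y\<in>A. G x y + G y x) + subset_avg q A (%b. \<Sum>i\<in>b. \<Sum>j\<in>b. G i j)" .
 show ?case
  unfolding subset_avg_insert[OF insert.hyps] * insert.IH exp[OF subset_refl] sum.insert[OF insert.hyps]
  by (simp add: algebra_simps power2_eq_square sum.distrib)
qed simp

lemma subset_avg_variance:
 assumes "finite A"
 shows "subset_avg q A (%b. ((\<Sum>y\<in>b. w y) - q * (\<Sum>y\<in>A. w y))\<^sup>2) = q * (1 - q) * (\<Sum>y\<in>A. (w y)\<^sup>2)"
proof -
 let ?s = "\<Sum>y\<in>A. w y"
 have "subset_avg q A (%b. ((\<Sum>y\<in>b. w y) - q * ?s)\<^sup>2) =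
  subset_avg q A (%b. (\<Sum>i\<in>b. \<Sum>j\<in>b. w i * w j) - (2 * q * ?s) * (\<Sum>y\<in>b. w y) + (q * ?s)\<^sup>2)"
  by (rule subset_avg_cong) (simp add: power2_eq_square algebra_simps sum_product)
 also have "... = q\<^sup>2 * (\<Sum>i\<in>A. \<Sum>j\<in>A. w i * w j) + q * (1 - q) * (\<Sum>i\<in>A. w i * w i)
   - 2 * q * ?s * (q * ?s) + (q * ?s)\<^sup>2"
  using assms by (simp add: subset_avg_add subset_avg_diff subset_avg_cmult subset_avg_const
    subset_avg_sum_elements subset_avg_quadratic)
 also have "(\<Sum>i\<in>A. \<Sum>j\<in>A. w i * w j) = ?s * ?s" by (simp add: sum_product)
 finally show ?thesis by (simp add: power2_eq_square algebra_simps)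
qed

text \<open>The generating function of a binomial variable. With \<open>c\<close> an exponential it
  is the moment needed for the Chernoff bounds.\<close>

lemma subset_avg_power_card:
 assumes "finite A"
 shows "subset_avg q A (%b. c ^ card (b Int B)) = (1 - q + q * c) ^ card (A Int B)"
 using assms
proof (induction A rule: finite_induct)
 case (insert x A)
 have "subset_avg q A (%b. c ^ card (insert x b Int B)) =
   (if x \<in> B then c else 1) * subset_avg q A (%b. c ^ card (b Int B))"
  unfolding subset_avg_cmult[symmetric]
 proof (rule subset_avg_cong)
  fix b assume "b <= A"
  hence "finite b" "x \<notin> b" using insert.hyps by (auto intro: finite_subset)
  thus "c ^ card (insert x b Int B) = (if x \<in> B then c else 1) * c ^ card (b Int B)"
   by (simp add: Int_insert_left)
 qed
 thus ?case using insert
  by (simp add: subset_avg_insert Int_insert_left algebra_simps)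
qed simp

lemma subset_avg_prob_le:
 assumes "0 <= q" "q <= 1" "\<And>b. b <= A ==> P b ==> 1 <= F b" "\<And>b. b <= A ==> 0 <= F b"
 shows "subset_avg q A (%b. of_bool (P b)) <= subset_avg q A F"
 using assms by (intro subset_avg_mono) (auto simp: of_bool_def)

text \<open>Chernoff bounds with a multiplicative and an additive error, which survive a union bound over
  sets of all sizes.\<close>

lemma subset_avg_lower_tail:
 assumes "finite A" "B <= A" "0 <= q" "q <= 1" "0 < \<eta>" "\<eta> <= 1"
 shows "subset_avg q A (%b. of_bool (rcard (b Int B) < (1 - \<eta>) * q * card B - s)) <= exp (- (2 * \<eta> * s))"
proof -
 \<comment> \<open>With the exponent \<open>2 * \<eta>\<close> the quadratic term
   \<open>?l\<^sup>2 / 2\<close> in the expansion of \<open>exp (- ?l)\<close> is compensated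
   exactly by the relative slack \<eta>, so only the additive slack \<open>s\<close> is left in the
   final bound.\<close>
 let ?k = "rcard B" and ?l = "2 * \<eta>"
 have AB: "A Int B = B" using assms by auto
 have "subset_avg q A (%b. of_bool (rcard (b Int B) < (1 - \<eta>) * q * ?k - s)) <=
    subset_avg q A (%b. exp (?l * ((1 - \<eta>) * q * ?k - s)) * exp (- ?l) ^ card (b Int B))"
 proof (rule subset_avg_prob_le)
  fix b assume lt: "rcard (b Int B) < (1 - \<eta>) * q * ?k - s"
  have "0 <= ?l * ((1 - \<eta>) * q * ?k - s - rcard (b Int B))"
   using lt assms by (intro mult_nonneg_nonneg) auto
  hence "1 <= exp (?l * ((1 - \<eta>) * q * ?k - s - rcard (b Int B)))" by simp
  also have "... = exp (?l * ((1 - \<eta>) * q * ?k - s)) * exp (- ?l) ^ card (b Int B)"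
   by (simp add: exp_of_nat_mult[symmetric] exp_add[symmetric] algebra_simps)
  finally show "1 <= exp (?l * ((1 - \<eta>) * q * ?k - s)) * exp (- ?l) ^ card (b Int B)" .
 qed (use assms in auto)
 also have "... = exp (?l * ((1 - \<eta>) * q * ?k - s)) * (1 - q + q * exp (- ?l)) ^ card B"
  using assms by (simp add: subset_avg_cmult subset_avg_power_card AB)
 finally have 1: "subset_avg q A (%b. of_bool (rcard (b Int B) < (1 - \<eta>) * q * ?k - s)) <=
  exp (?l * ((1 - \<eta>) * q * ?k - s)) * (1 - q + q * exp (- ?l)) ^ card B" .
 have "(1 - q + q * exp (- ?l)) <= exp (- (q * (?l - ?l\<^sup>2 / 2)))"
 proof -
  have "exp (- ?l) <= 1 - ?l + ?l\<^sup>2 / 2"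
  proof -
   \<comment> \<open>The third-order Lagrange remainder is nonpositive at a negative argument, so
     the second-order expansion is an upper bound.\<close>
   obtain t where t: "\<bar>t\<bar> <= \<bar>- ?l\<bar>" "exp (- ?l) = (\<Sum>m<3. (- ?l) ^ m / fact m) + exp t / fact 3 * (- ?l) ^ 3"
    using Maclaurin_exp_le[of "- ?l" 3] by blast
   have "exp t / fact 3 * (- ?l) ^ 3 <= 0"
    using assms by (simp add: mult_le_0_iff power3_eq_cube)
   thus ?thesis using t(2) by (simp add: eval_nat_numeral)
  qed
  hence "1 - q + q * exp (- ?l) <= 1 - q + q * (1 - ?l + ?l\<^sup>2 / 2)"
   using assms by (intro add_left_mono mult_left_mono) auto
  also have "... = 1 + - (q * (?l - ?l\<^sup>2 / 2))" by (simp add: algebra_simps)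
  also have "... <= exp (- (q * (?l - ?l\<^sup>2 / 2)))" by (rule exp_ge_add_one_self)
  finally show ?thesis .
 qed
 hence "(1 - q + q * exp (- ?l)) ^ card B <= exp (- (q * (?l - ?l\<^sup>2 / 2))) ^ card B"
  using assms by (intro power_mono) auto
 also have "exp (- (q * (?l - ?l\<^sup>2 / 2))) ^ card B = exp (- (?k * q * (?l - ?l\<^sup>2 / 2)))"
  by (simp add: exp_of_nat_mult[symmetric] algebra_simps)
 finally have "exp (?l * ((1 - \<eta>) * q * ?k - s)) * (1 - q + q * exp (- ?l)) ^ card B <=
   exp (?l * ((1 - \<eta>) * q * ?k - s)) * exp (- (?k * q * (?l - ?l\<^sup>2 / 2)))"
  by (rule mult_left_mono) simp
 also have "... = exp (- (2 * \<eta> * s))"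
  by (simp add: exp_add[symmetric] algebra_simps power2_eq_square)
 finally show ?thesis using 1 by linarith
qed

lemma subset_avg_upper_tail:
 assumes "finite A" "B <= A" "0 <= q" "q <= 1" "0 < \<eta>" "\<eta> <= 1"
 shows "subset_avg q A (%b. of_bool (rcard (b Int B) > (1 + \<eta>) * q * card B + s)) <= exp (- (\<eta> * s))"
proof -
 let ?k = "rcard B"
 have AB: "A Int B = B" using assms by auto
 have "subset_avg q A (%b. of_bool (rcard (b Int B) > (1 + \<eta>) * q * ?k + s)) <=
    subset_avg q A (%b. exp (- (\<eta> * ((1 + \<eta>) * q * ?k + s))) * exp \<eta> ^ card (b Int B))"
 proof (rule subset_avg_prob_le)
  fix b assume lt: "rcard (b Int B) > (1 + \<eta>) * q * ?k + s"
  have "0 <= \<eta> * (rcard (b Int B) - ((1 + \<eta>) * q * ?k + s))"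
   using lt assms by (intro mult_nonneg_nonneg) auto
  hence "1 <= exp (\<eta> * (rcard (b Int B) - ((1 + \<eta>) * q * ?k + s)))" by simp
  also have "... = exp (- (\<eta> * ((1 + \<eta>) * q * ?k + s))) * exp \<eta> ^ card (b Int B)"
   by (simp add: exp_of_nat_mult[symmetric] exp_add[symmetric] algebra_simps)
  finally show "1 <= exp (- (\<eta> * ((1 + \<eta>) * q * ?k + s))) * exp \<eta> ^ card (b Int B)" .
 qed (use assms in auto)
 also have "... = exp (- (\<eta> * ((1 + \<eta>) * q * ?k + s))) * (1 - q + q * exp \<eta>) ^ card B"
  using assms by (simp add: subset_avg_cmult subset_avg_power_card AB)
 finally have 1: "subset_avg q A (%b. of_bool (rcard (b Int B) > (1 + \<eta>) * q * ?k + s)) <=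
  exp (- (\<eta> * ((1 + \<eta>) * q * ?k + s))) * (1 - q + q * exp \<eta>) ^ card B" .
 have "(1 - q + q * exp \<eta>) <= exp (q * (\<eta> + \<eta>\<^sup>2))"
 proof -
  \<comment> \<open>The exponent is half that of the lower tail: here the second-order term is
    \<open>\<eta>\<^sup>2\<close>, which \<open>\<eta> * (1 + \<eta>)\<close> compensates
    exactly.\<close>
  have "exp \<eta> <= 1 + \<eta> + \<eta>\<^sup>2" using assms by (intro exp_bound) auto
  hence "1 - q + q * exp \<eta> <= 1 - q + q * (1 + \<eta> + \<eta>\<^sup>2)"
   using assms by (intro add_left_mono mult_left_mono) auto
  also have "... = 1 + q * (\<eta> + \<eta>\<^sup>2)" by (simp add: algebra_simps)
  also have "... <= exp (q * (\<eta> + \<eta>\<^sup>2))" by (rule exp_ge_add_one_self)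
  finally show ?thesis .
 qed
 hence "(1 - q + q * exp \<eta>) ^ card B <= exp (q * (\<eta> + \<eta>\<^sup>2)) ^ card B"
  using assms by (intro power_mono) auto
 also have "exp (q * (\<eta> + \<eta>\<^sup>2)) ^ card B = exp (?k * q * (\<eta> + \<eta>\<^sup>2))"
  by (simp add: exp_of_nat_mult[symmetric] algebra_simps)
 finally have "exp (- (\<eta> * ((1 + \<eta>) * q * ?k + s))) * (1 - q + q * exp \<eta>) ^ card B <=
   exp (- (\<eta> * ((1 + \<eta>) * q * ?k + s))) * exp (?k * q * (\<eta> + \<eta>\<^sup>2))"
  by (rule mult_left_mono) simp
 also have "... = exp (- (\<eta> * s))"
  by (simp add: exp_add[symmetric] algebra_simps power2_eq_square)
 finally show ?thesis using 1 by linarith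
qed

definition random_subset :: "real => 'a set => 'a set pmf" where
 "random_subset q A = map_pmf (%c. {x\<in>A. c x}) (Pi_pmf A False (%_. bernoulli_pmf q))"

lemma random_subset_insert:
 assumes "finite A" "x \<notin> A"
 shows "random_subset q (insert x A) =
  bind_pmf (bernoulli_pmf q) (%c. map_pmf (%b. if c then insert x b else b) (random_subset q A))"
proof -
 have "random_subset q (insert x A) = bind_pmf (bernoulli_pmf q) (%c.
   map_pmf (%u. {y\<in>insert x A. (u(x:=c)) y}) (Pi_pmf A False (%_. bernoulli_pmf q)))"
  unfolding random_subset_def Pi_pmf_insert'[OF assms]
  by (simp add: map_pmf_def bind_assoc_pmf bind_return_pmf)
 also have "... = bind_pmf (bernoulli_pmf q) (%c. map_pmf (%b. if c then insert x b else b) (random_subset q A))"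
  unfolding random_subset_def map_pmf_comp
  by (intro bind_pmf_cong map_pmf_cong refl) (use assms in auto)
 finally show ?thesis .
qed

lemma set_random_subset: "set_pmf (random_subset q A) <= Pow A"
 by (auto simp: random_subset_def)

lemma expectation_random_subset:
 assumes "finite A" "0 <= q" "q <= 1"
 shows "measure_pmf.expectation (random_subset q A) F = subset_avg q A F"
 using assms(1)
proof (induction A arbitrary: F rule: finite_induct)
 case empty
 thus ?case by (simp add: random_subset_def)
next
 case (insert x A)
 have fin: "finite (set_pmf (random_subset q A))"
  using finite_subset[OF set_random_subset] insert.hyps by auto
 have "measure_pmf.expectation (random_subset q (insert x A)) F =
  (\<Sum>c\<in>{False, True}. pmf (bernoulli_pmf q) c *\<^sub>R
    measure_pmf.expectation (map_pmf (%b. if c then insert x b else b) (random_subset q A)) F)"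
  unfolding random_subset_insert[OF insert.hyps] using fin
  by (intro pmf_expectation_bind) auto
 thus ?case
  using assms by (simp add: insert.IH subset_avg_insert[OF insert.hyps])
qed

lemma prob_random_subset:
 assumes "finite A" "0 <= q" "q <= 1"
 shows "pprob (random_subset q A) {b. P b} = subset_avg q A (%b. of_bool (P b))"
proof -
 have "pprob (random_subset q A) {b. P b} =
  measure_pmf.expectation (random_subset q A) (indicator {b. P b})"
  by simp
 also have "indicator {b. P b} = (%b. of_bool (P b) :: real)" by (auto simp: indicator_def)
 finally show ?thesis by (simp only: expectation_random_subset[OF assms])
qed

text \<open>Union bound for an experiment in two stages: either the first stage fails, or the second
  one fails after a good outcome of the first. The error probabilities of the iterated filter are
  added up in this way.\<close>

lemma prob_bind_le:
 assumes "pprob p {x. ~ G x} <= a"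
  and "\<And>x. x \<in> set_pmf p ==> G x ==> pprob (f x) S <= b" and "0 <= b"
 shows "pprob (bind_pmf p f) S <= a + b"
proof -
 have "pprob (bind_pmf p f) S = (\<integral>x. pprob (f x) S \<partial>measure_pmf p)"
  unfolding measure_pmf_bind
  by (subst measure_pmf.measure_bind[where N="count_space UNIV"]) (auto simp: measure_pmf_in_subprob_algebra)
 also have "... <= (\<integral>x. indicator {x. ~ G x} x + b \<partial>measure_pmf p)"
 proof (rule integral_mono_AE)
  show "integrable (measure_pmf p) (%x. pprob (f x) S)"
   by (intro measure_pmf.integrable_const_bound[where B=1]) auto
  show "AE x in measure_pmf p. pprob (f x) S <= indicator {x. ~ G x} x + b"
  proof (rule AE_pmfI)
   fix x assume x: "x \<in> set_pmf p"
   show "pprob (f x) S <= indicator {x. ~ G x} x + b"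
    using assms(2)[OF x] assms(3) measure_pmf.prob_le_1[of "f x" S]
    by (cases "G x") (auto simp: indicator_def intro: order_trans)
  qed
 qed (auto intro!: measure_pmf.integrable_const_bound[where B="1 + b"] simp: indicator_def assms(3))
 also have "... = pprob p {x. ~ G x} + b"
  by (subst Bochner_Integration.integral_add)
    (auto intro!: measure_pmf.integrable_const_bound[where B=1] simp: indicator_def)
 finally show ?thesis using assms(1) by linarith
qed

lemma subset_avg_union_bound:
 assumes "finite I" "0 <= q" "q <= 1" "\<And>i. i \<in> I ==> subset_avg q A (%b. of_bool (P i b)) <= e i"
 shows "subset_avg q A (%b. of_bool (\<exists>i\<in>I. P i b)) <= (\<Sum>i\<in>I. e i)"
proof -
 have "subset_avg q A (%b. of_bool (\<exists>i\<in>I. P i b)) <= subset_avg q A (%b. \<Sum>i\<in>I. of_bool (P i b))"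
 proof (rule subset_avg_prob_le)
  fix b assume "\<exists>i\<in>I. P i b"
  then obtain i where "i \<in> I" "P i b" by blast
  thus "1 <= (\<Sum>i\<in>I. of_bool (P i b) :: real)"
   using member_le_sum[of i I "%i. of_bool (P i b) :: real"] assms(1) by auto
 qed (use assms in \<open>auto intro: sum_nonneg\<close>)
 also have "... = (\<Sum>i\<in>I. subset_avg q A (%b. of_bool (P i b)))" by (rule subset_avg_sum)
 also have "... <= (\<Sum>i\<in>I. e i)" by (rule sum_mono) (rule assms(4))
 finally show ?thesis .
qed

section \<open>Families of tests, their price, and immunity\<close>

definition covered :: "('a => 'b => bool) => 'a set => 'b set => 'a set" where
 "covered tst Y V = {i\<in>Y. \<exists>f\<in>V. tst i f}"

text \<open>The price of a family of tests. In the application a test is a set of points whose sum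
  is the test direction. There are about \<open>N ^ k\<close> such sets of size \<open>k\<close>, so
  a price that grows with \<open>card f\<close> pays for a union bound over them; the summand 1
  charges for the number of tests.\<close>

definition weight :: "'a set set => real" where
 "weight V = (\<Sum>f\<in>V. rcard f + 1)"

text \<open>A penalised maximum coverage. Which maximiser is taken does not matter, but the choice
  depends on nothing except the outcome of the tests on \<open>Y\<close>; this is what
  \<open>best_cover_cong\<close> exploits.\<close>

definition best_cover :: "('a => 'b set => bool) => 'b set set => 'a set => real => 'b set set" where
 "best_cover tst Fam Y c = (SOME V. V <= Fam & (\<forall>V'\<subseteq>Fam.
   rcard (covered tst Y V') - c * weight V' <= rcard (covered tst Y V) - c * weight V))"

lemma weight_nonneg: "0 <= weight V"
 by (auto simp: weight_def intro!: sum_nonneg)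

lemma weight_empty [simp]: "weight {} = 0"
 by (simp add: weight_def)

lemma weight_ge_1: "finite V ==> V ~= {} ==> 1 <= weight V"
proof -
 assume V: "finite V" "V ~= {}"
 then obtain f where f: "f \<in> V" by auto
 have "rcard f + 1 <= weight V"
  unfolding weight_def using member_le_sum[OF f, of "%f. rcard f + 1"] V by auto
 thus ?thesis by linarith
qed

lemma weight_Un_le: "finite V ==> finite V' ==> weight (V Un V') <= weight V + weight V'"
 using sum.union_inter[of V V' "%f. rcard f + 1"] weight_nonneg[of "V Int V'"]
 unfolding weight_def by linarith

lemma card_le_weight: "finite V ==> rcard V <= weight V"
proof -
 have "rcard V = (\<Sum>f\<in>V. 1)" by simp
 also have "... <= weight V" unfolding weight_def by (rule sum_mono) auto
 finally show ?thesis .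
qed

lemma covered_empty [simp]: "covered tst Y {} = {}"
 by (simp add: covered_def)

lemma covered_Int: "covered tst (Z Int b) V = b Int covered tst Z V"
 by (auto simp: covered_def)

lemma covered_Un: "covered tst Z (V Un V') = covered tst Z V Un (covered tst Z V' - covered tst Z V)"
 by (auto simp: covered_def)

lemma covered_subset: "covered tst Z V <= Z"
 by (auto simp: covered_def)

lemma best_cover:
 assumes "finite Fam"
 shows "best_cover tst Fam Y c <= Fam"
  and "\<And>V'. V' <= Fam ==> rcard (covered tst Y V') - c * weight V' <=
   real (card (covered tst Y (best_cover tst Fam Y c))) - c * weight (best_cover tst Fam Y c)"
proof -
 let ?g = "%V. rcard (covered tst Y V) - c * weight V"
 have fin: "finite (?g ` Pow Fam)" "?g ` Pow Fam ~= {}" using assms by auto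
 then obtain V where V: "V \<in> Pow Fam" "Max (?g ` Pow Fam) = ?g V" using Max_in by blast
 have "\<exists>V. V <= Fam & (\<forall>V'\<subseteq>Fam. ?g V' <= ?g V)"
  using V Max_ge[OF fin(1)] by (intro exI[of _ V]) force
 from someI_ex[OF this] show "best_cover tst Fam Y c <= Fam"
  and "\<And>V'. V' <= Fam ==> ?g V' <= ?g (best_cover tst Fam Y c)"
  unfolding best_cover_def[symmetric] by auto
qed

text \<open>The empty family has value 0, so an optimal family cannot cost more than it
  covers.\<close>

lemma best_cover_weight_le:
 assumes "finite Fam" "finite Y" "0 <= c"
 shows "c * weight (best_cover tst Fam Y c) <= rcard Y"
proof -
 have "0 <= real (card (covered tst Y (best_cover tst Fam Y c))) - c * weight (best_cover tst Fam Y c)"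
  using best_cover(2)[OF assms(1), of "{}" tst Y c] by simp
 moreover have "card (covered tst Y (best_cover tst Fam Y c)) <= card Y"
  by (rule card_mono[OF assms(2) covered_subset])
 ultimately show ?thesis by linarith
qed

text \<open>A dichotomy: families that pay for themselves at price \<open>c\<close> may exist, but
  they flag at most \<open>m\<close> points. Successive rounds halve \<open>m\<close> at the expense
  of a slightly higher price; once \<open>m < 1\<close> and \<open>c > 0\<close>, no nonempty family
  pays for itself.\<close>

definition immune :: "('a => 'b set => bool) => 'b set set => real => real => 'a set => bool" where
 "immune tst Fam c m Z \<longleftrightarrow> (\<forall>V\<subseteq>Fam. c * weight V <= rcard (covered tst Z V) --> rcard (covered tst Z V) <= m)"

text \<open>Let \<open>V\<close> be optimal on the sample \<open>Z Int b\<close>. As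
  \<open>V\<close> pays there, it pays on \<open>Z\<close> at the old price, and immunity yields
  \<open>c * weight V <= m\<close>. A further family \<open>V'\<close> cannot improve the objective,
  so it flags few sampled points outside \<open>covered tst Z V\<close>. By the lower tail it then
  flags few points there altogether, too few to pay the new price, unless the sampling error
  proportional to \<open>weight V\<close> dominates. That error is a small fraction of
  \<open>m\<close>, which leaves at most \<open>m / 2\<close> points.\<close>

lemma immune_step_deterministic:
 fixes R :: real
 assumes fin: "finite Fam" "finite Z"
  and par: "1 <= R" "0 < \<rho>" "0 < a" "\<eta> = 1 / (16 * R)" "16 * a * R / \<rho> <= c0" "c0 <= c" "c + c0 / R <= 2 * c0"
  and inv: "immune tst Fam c m Z"
  and up: "\<And>V. V <= Fam ==> rcard (b Int covered tst Z V) <= (1 + \<eta>) * \<rho> * card (covered tst Z V) + a * (weight V + 1)"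
  and lo: "\<And>V V'. V <= Fam ==> V' <= Fam ==>
    (1 - \<eta>) * \<rho> * card (covered tst Z V' - covered tst Z V) - a * (weight V + weight V' + 1)
     <= real (card (b Int (covered tst Z V' - covered tst Z V)))"
  and V: "V = best_cover tst Fam (Z Int b) ((c + c0 / R / 2) * \<rho>)"
 shows "immune tst Fam (c + c0 / R) (m / 2) (Z - b - covered tst Z V)"
proof -
 define \<delta> where "\<delta> = c0 / R"
 \<comment> \<open>Halfway between the old price \<open>c\<close> and the new price
   \<open>c + \<delta>\<close>: one half of the increase absorbs the sampling error for
   \<open>V\<close>, the other half that for \<open>V'\<close>.\<close>
 define c' where "c' = c + \<delta> / 2"
 have c0: "0 < c0" using par by (smt (verit) divide_pos_pos mult_pos_pos)
 have \<delta>: "0 < \<delta>" using c0 par by (simp add: \<delta>_def)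
 have a_le: "2 * a / \<rho> <= \<delta> / 8"
  using par c0 unfolding \<delta>_def by (simp add: field_simps)
 \<comment> \<open>Together with \<open>a_le\<close>: the relative and the additive sampling error
   each cost at most an eighth of the price increase \<delta>.\<close>
 have \<eta>: "0 < \<eta>" "\<eta> <= 1" "\<eta> * (2 * c0) = \<delta> / 8"
  using par(1) unfolding \<delta>_def par(4) by auto
 have VF: "V <= Fam" using best_cover(1)[OF fin(1)] V by simp
 have finV: "finite V'" if "V' <= Fam" for V' using that fin finite_subset by blast
 have fcov: "finite (covered tst Z V')" for V' using fin covered_subset finite_subset by metis
 have max: "rcard (b Int covered tst Z V') - c' * \<rho> * weight V' <= rcard (b Int covered tst Z V) - c' * \<rho> * weight V"
  if "V' <= Fam" for V'
  using best_cover(2)[OF fin(1) that, of tst "Z Int b" "c' * \<rho>"] V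
  by (simp add: covered_Int c'_def \<delta>_def)
 have DV: "c * weight V <= m"
 proof (cases "V = {}")
  case True
  have "0 <= m" using inv unfolding immune_def by (auto dest!: spec[of _ "{}"])
  thus ?thesis using True by simp
 next
  case False
  let ?A = "rcard (covered tst Z V)"
  have w: "1 <= weight V" using False VF finV weight_ge_1 by blast
  have "c' * \<rho> * weight V <= rcard (b Int covered tst Z V)" using max[of "{}"] by simp
  also have "... <= (1 + \<eta>) * \<rho> * ?A + a * (weight V + 1)" by (rule up[OF VF])
  also have "a * (weight V + 1) <= 2 * a * weight V" using w par by (simp add: algebra_simps)
  also have "2 * a * weight V = \<rho> * (2 * a / \<rho> * weight V)" using par by simp
  also have "... <= \<rho> * (\<delta> / 8 * weight V)"
   using a_le par w by (intro mult_left_mono mult_right_mono) auto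
  finally have "\<rho> * (c' * weight V) <= \<rho> * ((1 + \<eta>) * ?A + \<delta> / 8 * weight V)"
   by (simp add: algebra_simps)
  hence 1: "c' * weight V <= (1 + \<eta>) * ?A + \<delta> / 8 * weight V" using par by simp
  have "(1 + \<eta>) * c <= c' - \<delta> / 8"
  proof -
   have "\<eta> * c <= \<eta> * (2 * c0)" using par \<eta> \<delta> by (intro mult_left_mono) (auto simp: \<delta>_def)
   thus ?thesis using \<eta>(3) \<delta> by (simp add: c'_def algebra_simps)
  qed
  hence "(1 + \<eta>) * c * weight V <= (c' - \<delta> / 8) * weight V" using w by (intro mult_right_mono) auto
  hence "(1 + \<eta>) * (c * weight V) <= (1 + \<eta>) * ?A" using 1 by (simp add: algebra_simps)
  hence "c * weight V <= ?A" using \<eta> by simp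
  moreover from this have "?A <= m" using inv VF unfolding immune_def by blast
  ultimately show ?thesis by linarith
 qed
 show ?thesis unfolding immune_def
 proof (intro allI impI)
  fix V' assume V': "V' <= Fam"
   and large: "(c + c0 / R) * weight V' <= real (card (covered tst (Z - b - covered tst Z V) V'))"
  define A where "A = covered tst Z V' - covered tst Z V"
  have sub: "covered tst (Z - b - covered tst Z V) V' <= A" by (auto simp: A_def covered_def)
  have finA: "finite A" using fcov by (simp add: A_def)
  have cA: "real (card (covered tst (Z - b - covered tst Z V) V')) <= card A"
   using card_mono[OF finA sub] by simp
  show "real (card (covered tst (Z - b - covered tst Z V) V')) <= m / 2"
  proof (cases "V' = {}")
   case True
   have "0 <= c * weight V" using c0 par weight_nonneg[of V] by simp
   thus ?thesis using True DV by simp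
  next
   case False
   have w': "1 <= weight V'" using False V' finV weight_ge_1 by blast
   \<comment> \<open>The competitor to the optimum \<open>V\<close> is
     \<open>V Un V'\<close>.\<close>
   have "real (card (b Int covered tst Z (V Un V'))) - c' * \<rho> * weight (V Un V')
     <= rcard (b Int covered tst Z V) - c' * \<rho> * weight V"
    by (rule max) (use VF V' in auto)
   moreover have "card (b Int covered tst Z (V Un V')) = card (b Int covered tst Z V) + card (b Int A)"
    unfolding covered_Un A_def Int_Un_distrib
    by (rule card_Un_disjoint) (use fcov in auto)
   moreover have "c' * \<rho> * weight (V Un V') <= c' * \<rho> * (weight V + weight V')"
    using weight_Un_le[OF finV[OF VF] finV[OF V']] c0 par \<delta>
    by (intro mult_left_mono) (auto simp: c'_def)
   ultimately have "rcard (b Int A) <= c' * \<rho> * weight V'" by (simp add: algebra_simps)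
   hence "(1 - \<eta>) * \<rho> * card A - a * (weight V + weight V' + 1) <= c' * \<rho> * weight V'"
    using lo[OF VF V'] unfolding A_def by linarith
   moreover have "a * (weight V + weight V' + 1) <= a * weight V + 2 * a * weight V'"
    using w' par by (simp add: algebra_simps)
   moreover have "2 * a * weight V' <= \<rho> * (\<delta> / 8 * weight V')"
   proof -
    have "2 * a * weight V' = \<rho> * (2 * a / \<rho> * weight V')" using par by simp
    also have "... <= \<rho> * (\<delta> / 8 * weight V')"
     using a_le par w' by (intro mult_left_mono mult_right_mono) auto
    finally show ?thesis .
   qed
   moreover have "a * weight V <= \<rho> * (m / (16 * R))"
   proof -
    have "16 * R * a * weight V <= \<rho> * (c0 * weight V)"
    proof -
     have "16 * R * a <= \<rho> * c0" using par by (simp add: field_simps)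
     thus ?thesis using weight_nonneg[of V] mult_right_mono[of "16 * R * a" "\<rho> * c0" "weight V"]
      by (simp add: mult.assoc)
    qed
    also have "c0 * weight V <= c * weight V" using par weight_nonneg by (intro mult_right_mono) auto
    also note DV
    finally show ?thesis using par by (simp add: field_simps)
   qed
   ultimately have "\<rho> * ((1 - \<eta>) * card A) <= \<rho> * ((c' + \<delta> / 8) * weight V' + m / (16 * R))"
    by (simp add: algebra_simps)
   hence 2: "(1 - \<eta>) * card A <= (c' + \<delta> / 8) * weight V' + m / (16 * R)" using par by simp
   have "(c + \<delta>) * weight V' <= card A" using large cA by (simp add: \<delta>_def)
   moreover have "c' + \<delta> / 8 = (c + \<delta>) - 3 * \<delta> / 8" by (simp add: c'_def)
   moreover have "(c + \<delta> - 3 * \<delta> / 8) <= (1 - 3 / (16 * R)) * (c + \<delta>)"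
   proof -
    have "3 / (16 * R) * (c + \<delta>) <= 3 / (16 * R) * (2 * c0)"
     using par by (intro mult_left_mono) (auto simp: \<delta>_def)
    also have "... = 3 * \<delta> / 8" using par by (simp add: \<delta>_def field_simps)
    finally show ?thesis unfolding left_diff_distrib mult_1 by linarith
   qed
   ultimately have "(c' + \<delta> / 8) * weight V' <= (1 - 3 / (16 * R)) * card A"
   proof -
    have "(c' + \<delta> / 8) * weight V' <= (1 - 3 / (16 * R)) * (c + \<delta>) * weight V'"
     using \<open>c' + \<delta> / 8 = (c + \<delta>) - 3 * \<delta> / 8\<close> \<open>(c + \<delta> - 3 * \<delta> / 8) <= (1 - 3 / (16 * R)) * (c + \<delta>)\<close> w'
     by (intro mult_right_mono) auto
    also have "... = (1 - 3 / (16 * R)) * ((c + \<delta>) * weight V')" by simp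
    also have "... <= (1 - 3 / (16 * R)) * card A"
     using \<open>(c + \<delta>) * weight V' <= card A\<close> par by (intro mult_left_mono) auto
    finally show ?thesis .
   qed
   hence "(1 - \<eta>) * card A <= (1 - 3 / (16 * R)) * card A + m / (16 * R)" using 2 by linarith
   hence "2 / (16 * R) * card A <= m / (16 * R)"
    by (simp add: par(4) algebra_simps)
   hence "card A <= m / 2" using par by (simp add: field_simps)
   thus ?thesis using cA by linarith
  qed
 qed
qed

text \<open>The sum over families factorises over single tests, and \<open>1 + x <= exp x\<close>
  turns the product into the exponential of a sum over tests.\<close>

lemma sum_exp_weight_le:
 assumes "finite Fam"
 shows "(\<Sum>V\<in>Pow Fam. exp (- (\<beta> * weight V))) <= exp (\<Sum>f\<in>Fam. exp (- (\<beta> * (rcard f + 1))))"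
proof -
 have "(\<Sum>V\<in>Pow Fam. exp (- (\<beta> * weight V))) =
    (\<Sum>V\<in>Pow Fam. (\<Prod>f\<in>V. exp (- (\<beta> * (rcard f + 1)))) * (\<Prod>f\<in>Fam - V. 1))"
 proof (rule sum.cong)
  fix V assume "V \<in> Pow Fam"
  hence "finite V" using assms finite_subset by blast
  thus "exp (- (\<beta> * weight V)) = (\<Prod>f\<in>V. exp (- (\<beta> * (rcard f + 1)))) * (\<Prod>f\<in>Fam - V. 1)"
   by (simp add: weight_def exp_sum[symmetric] sum_distrib_left sum_negf)
 qed simp
 also have "... = (\<Prod>f\<in>Fam. exp (- (\<beta> * (rcard f + 1))) + 1)"
  by (rule prod_add[OF assms, symmetric])
 also have "... <= (\<Prod>f\<in>Fam. exp (exp (- (\<beta> * (rcard f + 1)))))"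
  by (intro prod_mono) (auto simp: add.commute intro: exp_ge_add_one_self add_nonneg_nonneg)
 also have "... = exp (\<Sum>f\<in>Fam. exp (- (\<beta> * (rcard f + 1))))"
  using assms by (simp add: exp_sum)
 finally show ?thesis .
qed

lemma sum_exp_card:
 fixes \<beta> :: real
 assumes "finite P"
 shows "(\<Sum>f\<in>Pow P. exp (- (\<beta> * rcard f))) = (1 + exp (- \<beta>)) ^ card P"
proof -
 have "(1 + exp (- \<beta>)) ^ card P = (\<Prod>x\<in>P. exp (- \<beta>) + 1)" by (simp add: add.commute)
 also have "... = (\<Sum>f\<in>Pow P. (\<Prod>x\<in>f. exp (- \<beta>)) * (\<Prod>x\<in>P - f. 1))"
  by (rule prod_add[OF assms])
 also have "... = (\<Sum>f\<in>Pow P. exp (- (\<beta> * rcard f)))"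
  by (rule sum.cong) (auto simp: exp_of_nat_mult[symmetric] algebra_simps)
 finally show ?thesis by simp
qed

lemma sum_exp_card_le:
 fixes \<beta> :: real
 assumes "finite P" "rcard P * exp (- \<beta>) <= 1"
 shows "(\<Sum>f\<in>Pow P. exp (- (\<beta> * rcard f))) <= 3"
proof -
 have "(1 + exp (- \<beta>)) ^ card P <= exp (exp (- \<beta>)) ^ card P"
  by (intro power_mono) (auto simp: add_nonneg_nonneg)
 also have "... = exp (rcard P * exp (- \<beta>))" by (simp add: exp_of_nat_mult)
 also have "... <= exp 1" using assms by simp
 also have "... <= 3" using exp_le by simp
 finally show ?thesis using sum_exp_card[OF assms(1)] by simp
qed

text \<open>The deterministic step needs its sampling bounds for all families and all pairs of
  families at once. An additive slack proportional to the price gives failure probabilities of order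
  \<open>exp (- (\<beta> * weight V))\<close>, whose sum over all families is at most 3. The
  constant 12 is 3 for single families plus \<open>3 * 3\<close> for pairs.\<close>

lemma immune_step_prob:
 fixes R :: real
 assumes fin: "finite Fam" "finite A" "Z <= A"
  and par: "1 <= R" "0 < \<rho>" "\<rho> <= 1" "0 < \<beta>" "16 * (16 * R * \<beta>) * R / \<rho> <= c0" "c0 <= c" "c + c0 / R <= 2 * c0"
  and inv: "immune tst Fam c m Z"
  and Fam: "(\<Sum>f\<in>Fam. exp (- (\<beta> * (rcard f + 1)))) <= 1"
 shows "pprob (random_subset \<rho> A)
  {b. ~ immune tst Fam (c + c0 / R) (m / 2) (Z - b - covered tst Z (best_cover tst Fam (Z Int b) ((c + c0 / R / 2) * \<rho>)))}
  <= 12 * exp (- \<beta>)"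
proof -
 define \<eta> where "\<eta> = 1 / (16 * R)"
 define a where "a = 16 * R * \<beta>"
 have \<eta>: "0 < \<eta>" "\<eta> <= 1" using par by (auto simp: \<eta>_def field_simps)
 have a: "0 < a" "\<eta> * a = \<beta>" using par by (auto simp: a_def \<eta>_def)
 have finZ: "finite Z" using fin finite_subset by blast
 let ?up = "%V b. rcard (b Int covered tst Z V) > (1 + \<eta>) * \<rho> * card (covered tst Z V) + a * (weight V + 1)"
 let ?lo = "%p b. real (card (b Int (covered tst Z (snd p) - covered tst Z (fst p)))) <
   (1 - \<eta>) * \<rho> * card (covered tst Z (snd p) - covered tst Z (fst p)) - a * (weight (fst p) + weight (snd p) + 1)"
 have S: "(\<Sum>V\<in>Pow Fam. exp (- (\<beta> * weight V))) <= 3"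
 proof -
  have "(\<Sum>V\<in>Pow Fam. exp (- (\<beta> * weight V))) <= exp 1"
   using sum_exp_weight_le[OF fin(1), of \<beta>] Fam by (meson exp_le_cancel_iff order_trans)
  thus ?thesis using exp_le by simp
 qed
 have S0: "0 <= (\<Sum>V\<in>Pow Fam. exp (- (\<beta> * weight V)))" by (intro sum_nonneg) auto
 have covA: "covered tst Z V <= A" for V using fin covered_subset[of tst Z V] by auto
 have U: "subset_avg \<rho> A (%b. of_bool (\<exists>V\<in>Pow Fam. ?up V b)) <= 3 * exp (- \<beta>)"
 proof -
  have "subset_avg \<rho> A (%b. of_bool (\<exists>V\<in>Pow Fam. ?up V b)) <= (\<Sum>V\<in>Pow Fam. exp (- (\<eta> * (a * (weight V + 1)))))"
   using fin par \<eta> covA by (intro subset_avg_union_bound subset_avg_upper_tail) auto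
  also have "... = exp (- \<beta>) * (\<Sum>V\<in>Pow Fam. exp (- (\<beta> * weight V)))"
   unfolding sum_distrib_left mult.assoc[symmetric] a(2)
   by (rule sum.cong) (auto simp: exp_add[symmetric] algebra_simps)
  also have "... <= exp (- \<beta>) * 3" by (intro mult_left_mono S) auto
  finally show ?thesis by simp
 qed
 have L: "subset_avg \<rho> A (%b. of_bool (\<exists>p\<in>Pow Fam \<times> Pow Fam. ?lo p b)) <= 9 * exp (- \<beta>)"
 proof -
  have each: "subset_avg \<rho> A (%b. of_bool (?lo p b)) <= exp (- (2 * \<eta> * (a * (weight (fst p) + weight (snd p) + 1))))" for p
   using fin par \<eta> covA by (intro subset_avg_lower_tail) auto
  have "subset_avg \<rho> A (%b. of_bool (\<exists>p\<in>Pow Fam \<times> Pow Fam. ?lo p b)) <=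
    (\<Sum>p\<in>Pow Fam \<times> Pow Fam. exp (- (2 * \<eta> * (a * (weight (fst p) + weight (snd p) + 1)))))"
   by (rule subset_avg_union_bound[OF _ _ _ each]) (use fin par in auto)
  also have "... <= (\<Sum>p\<in>Pow Fam \<times> Pow Fam. exp (- \<beta>) * (exp (- (\<beta> * weight (fst p))) * exp (- (\<beta> * weight (snd p)))))"
  proof (rule sum_mono)
   fix p assume "p \<in> Pow Fam \<times> Pow Fam"
   have "2 * \<eta> * (a * (weight (fst p) + weight (snd p) + 1)) = 2 * \<beta> * (weight (fst p) + weight (snd p) + 1)"
    using a(2) by (simp add: mult.assoc[symmetric])
   also have "... \<ge> \<beta> + \<beta> * weight (fst p) + \<beta> * weight (snd p)"
    using par weight_nonneg[of "fst p"] weight_nonneg[of "snd p"] by (simp add: algebra_simps)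
   finally show "exp (- (2 * \<eta> * (a * (weight (fst p) + weight (snd p) + 1)))) <=
    exp (- \<beta>) * (exp (- (\<beta> * weight (fst p))) * exp (- (\<beta> * weight (snd p))))"
    by (simp add: exp_add[symmetric])
  qed
  also have "... = exp (- \<beta>) * ((\<Sum>V\<in>Pow Fam. exp (- (\<beta> * weight V))) * (\<Sum>V\<in>Pow Fam. exp (- (\<beta> * weight V))))"
   by (subst sum_product, subst sum.cartesian_product) (simp add: split_beta sum_distrib_left)
  also have "... <= exp (- \<beta>) * (3 * 3)"
   by (intro mult_left_mono mult_mono S S0) auto
  finally show ?thesis by simp
 qed
 let ?bad = "%b. ~ immune tst Fam (c + c0 / R) (m / 2) (Z - b - covered tst Z (best_cover tst Fam (Z Int b) ((c + c0 / R / 2) * \<rho>)))"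
 have "pprob (random_subset \<rho> A) {b. ?bad b} = subset_avg \<rho> A (%b. of_bool (?bad b))"
  using fin par by (intro prob_random_subset) auto
 also have "... <= subset_avg \<rho> A (%b. of_bool (\<exists>V\<in>Pow Fam. ?up V b) + of_bool (\<exists>p\<in>Pow Fam \<times> Pow Fam. ?lo p b))"
 proof (rule subset_avg_prob_le)
  fix b assume bad: "?bad b"
  have "(\<exists>V\<in>Pow Fam. ?up V b) \<or> (\<exists>p\<in>Pow Fam \<times> Pow Fam. ?lo p b)"
  proof (rule ccontr)
   assume "~ ?thesis"
   hence up: "\<And>V. V <= Fam ==> ~ ?up V b" and lo: "\<And>V V'. V <= Fam ==> V' <= Fam ==> ~ ?lo (V, V') b"
    by auto
   have "~ ?bad b"
    unfolding not_not
   proof (rule immune_step_deterministic[OF fin(1) finZ par(1,2) a(1) \<eta>_def _ par(6,7) inv _ _ refl])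
    show "16 * a * R / \<rho> <= c0" using par by (simp add: a_def)
   qed (use up lo in \<open>force simp: not_less\<close>)+
   thus False using bad by blast
  qed
  thus "1 <= of_bool (\<exists>V\<in>Pow Fam. ?up V b) + (of_bool (\<exists>p\<in>Pow Fam \<times> Pow Fam. ?lo p b) :: real)"
   by (auto simp: of_bool_def)
 qed (use par in auto)
 also have "... <= 12 * exp (- \<beta>)" using U L by (simp add: subset_avg_add)
 finally show ?thesis .
qed

section \<open>Correlations of sets of points and their amplification to tests\<close>

text \<open>For a Gram matrix \<open>G\<close> this is the inner product of two sums of points. The
  whole analysis of the filter is phrased through \<open>G\<close>, without vectors.\<close>

definition pair_sum :: "('a => 'a => real) => 'a set => 'a set => real" where
 "pair_sum G S T = (\<Sum>i\<in>S. \<Sum>j\<in>T. G i j)"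

text \<open>The first condition of friendliness, with \<open>M\<close> for \<epsilon>n and a
  variable level \<Lambda>.\<close>

definition correlation_le :: "('a => 'a => real) => real => 'a set => real => bool" where
 "correlation_le G M Z \<Lambda> \<longleftrightarrow> (\<forall>S T. S <= Z & T <= Z & S Int T = {} & rcard S <= M & rcard T <= M -->
   \<bar>pair_sum G S T\<bar> <= \<Lambda> * sqrt (rcard S * rcard T))"

text \<open>For a Gram matrix: the inner product of point \<open>i\<close> with the sum of the
  points in \<open>f\<close> is more than \<open>thr\<close> times the norm of that sum. A centred
  Gaussian point independent of \<open>f\<close> does this with probability at most
  \<open>2 * exp (- (thr\<^sup>2 / 2))\<close>.\<close>

definition exceeds :: "real => ('a => 'a => real) => 'a => 'a set => bool" where
 "exceeds thr G i f \<longleftrightarrow> \<bar>\<Sum>j\<in>f. G i j\<bar> > thr * sqrt (pair_sum G f f)"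

text \<open>The pool meets every half-space whose normal is plus or minus a sum of points at no less
  than half the expected rate, up to an error. The error grows with \<open>card U\<close>, as the
  union bound over \<open>U\<close> demands, so the property is useful for small \<open>U\<close>
  only.\<close>

definition pool_representative :: "('a => 'a => real) => real => real => 'a set => 'a set => bool" where
 "pool_representative G \<rho> \<beta> Z p \<longleftrightarrow> (\<forall>U s \<tau>. U <= Z & s \<in> {1, - 1} -->
   \<rho> / 2 * real (card {x\<in>Z - U. \<tau> <= s * (\<Sum>j\<in>U. G x j)}) - \<beta> * (rcard U + 2)
    <= real (card (p Int {x\<in>Z - U. \<tau> <= s * (\<Sum>j\<in>U. G x j)})))"

lemma pair_sum_empty [simp]: "pair_sum G {} T = 0" "pair_sum G S {} = 0"
 by (auto simp: pair_sum_def)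

lemma pair_sum_commute:
 assumes "\<And>i j. G i j = G j i"
 shows "pair_sum G S T = pair_sum G T S"
 unfolding pair_sum_def by (subst sum.swap) (simp add: assms)

text \<open>Although \<tau> is real, only finitely many of the half-spaces differ on
  \<open>Z\<close>: a threshold can be raised to the least value attained in the set. So
  \<open>U\<close>, a sign and one point of \<open>Z\<close> index the union bound.\<close>

lemma prob_pool_not_representative:
 assumes fin: "finite A" "Z <= A" and par: "0 < \<rho>" "\<rho> <= 1" "0 < \<beta>" "rcard A * exp (- \<beta>) <= 1"
 shows "pprob (random_subset \<rho> A) {p. ~ pool_representative G \<rho> \<beta> Z p} <= 6 * exp (- \<beta>)"
proof -
 have finZ: "finite Z" using fin finite_subset by blast
 let ?R = "%U s \<tau>. {x\<in>Z - U. \<tau> <= s * (\<Sum>j\<in>U. G x j)}"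
 let ?I = "Pow Z \<times> {1, - 1 :: real} \<times> Z"
 let ?B = "%i. ?R (fst i) (fst (snd i)) (fst (snd i) * (\<Sum>j\<in>fst i. G (snd (snd i)) j))"
 let ?bad = "%i p. rcard (p Int ?B i) < (1 - 1/2) * \<rho> * card (?B i) - \<beta> * (rcard (fst i) + 2)"
 have each: "subset_avg \<rho> A (%p. of_bool (?bad i p)) <= exp (- (2 * (1/2) * (\<beta> * (rcard (fst i) + 2))))" for i
  by (intro subset_avg_lower_tail) (use fin par in auto)
 have "pprob (random_subset \<rho> A) {p. ~ pool_representative G \<rho> \<beta> Z p}
   = subset_avg \<rho> A (%p. of_bool (~ pool_representative G \<rho> \<beta> Z p))"
  by (rule prob_random_subset[OF fin(1)]) (use par(1,2) in simp_all)
 also have "... <= subset_avg \<rho> A (%p. of_bool (\<exists>i\<in>?I. ?bad i p))"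
 proof (rule subset_avg_prob_le)
  fix p assume "~ pool_representative G \<rho> \<beta> Z p"
  then obtain U s \<tau> where U: "U <= Z" "s \<in> {1, - 1}"
   and bad: "rcard (p Int ?R U s \<tau>) < \<rho> / 2 * rcard (?R U s \<tau>) - \<beta> * (rcard U + 2)"
   unfolding pool_representative_def not_all not_imp not_le by blast
  have ne: "?R U s \<tau> ~= {}"
  proof
   assume e: "?R U s \<tau> = {}"
   have "0 < - (\<beta> * (rcard U + 2))" using bad unfolding e by simp
   moreover have "0 <= \<beta> * (rcard U + 2)" using par by simp
   ultimately show False by linarith
  qed
  have finR: "finite (?R U s \<tau>)" using finZ by simp
  define x where "x = arg_min_on (%x. s * (\<Sum>j\<in>U. G x j)) (?R U s \<tau>)"
  have x: "x \<in> ?R U s \<tau>" unfolding x_def by (rule arg_min_if_finite(1)[OF finR ne])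
  have min: "s * (\<Sum>j\<in>U. G x j) <= s * (\<Sum>j\<in>U. G y j)" if "y \<in> ?R U s \<tau>" for y
   unfolding x_def by (rule arg_min_least[OF finR ne that])
  have "?R U s \<tau> = ?B (U, s, x)"
  proof (rule set_eqI)
   fix y show "y \<in> ?R U s \<tau> \<longleftrightarrow> y \<in> ?B (U, s, x)" using x min[of y] by auto
  qed
  hence "?bad (U, s, x) p" using bad by simp
  hence "\<exists>i\<in>?I. ?bad i p" using U x by (intro bexI[of _ "(U, s, x)"]) auto
  thus "1 <= (of_bool (\<exists>i\<in>?I. ?bad i p) :: real)" by simp
 qed (use par in auto)
 also have "... <= (\<Sum>i\<in>?I. exp (- (2 * (1/2) * (\<beta> * (rcard (fst i) + 2)))))"
 proof (rule subset_avg_union_bound)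
  fix i assume "i \<in> ?I"
  show "subset_avg \<rho> A (%p. of_bool (?bad i p)) <= exp (- (2 * (1/2) * (\<beta> * (rcard (fst i) + 2))))"
   by (rule each)
 qed (use finZ par in auto)
 also have "... = (\<Sum>U\<in>Pow Z. 2 * rcard Z * exp (- (\<beta> * (rcard U + 2))))"
  by (simp add: sum.cartesian_product' card_cartesian_product finZ)
 also have "... = 2 * (rcard Z * exp (- \<beta>)) * exp (- \<beta>) * (\<Sum>U\<in>Pow Z. exp (- (\<beta> * rcard U)))"
  unfolding sum_distrib_left by (rule sum.cong) (auto simp: exp_add[symmetric] algebra_simps)
 also have "... <= 2 * 1 * exp (- \<beta>) * 3"
 proof -
  have "rcard Z <= rcard A" using fin by (simp add: card_mono)
  hence Z1: "rcard Z * exp (- \<beta>) <= 1" using par(4) by (smt (verit) exp_gt_zero mult_right_mono)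
  have "2 * (rcard Z * exp (- \<beta>)) * exp (- \<beta>) <= 2 * 1 * exp (- \<beta>)"
   using Z1 by simp
  moreover have "0 <= (\<Sum>U\<in>Pow Z. exp (- (\<beta> * rcard U)))" "0 <= 2 * 1 * exp (- \<beta>)"
   by (rule sum_nonneg, rule exp_ge_zero) simp
  ultimately show ?thesis by (intro mult_mono[OF _ sum_exp_card_le[OF finZ Z1]])
 qed
 finally show ?thesis by simp
qed

lemma correlation_leD:
 assumes "correlation_le G M Z \<Lambda>" "S <= Z" "T <= Z" "S Int T = {}" "rcard S <= M" "rcard T <= M"
 shows "\<bar>pair_sum G S T\<bar> <= \<Lambda> * sqrt (rcard S * rcard T)"
 using assms unfolding correlation_le_def by simp

text \<open>Decoupling: a uniformly random split of \<open>S\<close> into two parts retains on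
  average a quarter of the off-diagonal sum, and the hypothesis bounds every split.\<close>

lemma pair_sum_self_le:
 assumes fin: "finite S" and S: "S <= Z" "rcard S <= M" and diag: "\<And>i. i \<in> S ==> G i i <= D"
  and lev: "correlation_le G M Z \<Lambda>" and "0 <= \<Lambda>"
 shows "pair_sum G S S <= rcard S * (D + 2 * \<Lambda>)"
proof -
 have "subset_avg (1/2) S (%b. pair_sum G b (S - b)) = (pair_sum G S S - (\<Sum>i\<in>S. G i i)) / 4"
 proof -
  have "subset_avg (1/2) S (%b. pair_sum G b (S - b)) =
    subset_avg (1/2) S (%b. (\<Sum>i\<in>b. \<Sum>j\<in>S. G i j) - (\<Sum>i\<in>b. \<Sum>j\<in>b. G i j))"
  proof (rule subset_avg_cong)
   fix b assume "b <= S"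
   thus "pair_sum G b (S - b) = (\<Sum>i\<in>b. \<Sum>j\<in>S. G i j) - (\<Sum>i\<in>b. \<Sum>j\<in>b. G i j)"
    unfolding pair_sum_def using fin by (simp add: sum_diff sum_subtractf)
  qed
  also have "... = (pair_sum G S S - (\<Sum>i\<in>S. G i i)) / 4"
   using fin by (simp add: subset_avg_diff subset_avg_sum_elements subset_avg_quadratic pair_sum_def
     power2_eq_square field_simps)
  finally show ?thesis .
 qed
 moreover have "subset_avg (1/2) S (%b. pair_sum G b (S - b)) <= subset_avg (1/2) S (%b. \<Lambda> * card S / 2)"
 proof (rule subset_avg_mono)
  fix b assume b: "b <= S"
  hence cards: "card b + card (S - b) = card S" "card b <= card S" "card (S - b) <= card S"
   using fin by (auto simp: card_Diff_subset finite_subset card_mono)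
  have "\<bar>pair_sum G b (S - b)\<bar> <= \<Lambda> * sqrt (rcard b * rcard (S - b))"
   by (rule correlation_leD[OF lev]) (use b S cards in auto)
  hence "pair_sum G b (S - b) <= \<Lambda> * sqrt (rcard b * rcard (S - b))" by linarith
  also have "sqrt (rcard b * rcard (S - b)) <= (rcard b + rcard (S - b)) / 2"
   by (rule arith_geo_mean_sqrt) auto
  also have "... = card S / 2" using cards(1) by (metis of_nat_add)
  finally show "pair_sum G b (S - b) <= \<Lambda> * card S / 2" using assms(6) by (simp add: mult_left_mono)
 qed auto
 moreover have "(\<Sum>i\<in>S. G i i) <= rcard S * D" using sum_bounded_above[of S "%i. G i i" D] diag by simp
 ultimately show ?thesis using fin by (simp add: subset_avg_const field_simps)
qed

text \<open>A random \<open>U\<close> drawn from \<open>T\<close> at rate \<open>q\<close> scales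
  the correlation of a point by \<open>q\<close>, with standard deviation at most
  \<open>sqrt (q * card T) * B\<close>; by assumption this is small against \<open>q * c\<close>. By
  Chebyshev's inequality half of the points of \<open>X\<close> stay correlated with
  \<open>U\<close>, while the size of \<open>U\<close> and the norm of its sum shrink as expected.
  The first-moment method gives one \<open>U\<close> with all three properties.\<close>

lemma sparse_subset_exists:
 fixes G :: "'a => 'a => real"
 assumes fin: "finite X" "finite T" and q: "0 < q" "q <= 1" and c: "0 < c" and ub: "0 < ub"
  and corr: "\<And>x. x \<in> X ==> c <= s * (\<Sum>j\<in>T. G x j)" and s: "s \<in> {1, - 1}"
  and bnd: "\<And>x j. x \<in> X ==> j \<in> T ==> \<bar>G x j\<bar> <= B"
  and card: "0 < card T" "rcard T * B\<^sup>2 * 32 <= q * c\<^sup>2"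
  and quad: "q\<^sup>2 * pair_sum G T T + q * (\<Sum>i\<in>T. G i i) <= ub" "0 <= (\<Sum>i\<in>T. G i i)"
  and psd: "\<And>f. f <= T ==> 0 <= pair_sum G f f"
 shows "\<exists>U\<subseteq>T. rcard U <= 4 * q * rcard T & pair_sum G U U <= 4 * ub &
   rcard X / 2 <= real (card {x\<in>X. q * c / 2 <= s * (\<Sum>j\<in>U. G x j)})"
proof (cases "X = {}")
 case True
 thus ?thesis using ub q by (intro exI[of _ "{}"]) auto
next
 case False
 hence X: "0 < card X" using fin by auto
 define t where "t = q * c / 2"
 have t: "0 < t" using q c by (simp add: t_def)
 let ?g = "%x U. s * (\<Sum>j\<in>U. G x j)"
 let ?E = "%U. \<Sum>x\<in>X. (?g x U - q * ?g x T)\<^sup>2 / t\<^sup>2"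
 have each: "subset_avg q T (%U. (?g x U - q * ?g x T)\<^sup>2 / t\<^sup>2) <= 1 / 8" if x: "x \<in> X" for x
 proof -
  have s2: "s\<^sup>2 = 1" using s by auto
  have "(%U. (?g x U - q * ?g x T)\<^sup>2) = (%U. ((\<Sum>j\<in>U. s * G x j) - q * (\<Sum>j\<in>T. s * G x j))\<^sup>2)"
   by (simp add: sum_distrib_left)
  hence "subset_avg q T (%U. (?g x U - q * ?g x T)\<^sup>2) = q * (1 - q) * (\<Sum>j\<in>T. (s * G x j)\<^sup>2)"
   using subset_avg_variance[OF fin(2), of q "%j. s * G x j"] by simp
  also have "... <= q * 1 * (\<Sum>j\<in>T. B\<^sup>2)"
  proof (intro mult_mono sum_mono)
   fix j assume "j \<in> T"
   hence "\<bar>G x j\<bar> <= B" using bnd x by blast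
   hence "\<bar>G x j\<bar>\<^sup>2 <= B\<^sup>2" by (intro power_mono) auto
   thus "(s * G x j)\<^sup>2 <= B\<^sup>2" by (simp add: power_mult_distrib s2)
  qed (use q in \<open>auto intro: sum_nonneg\<close>)
  also have "... = q * (card T * B\<^sup>2)" by simp
  also have "... <= q * (q * c\<^sup>2 / 32)" using card(2) q by (intro mult_left_mono) auto
  also have "... = t\<^sup>2 / 8" by (simp add: t_def power2_eq_square)
  finally show ?thesis using t by (simp add: subset_avg_divide field_simps)
 qed
 have avgE: "subset_avg q T ?E <= rcard X / 8"
  unfolding subset_avg_sum using sum_mono[OF each] by simp
 have avgQ: "subset_avg q T (%U. pair_sum G U U) <= ub"
 proof -
  have "subset_avg q T (%U. pair_sum G U U) = q\<^sup>2 * pair_sum G T T + q * (1 - q) * (\<Sum>i\<in>T. G i i)"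
   unfolding pair_sum_def by (rule subset_avg_quadratic[OF fin(2)])
  also have "q * (1 - q) * (\<Sum>i\<in>T. G i i) <= q * 1 * (\<Sum>i\<in>T. G i i)"
   using q quad(2) by (intro mult_right_mono mult_left_mono) auto
  finally show ?thesis using quad(1) by simp
 qed
 have avgC: "subset_avg q T (%U. rcard U) = q * rcard T"
  using subset_avg_sum_elements[OF fin(2), of q "%_. 1"] by simp
 \<comment> \<open>Each summand has average at most 1/4. Where the sum is at most 3/4, each summand
   is at most 1, all of them being nonnegative.\<close>
 let ?F = "%U. ?E U / (card X / 2) + pair_sum G U U / (4 * ub) + rcard U / (4 * q * card T)"
 have avgF: "subset_avg q T ?F <= 1/4 + 1/4 + 1/4"
  unfolding subset_avg_add subset_avg_divide avgC using avgE avgQ X ub q card(1)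
  by (intro add_mono) (auto simp: field_simps)
 obtain U where U: "U <= T" "?F U <= 1/4 + 1/4 + 1/4"
  using subset_avg_exists_le[OF fin(2) less_imp_le[OF q(1)] q(2) avgF] by blast
 have nn: "0 <= ?E U / (card X / 2)" "0 <= pair_sum G U U / (4 * ub)" "0 <= rcard U / (4 * q * card T)"
  using ub q psd[OF U(1)] by (auto intro!: divide_nonneg_nonneg sum_nonneg)
 hence "?E U / (card X / 2) <= 1" "pair_sum G U U / (4 * ub) <= 1" "rcard U / (4 * q * card T) <= 1"
  using U(2) by linarith+
 hence 1: "?E U <= card X / 2" "pair_sum G U U <= 4 * ub" "rcard U <= 4 * q * card T"
  using X ub q card(1) by (auto simp: field_simps)
 have "?g x U \<ge> t \<or> (?g x U - q * c)\<^sup>2 <= (?g x U - q * ?g x T)\<^sup>2" if "x \<in> X" for x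
 proof -
  have "q * c <= q * ?g x T" using corr[OF that] q by (intro mult_left_mono) auto
  thus ?thesis
  proof (cases "?g x U \<ge> t")
   case False
   hence "0 <= q * c - ?g x U" "q * c - ?g x U <= q * ?g x T - ?g x U"
    using t \<open>q * c <= q * ?g x T\<close> by (auto simp: t_def)
   hence "(q * c - ?g x U)\<^sup>2 <= (q * ?g x T - ?g x U)\<^sup>2" by (intro power_mono)
   thus ?thesis by (simp add: power2_commute)
  qed simp
 qed
 note alt = this
 have "rcard {x\<in>X. ~ t <= ?g x U} = (\<Sum>x\<in>{x\<in>X. ~ t <= ?g x U}. 1)" by simp
 also have "... <= (\<Sum>x\<in>{x\<in>X. ~ t <= ?g x U}. (?g x U - q * ?g x T)\<^sup>2 / t\<^sup>2)"
 proof (rule sum_mono)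
  fix x assume x: "x \<in> {x\<in>X. ~ t <= ?g x U}"
  hence "?g x U < t" by simp
  hence "t <= q * c - ?g x U" unfolding t_def by linarith
  hence "t\<^sup>2 <= (q * c - ?g x U)\<^sup>2" using t by (intro power_mono) auto
  also have "... <= (?g x U - q * ?g x T)\<^sup>2" using alt[of x] x by (auto simp: power2_commute)
  finally show "1 <= (?g x U - q * ?g x T)\<^sup>2 / t\<^sup>2" using t by (simp add: field_simps)
 qed
 also have "... <= ?E U" using fin by (intro sum_mono2) auto
 finally have "rcard {x\<in>X. ~ t <= ?g x U} <= rcard X / 2" using 1 by linarith
 moreover have "card X = card {x\<in>X. t <= ?g x U} + card {x\<in>X. ~ t <= ?g x U}"
  by (subst card_Un_disjoint[symmetric]) (use fin in \<open>auto intro!: arg_cong[where f=card]\<close>)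
 ultimately have "rcard X / 2 <= rcard {x\<in>X. t <= ?g x U}" by linarith
 thus ?thesis using U(1) 1 by (intro exI[of _ U]) (simp add: t_def)
qed

text \<open>Let \<open>S\<close> and \<open>T\<close> in \<open>Q\<close> be correlated beyond
  \<theta>, while no pair in \<open>Z\<close> is correlated beyond 2\<theta>. Then the correlation
  is spread over a constant fraction of \<open>S\<close>, and it persists when \<open>T\<close> is
  thinned to a small \<open>U\<close>. So the half-space of points correlated with \<open>U\<close>
  is large, and the pool contains many of its points; let \<open>P\<close> consist of such points.
  Counted the other way round, many points of \<open>U\<close> are correlated with the sum of
  \<open>P\<close>, and they remain so when \<open>P\<close> is thinned to a small \<open>f\<close>.
  Thus the test \<open>f\<close>, made of pool points, flags more points of \<open>Q\<close> than
  \<open>imm\<close> permits. Both thinnings are needed: \<open>U\<close> must be small for the pool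
  to represent its half-space, and \<open>f\<close> must be small because a test pays for its
  size.\<close>

lemma amplification_contradiction:
 fixes G :: "'a => 'a => real"
 assumes sym: "\<And>i j. G i j = G j i" and psd: "\<And>f. f <= Z ==> 0 <= pair_sum G f f"
  and finZ: "finite Z"
  and diag: "\<And>i. i \<in> Z ==> 0 <= G i i & G i i <= D" and off: "\<And>i j. i \<in> Z ==> j \<in> Z ==> i ~= j ==> \<bar>G i j\<bar> <= B"
  and lev: "correlation_le G M Z (2 * \<theta>)"
  and pool: "pool_representative G \<rho> \<beta> Z p" and Q: "Q <= Z - p"
  and imm: "\<And>f. f <= Z Int p ==> f ~= {} ==> rcard {i\<in>Q. exceeds thr G i f} < c * (rcard f + 1)"
  and par: "0 < \<theta>" "0 < B" "0 <= D" "0 < \<rho>" "\<rho> <= 1" "0 < q" "q <= 1" "0 < \<beta>" "0 < c" "0 <= thr" "0 < \<nu>" "0 < M"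
  and H1: "128 * B\<^sup>2 * M <= q * \<theta>\<^sup>2"
  and H2: "1024 * q * \<beta> <= \<rho>" and H3: "512 * \<beta> / \<rho> <= \<theta> / B"
  and H4: "1024 * M * (32 * B\<^sup>2 + 64 * thr\<^sup>2 * (D + 2 * \<theta>)) <= \<nu> * \<theta>\<^sup>2"
  and H5: "128 * \<nu> <= \<rho>" "1048576 * c * \<nu> <= \<rho> * q\<^sup>2" "131072 * c <= \<rho> * q\<^sup>2 * (\<theta>\<^sup>2 / (B\<^sup>2 * M))"
  and ST: "S <= Q" "T <= Q" "S Int T = {}" "rcard S <= M" "card T <= card S"
  and s: "s \<in> {1, - 1}" and viol: "\<theta> * sqrt (rcard S * rcard T) < s * pair_sum G S T"
 shows False
proof -
 define k1 where "k1 = rcard S"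
 define k2 where "k2 = rcard T"
 define r where "r = sqrt (k1 * k2)"
 have s2: "\<bar>s\<bar> = 1" using s by auto
 have "S <= Z" "T <= Z" using ST Q by auto
 hence STZ: "S <= Z" "T <= Z" "finite S" "finite T" using finite_subset[OF _ finZ] by blast+
 have k12: "k2 <= k1" "k1 <= M" using ST by (auto simp: k1_def k2_def)
 have "T ~= {}" "S ~= {}" using viol by auto
 hence k: "0 < k1" "0 < k2" using STZ by (auto simp: k1_def k2_def card_gt_0_iff)
 have r: "0 < r" "r\<^sup>2 = k1 * k2" using k by (auto simp: r_def)
 \<comment> \<open>A violating pair cannot be small, because single correlations are at most \<open>B\<close>.\<close>
 have "s * pair_sum G S T <= \<bar>pair_sum G S T\<bar>" using s by auto
 also have "... <= (\<Sum>i\<in>S. \<Sum>j\<in>T. \<bar>G i j\<bar>)"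
  unfolding pair_sum_def by (rule order_trans[OF sum_abs]) (intro sum_mono sum_abs)
 also have "... <= (\<Sum>i\<in>S. \<Sum>j\<in>T. B)" using ST(3) STZ by (intro sum_mono off) auto
 also have "... = r\<^sup>2 * B" by (simp add: r k1_def k2_def)
 finally have "s * pair_sum G S T <= r\<^sup>2 * B" .
 hence "\<theta> * r < r\<^sup>2 * B" using viol unfolding r_def k1_def k2_def by linarith
 hence "\<theta> * r < r * (r * B)" by (simp add: power2_eq_square mult.assoc)
 hence rB: "\<theta> / B < r" using r par by (simp add: field_simps)
 have k1_ge: "\<theta> / B <= k1"
 proof -
  have "r <= sqrt (k1 * k1)" unfolding r_def using k12 k by (intro real_sqrt_le_mono mult_left_mono) auto
  thus ?thesis using rB k by simp
 qed
 have k2_ge: "\<theta>\<^sup>2 / (B\<^sup>2 * M) <= k2"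
 proof -
  have "(\<theta> / B)\<^sup>2 <= r\<^sup>2" using rB par by (intro power_mono) auto
  also have "... <= M * k2" using r k12 k by (simp add: mult_right_mono)
  finally show ?thesis using par by (simp add: field_simps power_divide)
 qed
 define g where "g = (%x U. s * (\<Sum>j\<in>U. G x j))"
 have g_sum: "(\<Sum>x\<in>X. g x U) = s * pair_sum G X U" for X U
  by (simp add: g_def pair_sum_def sum_distrib_left)
 have g_swap: "(\<Sum>x\<in>X. g x U) = (\<Sum>y\<in>U. g y X)" for X U
  unfolding g_sum by (simp only: pair_sum_commute[of G X U, OF sym])
 have lev_g: "(\<Sum>x\<in>X. g x U) <= 2 * \<theta> * sqrt (rcard X * rcard U)"
  if "X <= Z" "U <= Z" "X Int U = {}" "rcard X <= M" "rcard U <= M" for X U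
 proof -
  have "s * pair_sum G X U <= \<bar>pair_sum G X U\<bar>" using s by auto
  thus ?thesis using correlation_leD[OF lev that] g_sum[where X=X and U=U] by linarith
 qed
 \<comment> \<open>Half the guaranteed average correlation of a point of \<open>S\<close> with
   \<open>T\<close>; the points below it contribute at most half of the total.\<close>
 define c1 where "c1 = \<theta> * r / (2 * k1)"
 have c1: "0 < c1" using par r k by (simp add: c1_def)
 define S' where "S' = {x\<in>S. c1 <= g x T}"
 have S'S: "S' <= S" "finite S'" using STZ by (auto simp: S'_def)
 have S'_large: "k1 / 16 <= real (card S')"
 proof -
  have "\<theta> * r <= (\<Sum>x\<in>S. g x T)" using viol by (simp add: g_sum r_def k1_def k2_def)
  also have "... = (\<Sum>x\<in>S'. g x T) + (\<Sum>x\<in>S - S'. g x T)"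
   using sum.subset_diff[OF S'S(1) STZ(3), of "%x. g x T"] by linarith
  also have "(\<Sum>x\<in>S - S'. g x T) <= (\<Sum>x\<in>S - S'. c1)" by (intro sum_mono) (auto simp: S'_def)
  also have "... <= k1 * c1"
   using c1 STZ(3) by (simp add: k1_def card_mono)
  also have "k1 * c1 = \<theta> * r / 2" using k by (simp add: c1_def)
  \<comment> \<open>Here the level 2\<theta> on \<open>Z\<close> enters: a small \<open>S'\<close>
    could not carry half of the correlation.\<close>
  also have "(\<Sum>x\<in>S'. g x T) <= 2 * \<theta> * sqrt (real (card S') * k2)"
   unfolding k2_def
  proof (rule lev_g)
   show "real (card S') <= M" using card_mono[OF STZ(3) S'S(1)] ST(4) by linarith
  qed (use S'S STZ ST k12 in \<open>auto simp: k2_def\<close>)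
  finally have "\<theta> * r / 2 <= 2 * \<theta> * sqrt (real (card S') * k2)" by simp
  hence "\<theta> * r <= \<theta> * (4 * sqrt (real (card S') * k2))" by simp
  hence "r <= 4 * sqrt (real (card S') * k2)" using par by simp
  hence "r\<^sup>2 <= (4 * sqrt (real (card S') * k2))\<^sup>2" using r by (intro power_mono) auto
  hence "k1 * k2 <= 16 * real (card S') * k2" using r k by (simp add: power_mult_distrib)
  thus ?thesis using k by simp
 qed
 have ex1: "\<exists>U\<subseteq>T. rcard U <= 4 * q * rcard T &
   pair_sum G U U <= 4 * (q\<^sup>2 * pair_sum G T T + q * (\<Sum>i\<in>T. G i i) + 1) &
   real (card S') / 2 <= real (card {x\<in>S'. q * c1 / 2 <= s * (\<Sum>j\<in>U. G x j)})"
 proof (rule sparse_subset_exists[where B=B])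
  have nnT: "0 <= pair_sum G T T" "0 <= (\<Sum>i\<in>T. G i i)"
   using psd[OF STZ(2)] diag STZ(2) by (auto intro!: sum_nonneg)
  have "0 <= q\<^sup>2 * pair_sum G T T + q * (\<Sum>i\<in>T. G i i)" using nnT par by simp
  thus "0 < q\<^sup>2 * pair_sum G T T + q * (\<Sum>i\<in>T. G i i) + 1" by linarith
  show "0 <= (\<Sum>i\<in>T. G i i)" by (rule nnT)
  show "rcard T * B\<^sup>2 * 32 <= q * c1\<^sup>2"
  proof -
   have "128 * B\<^sup>2 * k1 <= 128 * B\<^sup>2 * M" using k12 by (intro mult_left_mono) auto
   hence "128 * B\<^sup>2 * k1 <= q * \<theta>\<^sup>2" using H1 by linarith
   hence "(128 * B\<^sup>2 * k1) * k2 <= (q * \<theta>\<^sup>2) * k2" using k by (intro mult_right_mono) auto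
   moreover have "c1\<^sup>2 = \<theta>\<^sup>2 * k2 / (4 * k1)"
    using k by (simp add: c1_def power_divide power_mult_distrib r) (simp add: power2_eq_square field_simps)
   moreover have "(128 * B\<^sup>2 * k1) * k2 / (4 * k1) <= (q * \<theta>\<^sup>2) * k2 / (4 * k1)"
    by (rule divide_right_mono) (use calculation k in auto)
   ultimately have "(128 * B\<^sup>2 * k1) * k2 / (4 * k1) <= q * c1\<^sup>2" by simp
   thus ?thesis using k by (simp add: k2_def)
  qed
  show "\<And>f. f <= T ==> 0 <= pair_sum G f f" using psd STZ by auto
  show "\<bar>G x j\<bar> <= B" if "x \<in> S'" "j \<in> T" for x j
   by (rule off) (use that S'S(1) STZ(1,2) ST(3) in auto)
 qed (use S'S STZ par c1 s k in \<open>auto simp: S'_def g_def k2_def\<close>)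
 then obtain U where U: "U <= T" "rcard U <= 4 * q * k2"
  and Ucorr: "real (card S') / 2 <= rcard {x\<in>S'. q * c1 / 2 <= g x U}"
  unfolding g_def k2_def by blast
 define \<tau> where "\<tau> = q * c1 / 2"
 have \<tau>: "0 < \<tau>" using par c1 by (simp add: \<tau>_def)
 define R where "R = {x\<in>Z - U. \<tau> <= g x U}"
 have finR: "finite R" using finZ by (simp add: R_def)
 have R_large: "k1 / 32 <= rcard R"
 proof -
  have "{x\<in>S'. q * c1 / 2 <= g x U} <= R" using S'S STZ U ST(3) by (auto simp: R_def \<tau>_def)
  hence "card {x\<in>S'. q * c1 / 2 <= g x U} <= card R" by (intro card_mono finR)
  thus ?thesis using Ucorr S'_large by linarith
 qed
 have pR: "\<rho> * k1 / 128 <= rcard (p Int R)"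
 proof -
  have "\<rho> / 2 * rcard R - \<beta> * (rcard U + 2) <= rcard (p Int R)"
   using pool U STZ s unfolding pool_representative_def R_def g_def by auto
  moreover have "\<rho> / 2 * (k1 / 32) <= \<rho> / 2 * rcard R" using R_large par by (intro mult_left_mono) auto
  moreover have "\<beta> * (rcard U + 2) <= \<rho> * k1 / 128"
  proof -
   have "\<beta> * rcard U <= \<beta> * (4 * q * k1)" using U(2) k12 par
    by (intro mult_left_mono order_trans[OF U(2)]) auto
   also have "... = (1024 * q * \<beta>) * k1 / 256" by simp
   also have "... <= \<rho> * k1 / 256" using H2 k by (intro divide_right_mono mult_right_mono) auto
   finally have 1: "\<beta> * rcard U <= \<rho> * k1 / 256" .
   have "512 * \<beta> / \<rho> <= k1" using H3 k1_ge by linarith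
   hence "2 * \<beta> <= \<rho> * k1 / 256" using par by (simp add: field_simps)
   thus ?thesis using 1 by (simp add: algebra_simps)
  qed
  ultimately show ?thesis by simp
 qed
 \<comment> \<open>\<open>P\<close> is trimmed to this size so that it has at most
   \<open>card S\<close>, hence at most \<open>M\<close>, points and \<open>lev\<close> applies to
   it.\<close>
 define n1 where "n1 = nat \<lceil>\<rho> * k1 / 128\<rceil>"
 have n1: "\<rho> * k1 / 128 <= real n1" "real n1 <= k1" "n1 <= card (p Int R)"
 proof -
  show "\<rho> * k1 / 128 <= real n1" unfolding n1_def by linarith
  have "\<rho> * k1 <= 1 * k1" using par k by (intro mult_right_mono) auto
  hence "\<lceil>\<rho> * k1 / 128\<rceil> <= int (card S)" using k by (intro ceiling_le) (auto simp: k1_def)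
  thus "real n1 <= k1" unfolding n1_def k1_def by linarith
  show "n1 <= card (p Int R)" unfolding n1_def using pR by linarith
 qed
 obtain P where P: "P <= p Int R" "card P = n1" "finite P"
  using obtain_subset_with_card_n[OF n1(3)] by blast
 define sz where "sz = real n1"
 have sz: "0 < sz" "sz <= k1" "\<rho> * k1 / 128 <= sz"
 proof -
  have "0 < \<rho> * k1 / 128" using par k by simp
  thus "0 < sz" using n1(1) unfolding sz_def by linarith
 qed (use n1 in \<open>auto simp: sz_def\<close>)
 have PZ: "P <= Z" using P by (auto simp: R_def)
 have UQ: "U <= Q" "U <= Z" "finite U" "U Int P = {}"
  using U(1) ST(2) Q P(1) STZ(2) finite_subset[OF U(1) STZ(4)] by blast+
 \<comment> \<open>This equals \<open>\<tau> / (8 * q * k2)\<close>: half the average of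
   \<open>g y P / sz\<close> over the at most \<open>4 * q * k2\<close> points \<open>y\<close> of
   \<open>U\<close>.\<close>
 define \<tau>2 where "\<tau>2 = \<theta> / (32 * r)"
 have \<tau>2: "0 < \<tau>2" "\<tau> / (8 * q * k2) = \<tau>2"
 proof -
  show "0 < \<tau>2" using par r by (simp add: \<tau>2_def)
  have "\<tau> / (8 * q * k2) = \<theta> * r / (32 * (k1 * k2))" using par k by (simp add: \<tau>_def c1_def field_simps)
  also have "... = \<tau>2" unfolding r(2)[symmetric] \<tau>2_def using r(1) by (simp add: power2_eq_square)
  finally show "\<tau> / (8 * q * k2) = \<tau>2" .
 qed
 define X where "X = {y\<in>U. sz * \<tau>2 <= g y P}"
 have XU: "X <= U" "finite X" using UQ by (auto simp: X_def)
 have X_large: "\<rho> * q\<^sup>2 * k2 / 32768 <= rcard X"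
 proof -
  have "sz * \<tau> = (\<Sum>x\<in>P. \<tau>)" using P by (simp add: sz_def)
  also have "... <= (\<Sum>x\<in>P. g x U)" using P by (intro sum_mono) (auto simp: R_def)
  also have "... = (\<Sum>y\<in>U. g y P)" by (rule g_swap)
  also have "... = (\<Sum>y\<in>X. g y P) + (\<Sum>y\<in>U - X. g y P)"
   using sum.subset_diff[OF XU(1) UQ(3), of "%x. g x P"] by linarith
  also have "(\<Sum>y\<in>U - X. g y P) <= (\<Sum>y\<in>U - X. sz * \<tau>2)" by (intro sum_mono) (auto simp: X_def)
  also have "... <= (4 * q * k2) * (sz * \<tau>2)"
  proof -
   have "rcard (U - X) <= 4 * q * k2" using card_mono[OF UQ(3), of "U - X"] U(2) by auto
   thus ?thesis using sz \<tau>2 by (simp add: mult_right_mono)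
  qed
  also have "(4 * q * k2) * (sz * \<tau>2) = sz * \<tau> / 2" unfolding \<tau>2(2)[symmetric] using par k by simp
  also have "(\<Sum>y\<in>X. g y P) <= 2 * \<theta> * sqrt (rcard X * rcard P)"
  proof (rule lev_g)
   have "card X <= card T" using XU U STZ by (intro card_mono) auto
   thus "rcard X <= M" using k12 by (simp add: k2_def)
   show "rcard P <= M" using P sz k12 by (simp add: sz_def)
  qed (use XU UQ PZ in auto)
  finally have "sz * \<tau> / 2 <= 2 * \<theta> * sqrt (rcard X * sz)" using P by (simp add: sz_def)
  hence "sz * \<tau> <= 4 * \<theta> * sqrt (rcard X * sz)" by simp
  hence "(sz * \<tau>)\<^sup>2 <= (4 * \<theta> * sqrt (rcard X * sz))\<^sup>2" using sz \<tau> by (intro power_mono) auto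
  hence "sz\<^sup>2 * \<tau>\<^sup>2 <= 16 * \<theta>\<^sup>2 * (rcard X * sz)" using sz by (simp add: power_mult_distrib)
  hence "sz * \<tau>\<^sup>2 <= 16 * \<theta>\<^sup>2 * rcard X" using sz by (simp add: power2_eq_square)
  moreover have "\<tau>\<^sup>2 = \<theta>\<^sup>2 * (q\<^sup>2 * k2 / (16 * k1))"
  proof -
   have "\<tau>\<^sup>2 = q\<^sup>2 * (\<theta>\<^sup>2 * r\<^sup>2) / (16 * k1\<^sup>2)"
    by (simp add: \<tau>_def c1_def power_mult_distrib power_divide)
   thus ?thesis unfolding r(2) using k by (simp add: power2_eq_square)
  qed
  ultimately have "\<theta>\<^sup>2 * (sz * (q\<^sup>2 * k2 / (16 * k1))) <= \<theta>\<^sup>2 * (16 * rcard X)" by (simp add: algebra_simps)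
  hence "sz * (q\<^sup>2 * k2 / (16 * k1)) <= 16 * rcard X"
   by (rule mult_left_le_imp_le) (use par in simp)
  moreover have "(\<rho> * k1 / 128) * (q\<^sup>2 * k2 / (16 * k1)) <= sz * (q\<^sup>2 * k2 / (16 * k1))"
   using sz par k by (intro mult_right_mono) auto
  ultimately have "(\<rho> * k1 / 128) * (q\<^sup>2 * k2 / (16 * k1)) <= 16 * rcard X" by linarith
  thus ?thesis using k by (simp add: field_simps)
 qed
 \<comment> \<open>The expected size \<open>u\<close> of the thinned set is chosen such that
   \<open>u * \<tau>2\<^sup>2 = \<Omega>\<close>. The first term of \<Omega> makes the thinning of
   \<open>P\<close> concentrate; the second lifts the remaining correlation
   \<open>u * \<tau>2 / 2\<close> above \<open>thr\<close> times the norm of the test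
   direction.\<close>
 define \<Omega> where "\<Omega> = 32 * B\<^sup>2 + 64 * thr\<^sup>2 * (D + 2 * \<theta>)"
 have \<Omega>: "0 < \<Omega>" using par by (simp add: \<Omega>_def add_pos_nonneg)
 define u where "u = \<Omega> / \<tau>2\<^sup>2"
 have u: "0 < u" "u * \<tau>2\<^sup>2 = \<Omega>" using \<Omega> \<tau>2 by (auto simp: u_def)
 have u_le: "u <= \<nu> * k2"
 proof -
  have "u = 1024 * (k1 * k2) * \<Omega> / \<theta>\<^sup>2"
   unfolding u_def \<tau>2_def using r par by (simp add: power_divide power_mult_distrib field_simps)
  also have "... <= 1024 * (M * k2) * \<Omega> / \<theta>\<^sup>2"
   using k12 k \<Omega> by (intro divide_right_mono mult_right_mono mult_left_mono) auto
  also have "... = (1024 * M * \<Omega>) * k2 / \<theta>\<^sup>2" by simp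
  also have "... <= (\<nu> * \<theta>\<^sup>2) * k2 / \<theta>\<^sup>2"
   using H4 k unfolding \<Omega>_def by (intro divide_right_mono mult_right_mono) auto
  finally show ?thesis using par by simp
 qed
 have u_sz: "u <= sz"
 proof -
  have "\<nu> * k2 <= \<rho> / 128 * k1" using H5(1) k12 k par by (intro mult_mono) auto
  thus ?thesis using u_le sz(3) by simp
 qed
 define q2 where "q2 = u / sz"
 have q2: "0 < q2" "q2 <= 1" "q2 * sz = u" using u sz u_sz by (auto simp: q2_def)
 define ub where "ub = u * (2 * D + 4 * \<theta>)"
 have ub: "0 < ub" using u par by (simp add: ub_def add_nonneg_pos)
 have ex2: "\<exists>f\<subseteq>P. rcard f <= 4 * q2 * rcard P & pair_sum G f f <= 4 * ub &
   rcard X / 2 <= real (card {x\<in>X. q2 * (sz * \<tau>2) / 2 <= s * (\<Sum>j\<in>f. G x j)})"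
 proof (rule sparse_subset_exists[where B=B])
  show "rcard P * B\<^sup>2 * 32 <= q2 * (sz * \<tau>2)\<^sup>2"
  proof -
   have "32 * B\<^sup>2 <= u * \<tau>2\<^sup>2" unfolding u(2) \<Omega>_def using par by simp
   hence "sz * (32 * B\<^sup>2) <= sz * (u * \<tau>2\<^sup>2)" using sz by (intro mult_left_mono) auto
   also have "... = q2 * (sz * \<tau>2)\<^sup>2" unfolding q2(3)[symmetric] by (simp add: power2_eq_square)
   finally show ?thesis using P by (simp add: sz_def mult_ac)
  qed
  have tr: "(\<Sum>i\<in>P. G i i) <= sz * D" "0 <= (\<Sum>i\<in>P. G i i)"
   using sum_bounded_above[of P "%i. G i i" D] diag PZ P by (auto simp: sz_def intro!: sum_nonneg)
  show "0 <= (\<Sum>i\<in>P. G i i)" by (rule tr)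
  have "pair_sum G P P <= rcard P * (D + 2 * (2 * \<theta>))"
   by (rule pair_sum_self_le[OF P(3) PZ _ _ lev]) (use P sz k12 diag PZ par in \<open>auto simp: sz_def\<close>)
  hence pp: "pair_sum G P P <= sz * (D + 4 * \<theta>)" using P by (simp add: sz_def)
  have "q2\<^sup>2 * pair_sum G P P <= q2\<^sup>2 * (sz * (D + 4 * \<theta>))" using pp by (intro mult_left_mono) auto
  also have "... = q2 * (u * (D + 4 * \<theta>))" unfolding q2(3)[symmetric] by (simp add: power2_eq_square)
  also have "... <= 1 * (u * (D + 4 * \<theta>))" using q2 u par by (intro mult_right_mono) auto
  finally have "q2\<^sup>2 * pair_sum G P P <= u * (D + 4 * \<theta>)" by simp
  moreover have "q2 * (\<Sum>i\<in>P. G i i) <= q2 * (sz * D)" using tr q2 by (intro mult_left_mono) auto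
  moreover have "q2 * (sz * D) = u * D" unfolding q2(3)[symmetric] by simp
  moreover have "ub = u * (D + 4 * \<theta>) + u * D" by (simp add: ub_def algebra_simps)
  ultimately show "q2\<^sup>2 * pair_sum G P P + q2 * (\<Sum>i\<in>P. G i i) <= ub" by linarith
  show "\<And>f. f <= P ==> 0 <= pair_sum G f f" using psd PZ by auto
  show "\<bar>G x j\<bar> <= B" if "x \<in> X" "j \<in> P" for x j
   by (rule off) (use that XU(1) UQ(2,4) PZ in auto)
  show "0 < card P" using P sz by (simp add: sz_def)
 qed (use XU P q2 sz \<tau>2 ub s in \<open>auto simp: X_def g_def\<close>)
 then obtain f where f: "f <= P" "rcard f <= 4 * u" "pair_sum G f f <= 4 * ub"
  and fX: "rcard X / 2 <= rcard {x\<in>X. u * \<tau>2 / 2 <= g x f}"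
  unfolding g_def using q2(3) P by (auto simp: sz_def mult.assoc)
 have pass: "{x\<in>X. u * \<tau>2 / 2 <= g x f} <= {i\<in>Q. exceeds thr G i f}"
 proof
  fix x assume x: "x \<in> {x\<in>X. u * \<tau>2 / 2 <= g x f}"
  have "thr * sqrt (pair_sum G f f) <= thr * sqrt (4 * ub)" using f par by (intro mult_left_mono real_sqrt_le_mono) auto
  also have "... < u * \<tau>2 / 2"
  proof -
   have "thr\<^sup>2 * (4 * ub) < u * \<Omega> / 4"
   proof -
    have "32 * B\<^sup>2 > 0" using par by simp
    hence "64 * thr\<^sup>2 * (D + 2 * \<theta>) < \<Omega>" unfolding \<Omega>_def by linarith
    hence "u * (64 * thr\<^sup>2 * (D + 2 * \<theta>)) < u * \<Omega>" using u by (intro mult_strict_left_mono) auto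
    moreover have "4 * (thr\<^sup>2 * (4 * ub)) <= u * (64 * thr\<^sup>2 * (D + 2 * \<theta>))"
     using u par by (simp add: ub_def algebra_simps)
    ultimately show ?thesis by linarith
   qed
   also have "u * \<Omega> / 4 = (u * \<tau>2 / 2)\<^sup>2" unfolding u(2)[symmetric] by (simp add: power2_eq_square)
   finally have "(thr * sqrt (4 * ub))\<^sup>2 < (u * \<tau>2 / 2)\<^sup>2" using ub by (simp add: power_mult_distrib)
   thus ?thesis by (rule power2_less_imp_less) (use u \<tau>2 in auto)
  qed
  also have "... <= g x f" using x by simp
  also have "... <= \<bar>\<Sum>j\<in>f. G x j\<bar>" unfolding g_def using s by auto
  finally show "x \<in> {i\<in>Q. exceeds thr G i f}" using x XU UQ by (auto simp: exceeds_def)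
 qed
 have Xpos: "0 < rcard X" using X_large par k by (smt (verit) divide_pos_pos mult_pos_pos zero_less_power)
 have "f ~= {}"
 proof
  assume "f = {}"
  hence e: "{x\<in>X. u * \<tau>2 / 2 <= g x f} = {}" using u \<tau>2 by (auto simp: g_def not_le)
  show False using fX Xpos unfolding e by simp
 qed
 hence "rcard {i\<in>Q. exceeds thr G i f} < c * (rcard f + 1)"
  using f P PZ by (intro imm) auto
 moreover have "rcard {x\<in>X. u * \<tau>2 / 2 <= g x f} <= rcard {i\<in>Q. exceeds thr G i f}"
  using card_mono[OF _ pass] finite_subset[OF _ finZ, of "{i\<in>Q. exceeds thr G i f}"] Q by auto
 ultimately have "rcard X / 2 < c * (4 * u + 1)"
  using fX f(2) par by (smt (verit) mult_left_mono)
 also have "... <= \<rho> * q\<^sup>2 * k2 / 65536"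
 proof -
  have "c * (8 * u) <= c * (8 * (\<nu> * k2))" using u_le par by (intro mult_left_mono) auto
  also have "... = (1048576 * c * \<nu>) * k2 / 131072" by simp
  also have "... <= (\<rho> * q\<^sup>2) * k2 / 131072" using H5(2) k by (intro divide_right_mono mult_right_mono) auto
  finally have 1: "c * (8 * u) <= (\<rho> * q\<^sup>2) * k2 / 131072" .
  have "131072 * c <= \<rho> * q\<^sup>2 * (\<theta>\<^sup>2 / (B\<^sup>2 * M))" by (rule H5(3))
  also have "... <= \<rho> * q\<^sup>2 * k2" using k2_ge par by (intro mult_left_mono) auto
  finally have "c <= \<rho> * q\<^sup>2 * k2 / 131072" by simp
  moreover have "c * (4 * u + 1) <= c * (8 * u) + c" using par u by (simp add: algebra_simps)
  ultimately show ?thesis using 1 by linarith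
 qed
 finally show False using X_large by simp
qed

section \<open>The iterated filter\<close>

text \<open>The points still alive and the tests collected so far.\<close>

type_synonym 'a filter_state = "'a set \<times> 'a set set"

text \<open>The sampled points \<open>b\<close> are given up, because the choice of the tests
  depends on them.\<close>

definition round_step :: "('a => 'a set => bool) => 'a set set => real => real => 'a set => 'a filter_state => 'a filter_state" where
 "round_step tst Fam \<rho> c b s = (let V = best_cover tst Fam (fst s Int b) (c * \<rho>) in
   (fst s - b - covered tst (fst s) V, snd s Un V))"

fun rounds :: "('a => 'a set => bool) => 'a set set => real => real => real => 'a set list => 'a filter_state => 'a filter_state" where
 "rounds tst Fam \<rho> \<delta> c [] s = s"
| "rounds tst Fam \<rho> \<delta> c (b # bs) s = rounds tst Fam \<rho> \<delta> (c + \<delta>) bs (round_step tst Fam \<rho> (c + \<delta> / 2) b s)"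

text \<open>The head of \<open>cs\<close> is the pool, whose surviving points form the test
  directions; the tail holds the samples on which the tests are selected, one for each
  round.\<close>

definition super_step :: "('a => 'a set => bool) => real => real => real => 'a set list => 'a filter_state => 'a filter_state" where
 "super_step tst \<rho> \<delta> c cs s = rounds tst (Pow (fst s Int hd cs) - {{}}) \<rho> \<delta> c (tl cs) (fst s - hd cs, snd s)"

definition run :: "('a => 'a set => bool) => real => real => real => 'a set list list => 'a filter_state => 'a filter_state" where
 "run tst \<rho> \<delta> c css s = fold (super_step tst \<rho> \<delta> c) css s"

definition surviving :: "('a => 'a set => bool) => 'a filter_state => bool" where
 "surviving tst s \<longleftrightarrow> (\<forall>i\<in>fst s. \<forall>f\<in>snd s. ~ tst i f)"

text \<open>Every test is applied to all points when it is found, and points never come back. Hence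
  the survivors can be recovered from the final list of tests alone, regardless of the order of the
  rounds.\<close>

lemma rounds_surviving:
 assumes "surviving tst s"
 shows "fst (rounds tst Fam \<rho> \<delta> c bs s) = {i\<in>fst s - \<Union>(set bs). \<forall>f\<in>snd (rounds tst Fam \<rho> \<delta> c bs s). ~ tst i f}
  & surviving tst (rounds tst Fam \<rho> \<delta> c bs s) & snd s <= snd (rounds tst Fam \<rho> \<delta> c bs s)"
 using assms
proof (induction bs arbitrary: c s)
 case (Cons b bs)
 have sv: "surviving tst (round_step tst Fam \<rho> (c + \<delta> / 2) b s)"
  using Cons.prems by (auto simp: surviving_def round_step_def Let_def covered_def)
 have *: "i \<in> fst (round_step tst Fam \<rho> (c + \<delta> / 2) b s)"
  if "i \<in> fst s" "i \<notin> b" "\<forall>f\<in>snd (round_step tst Fam \<rho> (c + \<delta> / 2) b s). ~ tst i f" for i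
  using that by (auto simp: round_step_def Let_def covered_def)
 have **: "fst (round_step tst Fam \<rho> (c + \<delta> / 2) b s) <= fst s - b" "snd s <= snd (round_step tst Fam \<rho> (c + \<delta> / 2) b s)"
  by (auto simp: round_step_def Let_def)
 show ?case using Cons.IH[OF sv, of "c + \<delta>"] * ** by (auto simp: subset_iff)
qed (auto simp: surviving_def)

lemma run_surviving:
 assumes "surviving tst s" "\<forall>cs\<in>set css. cs ~= []"
 shows "fst (run tst \<rho> \<delta> c css s) = {i\<in>fst s - \<Union>(\<Union>(set ` set css)). \<forall>f\<in>snd (run tst \<rho> \<delta> c css s). ~ tst i f}
  & surviving tst (run tst \<rho> \<delta> c css s) & snd s <= snd (run tst \<rho> \<delta> c css s)"
 using assms
proof (induction css arbitrary: s)
 case (Cons cs css)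
 define s' where "s' = super_step tst \<rho> \<delta> c cs s"
 have sv0: "surviving tst (fst s - hd cs, snd s)" using Cons.prems by (auto simp: surviving_def)
 have r: "fst s' = {i\<in>fst s - hd cs - \<Union>(set (tl cs)). \<forall>f\<in>snd s'. ~ tst i f}" "surviving tst s'" "snd s <= snd s'"
  using rounds_surviving[OF sv0, of "Pow (fst s Int hd cs) - {{}}" \<rho> \<delta> c "tl cs"] by (simp_all add: s'_def super_step_def)
 have cs: "set cs = insert (hd cs) (set (tl cs))" using Cons.prems by (cases cs) auto
 have "run tst \<rho> \<delta> c (cs # css) s = run tst \<rho> \<delta> c css s'" by (simp add: run_def s'_def)
 thus ?case using Cons.IH[OF r(2)] Cons.prems r by (auto simp: cs subset_iff)
qed (auto simp: surviving_def run_def)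

lemma best_cover_cong:
 assumes "Y = Y'" "\<And>i f. i \<in> Y ==> f \<in> Fam ==> tst i f = tst' i f"
 shows "best_cover tst Fam Y c = best_cover tst' Fam Y' c"
proof -
 have "covered tst Y V = covered tst' Y' V" if "V <= Fam" for V
  using assms that by (auto simp: covered_def)
 thus ?thesis unfolding best_cover_def
  by (intro arg_cong[where f=Eps] ext) (metis (no_types, lifting))
qed

text \<open>The selection of tests evaluates only tests and points inside \<open>C\<close>. With
  \<open>C\<close> the union of all coins this shows that the tests do not depend on any point that
  can survive, which is why the filter does not bias the genuine survivors.\<close>

lemma rounds_local:
 assumes fam: "finite Fam" "Fam <= Pow C" and bs: "\<forall>b\<in>set bs. b <= C" and tst: "\<And>i f. i \<in> C ==> f <= C ==> tst i f = tst' i f"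
  and s: "fst s Int C = fst s' Int C" "snd s = snd s'"
 shows "snd (rounds tst Fam \<rho> \<delta> c bs s) = snd (rounds tst' Fam \<rho> \<delta> c bs s') &
  fst (rounds tst Fam \<rho> \<delta> c bs s) Int C = fst (rounds tst' Fam \<rho> \<delta> c bs s') Int C"
 using bs s
proof (induction bs arbitrary: c s s')
 case (Cons b bs)
 have eq: "fst s Int b = fst s' Int b" using Cons.prems by auto
 have V: "best_cover tst Fam (fst s Int b) ((c + \<delta> / 2) * \<rho>) = best_cover tst' Fam (fst s' Int b) ((c + \<delta> / 2) * \<rho>)"
  by (rule best_cover_cong[OF eq], rule tst) (use Cons.prems fam in auto)
 have sub: "best_cover tst' Fam (fst s' Int b) ((c + \<delta> / 2) * \<rho>) <= Pow C"
  using best_cover(1)[OF fam(1)] fam(2) by blast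
 have "fst (round_step tst Fam \<rho> (c + \<delta> / 2) b s) Int C = fst (round_step tst' Fam \<rho> (c + \<delta> / 2) b s') Int C"
  unfolding round_step_def Let_def V fst_conv covered_def using Cons.prems(2) sub tst by (auto simp: subset_iff)
 moreover have "snd (round_step tst Fam \<rho> (c + \<delta> / 2) b s) = snd (round_step tst' Fam \<rho> (c + \<delta> / 2) b s')"
  unfolding round_step_def Let_def V using Cons.prems by simp
 ultimately show ?case using Cons.IH Cons.prems(1) by simp
qed simp

lemma run_local:
 assumes fin: "finite C" and css: "\<forall>cs\<in>set css. cs ~= [] & (\<forall>b\<in>set cs. b <= C)"
  and tst: "\<And>i f. i \<in> C ==> f <= C ==> tst i f = tst' i f"
  and s: "fst s Int C = fst s' Int C" "snd s = snd s'"
 shows "snd (run tst \<rho> \<delta> c css s) = snd (run tst' \<rho> \<delta> c css s')"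
 using css s
proof (induction css arbitrary: s s')
 case (Cons cs css)
 have hd: "hd cs <= C" and tl: "\<forall>b\<in>set (tl cs). b <= C" using Cons.prems(1) by (cases cs; auto)+
 have P: "fst s Int hd cs = fst s' Int hd cs" using hd Cons.prems(2) by blast
 have "snd (super_step tst \<rho> \<delta> c cs s) = snd (super_step tst' \<rho> \<delta> c cs s') &
    fst (super_step tst \<rho> \<delta> c cs s) Int C = fst (super_step tst' \<rho> \<delta> c cs s') Int C"
  unfolding super_step_def P
 proof (rule rounds_local)
  show "finite (Pow (fst s' Int hd cs) - {{}})" using finite_subset[OF hd fin] by simp
  show "Pow (fst s' Int hd cs) - {{}} <= Pow C" using hd by blast
  show "fst (fst s - hd cs, snd s) Int C = fst (fst s' - hd cs, snd s') Int C" using Cons.prems(2) by auto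
  show "snd (fst s - hd cs, snd s) = snd (fst s' - hd cs, snd s')" using Cons.prems(3) by simp
 qed (rule tl, rule tst)
 hence "snd (run tst \<rho> \<delta> c css (super_step tst \<rho> \<delta> c cs s)) = snd (run tst' \<rho> \<delta> c css (super_step tst' \<rho> \<delta> c cs s'))"
  using Cons.IH Cons.prems(1) by auto
 thus ?case unfolding run_def by simp
next
 case Nil
 show ?case unfolding run_def using Nil(3) by (simp only: fold.simps id_apply)
qed

text \<open>A family chosen at a price of at least 1 costs no more than the number of sampled
  points, so the total number of tests remains polynomial and a union bound over fresh points is
  affordable.\<close>

lemma rounds_tests:
 assumes "finite Fam" "finite A" "\<forall>b\<in>set bs. b <= A" "1 <= c * \<rho>" "0 <= \<delta>" "0 <= \<rho>" "finite (snd s)"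
 shows "finite (snd (rounds tst Fam \<rho> \<delta> c bs s)) & snd (rounds tst Fam \<rho> \<delta> c bs s) <= snd s Un Fam &
  card (snd (rounds tst Fam \<rho> \<delta> c bs s)) <= card (snd s) + length bs * card A"
 using assms
proof (induction bs arbitrary: c s)
 case (Cons b bs)
 define V where "V = best_cover tst Fam (fst s Int b) ((c + \<delta> / 2) * \<rho>)"
 have c1: "1 <= (c + \<delta> / 2) * \<rho>" "1 <= (c + \<delta>) * \<rho>"
 proof -
  have "0 <= \<delta> * \<rho>" using Cons.prems by simp
  thus "1 <= (c + \<delta> / 2) * \<rho>" "1 <= (c + \<delta>) * \<rho>"
   using Cons.prems(4) unfolding distrib_right by simp_all
 qed
 have VF: "V <= Fam" unfolding V_def by (rule best_cover(1)[OF Cons.prems(1)])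
 hence finV: "finite V" using Cons.prems(1) finite_subset by blast
 have b: "finite (fst s Int b)" "card (fst s Int b) <= card A"
  using Cons.prems by (auto intro: finite_subset card_mono)
 have "(c + \<delta> / 2) * \<rho> * weight V <= rcard (fst s Int b)"
  unfolding V_def using Cons.prems b c1 by (intro best_cover_weight_le) auto
 moreover have "1 * weight V <= (c + \<delta> / 2) * \<rho> * weight V" using c1 weight_nonneg by (intro mult_right_mono) auto
 ultimately have cV: "card V <= card A" using card_le_weight[OF finV] b by linarith
 have "card (snd s Un V) <= card (snd s) + card A" using card_Un_le[of "snd s" V] cV by linarith
 moreover have sn: "snd (round_step tst Fam \<rho> (c + \<delta> / 2) b s) = snd s Un V" by (simp add: round_step_def Let_def V_def)
 ultimately show ?case
  using Cons.IH[of "c + \<delta>" "round_step tst Fam \<rho> (c + \<delta> / 2) b s"] Cons.prems VF finV c1 unfolding sn by auto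
qed auto

lemma run_tests:
 assumes "finite A" "\<forall>cs\<in>set css. length cs = Suc R & (\<forall>b\<in>set cs. b <= A)" "1 <= c * \<rho>" "0 <= \<delta>" "0 <= \<rho>" "finite (snd s)"
 shows "finite (snd (run tst \<rho> \<delta> c css s)) & snd (run tst \<rho> \<delta> c css s) <= snd s Un (Pow (\<Union>(\<Union>(set ` set css))) - {{}}) &
  card (snd (run tst \<rho> \<delta> c css s)) <= card (snd s) + length css * (R * card A)"
 using assms
proof (induction css arbitrary: s)
 case (Cons cs css)
 define s' where "s' = super_step tst \<rho> \<delta> c cs s"
 have hd: "hd cs \<in> set cs" and tl: "set (tl cs) <= set cs" "length (tl cs) = R" using Cons.prems(2) by (cases cs; auto)+
 have "finite (hd cs)" using hd Cons.prems by (auto intro: finite_subset)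
 hence 1: "finite (snd s') & snd s' <= snd s Un (Pow (fst s Int hd cs) - {{}}) & card (snd s') <= card (snd s) + length (tl cs) * card A"
  using rounds_tests[of "Pow (fst s Int hd cs) - {{}}" A "tl cs" c \<rho> \<delta> "(fst s - hd cs, snd s)" tst] Cons.prems tl
  unfolding s'_def super_step_def by auto
 have 2: "finite (snd (run tst \<rho> \<delta> c css s')) & snd (run tst \<rho> \<delta> c css s') <= snd s' Un (Pow (\<Union>(\<Union>(set ` set css))) - {{}}) &
  card (snd (run tst \<rho> \<delta> c css s')) <= card (snd s') + length css * (R * card A)"
  by (rule Cons.IH) (use Cons.prems 1 in auto)
 have eq: "run tst \<rho> \<delta> c (cs # css) s = run tst \<rho> \<delta> c css s'" by (simp add: run_def s'_def)
 have "snd s' <= snd s Un (Pow (\<Union>(\<Union>(set ` set (cs # css)))) - {{}})" using 1 hd by auto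
 moreover have "Pow (\<Union>(\<Union>(set ` set css))) - {{}} <= Pow (\<Union>(\<Union>(set ` set (cs # css)))) - {{}}" by auto
 ultimately have "snd (run tst \<rho> \<delta> c css s') <= snd s Un (Pow (\<Union>(\<Union>(set ` set (cs # css)))) - {{}})"
  using 2 by (meson Un_least order_trans sup_ge2)
 thus ?case unfolding eq using 1 2 tl(2) by auto
qed (auto simp: run_def)

lemma prob_replicate_Suc_le:
 assumes "pprob p {x. ~ G x} <= a" "\<And>x. x \<in> set_pmf p ==> G x ==> pprob (replicate_pmf k p) {xs. P (x # xs)} <= b" "0 <= b"
 shows "pprob (replicate_pmf (Suc k) p) {xs. P xs} <= a + b"
proof -
 have "replicate_pmf (Suc k) p = bind_pmf p (%x. map_pmf ((#) x) (replicate_pmf k p))"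
  by (simp add: map_pmf_def)
 moreover have "pprob (map_pmf ((#) x) (replicate_pmf k p)) {xs. P xs} = pprob (replicate_pmf k p) {xs. P (x # xs)}" for x
  by (simp add: measure_map_pmf vimage_def)
 ultimately show ?thesis using prob_bind_le[of p G a "%x. map_pmf ((#) x) (replicate_pmf k p)" "{xs. P xs}" b] assms by simp
qed

text \<open>The price rises linearly and stays below \<open>2 * c0\<close>, while \<open>m\<close>
  falls geometrically; so logarithmically many rounds reach \<open>m < 1\<close>.\<close>

lemma rounds_immune_prob:
 fixes R :: real
 assumes fin: "finite Fam" "finite A"
  and par: "1 <= R" "0 < \<rho>" "\<rho> <= 1" "0 < \<beta>" "16 * (16 * R * \<beta>) * R / \<rho> <= c0"
  and Fam: "(\<Sum>f\<in>Fam. exp (- (\<beta> * (rcard f + 1)))) <= 1"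
  and st: "Z <= A" "immune tst Fam c m Z" "c0 <= c" "c + real k * (c0 / R) <= 2 * c0"
 shows "pprob (replicate_pmf k (random_subset \<rho> A))
  {bs. ~ immune tst Fam (c + real k * (c0 / R)) (m / 2 ^ k) (fst (rounds tst Fam \<rho> (c0 / R) c bs (Z, W)))} <= real k * (12 * exp (- \<beta>))"
 using st
proof (induction k arbitrary: c m Z W)
 case (Suc k)
 have c0: "0 <= c0 / R" using par by (smt (verit) divide_nonneg_nonneg mult_nonneg_nonneg)
 let ?s = "%b. round_step tst Fam \<rho> (c + c0 / R / 2) b (Z, W)"
 have s: "fst (?s b) = Z - b - covered tst Z (best_cover tst Fam (Z Int b) ((c + c0 / R / 2) * \<rho>))" for b
  by (simp add: round_step_def Let_def)
 have le: "c + c0 / R <= 2 * c0"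
 proof -
  have "0 <= real k * (c0 / R)" using c0 by (intro mult_nonneg_nonneg) auto
  thus ?thesis using Suc.prems(4) by (simp add: algebra_simps)
 qed
 have "pprob (replicate_pmf (Suc k) (random_subset \<rho> A))
  {bs. ~ immune tst Fam (c + real (Suc k) * (c0 / R)) (m / 2 ^ Suc k) (fst (rounds tst Fam \<rho> (c0 / R) c bs (Z, W)))}
   <= 12 * exp (- \<beta>) + real k * (12 * exp (- \<beta>))"
 proof (rule prob_replicate_Suc_le[where G = "%b. immune tst Fam (c + c0 / R) (m / 2) (fst (?s b))"])
  show "pprob (random_subset \<rho> A) {b. ~ immune tst Fam (c + c0 / R) (m / 2) (fst (?s b))} <= 12 * exp (- \<beta>)"
   unfolding s using fin Suc.prems par Fam le by (intro immune_step_prob) auto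
  fix b assume im: "immune tst Fam (c + c0 / R) (m / 2) (fst (?s b))"
  have "pprob (replicate_pmf k (random_subset \<rho> A))
   {bs. ~ immune tst Fam ((c + c0 / R) + real k * (c0 / R)) (m / 2 / 2 ^ k)
     (fst (rounds tst Fam \<rho> (c0 / R) (c + c0 / R) bs (fst (?s b), snd (?s b))))} <= real k * (12 * exp (- \<beta>))"
  proof (rule Suc.IH[OF _ im])
   show "fst (?s b) <= A" unfolding s using Suc.prems(1) by blast
   show "c0 <= c + c0 / R" using Suc.prems c0 by linarith
   show "c + c0 / R + real k * (c0 / R) <= 2 * c0" using Suc.prems(4) by (simp add: algebra_simps)
  qed
  thus "pprob (replicate_pmf k (random_subset \<rho> A))
   {bs. ~ immune tst Fam (c + real (Suc k) * (c0 / R)) (m / 2 ^ Suc k) (fst (rounds tst Fam \<rho> (c0 / R) c (b # bs) (Z, W)))}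
    <= real k * (12 * exp (- \<beta>))"
   by (simp add: algebra_simps)
 qed simp
 thus ?case by (simp add: algebra_simps)
qed simp

lemma correlation_le_mono:
 assumes "correlation_le G M Z \<Lambda>" "Z' <= Z" "\<Lambda> <= \<Lambda>'"
 shows "correlation_le G M Z' \<Lambda>'"
 unfolding correlation_le_def
proof (intro allI impI)
 fix S T assume ST: "S <= Z' & T <= Z' & S Int T = {} & rcard S <= M & rcard T <= M"
 have "\<bar>pair_sum G S T\<bar> <= \<Lambda> * sqrt (rcard S * rcard T)"
  by (rule correlation_leD[OF assms(1)]) (use ST assms(2) in auto)
 also have "... <= \<Lambda>' * sqrt (rcard S * rcard T)" using assms(3) by (intro mult_right_mono) auto
 finally show "\<bar>pair_sum G S T\<bar> <= \<Lambda>' * sqrt (rcard S * rcard T)" .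
qed

definition gram_bounded :: "('a => 'a => real) => real => real => 'a set => bool" where
 "gram_bounded G D B Z \<longleftrightarrow> (\<forall>f\<subseteq>Z. 0 <= pair_sum G f f) & (\<forall>i\<in>Z. 0 <= G i i & G i i <= D) &
   (\<forall>i\<in>Z. \<forall>j\<in>Z. i ~= j --> \<bar>G i j\<bar> <= B)"

lemma gram_bounded_subset: "gram_bounded G D B Z ==> Z' <= Z ==> gram_bounded G D B Z'"
 unfolding gram_bounded_def by (meson order_trans subsetD)

text \<open>\<Theta> is the level at which the halving of correlations stops. \<open>H1\<close> to
  \<open>H5\<close> are the requirements of \<open>amplification_contradiction\<close> at level
  \<Theta> and price \<open>2 * c0\<close>; they persist at every higher level. \<open>H4\<close> is
  split in two because there \<theta> occurs on both sides.\<close>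

locale amplification =
 fixes G :: "'a => 'a => real" and A :: "'a set" and M D B thr q \<rho> \<beta> c0 \<nu> \<Theta> :: real and R :: nat
 assumes finA: "finite A" and sym: "\<And>i j. G i j = G j i"
  and pos: "0 < M" "0 < B" "0 <= D" "0 < \<rho>" "\<rho> <= 1" "0 < q" "q <= 1" "2 <= \<beta>" "0 <= thr" "0 < \<nu>" "0 < \<Theta>" "1 <= R"
  and cardA: "rcard A * exp (- \<beta>) <= 1" "rcard A < 2 ^ R"
  and c0: "16 * (16 * real R * \<beta>) * real R / \<rho> <= c0"
  and H1: "128 * B\<^sup>2 * M <= q * \<Theta>\<^sup>2"
  and H2: "1024 * q * \<beta> <= \<rho>" and H3: "512 * \<beta> / \<rho> <= \<Theta> / B"
  and H4: "2048 * M * (32 * B\<^sup>2 + 64 * thr\<^sup>2 * D) <= \<nu> * \<Theta>\<^sup>2" "262144 * M * thr\<^sup>2 <= \<nu> * \<Theta>"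
  and H5: "128 * \<nu> <= \<rho>" "1048576 * (2 * c0) * \<nu> <= \<rho> * q\<^sup>2" "131072 * (2 * c0) <= \<rho> * q\<^sup>2 * (\<Theta>\<^sup>2 / (B\<^sup>2 * M))"
begin

lemma c0_pos: "0 < c0"
proof -
 have "0 < 16 * (16 * real R * \<beta>) * real R / \<rho>" using pos by (intro divide_pos_pos mult_pos_pos) auto
 thus ?thesis using c0 by linarith
qed

text \<open>With \<open>m < 1\<close> immunity says that no single test from the pool pays at price
  \<open>2 * c0\<close>. By amplification, a pair correlated beyond half the old level, and beyond
  \<Theta>, would produce a test that does.\<close>

lemma pool_immune_correlation_le:
 assumes Z: "Z <= A" "gram_bounded G D B Z" and lev: "correlation_le G M Z \<Lambda>"
  and pool: "pool_representative G \<rho> \<beta> Z p" and Q: "Q <= Z - p"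
  and imm: "immune (exceeds thr G) (Pow (Z Int p) - {{}}) (2 * c0) m Q" "m < 1"
 shows "correlation_le G M Q (max (\<Lambda> / 2) \<Theta>)"
proof -
 define \<theta> where "\<theta> = max (\<Lambda> / 2) \<Theta>"
 have \<theta>: "\<Theta> <= \<theta>" "0 < \<theta>" "\<Lambda> <= 2 * \<theta>" using pos by (auto simp: \<theta>_def)
 have \<theta>2: "\<Theta>\<^sup>2 <= \<theta>\<^sup>2" using \<theta> pos by (intro power_mono) auto
 have finZ: "finite Z" "finite Q" using Z Q finA finite_subset[of Z A] finite_subset[of Q Z] by auto
 have gram: "\<And>f. f <= Z ==> 0 <= pair_sum G f f" "\<And>i. i \<in> Z ==> 0 <= G i i & G i i <= D"
  "\<And>i j. i \<in> Z ==> j \<in> Z ==> i ~= j ==> \<bar>G i j\<bar> <= B"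
  using Z(2) unfolding gram_bounded_def by auto
 have few: "rcard {i\<in>Q. exceeds thr G i f} < 2 * c0 * (rcard f + 1)" if "f <= Z Int p" "f ~= {}" for f
 proof (rule ccontr)
  assume neg: "~ ?thesis"
  have cov: "covered (exceeds thr G) Q {f} = {i\<in>Q. exceeds thr G i f}" by (auto simp: covered_def)
  have w: "weight {f} = rcard f + 1" by (simp add: weight_def)
  have "rcard {i\<in>Q. exceeds thr G i f} <= m"
   using imm(1) that neg unfolding immune_def by (auto dest!: spec[of _ "{f}"] simp: cov w)
  hence "card {i\<in>Q. exceeds thr G i f} = 0" using imm(2) by linarith
  moreover have "0 < 2 * c0 * (rcard f + 1)" using c0_pos by (intro mult_pos_pos) auto
  ultimately show False using neg by linarith
 qed
 have H1': "128 * B\<^sup>2 * M <= q * \<theta>\<^sup>2" using H1 mult_left_mono[OF \<theta>2, of q] pos by linarith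
 have H3': "512 * \<beta> / \<rho> <= \<theta> / B" using H3 divide_right_mono[OF \<theta>(1), of B] pos by linarith
 have H4': "1024 * M * (32 * B\<^sup>2 + 64 * thr\<^sup>2 * (D + 2 * \<theta>)) <= \<nu> * \<theta>\<^sup>2"
 proof -
  have "2048 * M * (32 * B\<^sup>2 + 64 * thr\<^sup>2 * D) <= \<nu> * \<theta>\<^sup>2"
   using H4(1) mult_left_mono[OF \<theta>2, of \<nu>] pos by linarith
  moreover have "262144 * M * thr\<^sup>2 * \<theta> <= \<nu> * \<theta> * \<theta>"
  proof (rule mult_right_mono)
   show "262144 * M * thr\<^sup>2 <= \<nu> * \<theta>" using H4(2) mult_left_mono[OF \<theta>(1), of \<nu>] pos by linarith
  qed (use \<theta> in simp)
  ultimately show ?thesis by (simp add: algebra_simps power2_eq_square)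
 qed
 have H5': "131072 * (2 * c0) <= \<rho> * q\<^sup>2 * (\<theta>\<^sup>2 / (B\<^sup>2 * M))"
 proof -
  have "\<Theta>\<^sup>2 / (B\<^sup>2 * M) <= \<theta>\<^sup>2 / (B\<^sup>2 * M)" using \<theta>2 pos by (intro divide_right_mono) auto
  hence "\<rho> * q\<^sup>2 * (\<Theta>\<^sup>2 / (B\<^sup>2 * M)) <= \<rho> * q\<^sup>2 * (\<theta>\<^sup>2 / (B\<^sup>2 * M))" using pos by (intro mult_left_mono) auto
  thus ?thesis using H5(3) by linarith
 qed
 have c2: "0 < 2 * c0" "0 < \<beta>" using c0_pos pos by auto
 have lev2: "correlation_le G M Z (2 * \<theta>)" by (rule correlation_le_mono[OF lev subset_refl \<theta>(3)])
 have main: "\<bar>pair_sum G S T\<bar> <= \<theta> * sqrt (rcard S * rcard T)"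
  if ST: "S <= Q" "T <= Q" "S Int T = {}" "rcard S <= M" "card T <= card S" for S T
 proof (rule ccontr)
  assume neg: "~ ?thesis"
  define s :: real where "s = (if 0 <= pair_sum G S T then 1 else - 1)"
  have s: "s \<in> {1, - 1}" "\<theta> * sqrt (rcard S * rcard T) < s * pair_sum G S T"
   using neg by (auto simp: s_def not_le)
  show False
   by (rule amplification_contradiction[OF sym gram(1) finZ(1) gram(2,3) lev2 pool Q few \<theta>(2) pos(2-7) c2(2,1) pos(9,10,1)
      H1' H2 H3' H4' H5(1,2) H5' ST s])
 qed
 show ?thesis unfolding correlation_le_def \<theta>_def[symmetric]
 proof (intro allI impI)
  fix S T assume ST: "S <= Q & T <= Q & S Int T = {} & rcard S <= M & rcard T <= M"
  show "\<bar>pair_sum G S T\<bar> <= \<theta> * sqrt (rcard S * rcard T)"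
  proof (cases "card T <= card S")
   case False
   hence "\<bar>pair_sum G T S\<bar> <= \<theta> * sqrt (rcard T * rcard S)" using ST by (intro main) auto
   thus ?thesis using pair_sum_commute[of G S T, OF sym] by (simp add: mult.commute)
  qed (use ST main in auto)
 qed
qed

lemma super_step_prob:
 assumes Z: "Z <= A" "gram_bounded G D B Z" and lev: "correlation_le G M Z \<Lambda>"
 shows "pprob (replicate_pmf (Suc R) (random_subset \<rho> A))
   {cs. ~ correlation_le G M (fst (super_step (exceeds thr G) \<rho> (c0 / R) c0 cs (Z, W))) (max (\<Lambda> / 2) \<Theta>)}
   <= 6 * exp (- \<beta>) + real R * (12 * exp (- \<beta>))"
proof (rule prob_replicate_Suc_le[where G="pool_representative G \<rho> \<beta> Z"])
 show "pprob (random_subset \<rho> A) {p. ~ pool_representative G \<rho> \<beta> Z p} <= 6 * exp (- \<beta>)"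
  using finA Z pos cardA by (intro prob_pool_not_representative) auto
 fix p assume p: "p \<in> set_pmf (random_subset \<rho> A)" and pool: "pool_representative G \<rho> \<beta> Z p"
 have pA: "p <= A" using p set_random_subset by auto
 have finp: "finite (Z Int p)" using pA finA finite_subset by blast
 hence finPow: "finite (Pow (Z Int p))" by (rule finite_Pow_iff[THEN iffD2])
 let ?F = "Pow (Z Int p) - {{}}"
 let ?Q = "%bs. fst (rounds (exceeds thr G) ?F \<rho> (c0 / R) c0 bs (Z - p, W))"
 have sumF: "(\<Sum>f\<in>?F. exp (- (\<beta> * (rcard f + 1)))) <= 1"
 proof -
  have "(\<Sum>f\<in>?F. exp (- (\<beta> * (rcard f + 1)))) <= (\<Sum>f\<in>Pow (Z Int p). exp (- (\<beta> * (rcard f + 1))))"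
   by (rule sum_mono2[OF finPow]) auto
  also have "... = exp (- \<beta>) * (\<Sum>f\<in>Pow (Z Int p). exp (- (\<beta> * rcard f)))"
   unfolding sum_distrib_left by (rule sum.cong) (auto simp: exp_add[symmetric] algebra_simps)
  also have "... <= exp (- \<beta>) * 3"
  proof (rule mult_left_mono[OF sum_exp_card_le[OF finp]])
   have "card (Z Int p) <= card A" using pA finA by (intro card_mono) auto
   hence "rcard (Z Int p) * exp (- \<beta>) <= rcard A * exp (- \<beta>)" by simp
   thus "rcard (Z Int p) * exp (- \<beta>) <= 1" using cardA by linarith
  qed simp
  also have "... <= 1"
  proof -
   have "1 + \<beta> <= exp \<beta>" by (rule exp_ge_add_one_self)
   hence "3 <= exp \<beta>" using pos by linarith
   thus ?thesis by (simp add: exp_minus field_simps)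
  qed
  finally show ?thesis .
 qed
 \<comment> \<open>The start is trivial: no family flags more than all the points.\<close>
 have imm0: "immune (exceeds thr G) ?F c0 (rcard A) (Z - p)"
  unfolding immune_def
 proof (intro allI impI)
  fix V
  have "covered (exceeds thr G) (Z - p) V <= A" using Z by (auto simp: covered_def)
  thus "real (card (covered (exceeds thr G) (Z - p) V)) <= rcard A" using finA by (simp add: card_mono)
 qed
 have "pprob (replicate_pmf R (random_subset \<rho> A))
    {bs. ~ immune (exceeds thr G) ?F (c0 + real R * (c0 / real R)) (rcard A / 2 ^ R) (?Q bs)} <= real R * (12 * exp (- \<beta>))"
  by (rule rounds_immune_prob[OF _ finA _ _ _ _ c0 sumF _ imm0]) (use finPow pos Z in \<open>auto simp del: Pow_Int_eq\<close>)
 moreover have "pprob (replicate_pmf R (random_subset \<rho> A))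
   {bs. ~ correlation_le G M (fst (super_step (exceeds thr G) \<rho> (c0 / R) c0 (p # bs) (Z, W))) (max (\<Lambda> / 2) \<Theta>)}
  <= pprob (replicate_pmf R (random_subset \<rho> A))
    {bs. ~ immune (exceeds thr G) ?F (c0 + real R * (c0 / real R)) (rcard A / 2 ^ R) (?Q bs)}"
 proof (rule measure_pmf.finite_measure_mono)
  show "{bs. ~ correlation_le G M (fst (super_step (exceeds thr G) \<rho> (c0 / R) c0 (p # bs) (Z, W))) (max (\<Lambda> / 2) \<Theta>)}
   <= {bs. ~ immune (exceeds thr G) ?F (c0 + real R * (c0 / real R)) (rcard A / 2 ^ R) (?Q bs)}"
  proof (rule subsetI, rule CollectI, rule notI)
   fix bs assume neg: "bs \<in> {bs. ~ correlation_le G M (fst (super_step (exceeds thr G) \<rho> (c0 / R) c0 (p # bs) (Z, W))) (max (\<Lambda> / 2) \<Theta>)}"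
    and "immune (exceeds thr G) ?F (c0 + real R * (c0 / real R)) (rcard A / 2 ^ R) (?Q bs)"
   hence im: "immune (exceeds thr G) ?F (2 * c0) (rcard A / 2 ^ R) (?Q bs)" using pos by simp
   have sub: "?Q bs <= Z - p" for bs
   proof -
    have "fst (rounds tst F \<rho> \<delta> c bs s) <= fst s" for tst F \<delta> c and s :: "'a filter_state"
     by (induction bs arbitrary: c s) (auto simp: round_step_def Let_def, blast)
    thus ?thesis by (metis fst_conv)
   qed
   have "correlation_le G M (?Q bs) (max (\<Lambda> / 2) \<Theta>)"
    by (rule pool_immune_correlation_le[OF Z lev pool sub im]) (use cardA in simp)
   thus False using neg by (simp add: super_step_def)
  qed
 qed simp
 ultimately show "pprob (replicate_pmf R (random_subset \<rho> A))
   {bs. ~ correlation_le G M (fst (super_step (exceeds thr G) \<rho> (c0 / R) c0 (p # bs) (Z, W))) (max (\<Lambda> / 2) \<Theta>)} <= real R * (12 * exp (- \<beta>))"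
  by linarith
qed simp

lemma run_prob:
 assumes "Z <= A" "gram_bounded G D B Z" "correlation_le G M Z \<Lambda>"
 shows "pprob (replicate_pmf J (replicate_pmf (Suc R) (random_subset \<rho> A)))
   {css. ~ correlation_le G M (fst (run (exceeds thr G) \<rho> (c0 / R) c0 css (Z, W))) (max (\<Lambda> / 2 ^ J) \<Theta>)}
   <= real J * (6 * exp (- \<beta>) + real R * (12 * exp (- \<beta>)))"
 using assms
proof (induction J arbitrary: Z \<Lambda> W)
 case 0
 have "correlation_le G M Z (max (\<Lambda> / 2 ^ 0) \<Theta>)" by (rule correlation_le_mono[OF 0(3)]) auto
 thus ?case by (simp add: run_def indicator_def)
next
 case (Suc J)
 let ?e = "6 * exp (- \<beta>) + real R * (12 * exp (- \<beta>))"
 let ?s = "%cs. super_step (exceeds thr G) \<rho> (c0 / R) c0 cs (Z, W)"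
 have sub: "fst (rounds tst F \<rho> \<delta> c bs s) <= fst s" for tst F \<delta> c bs and s :: "'a filter_state"
  by (induction bs arbitrary: c s) (auto simp: round_step_def Let_def, blast)
 have "pprob (replicate_pmf (Suc J) (replicate_pmf (Suc R) (random_subset \<rho> A)))
   {css. ~ correlation_le G M (fst (run (exceeds thr G) \<rho> (c0 / R) c0 css (Z, W))) (max (\<Lambda> / 2 ^ Suc J) \<Theta>)}
   <= ?e + real J * ?e"
 proof (rule prob_replicate_Suc_le[where G="%cs. correlation_le G M (fst (?s cs)) (max (\<Lambda> / 2) \<Theta>)"])
  show "pprob (replicate_pmf (Suc R) (random_subset \<rho> A)) {cs. ~ correlation_le G M (fst (?s cs)) (max (\<Lambda> / 2) \<Theta>)} <= ?e"
   by (rule super_step_prob[OF Suc.prems])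
  fix cs assume lev: "correlation_le G M (fst (?s cs)) (max (\<Lambda> / 2) \<Theta>)"
  have Z': "fst (?s cs) <= Z" using sub[where s="(Z - hd cs, W)"] unfolding super_step_def by fastforce
  have "pprob (replicate_pmf J (replicate_pmf (Suc R) (random_subset \<rho> A)))
   {css. ~ correlation_le G M (fst (run (exceeds thr G) \<rho> (c0 / R) c0 css (fst (?s cs), snd (?s cs)))) (max (max (\<Lambda> / 2) \<Theta> / 2 ^ J) \<Theta>)}
   <= real J * ?e"
   by (rule Suc.IH[OF _ _ lev]) (use Z' Suc.prems gram_bounded_subset in auto)
  moreover have "max (max (\<Lambda> / 2) \<Theta> / 2 ^ J) \<Theta> = max (\<Lambda> / 2 ^ Suc J) \<Theta>"
  proof -
   have "\<Theta> / 2 ^ J <= \<Theta>" using pos by (simp add: field_simps)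
   thus ?thesis by (auto simp: max_def field_simps)
  qed
  ultimately show "pprob (replicate_pmf J (replicate_pmf (Suc R) (random_subset \<rho> A)))
   {css. ~ correlation_le G M (fst (run (exceeds thr G) \<rho> (c0 / R) c0 (cs # css) (Z, W))) (max (\<Lambda> / 2 ^ Suc J) \<Theta>)} <= real J * ?e"
   by (simp add: run_def)
 qed simp
 thus ?case by (simp add: algebra_simps)
qed

end

section \<open>Exponential moments and tails of Gaussian points\<close>

lemma nn_integral_normal_density: "0 < \<sigma> ==> (\<integral>\<^sup>+x. ennreal (normal_density m \<sigma> x) \<partial>lborel) = 1"
 using prob_space.emeasure_space_1[OF prob_space_normal_density[of \<sigma> m]]
 by (simp add: emeasure_density)

text \<open>Completing the square: the exponential tilt moves the mean from \<open>m\<close> to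
  \<open>m + c\<close>.\<close>

lemma nn_integral_normal_exp:
 "(\<integral>\<^sup>+x. ennreal (exp (c * (x - m))) \<partial>density lborel (%x. ennreal (normal_density m 1 x))) = ennreal (exp (c\<^sup>2 / 2))"
proof -
 have "(\<integral>\<^sup>+x. ennreal (exp (c * (x - m))) \<partial>density lborel (%x. ennreal (normal_density m 1 x))) =
  (\<integral>\<^sup>+x. ennreal (normal_density m 1 x) * ennreal (exp (c * (x - m))) \<partial>lborel)"
  by (subst nn_integral_density) auto
 also have "... = (\<integral>\<^sup>+x. ennreal (exp (c\<^sup>2 / 2)) * ennreal (normal_density (m + c) 1 x) \<partial>lborel)"
 proof (rule nn_integral_cong)
  fix x :: real
  have "exp (c * (x - m)) * exp (- (x - m)\<^sup>2 / 2) = exp (c\<^sup>2 / 2) * exp (- (x - (m + c))\<^sup>2 / 2)"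
   unfolding exp_add[symmetric] by (intro arg_cong[where f=exp]) (simp add: power2_eq_square field_simps)
  hence "normal_density m 1 x * exp (c * (x - m)) = exp (c\<^sup>2 / 2) * normal_density (m + c) 1 x"
   by (simp add: normal_density_def field_simps)
  thus "ennreal (normal_density m 1 x) * ennreal (exp (c * (x - m))) = ennreal (exp (c\<^sup>2 / 2)) * ennreal (normal_density (m + c) 1 x)"
   by (simp add: ennreal_mult[symmetric])
 qed
 also have "... = ennreal (exp (c\<^sup>2 / 2))" by (simp add: nn_integral_cmult nn_integral_normal_density)
 finally show ?thesis .
qed

text \<open>The tilt by a square changes the variance to \<open>1 / (1 - 2 * a)\<close>, so the
  integral is the corresponding standard deviation; a second-order bound for the logarithm does the
  rest.\<close>

lemma nn_integral_normal_exp_square: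
 assumes "\<bar>a\<bar> <= 1 / 4"
 shows "(\<integral>\<^sup>+x. ennreal (exp (a * (x - m)\<^sup>2)) \<partial>density lborel (%x. ennreal (normal_density m 1 x))) <= ennreal (exp (a + 4 * a\<^sup>2))"
proof -
 define s where "s = 1 / sqrt (1 - 2 * a)"
 have pos: "0 < 1 - 2 * a" using assms by (simp add: abs_le_iff)
 have s: "0 < s" "s\<^sup>2 = 1 / (1 - 2 * a)" using pos by (auto simp: s_def power_divide)
 have "(\<integral>\<^sup>+x. ennreal (exp (a * (x - m)\<^sup>2)) \<partial>density lborel (%x. ennreal (normal_density m 1 x))) =
  (\<integral>\<^sup>+x. ennreal (normal_density m 1 x) * ennreal (exp (a * (x - m)\<^sup>2)) \<partial>lborel)"
  by (subst nn_integral_density) auto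
 also have "... = (\<integral>\<^sup>+x. ennreal s * ennreal (normal_density m s x) \<partial>lborel)"
 proof (rule nn_integral_cong)
  fix x :: real
  have "exp (a * (x - m)\<^sup>2) * exp (- (x - m)\<^sup>2 / 2) = exp (- (x - m)\<^sup>2 / (2 * s\<^sup>2))"
   unfolding exp_add[symmetric] s(2) using pos by (intro arg_cong[where f=exp]) (simp add: field_simps)
  moreover have "sqrt (2 * pi * s\<^sup>2) = sqrt (2 * pi) * s" using s(1) by (simp add: real_sqrt_mult)
  ultimately have "normal_density m 1 x * exp (a * (x - m)\<^sup>2) = s * normal_density m s x"
   using s(1) by (simp add: normal_density_def field_simps)
  thus "ennreal (normal_density m 1 x) * ennreal (exp (a * (x - m)\<^sup>2)) = ennreal s * ennreal (normal_density m s x)"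
   using s(1) by (simp add: ennreal_mult[symmetric])
 qed
 also have "... = ennreal s" using s(1) by (simp add: nn_integral_cmult nn_integral_normal_density)
 also have "s <= exp (a + 4 * a\<^sup>2)"
 proof -
  have ln: "- (2 * a) - 2 * (2 * a)\<^sup>2 <= ln (1 - 2 * a)"
  proof (cases "0 <= a")
   case True
   thus ?thesis using ln_one_minus_pos_lower_bound[of "2 * a"] assms by simp
  next
   case False
   have "(- (2 * a)) - (- (2 * a))\<^sup>2 <= ln (1 + (- (2 * a)))"
    using False assms by (intro ln_one_plus_pos_lower_bound) (auto simp: abs_le_iff)
   hence "- (2 * a) - 4 * a\<^sup>2 <= ln (1 - 2 * a)" by (simp add: power_mult_distrib)
   hence "- (2 * a) - 8 * a\<^sup>2 <= ln (1 - 2 * a)" using zero_le_power2[of a] by linarith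
   thus ?thesis by (simp add: power_mult_distrib)
  qed
  have "s = exp (- ln (1 - 2 * a) / 2)"
  proof -
   have "ln s = - ln (1 - 2 * a) / 2" using pos by (simp add: s_def ln_div ln_sqrt)
   thus ?thesis using s(1) by (metis exp_ln)
  qed
  also have "... <= exp (a + 4 * a\<^sup>2)" using ln by (simp add: power_mult_distrib)
  finally show ?thesis .
 qed
 finally show ?thesis by (simp add: ennreal_leI)
qed

lemma prob_space_gaussian: "prob_space (gaussian d mu)"
 unfolding gaussian_def by (intro prob_space_PiM prob_space_normal_density) simp

lemma sets_gaussian [measurable_cong]: "sets (gaussian d mu) = sets (point_space d)"
 unfolding gaussian_def point_space_def by (intro sets_PiM_cong) auto

lemma space_gaussian: "space (gaussian d mu) = space (point_space d)"
 by (rule sets_eq_imp_space_eq) (rule sets_gaussian)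

lemma measurable_point [measurable]: "j < d ==> (%x. x j) \<in> borel_measurable (point_space d)"
 unfolding point_space_def by measurable

lemma measurable_dot [measurable]:
 assumes [measurable]: "\<And>j. j < d ==> (%x. u x j) \<in> borel_measurable M" "\<And>j. j < d ==> (%x. v x j) \<in> borel_measurable M"
 shows "(%x. dot d (u x) (v x)) \<in> borel_measurable M"
 unfolding dot_def by measurable

lemma gaussian_exp_dot:
 "(\<integral>\<^sup>+x. ennreal (exp (dot d (%j. x j - mu j) v)) \<partial>gaussian d mu) = ennreal (exp (dot d v v / 2))"
proof -
 interpret product_sigma_finite "%j. density lborel (%x. ennreal (normal_density (mu j) 1 x))"
  by (intro product_sigma_finite.intro prob_space_imp_sigma_finite prob_space_normal_density) simp
 have "(\<integral>\<^sup>+x. ennreal (exp (dot d (%j. x j - mu j) v)) \<partial>gaussian d mu) =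
  (\<integral>\<^sup>+x. (\<Prod>j<d. ennreal (exp (v j * (x j - mu j)))) \<partial>gaussian d mu)"
  by (simp add: dot_def exp_sum prod_ennreal mult.commute)
 also have "... = (\<Prod>j<d. ennreal (exp ((v j)\<^sup>2 / 2)))"
  unfolding gaussian_def by (subst product_nn_integral_prod) (auto simp: nn_integral_normal_exp)
 also have "... = ennreal (exp (dot d v v / 2))"
  by (simp add: prod_ennreal exp_sum[symmetric] dot_def sum_divide_distrib power2_eq_square)
 finally show ?thesis .
qed

lemma gaussian_exp_square_le:
 assumes "\<bar>a\<bar> <= 1 / 4"
 shows "(\<integral>\<^sup>+x. ennreal (exp (a * dot d (%j. x j - mu j) (%j. x j - mu j))) \<partial>gaussian d mu) <= ennreal (exp (real d * (a + 4 * a\<^sup>2)))"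
proof -
 interpret product_sigma_finite "%j. density lborel (%x. ennreal (normal_density (mu j) 1 x))"
  by (intro product_sigma_finite.intro prob_space_imp_sigma_finite prob_space_normal_density) simp
 have "(\<integral>\<^sup>+x. ennreal (exp (a * dot d (%j. x j - mu j) (%j. x j - mu j))) \<partial>gaussian d mu) =
  (\<integral>\<^sup>+x. (\<Prod>j<d. ennreal (exp (a * (x j - mu j)\<^sup>2))) \<partial>gaussian d mu)"
  by (simp add: dot_def exp_sum prod_ennreal sum_distrib_left power2_eq_square)
 also have "... = (\<Prod>j<d. \<integral>\<^sup>+x. ennreal (exp (a * (x - mu j)\<^sup>2)) \<partial>density lborel (%x. ennreal (normal_density (mu j) 1 x)))"
  unfolding gaussian_def by (subst product_nn_integral_prod) auto
 also have "... <= (\<Prod>j<d. ennreal (exp (a + 4 * a\<^sup>2)))"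
  by (intro prod_mono_ennreal nn_integral_normal_exp_square assms)
 also have "... = ennreal (exp (real d * (a + 4 * a\<^sup>2)))"
  by (simp add: ennreal_power exp_of_nat_mult)
 finally show ?thesis .
qed

lemma chernoff_bound:
 assumes "prob_space M" and [measurable]: "f \<in> borel_measurable M" and le: "(\<integral>\<^sup>+x. ennreal (exp (f x)) \<partial>M) <= ennreal K" and K: "0 <= K"
 shows "measure M {x\<in>space M. s <= f x} <= K * exp (- s)"
proof -
 interpret prob_space M by fact
 have "emeasure M {x\<in>space M. s <= f x} = (\<integral>\<^sup>+x. indicator {x\<in>space M. s <= f x} x \<partial>M)" by simp
 also have "... <= (\<integral>\<^sup>+x. ennreal (exp (- s)) * ennreal (exp (f x)) \<partial>M)"
 proof (rule nn_integral_mono)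
  fix x
  have "1 <= exp (- s) * exp (f x)" if "s <= f x" using that by (simp add: exp_add[symmetric])
  thus "indicator {x\<in>space M. s <= f x} x <= ennreal (exp (- s)) * ennreal (exp (f x))"
   by (auto simp: indicator_def ennreal_mult[symmetric])
 qed
 also have "... = ennreal (exp (- s)) * (\<integral>\<^sup>+x. ennreal (exp (f x)) \<partial>M)" by (rule nn_integral_cmult) simp
 also have "... <= ennreal (exp (- s)) * ennreal K" by (intro mult_left_mono le) simp
 also have "... = ennreal (K * exp (- s))" using K by (simp add: ennreal_mult[symmetric] mult.commute)
 finally show ?thesis using K by (simp add: emeasure_eq_measure)
qed

lemma dot_self_nonneg: "0 <= dot d v v"
 unfolding dot_def by (intro sum_nonneg) auto

lemma norm2_power2: "(norm2 d v)\<^sup>2 = dot d v v"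
 by (simp add: norm2_def L2_set_def dot_def sum_nonneg power2_eq_square)

lemma norm2_nonneg: "0 <= norm2 d v"
 by (simp add: norm2_def)

lemma norm2_eq_sqrt: "norm2 d v = sqrt (dot d v v)"
 by (simp add: norm2_def L2_set_def dot_def power2_eq_square)

lemma dot_Cauchy_Schwarz: "\<bar>dot d u v\<bar> <= norm2 d u * norm2 d v"
proof -
 have "\<bar>dot d u v\<bar> <= (\<Sum>j<d. \<bar>u j\<bar> * \<bar>v j\<bar>)" unfolding dot_def by (rule order_trans[OF sum_abs]) (simp add: abs_mult)
 also have "... <= norm2 d u * norm2 d v" unfolding norm2_def by (rule L2_set_mult_ineq)
 finally show ?thesis .
qed

lemma dot_commute: "dot d u v = dot d v u"
 by (simp add: dot_def mult.commute)

lemma dot_scale: "dot d u (%j. c * v j) = c * dot d u v" "dot d (%j. c * u j) v = c * dot d u v"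
 by (auto simp: dot_def sum_distrib_left mult_ac)

lemma gaussian_linear_tail:
 assumes "0 < t"
 shows "measure (gaussian d mu) {x\<in>space (gaussian d mu). t * norm2 d v < \<bar>dot d (%j. x j - mu j) v\<bar>} <= 2 * exp (- (t\<^sup>2 / 2))"
proof (cases "norm2 d v = 0")
 case True
 have "\<bar>dot d u v\<bar> = 0" for u using dot_Cauchy_Schwarz[of d u v] True by simp
 thus ?thesis using True by simp
next
 case False
 interpret prob_space "gaussian d mu" by (rule prob_space_gaussian)
 define r where "r = norm2 d v"
 have r: "0 < r" "r\<^sup>2 = dot d v v" using False norm2_nonneg[of d v] by (auto simp: r_def norm2_power2)
 have side: "prob {x\<in>space (gaussian d mu). t\<^sup>2 <= dot d (%j. x j - mu j) (%j. c * v j)} <= exp (t\<^sup>2 / 2) * exp (- t\<^sup>2)"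
  if c: "c\<^sup>2 = (t / r)\<^sup>2" for c
 proof (rule chernoff_bound[OF prob_space_axioms])
  have "dot d (%j. c * v j) (%j. c * v j) = t\<^sup>2"
   using c r by (simp add: dot_scale power2_eq_square field_simps)
  thus "(\<integral>\<^sup>+x. ennreal (exp (dot d (%j. x j - mu j) (%j. c * v j))) \<partial>gaussian d mu) <= ennreal (exp (t\<^sup>2 / 2))"
   by (simp add: gaussian_exp_dot)
  show "(%x. dot d (%j. x j - mu j) (%j. c * v j)) \<in> borel_measurable (gaussian d mu)" by measurable
 qed simp
 have "{x\<in>space (gaussian d mu). t * norm2 d v < \<bar>dot d (%j. x j - mu j) v\<bar>} \<subseteq>
   {x\<in>space (gaussian d mu). t\<^sup>2 <= dot d (%j. x j - mu j) (%j. (t / r) * v j)} \<union>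
   {x\<in>space (gaussian d mu). t\<^sup>2 <= dot d (%j. x j - mu j) (%j. (- (t / r)) * v j)}"
 proof
  fix x assume x: "x \<in> {x\<in>space (gaussian d mu). t * norm2 d v < \<bar>dot d (%j. x j - mu j) v\<bar>}"
  let ?w = "dot d (%j. x j - mu j) v"
  have "t * r < \<bar>?w\<bar>" using x by (simp add: r_def)
  hence "(t / r) * (t * r) <= (t / r) * \<bar>?w\<bar>" using assms r by (intro mult_left_mono) auto
  hence "t\<^sup>2 <= (t / r) * \<bar>?w\<bar>" using r by (simp add: power2_eq_square)
  hence "t\<^sup>2 <= (t / r) * ?w \<or> t\<^sup>2 <= (- (t / r)) * ?w" by (cases "0 <= ?w") auto
  thus "x \<in> {x\<in>space (gaussian d mu). t\<^sup>2 <= dot d (%j. x j - mu j) (%j. (t / r) * v j)} \<union>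
   {x\<in>space (gaussian d mu). t\<^sup>2 <= dot d (%j. x j - mu j) (%j. (- (t / r)) * v j)}"
   using x by (auto simp only: dot_scale Un_iff mem_Collect_eq)
 qed
 hence "prob {x\<in>space (gaussian d mu). t * norm2 d v < \<bar>dot d (%j. x j - mu j) v\<bar>} <=
   prob ({x\<in>space (gaussian d mu). t\<^sup>2 <= dot d (%j. x j - mu j) (%j. (t / r) * v j)} \<union>
   {x\<in>space (gaussian d mu). t\<^sup>2 <= dot d (%j. x j - mu j) (%j. (- (t / r)) * v j)})"
  by (intro finite_measure_mono) (auto intro!: sets.Un)
 also have "... <= exp (t\<^sup>2 / 2) * exp (- t\<^sup>2) + exp (t\<^sup>2 / 2) * exp (- t\<^sup>2)"
  by (rule order_trans[OF measure_Un_le add_mono[OF side[of "t / r"] side[of "- (t / r)"]]]) simp_all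
 also have "... = 2 * exp (- (t\<^sup>2 / 2))" by (simp add: exp_add[symmetric])
 finally show ?thesis .
qed

text \<open>Chernoff bound with the exponents \<open>1 / (4 * sqrt d)\<close> and its negative. This
  is the order at which the second-order term \<open>4 * a\<^sup>2 * d\<close> of the exponential
  moment is still a constant, namely 1/4.\<close>

lemma gaussian_norm_tail:
 assumes "1 <= d"
 shows "measure (gaussian d mu) {x\<in>space (gaussian d mu). t * sqrt d < \<bar>dot d (%j. x j - mu j) (%j. x j - mu j) - d\<bar>} <= 2 * exp (1 / 4 - t / 4)"
proof -
 interpret prob_space "gaussian d mu" by (rule prob_space_gaussian)
 let ?w = "%x. dot d (%j. x j - mu j) (%j. x j - mu j)"
 have sd: "1 <= sqrt d" "sqrt d * sqrt d = d" using assms by auto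
 have side: "prob {x\<in>space (gaussian d mu). t / 4 + a * d <= a * ?w x} <= exp (1 / 4 - t / 4)"
  if a: "a\<^sup>2 = 1 / (16 * real d)" for a :: real
 proof -
  have "a\<^sup>2 <= (1 / 4)\<^sup>2" unfolding a using assms by (simp add: power2_eq_square field_simps)
  hence a4: "\<bar>a\<bar> <= 1 / 4" using abs_le_square_iff[of a "1/4"] by simp
  have "prob {x\<in>space (gaussian d mu). t / 4 + a * d <= a * ?w x} <= exp (real d * (a + 4 * a\<^sup>2)) * exp (- (t / 4 + a * d))"
   by (rule chernoff_bound[OF prob_space_axioms _ gaussian_exp_square_le[OF a4]]) auto
  also have "... = exp (1 / 4 - t / 4)"
   unfolding exp_add[symmetric] using assms by (simp add: a algebra_simps)
  finally show ?thesis .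
 qed
 define a where "a = 1 / (4 * sqrt d)"
 have a: "a\<^sup>2 = 1 / (16 * real d)" "(- a)\<^sup>2 = 1 / (16 * real d)" "0 < a" "a * sqrt d = 1 / 4"
  using sd assms by (auto simp: a_def power_divide power_mult_distrib)
 have "{x\<in>space (gaussian d mu). t * sqrt d < \<bar>?w x - d\<bar>} \<subseteq>
   {x\<in>space (gaussian d mu). t / 4 + a * d <= a * ?w x} Un {x\<in>space (gaussian d mu). t / 4 + (- a) * d <= (- a) * ?w x}"
 proof
  fix x assume x: "x \<in> {x\<in>space (gaussian d mu). t * sqrt d < \<bar>?w x - d\<bar>}"
  hence "a * (t * sqrt d) <= a * \<bar>?w x - d\<bar>" using a by (intro mult_left_mono) auto
  moreover have "a * (t * sqrt d) = t / 4" using a(4) by (simp add: mult.left_commute)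
  moreover have "a * \<bar>?w x - d\<bar> = a * (?w x - d) \<or> a * \<bar>?w x - d\<bar> = - a * (?w x - d)" by (simp add: abs_if algebra_simps)
  ultimately have "t / 4 <= a * (?w x - d) \<or> t / 4 <= - a * (?w x - d)" by linarith
  thus "x \<in> {x\<in>space (gaussian d mu). t / 4 + a * d <= a * ?w x} Un {x\<in>space (gaussian d mu). t / 4 + (- a) * d <= (- a) * ?w x}"
   using x by (auto simp: algebra_simps)
 qed
 hence "prob {x\<in>space (gaussian d mu). t * sqrt d < \<bar>?w x - d\<bar>} <=
   prob ({x\<in>space (gaussian d mu). t / 4 + a * d <= a * ?w x} Un {x\<in>space (gaussian d mu). t / 4 + (- a) * d <= (- a) * ?w x})"
  by (intro finite_measure_mono) (auto intro!: sets.Un)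
 also have "... <= exp (1 / 4 - t / 4) + exp (1 / 4 - t / 4)"
  by (rule order_trans[OF measure_Un_le add_mono[OF side[OF a(1)] side[OF a(2)]]]) simp_all
 finally show ?thesis by simp
qed

section \<open>Product measures, random permutations and oblivious adversaries\<close>

text \<open>It has two roles: \<open>mix I y g\<close> puts the adversary's points \<open>y\<close>
  at the positions \<open>I\<close> of genuine data \<open>g\<close>, and mixing two independent
  datasets splits a product measure into a part to be integrated and a part that is frozen.\<close>

definition mix :: "'i set => ('i => 'a) => ('i => 'a) => 'i => 'a" where
 "mix K x y = (%i. if i \<in> K then x i else y i)"

lemma measurable_mix [measurable]:
 assumes "\<And>i. i \<in> I ==> sets (M1 i) = sets (N i)" "\<And>i. i \<in> I ==> sets (M2 i) = sets (N i)"
 shows "(%p. mix K (fst p) (snd p)) \<in> measurable (PiM I M1 \<Otimes>\<^sub>M PiM I M2) (PiM I N)"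
proof (rule measurable_PiM_single')
 show "(%p. mix K (fst p) (snd p)) \<in> space (PiM I M1 \<Otimes>\<^sub>M PiM I M2) \<rightarrow> (\<Pi>\<^sub>E i\<in>I. space (N i))"
  using sets_eq_imp_space_eq[OF assms(1)] sets_eq_imp_space_eq[OF assms(2)]
  by (auto simp: space_pair_measure space_PiM mix_def PiE_iff extensional_def)
 fix i assume i: "i \<in> I"
 have "(%p. fst p i) \<in> measurable (PiM I M1 \<Otimes>\<^sub>M PiM I M2) (M1 i)" "(%p. snd p i) \<in> measurable (PiM I M1 \<Otimes>\<^sub>M PiM I M2) (M2 i)"
  using i by measurable
 thus "(%p. mix K (fst p) (snd p) i) \<in> measurable (PiM I M1 \<Otimes>\<^sub>M PiM I M2) (N i)"
  using assms[OF i] by (cases "i \<in> K") (simp_all add: mix_def cong: measurable_cong_sets)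
qed

lemma distr_mix:
 fixes K :: "'i set"
 assumes fin: "finite I" and p1: "\<And>i. prob_space (M1 i)" and p2: "\<And>i. prob_space (M2 i)"
  and sets: "\<And>i. i \<in> I ==> sets (M1 i) = sets (M2 i)"
 defines "N \<equiv> %i. if i \<in> K then M1 i else M2 i"
 shows "distr (PiM I M1 \<Otimes>\<^sub>M PiM I M2) (PiM I N) (%p. mix K (fst p) (snd p)) = PiM I N"
proof -
 interpret P1: product_prob_space M1 by (intro product_prob_spaceI p1)
 interpret P2: product_prob_space M2 by (intro product_prob_spaceI p2)
 have pN: "prob_space (N i)" for i using p1 p2 by (simp add: N_def)
 interpret PN: product_prob_space N by (intro product_prob_spaceI pN)
 have s1: "sets (M1 i) = sets (N i)" and s2: "sets (M2 i) = sets (N i)" if "i \<in> I" for i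
  using sets[OF that] by (auto simp: N_def)
 have meas: "(%p. mix K (fst p) (snd p)) \<in> measurable (PiM I M1 \<Otimes>\<^sub>M PiM I M2) (PiM I N)"
  by (rule measurable_mix) (auto simp: s1 s2)
 show ?thesis
 proof (rule PN.PiM_eqI[OF fin])
  fix A assume A: "\<And>i. i \<in> I ==> A i \<in> sets (N i)"
  define A1 where "A1 i = (if i \<in> K then A i else space (M1 i))" for i
  define A2 where "A2 i = (if i \<in> K then space (M2 i) else A i)" for i
  have A1: "A1 i \<in> sets (M1 i)" and A2: "A2 i \<in> sets (M2 i)" if "i \<in> I" for i
   using A[OF that] s1[OF that] s2[OF that] by (auto simp: A1_def A2_def)
  have sub: "A i <= space (N i)" if "i \<in> I" for i using A[OF that] sets.sets_into_space by blast
  have sp: "space (M1 i) = space (N i)" "space (M2 i) = space (N i)" if "i \<in> I" for i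
   using sets_eq_imp_space_eq[OF s1[OF that]] sets_eq_imp_space_eq[OF s2[OF that]] by auto
  have pre: "(%p. mix K (fst p) (snd p)) -` Pi\<^sub>E I A Int space (PiM I M1 \<Otimes>\<^sub>M PiM I M2) = Pi\<^sub>E I A1 \<times> Pi\<^sub>E I A2"
  proof (rule set_eqI)
   fix p
   show "p \<in> (%p. mix K (fst p) (snd p)) -` Pi\<^sub>E I A Int space (PiM I M1 \<Otimes>\<^sub>M PiM I M2) \<longleftrightarrow> p \<in> Pi\<^sub>E I A1 \<times> Pi\<^sub>E I A2"
    using sub sp by (cases p) (auto simp: space_pair_measure space_PiM mix_def PiE_iff extensional_def A1_def A2_def split: if_splits; metis subsetD)
  qed
  have "emeasure (distr (PiM I M1 \<Otimes>\<^sub>M PiM I M2) (PiM I N) (%p. mix K (fst p) (snd p))) (Pi\<^sub>E I A) =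
    emeasure (PiM I M1 \<Otimes>\<^sub>M PiM I M2) (Pi\<^sub>E I A1 \<times> Pi\<^sub>E I A2)"
   by (subst emeasure_distr[OF meas]) (use A fin in \<open>auto simp: pre intro!: sets_PiM_I_finite\<close>)
  also have "... = emeasure (PiM I M1) (Pi\<^sub>E I A1) * emeasure (PiM I M2) (Pi\<^sub>E I A2)"
   by (rule sigma_finite_measure.emeasure_pair_measure_Times[OF prob_space_imp_sigma_finite[OF prob_space_PiM[OF p2]]]) (use A1 A2 fin in \<open>auto intro!: sets_PiM_I_finite\<close>)
  also have "... = (\<Prod>i\<in>I. emeasure (M1 i) (A1 i)) * (\<Prod>i\<in>I. emeasure (M2 i) (A2 i))"
   using A1 A2 fin by (simp add: P1.emeasure_PiM P2.emeasure_PiM)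
  also have "... = (\<Prod>i\<in>I. emeasure (N i) (A i))"
   unfolding prod.distrib[symmetric]
   by (rule prod.cong) (auto simp: A1_def A2_def N_def prob_space.emeasure_space_1[OF p1] prob_space.emeasure_space_1[OF p2])
  finally show "emeasure (distr (PiM I M1 \<Otimes>\<^sub>M PiM I M2) (PiM I N) (%p. mix K (fst p) (snd p))) (Pi\<^sub>E I A) = (\<Prod>i\<in>I. emeasure (N i) (A i))" .
 qed simp
qed

text \<open>Fubini with coordinate \<open>i\<close> integrated first. All other coordinates act as
  constants, so directions computed from them may be treated as fixed.\<close>

lemma PiM_single_coordinate_le:
 assumes fin: "finite I" and i: "i \<in> I" and p: "\<And>i. prob_space (M i)" and W: "W \<in> sets (PiM I M)"
  and le: "\<And>x. x \<in> space (PiM I M) ==> measure (M i) {u\<in>space (M i). x(i := u) \<in> W} <= \<delta>" and \<delta>: "0 <= \<delta>"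
 shows "measure (PiM I M) W <= \<delta>"
proof -
 interpret product_prob_space M by (intro product_prob_spaceI p)
 have I: "I = insert i (I - {i})" using i by auto
 have "emeasure (PiM I M) W = (\<integral>\<^sup>+x. indicator W x \<partial>PiM (insert i (I - {i})) M)" using W I by simp
 also have "... = (\<integral>\<^sup>+x. (\<integral>\<^sup>+u. indicator W (x(i := u)) \<partial>M i) \<partial>PiM (I - {i}) M)"
  by (rule product_nn_integral_insert) (use fin W I in auto)
 also have "... <= (\<integral>\<^sup>+x. ennreal \<delta> \<partial>PiM (I - {i}) M)"
 proof (rule nn_integral_mono)
  fix x assume x: "x \<in> space (PiM (I - {i}) M)"
  obtain u0 where u0: "u0 \<in> space (M i)" using prob_space.not_empty[OF p] by auto
  have sp: "x(i := u) \<in> space (PiM I M)" if "u \<in> space (M i)" for u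
   using x that i by (auto simp: space_PiM PiE_iff extensional_def)
  have "(\<integral>\<^sup>+u. indicator W (x(i := u)) \<partial>M i) = (\<integral>\<^sup>+u. indicator {u\<in>space (M i). x(i := u) \<in> W} u \<partial>M i)"
   by (rule nn_integral_cong) (auto simp: indicator_def)
  also have "... = emeasure (M i) {u\<in>space (M i). x(i := u) \<in> W}"
  proof (rule nn_integral_indicator)
   have "(%u. x(i := u)) \<in> measurable (M i) (PiM (insert i (I - {i})) M)"
    using x by (intro measurable_fun_upd[where J="I - {i}"]) auto
   thus "{u\<in>space (M i). x(i := u) \<in> W} \<in> sets (M i)"
    using W unfolding I[symmetric] by measurable
  qed
  also have "... <= ennreal \<delta>"
   using le[OF sp[OF u0]] \<delta> by (simp add: finite_measure.emeasure_eq_measure[OF prob_space.finite_measure[OF p]] ennreal_leI)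
  finally show "(\<integral>\<^sup>+u. indicator W (x(i := u)) \<partial>M i) <= ennreal \<delta>" .
 qed
 also have "... = ennreal \<delta>" by (simp add: prob_space.emeasure_space_1[OF prob_space_PiM] p)
 finally show ?thesis using \<delta> by (simp add: finite_measure.emeasure_eq_measure[OF prob_space.finite_measure[OF prob_space_PiM[OF p]]])
qed

text \<open>Each point has its own mean, because the mixture of both hypotheses that appears for
  heavy corruption must have this form, too.\<close>

definition gaussian_data :: "nat => nat => (nat => nat => real) => (nat => nat => real) measure" where
 "gaussian_data d n m = Pi\<^sub>M {..<n} (%i. gaussian d (m i))"

lemma prob_space_gaussian_data: "prob_space (gaussian_data d n m)"
 unfolding gaussian_data_def by (intro prob_space_PiM prob_space_gaussian)

lemma sets_gaussian_data [measurable_cong]: "sets (gaussian_data d n m) = sets (data_space d n)"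
 unfolding gaussian_data_def data_space_def by (intro sets_PiM_cong) (auto simp: sets_gaussian)

lemma space_gaussian_data: "space (gaussian_data d n m) = space (data_space d n)"
 by (rule sets_eq_imp_space_eq) (rule sets_gaussian_data)

lemma space_data_space: "space (data_space d n) = (\<Pi>\<^sub>E i\<in>{..<n}. space (point_space d))"
 by (simp add: data_space_def space_PiM)

lemma measurable_data_coord [measurable]: "i < n ==> (%X. X i) \<in> measurable (data_space d n) (point_space d)"
 unfolding data_space_def by measurable

lemma measurable_data [measurable]: "i < n ==> j < d ==> (%X. X i j) \<in> borel_measurable (data_space d n)"
 using measurable_compose[OF measurable_data_coord measurable_point] by simp

lemma mix_in_space: "x \<in> space (data_space d n) ==> y \<in> space (data_space d n) ==> mix K x y \<in> space (data_space d n)"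
 by (auto simp: space_data_space PiE_iff mix_def extensional_def)

lemma measurable_mix_right:
 assumes "y \<in> space (data_space d n)"
 shows "(%g. mix I y g) \<in> measurable (data_space d n) (data_space d n)"
 unfolding data_space_def
proof (rule measurable_PiM_single')
 show "mix I y \<in> space (Pi\<^sub>M {..<n} (%_. point_space d)) \<rightarrow> {..<n} \<rightarrow>\<^sub>E space (point_space d)"
  using mix_in_space[OF assms] by (auto simp: space_data_space[symmetric] data_space_def[symmetric])
 fix i assume i: "i \<in> {..<n}"
 show "(%g. mix I y g i) \<in> Pi\<^sub>M {..<n} (%_. point_space d) \<rightarrow>\<^sub>M point_space d"
 proof (cases "i \<in> I")
  case True
  thus ?thesis using assms i by (auto simp: mix_def space_data_space PiE_iff)
 next
  case False
  thus ?thesis using i by (simp add: mix_def)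
 qed
qed

lemma nn_integral_gaussian_data_mix:
 assumes [measurable]: "F \<in> borel_measurable (data_space d n)"
 shows "(\<integral>\<^sup>+g. F g \<partial>gaussian_data d n (%i. if i \<in> K then m1 i else m2 i)) =
  (\<integral>\<^sup>+g1. \<integral>\<^sup>+g2. F (mix K g1 g2) \<partial>gaussian_data d n m2 \<partial>gaussian_data d n m1)"
proof -
 interpret P2: prob_space "gaussian_data d n m2" by (rule prob_space_gaussian_data)
 have eq: "(%i. gaussian d (if i \<in> K then m1 i else m2 i)) = (%i. if i \<in> K then gaussian d (m1 i) else gaussian d (m2 i))" by auto
 have meas: "(%p. mix K (fst p) (snd p)) \<in> measurable (gaussian_data d n m1 \<Otimes>\<^sub>M gaussian_data d n m2) (data_space d n)"
  unfolding gaussian_data_def data_space_def by (rule measurable_mix) (auto simp: sets_gaussian)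
 have "gaussian_data d n (%i. if i \<in> K then m1 i else m2 i) =
   distr (gaussian_data d n m1 \<Otimes>\<^sub>M gaussian_data d n m2) (gaussian_data d n (%i. if i \<in> K then m1 i else m2 i)) (%p. mix K (fst p) (snd p))"
  unfolding gaussian_data_def eq by (rule distr_mix[symmetric]) (auto simp: prob_space_gaussian sets_gaussian)
 also have "... = distr (gaussian_data d n m1 \<Otimes>\<^sub>M gaussian_data d n m2) (data_space d n) (%p. mix K (fst p) (snd p))"
  by (rule distr_cong) (auto simp: sets_gaussian_data)
 finally have "(\<integral>\<^sup>+g. F g \<partial>gaussian_data d n (%i. if i \<in> K then m1 i else m2 i)) =
   (\<integral>\<^sup>+p. F (mix K (fst p) (snd p)) \<partial>(gaussian_data d n m1 \<Otimes>\<^sub>M gaussian_data d n m2))"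
  using nn_integral_distr[OF meas, of F] assms by simp
 also have "... = (\<integral>\<^sup>+g1. \<integral>\<^sup>+g2. F (mix K g1 g2) \<partial>gaussian_data d n m2 \<partial>gaussian_data d n m1)"
  using P2.nn_integral_fst[OF measurable_compose[OF meas assms]] by simp
 finally show ?thesis .
qed

lemma nn_integral_gaussian_data_reindex:
 assumes [measurable]: "F \<in> borel_measurable (data_space d n)" and e: "inj_on e {..<n}" "e ` {..<n} <= {..<N}"
 shows "(\<integral>\<^sup>+g. F (\<lambda>i\<in>{..<n}. g (e i)) \<partial>gaussian_data d N (%_. mu)) = (\<integral>\<^sup>+g. F g \<partial>gaussian_data d n (%_. mu))"
proof -
 have d: "distr (gaussian_data d N (%_. mu)) (gaussian_data d n (%_. mu)) (%g. \<lambda>i\<in>{..<n}. g (e i)) = gaussian_data d n (%_. mu)"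
  unfolding gaussian_data_def
  using distr_PiM_reindex[of "{..<N}" "%_. gaussian d mu" e "{..<n}"] e prob_space_gaussian by auto
 have meas: "(%g. \<lambda>i\<in>{..<n}. g (e i)) \<in> measurable (gaussian_data d N (%_. mu)) (gaussian_data d n (%_. mu))"
  unfolding gaussian_data_def using e by (intro measurable_restrict measurable_component_singleton) auto
 have "(\<integral>\<^sup>+g. F g \<partial>gaussian_data d n (%_. mu)) =
  (\<integral>\<^sup>+g. F g \<partial>distr (gaussian_data d N (%_. mu)) (gaussian_data d n (%_. mu)) (%g. \<lambda>i\<in>{..<n}. g (e i)))"
  by (simp only: d)
 also have "... = (\<integral>\<^sup>+g. F (\<lambda>i\<in>{..<n}. g (e i)) \<partial>gaussian_data d N (%_. mu))"
  by (rule nn_integral_distr[OF meas]) measurable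
 finally show ?thesis by simp
qed

definition rearrange :: "nat => (nat => 'a) => (nat => nat) => nat => 'a" where
 "rearrange n X e = (\<lambda>i\<in>{..<n}. X (e i))"

definition perms :: "nat => (nat => nat) set" where
 "perms n = {\<sigma>. \<sigma> permutes {..<n}}"

lemma finite_perms: "finite (perms n)" and perms_nonempty: "perms n ~= {}"
 unfolding perms_def using finite_permutations[of "{..<n}"] permutes_id[of "{..<n}"] by (simp, blast)

lemma rearrange_in_space:
 "X \<in> space (data_space d N) ==> e ` {..<n} <= {..<N} ==> rearrange n X e \<in> space (data_space d n)"
 by (auto simp: space_data_space rearrange_def PiE_iff)

lemma measurable_rearrange:
 assumes "e ` {..<n} <= {..<N}"
 shows "(%X. rearrange n X e) \<in> measurable (data_space d N) (data_space d n)"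
 unfolding rearrange_def data_space_def using assms by (intro measurable_restrict measurable_component_singleton) auto

text \<open>The random permutation of the contamination model, averaged out. By
  \<open>perm_avg_rearrange\<close> the positions of the corrupted points become irrelevant.\<close>

definition perm_avg :: "nat => ((nat => nat => real) => ennreal) => (nat => nat => real) => ennreal" where
 "perm_avg n F X = (\<Sum>\<sigma>\<in>perms n. ennreal (1 / card (perms n)) * F (rearrange n X \<sigma>))"

lemma perms_image: "\<sigma> \<in> perms n ==> \<sigma> ` {..<n} = {..<n}" "\<sigma> \<in> perms n ==> inj_on \<sigma> {..<n}"
 by (auto simp: perms_def permutes_image permutes_inj_on)

lemma measurable_perm_avg [measurable]:
 assumes [measurable]: "F \<in> borel_measurable (data_space d n)"
 shows "perm_avg n F \<in> borel_measurable (data_space d n)"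
proof -
 have "(%X. F (rearrange n X \<sigma>)) \<in> borel_measurable (data_space d n)" if "\<sigma> \<in> perms n" for \<sigma>
  using measurable_compose[OF measurable_rearrange assms] perms_image(1)[OF that] by simp
 thus ?thesis unfolding perm_avg_def by measurable
qed

lemma perm_avg_rearrange:
 assumes "\<pi> \<in> perms n"
 shows "perm_avg n F (rearrange n X \<pi>) = perm_avg n F X"
proof -
 have bij: "bij_betw (%\<sigma>. \<pi> \<circ> \<sigma>) (perms n) (perms n)"
 proof (rule bij_betwI[where g="%\<sigma>. inv \<pi> \<circ> \<sigma>"])
  have \<pi>: "\<pi> permutes {..<n}" using assms by (simp add: perms_def)
  show "(%\<sigma>. \<pi> \<circ> \<sigma>) \<in> perms n \<rightarrow> perms n" using permutes_compose[OF _ \<pi>] by (auto simp: perms_def)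
  show "(%\<sigma>. inv \<pi> \<circ> \<sigma>) \<in> perms n \<rightarrow> perms n" using permutes_compose[OF _ permutes_inv[OF \<pi>]] by (auto simp: perms_def)
  show "inv \<pi> \<circ> (\<pi> \<circ> \<sigma>) = \<sigma>" "\<pi> \<circ> (inv \<pi> \<circ> \<sigma>) = \<sigma>" for \<sigma>
   by (simp_all add: comp_assoc[symmetric] permutes_inv_o[OF \<pi>])
 qed
 have "rearrange n (rearrange n X \<pi>) \<sigma> = rearrange n X (\<pi> \<circ> \<sigma>)" if "\<sigma> \<in> perms n" for \<sigma>
  using perms_image(1)[OF that] by (auto simp: rearrange_def fun_eq_iff)
 thus ?thesis unfolding perm_avg_def
  using sum.reindex_bij_betw[OF bij, of "%\<sigma>. ennreal (1 / card (perms n)) * F (rearrange n X \<sigma>)"] by simp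
qed

text \<open>Genuine samples are drawn for all \<open>n\<close> positions and overwritten at the
  corrupted ones. Thus one product space serves every choice of the corrupted positions.\<close>

lemma nn_integral_contaminated:
 assumes F[measurable]: "F \<in> borel_measurable (data_space d n)" and y: "y \<in> space (data_space d n)"
  and f: "num_corrupt eps n <= n"
 shows "(\<integral>\<^sup>+X. F X \<partial>contaminated d eps n mu y) = (\<integral>\<^sup>+g. perm_avg n F (mix {..<num_corrupt eps n} y g) \<partial>gaussian_data d n (%_. mu))"
proof -
 let ?f = "num_corrupt eps n"
 let ?P = "Pi\<^sub>M {?f..<n} (%_. gaussian d mu)" and ?U = "uniform_count_measure (perms n)"
 let ?W = "%z k. if k < ?f then y k else z k"
 let ?T = "%p. rearrange n (?W (fst p)) (snd p)"
 interpret U: prob_space ?U by (rule prob_space_uniform_count_measure[OF finite_perms perms_nonempty])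
 have W: "(%z. rearrange n (?W z) \<sigma>) \<in> measurable ?P (data_space d n)" if \<sigma>: "\<sigma> \<in> perms n" for \<sigma>
  unfolding rearrange_def data_space_def
 proof (rule measurable_restrict)
  fix i assume i: "i \<in> {..<n}"
  hence "\<sigma> i < n" using perms_image(1)[OF \<sigma>] by auto
  thus "(%z. ?W z (\<sigma> i)) \<in> measurable ?P (point_space d)"
  proof (cases "\<sigma> i < ?f")
   case True
   thus ?thesis using y \<open>\<sigma> i < n\<close> by (auto simp: space_data_space PiE_iff)
  next
   case False
   have "(%z. z (\<sigma> i)) \<in> measurable ?P (gaussian d mu)" using False \<open>\<sigma> i < n\<close> by (intro measurable_component_singleton) auto
   thus ?thesis using False by (simp add: sets_gaussian cong: measurable_cong_sets)
  qed
 qed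
 have T: "?T \<in> measurable (?P \<Otimes>\<^sub>M ?U) (data_space d n)"
 proof (rule measurable_compose_countable'[where f="%\<sigma> p. rearrange n (?W (fst p)) \<sigma>" and g=snd and I="perms n"])
  show "(%p. rearrange n (?W (fst p)) \<sigma>) \<in> measurable (?P \<Otimes>\<^sub>M ?U) (data_space d n)" if "\<sigma> \<in> perms n" for \<sigma>
   by (rule measurable_compose[OF measurable_fst W[OF that]])
  have "snd \<in> measurable (?P \<Otimes>\<^sub>M ?U) ?U" by simp
  thus "snd \<in> measurable (?P \<Otimes>\<^sub>M ?U) (count_space (perms n))"
   by (simp add: sets_uniform_count_measure_count_space cong: measurable_cong_sets)
 qed (simp add: finite_perms countable_finite)
 have "contaminated d eps n mu y = distr (?P \<Otimes>\<^sub>M ?U) (data_space d n) ?T"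
  unfolding contaminated_def perms_def[symmetric]
  by (intro distr_cong) (auto simp: rearrange_def)
 hence "(\<integral>\<^sup>+X. F X \<partial>contaminated d eps n mu y) = (\<integral>\<^sup>+p. F (?T p) \<partial>(?P \<Otimes>\<^sub>M ?U))"
  using nn_integral_distr[OF T, of F] F by simp
 also have "... = (\<integral>\<^sup>+z. \<integral>\<^sup>+\<sigma>. F (rearrange n (?W z) \<sigma>) \<partial>?U \<partial>?P)"
  using U.nn_integral_fst[OF measurable_compose[OF T F]] unfolding fst_conv snd_conv by (rule sym)
 also have "... = (\<integral>\<^sup>+z. perm_avg n F (?W z) \<partial>?P)"
  unfolding uniform_count_measure_def perm_avg_def
  by (simp add: nn_integral_point_measure_finite[OF finite_perms])
 also have "?P = distr (gaussian_data d n (%_. mu)) ?P (%g. \<lambda>i\<in>{?f..<n}. g i)"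
  unfolding gaussian_data_def
  using distr_PiM_reindex[of "{..<n}" "%_. gaussian d mu" id "{?f..<n}"] prob_space_gaussian by auto
 also have "(\<integral>\<^sup>+z. perm_avg n F (?W z) \<partial>distr (gaussian_data d n (%_. mu)) ?P (%g. \<lambda>i\<in>{?f..<n}. g i)) =
   (\<integral>\<^sup>+g. perm_avg n F (?W (\<lambda>i\<in>{?f..<n}. g i)) \<partial>gaussian_data d n (%_. mu))"
 proof -
  have mT: "(%g. \<lambda>i\<in>{?f..<n}. g i) \<in> measurable (gaussian_data d n (%_. mu)) ?P"
   unfolding gaussian_data_def by (intro measurable_restrict measurable_component_singleton) auto
  have "(%z. F (rearrange n (?W z) \<sigma>)) \<in> borel_measurable ?P" if "\<sigma> \<in> perms n" for \<sigma>
   using measurable_compose[OF W[OF that] F] .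
  hence "(%z. perm_avg n F (?W z)) \<in> borel_measurable ?P" unfolding perm_avg_def by measurable
  thus ?thesis using nn_integral_distr[OF mT, of "%z. perm_avg n F (?W z)"] by simp
 qed
 also have "... = (\<integral>\<^sup>+g. perm_avg n F (mix {..<?f} y g) \<partial>gaussian_data d n (%_. mu))"
 proof (rule nn_integral_cong)
  fix g
  have "rearrange n (?W (\<lambda>i\<in>{?f..<n}. g i)) \<sigma> = rearrange n (mix {..<?f} y g) \<sigma>" if "\<sigma> \<in> perms n" for \<sigma>
   using perms_image(1)[OF that] by (auto simp: rearrange_def mix_def fun_eq_iff)
  thus "perm_avg n F (?W (\<lambda>i\<in>{?f..<n}. g i)) = perm_avg n F (mix {..<?f} y g)"
   unfolding perm_avg_def by simp
 qed
 finally show ?thesis .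
qed

lemma rearrange_mix:
 "\<pi> \<in> perms n ==> rearrange n (mix I y g) \<pi> = mix {i. i < n & \<pi> i \<in> I} (rearrange n y \<pi>) (rearrange n g \<pi>)"
 by (auto simp: rearrange_def mix_def fun_eq_iff)

text \<open>An oblivious adversary who controls at most \<open>num_corrupt \<epsilon> n\<close> positions, wherever they are, is no
  stronger than one who controls the first ones: the uncontrolled surplus can be filled with fresh samples.\<close>

lemma perm_avg_mix_ge:
 assumes F[measurable]: "F \<in> borel_measurable (data_space d n)" and f: "num_corrupt eps n <= n"
  and ge: "\<And>y. y \<in> adversaries d eps n ==> c <= (\<integral>\<^sup>+X. F X \<partial>contaminated d eps n mu y)"
  and I: "I <= {..<n}" "card I <= num_corrupt eps n" and y: "y \<in> space (data_space d n)"
 shows "c <= (\<integral>\<^sup>+g. perm_avg n F (mix I y g) \<partial>gaussian_data d n (%_. mu))"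
proof -
 let ?f = "num_corrupt eps n"
 have base: "c <= (\<integral>\<^sup>+g. perm_avg n F (mix {..<?f} w g) \<partial>gaussian_data d n (%_. mu))"
  if w: "w \<in> space (data_space d n)" for w
 proof -
  have "w \<in> adversaries d eps n" using w f by (auto simp: adversaries_def space_data_space PiE_iff)
  thus ?thesis using ge nn_integral_contaminated[OF F w f] by metis
 qed
 have "card I <= card {..<?f}" using I by simp
 then obtain h where h: "h ` I <= {..<?f}" "inj_on h I"
  using card_le_inj[of I "{..<?f}"] finite_subset[OF I(1)] by auto
 \<comment> \<open>An injection of \<open>I\<close> into the first positions extends to a
   permutation, which moves the controlled positions to the front.\<close>
 have "\<exists>\<pi>. \<pi> permutes {..<n} & (\<forall>i\<in>I. \<pi> i = h i)"
 proof -
  have sub: "h ` I <= {..<n}" using h f by auto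
  have "card ({..<n} - I) = card ({..<n} - h ` I)"
   using I sub h(2) finite_subset[OF I(1)] by (simp add: card_Diff_subset card_image)
  then obtain k where k: "bij_betw k ({..<n} - I) ({..<n} - h ` I)"
   using finite_same_card_bij[of "{..<n} - I" "{..<n} - h ` I"] by auto
  define \<pi> where "\<pi> i = (if i \<in> I then h i else if i < n then k i else i)" for i
  have "bij_betw \<pi> (I Un ({..<n} - I)) (h ` I Un ({..<n} - h ` I))"
  proof (rule bij_betw_combine)
   show "bij_betw \<pi> I (h ` I)" using h(2) by (auto simp: bij_betw_def \<pi>_def inj_on_def)
   show "bij_betw \<pi> ({..<n} - I) ({..<n} - h ` I)"
    using k by (subst bij_betw_cong[where g=k]) (auto simp: \<pi>_def)
  qed auto
  moreover have "I Un ({..<n} - I) = {..<n}" "h ` I Un ({..<n} - h ` I) = {..<n}" using I sub by auto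
  ultimately have "bij_betw \<pi> {..<n} {..<n}" by simp
  hence "\<pi> permutes {..<n}" using I by (intro bij_imp_permutes) (auto simp: \<pi>_def)
  thus ?thesis by (intro exI[of _ \<pi>]) (auto simp: \<pi>_def)
 qed
 then obtain \<pi> where \<pi>: "\<pi> permutes {..<n}" "\<And>i. i \<in> I ==> \<pi> i < ?f" using h by fastforce
 define \<tau> where "\<tau> = inv \<pi>"
 have \<tau>: "\<tau> \<in> perms n" using permutes_inv[OF \<pi>(1)] by (simp add: \<tau>_def perms_def)
 define I' where "I' = {i. i < n & \<tau> i \<in> I}"
 have I': "I' <= {..<?f}"
 proof
  fix i assume "i \<in> I'"
  hence "\<pi> (\<tau> i) < ?f" using \<pi>(2) by (simp add: I'_def)
  thus "i \<in> {..<?f}" using permutes_inverses(1)[OF \<pi>(1)] by (simp add: \<tau>_def)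
 qed
 define y' where "y' = rearrange n y \<tau>"
 have y': "y' \<in> space (data_space d n)" unfolding y'_def
  by (rule rearrange_in_space[OF y]) (simp add: perms_image[OF \<tau>])
 have m[measurable]: "(%g. perm_avg n F (mix I' y' g)) \<in> borel_measurable (data_space d n)"
  by (rule measurable_compose[OF measurable_mix_right[OF y']]) measurable
 \<comment> \<open>The positions at the front that the adversary does not control are filled with
   the sample \<open>g1\<close>, which is frozen while \<open>base\<close> is applied.\<close>
 have "c <= (\<integral>\<^sup>+g1. c \<partial>gaussian_data d n (%_. mu))"
  by (simp add: prob_space.emeasure_space_1[OF prob_space_gaussian_data])
 also have "... <= (\<integral>\<^sup>+g1. \<integral>\<^sup>+g2. perm_avg n F (mix I' y' (mix {..<?f} g1 g2)) \<partial>gaussian_data d n (%_. mu) \<partial>gaussian_data d n (%_. mu))"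
 proof (rule nn_integral_mono)
  fix g1 assume g1: "g1 \<in> space (gaussian_data d n (%_. mu))"
  have "mix I' y' (mix {..<?f} g1 g2) = mix {..<?f} (mix I' y' g1) g2" for g2 using I' by (auto simp: mix_def fun_eq_iff)
  thus "c <= (\<integral>\<^sup>+g2. perm_avg n F (mix I' y' (mix {..<?f} g1 g2)) \<partial>gaussian_data d n (%_. mu))"
   using base[OF mix_in_space[OF y']] g1 by (simp add: space_gaussian_data)
 qed
 also have "... = (\<integral>\<^sup>+g. perm_avg n F (mix I' y' g) \<partial>gaussian_data d n (%_. mu))"
  using nn_integral_gaussian_data_mix[OF m, of "{..<?f}" "%_. mu" "%_. mu"] by simp
 also have "... = (\<integral>\<^sup>+g. perm_avg n F (mix I' y' (rearrange n g \<tau>)) \<partial>gaussian_data d n (%_. mu))"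
  unfolding rearrange_def
  by (rule nn_integral_gaussian_data_reindex[OF m, symmetric]) (use perms_image[OF \<tau>] in auto)
 also have "... = (\<integral>\<^sup>+g. perm_avg n F (mix I y g) \<partial>gaussian_data d n (%_. mu))"
  unfolding I'_def y'_def rearrange_mix[OF \<tau>, symmetric] perm_avg_rearrange[OF \<tau>] ..
 finally show ?thesis .
qed

text \<open>For each fixed permutation the corrupted points occupy some set of exactly
  \<open>num_corrupt eps n\<close> positions, so a bound for every such set and every
  \<open>y\<close> survives the average over permutations.\<close>

lemma contaminated_ge:
 assumes F[measurable]: "F \<in> borel_measurable (data_space d n)" and f: "num_corrupt eps n <= n"
  and ge: "\<And>I y. I <= {..<n} ==> card I = num_corrupt eps n ==> y \<in> space (data_space d n) ==>
    c <= (\<integral>\<^sup>+g. F (mix I y g) \<partial>gaussian_data d n (%_. mu))"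
  and y: "y \<in> adversaries d eps n"
 shows "c <= (\<integral>\<^sup>+X. F X \<partial>contaminated d eps n mu y)"
proof -
 let ?f = "num_corrupt eps n"
 \<comment> \<open>An adversary is specified at the corrupted indices only; zero points complete it
   to a dataset.\<close>
 define z0 where "z0 = (\<lambda>i\<in>{..<n}. \<lambda>j\<in>{..<d}. 0 :: real)"
 define y' where "y' = mix {..<?f} y z0"
 have z0: "z0 \<in> space (data_space d n)" by (auto simp: z0_def space_data_space point_space_def space_PiM)
 have y': "y' \<in> space (data_space d n)"
  using y z0 f by (auto simp: y'_def mix_def adversaries_def space_data_space PiE_iff extensional_def Pi_iff)
 have "contaminated d eps n mu y = contaminated d eps n mu y'"
  unfolding contaminated_def by (intro distr_cong refl) (auto simp: y'_def mix_def fun_eq_iff)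
 moreover have "c <= (\<integral>\<^sup>+X. F X \<partial>contaminated d eps n mu y')"
 proof -
  have each: "c <= (\<integral>\<^sup>+g. F (rearrange n (mix {..<?f} y' g) \<sigma>) \<partial>gaussian_data d n (%_. mu))" if \<sigma>: "\<sigma> \<in> perms n" for \<sigma>
  proof -
   define I where "I = {i. i < n & \<sigma> i \<in> {..<?f}}"
   have s: "\<sigma> permutes {..<n}" using \<sigma> by (simp add: perms_def)
   have "\<sigma> ` I = {..<?f}"
   proof
    show "{..<?f} <= \<sigma> ` I"
    proof
     fix k assume k: "k \<in> {..<?f}"
     hence "inv \<sigma> k < n" using permutes_in_image[OF permutes_inv[OF s], of k] f by auto
     thus "k \<in> \<sigma> ` I" using k permutes_inverses(1)[OF s, of k]
      by (intro image_eqI[of _ _ "inv \<sigma> k"]) (auto simp: I_def)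
    qed
   qed (auto simp: I_def)
   moreover have "inj_on \<sigma> I" using permutes_inj[OF s] by (auto intro: inj_on_subset)
   ultimately have cI: "card I = ?f" using card_image[of \<sigma> I] by simp
   have ry: "rearrange n y' \<sigma> \<in> space (data_space d n)"
    by (rule rearrange_in_space[OF y']) (simp add: perms_image[OF \<sigma>])
   have m: "(%g. F (mix I (rearrange n y' \<sigma>) g)) \<in> borel_measurable (data_space d n)"
    by (rule measurable_compose[OF measurable_mix_right[OF ry] F])
   have "c <= (\<integral>\<^sup>+g. F (mix I (rearrange n y' \<sigma>) g) \<partial>gaussian_data d n (%_. mu))"
    by (rule ge[OF _ cI ry]) (auto simp: I_def)
   also have "... = (\<integral>\<^sup>+g. F (mix I (rearrange n y' \<sigma>) (rearrange n g \<sigma>)) \<partial>gaussian_data d n (%_. mu))"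
    unfolding rearrange_def[of n _ \<sigma>]
    by (rule nn_integral_gaussian_data_reindex[OF m[unfolded rearrange_def[of n _ \<sigma>]], symmetric]) (use perms_image[OF \<sigma>] in auto)
   finally show ?thesis by (simp add: rearrange_mix[OF \<sigma>] I_def)
  qed
  have mF: "(%g. F (rearrange n (mix {..<?f} y' g) \<sigma>)) \<in> borel_measurable (data_space d n)" if "\<sigma> \<in> perms n" for \<sigma>
   by (rule measurable_compose[OF measurable_mix_right[OF y'] measurable_compose[OF measurable_rearrange F]])
     (simp add: perms_image[OF that])
  have "c = (\<Sum>\<sigma>\<in>perms n. ennreal (1 / card (perms n)) * c)"
  proof -
   have "0 < card (perms n)" using finite_perms perms_nonempty by (simp add: card_gt_0_iff)
   hence "of_nat (card (perms n)) * ennreal (1 / card (perms n)) = 1"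
    by (simp add: ennreal_of_nat_eq_real_of_nat ennreal_mult[symmetric])
   thus ?thesis by (simp add: mult.assoc[symmetric])
  qed
  also have "... <= (\<Sum>\<sigma>\<in>perms n. ennreal (1 / card (perms n)) * (\<integral>\<^sup>+g. F (rearrange n (mix {..<?f} y' g) \<sigma>) \<partial>gaussian_data d n (%_. mu)))"
   by (intro sum_mono mult_left_mono each) auto
  also have "... = (\<integral>\<^sup>+g. perm_avg n F (mix {..<?f} y' g) \<partial>gaussian_data d n (%_. mu))"
   unfolding perm_avg_def using mF by (subst nn_integral_sum) (auto simp: nn_integral_cmult)
  also have "... = (\<integral>\<^sup>+X. F X \<partial>contaminated d eps n mu y')"
   by (rule nn_integral_contaminated[OF F y' f, symmetric])
  finally show ?thesis .
 qed
 ultimately show ?thesis by simp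
qed

lemma measurable_friendly [measurable]: "Measurable.pred (data_space d n) (friendly d eps n \<kappa>)"
proof -
 have eq: "friendly d eps n \<kappa> = (%X.
   (\<forall>S\<in>Pow {..<n}. \<forall>T\<in>Pow {..<n}. S Int T = {} & rcard S <= eps * real n & rcard T <= eps * real n -->
    \<bar>dot d (%j. \<Sum>i\<in>S. X i j) (%j. \<Sum>i\<in>T. X i j)\<bar>
     <= \<kappa> * sqrt (rcard S * rcard T) * max (sqrt (eps * real n * real d)) (eps * real n)) &
   (\<forall>i\<in>{..<n}. \<forall>j\<in>{..<n}. i ~= j --> \<bar>dot d (X i) (X j)\<bar> <= \<kappa> * sqrt (real d)) &
   (\<forall>i\<in>{..<n}. real d - \<kappa> * sqrt (real d) <= dot d (X i) (X i) & dot d (X i) (X i) <= real d + \<kappa> * sqrt (real d)))"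
  by (auto simp: friendly_def norm2_power2 fun_eq_iff)
 have m1: "(%X. dot d (%j. \<Sum>i\<in>S. X i j) (%j. \<Sum>i\<in>T. X i j)) \<in> borel_measurable (data_space d n)"
  if "S \<in> Pow {..<n}" "T \<in> Pow {..<n}" for S T
  using that by (intro measurable_dot borel_measurable_sum measurable_data) auto
 have m2: "(%X. dot d (X i) (X j)) \<in> borel_measurable (data_space d n)" if "i \<in> {..<n}" "j \<in> {..<n}" for i j
  using that by (intro measurable_dot measurable_data) auto
 show ?thesis unfolding eq
  by (intro pred_intros_logic pred_intros_finite) (use m1 m2 in measurable)
qed

definition correct_mass :: "((nat => nat => real) => bool) => ((nat => nat => real) => hypothesis pmf) => hypothesis => (nat => nat => real) => real" where
 "correct_mass G A h X = (if G X then pmf (A X) h else 1)"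

lemma success_prob_eq: "success_prob G A D h = (\<integral>X. correct_mass G A h X \<partial>D)"
 unfolding success_prob_def correct_mass_def
 by (intro Bochner_Integration.integral_cong refl) (auto simp: measure_pmf_single[symmetric] simp del: measure_pmf_single)

lemma correct_mass_bounds: "0 <= correct_mass G A h X" "correct_mass G A h X <= 1"
 by (auto simp: correct_mass_def pmf_le_1)

lemma measurable_correct_mass:
 assumes "A \<in> algorithms d n" "Measurable.pred (data_space d n) G"
 shows "correct_mass G A h \<in> borel_measurable (data_space d n)"
proof -
 have [measurable]: "(%X. pmf (A X) h) \<in> borel_measurable (data_space d n)" using assms(1) by (simp add: algorithms_def)
 note assms(2)[measurable]
 show ?thesis unfolding correct_mass_def by measurable
qed

lemma num_corrupt_le: "eps <= 1 ==> num_corrupt eps n <= n"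
proof -
 assume "eps <= 1"
 hence "eps * real n <= real n" using mult_right_mono[of eps 1 "real n"] by simp
 thus ?thesis unfolding num_corrupt_def by linarith
qed

lemma prob_space_contaminated:
 assumes "y \<in> adversaries d eps n" "eps <= 1"
 shows "prob_space (contaminated d eps n mu y)"
proof (rule prob_spaceI)
 let ?C = "contaminated d eps n mu y"
 define z0 where "z0 = (\<lambda>i\<in>{..<n}. \<lambda>j\<in>{..<d}. 0 :: real)"
 define y' where "y' = mix {..<num_corrupt eps n} y z0"
 have z0: "z0 \<in> space (data_space d n)" by (auto simp: z0_def space_data_space point_space_def space_PiM)
 have y': "y' \<in> space (data_space d n)"
  using assms(1) z0 num_corrupt_le[OF assms(2), of n] by (auto simp: y'_def mix_def adversaries_def space_data_space PiE_iff extensional_def Pi_iff)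
 have "?C = contaminated d eps n mu y'"
  unfolding contaminated_def by (intro distr_cong refl) (auto simp: y'_def mix_def fun_eq_iff)
 hence "emeasure ?C (space ?C) = (\<integral>\<^sup>+X. 1 \<partial>contaminated d eps n mu y')" by simp
 also have "... = (\<integral>\<^sup>+g. perm_avg n (%_. 1) (mix {..<num_corrupt eps n} y' g) \<partial>gaussian_data d n (%_. mu))"
  by (rule nn_integral_contaminated[OF _ y' num_corrupt_le[OF assms(2)]]) simp
 also have "perm_avg n (%_. 1) = (%_. 1)"
 proof
  fix X
  have "0 < card (perms n)" using finite_perms perms_nonempty by (simp add: card_gt_0_iff)
  thus "perm_avg n (%_. 1) X = 1"
   by (simp add: perm_avg_def ennreal_of_nat_eq_real_of_nat ennreal_mult[symmetric])
 qed
 finally show "emeasure ?C (space ?C) = 1"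
  by (simp add: prob_space.emeasure_space_1[OF prob_space_gaussian_data])
qed

lemma ennreal_success_prob:
 assumes "A \<in> algorithms d n" "Measurable.pred (data_space d n) G" "y \<in> adversaries d eps n" "eps <= 1"
 shows "ennreal (success_prob G A (contaminated d eps n mu y) h) = (\<integral>\<^sup>+X. ennreal (correct_mass G A h X) \<partial>contaminated d eps n mu y)"
proof -
 interpret prob_space "contaminated d eps n mu y" by (rule prob_space_contaminated[OF assms(3,4)])
 have "correct_mass G A h \<in> borel_measurable (contaminated d eps n mu y)"
  using measurable_correct_mass[OF assms(1,2)] by (simp add: contaminated_def)
 hence "integrable (contaminated d eps n mu y) (correct_mass G A h)"
  by (intro integrable_const_bound[where B=1]) (auto simp: correct_mass_bounds)
 thus ?thesis unfolding success_prob_eq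
  by (subst nn_integral_eq_integral) (auto simp: correct_mass_bounds)
qed

definition admissible :: "nat => real => (nat => real) => hypothesis => bool" where
 "admissible d \<alpha> mu h \<longleftrightarrow> (mu = (%_. 0) & h = Null) \<or> (\<alpha> <= norm2 d mu & h = Alternative)"

lemma solves_mean_testing_ge:
 assumes "solves_mean_testing d \<alpha> eps n G p A" "Measurable.pred (data_space d n) G" "eps <= 1" "admissible d \<alpha> mu h"
  and "I <= {..<n}" "card I <= num_corrupt eps n" "y \<in> space (data_space d n)"
 shows "ennreal p <= (\<integral>\<^sup>+g. perm_avg n (%X. ennreal (correct_mass G A h X)) (mix I y g) \<partial>gaussian_data d n (%_. mu))"
proof (rule perm_avg_mix_ge[OF _ num_corrupt_le[OF assms(3)] _ assms(5-7)])
 have A: "A \<in> algorithms d n" using assms(1) by (simp add: solves_mean_testing_def)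
 show "(%X. ennreal (correct_mass G A h X)) \<in> borel_measurable (data_space d n)"
  using measurable_correct_mass[OF A assms(2)] by measurable
 fix y assume y: "y \<in> adversaries d eps n"
 hence "p <= success_prob G A (contaminated d eps n mu y) h"
  using assms(1,4) unfolding solves_mean_testing_def admissible_def by auto
 thus "ennreal p <= (\<integral>\<^sup>+X. ennreal (correct_mass G A h X) \<partial>contaminated d eps n mu y)"
  using ennreal_success_prob[OF A assms(2) y assms(3)] by (metis ennreal_leI)
qed

lemma solves_obliviousI:
 assumes B: "B \<in> algorithms d n" and eps: "eps <= 1"
  and ge: "\<And>mu h I y. admissible d \<alpha> mu h ==> I <= {..<n} ==> card I = num_corrupt eps n ==> y \<in> space (data_space d n) ==>
    ennreal p <= (\<integral>\<^sup>+g. ennreal (pmf (B (mix I y g)) h) \<partial>gaussian_data d n (%_. mu))"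
 shows "solves_oblivious d \<alpha> eps n p B"
proof -
 have key: "p <= success_prob (%_. True) B (contaminated d eps n mu y) h"
  if adm: "admissible d \<alpha> mu h" and y: "y \<in> adversaries d eps n" for mu h y
 proof -
  have m: "(%X. ennreal (correct_mass (%_. True) B h X)) \<in> borel_measurable (data_space d n)"
   using measurable_correct_mass[OF B, of "%_. True"] by measurable
  have "ennreal p <= (\<integral>\<^sup>+X. ennreal (correct_mass (%_. True) B h X) \<partial>contaminated d eps n mu y)"
   by (rule contaminated_ge[OF m num_corrupt_le[OF eps] _ y]) (use ge[OF adm] in \<open>simp add: correct_mass_def\<close>)
  hence "ennreal p <= ennreal (success_prob (%_. True) B (contaminated d eps n mu y) h)"
   using ennreal_success_prob[OF B _ y eps, of "%_. True"] by simp
  moreover have "0 <= success_prob (%_. True) B (contaminated d eps n mu y) h"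
   unfolding success_prob_eq by (intro Bochner_Integration.integral_nonneg) (simp add: correct_mass_bounds)
  ultimately show ?thesis by (simp add: ennreal_le_iff)
 qed
 show ?thesis unfolding solves_oblivious_def solves_mean_testing_def
  using B key by (auto simp: admissible_def)
qed

section \<open>Transfer of success probabilities to selected samples\<close>

definition select :: "nat set => nat => nat" where
 "select K i = sorted_list_of_set K ! i"

lemma select:
 assumes "finite K" "n <= card K"
 shows "inj_on (select K) {..<n}" "select K ` {..<n} <= K"
proof -
 have len: "length (sorted_list_of_set K) = card K" "distinct (sorted_list_of_set K)" by auto
 show "inj_on (select K) {..<n}" using len assms by (auto simp: inj_on_def select_def nth_eq_iff_index_eq)
 show "select K ` {..<n} <= K"
 proof
  fix k assume "k \<in> select K ` {..<n}"
  then obtain i where i: "i < n" "k = sorted_list_of_set K ! i" by (auto simp: select_def)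
  hence "i < card K" using assms by linarith
  with i(2) have "k \<in> set (sorted_list_of_set K)" using len by simp
  thus "k \<in> K" using assms by simp
 qed
qed

text \<open>If the selected indices are determined without looking at the fresh samples \<open>J\<close>, then the selected dataset is again
  obliviously contaminated.\<close>

lemma selection_ge:
 assumes sol: "solves_mean_testing d \<alpha> eps n G p A" "Measurable.pred (data_space d n) G" "eps <= 1" "admissible d \<alpha> mu h"
  and I: "I <= {..<N}" and J: "J <= {..<N} - I" and y: "y \<in> space (data_space d N)"
  and K: "K \<in> measurable (data_space d N) (count_space (Pow {..<N}))"
  and indep: "\<And>g1 g1' g2. g1 \<in> space (data_space d N) ==> g1' \<in> space (data_space d N) ==> g2 \<in> space (data_space d N) ==> K (mix J g1 g2) = K (mix J g1' g2)"
  and Kc: "\<And>g. g \<in> space (data_space d N) ==> n <= card (K g) & K g <= J Un I & card (K g Int I) <= num_corrupt eps n"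
 shows "(%g. perm_avg n (%X. ennreal (correct_mass G A h X)) (rearrange n (mix I y g) (select (K g)))) \<in> borel_measurable (data_space d N)"
  and "ennreal p <= (\<integral>\<^sup>+g. perm_avg n (%X. ennreal (correct_mass G A h X)) (rearrange n (mix I y g) (select (K g))) \<partial>gaussian_data d N (%_. mu))"
proof -
 let ?q = "%X. ennreal (correct_mass G A h X)"
 have A: "A \<in> algorithms d n" using sol(1) by (simp add: solves_mean_testing_def)
 have q[measurable]: "?q \<in> borel_measurable (data_space d n)" using measurable_correct_mass[OF A sol(2)] by measurable
 have sel: "inj_on (select S) {..<n}" "select S ` {..<n} <= S" "select S ` {..<n} <= {..<N}"
  if "S <= {..<N}" "n <= card S" for S
  using select[OF finite_subset[OF that(1)] that(2)] that(1) by auto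
 define H where "H S g = (if n <= card S then perm_avg n ?q (rearrange n (mix I y g) (select S)) else 0)" for S g
 have mH: "H S \<in> borel_measurable (data_space d N)" if "S \<in> Pow {..<N}" for S
 proof (cases "n <= card S")
  case True
  have "(%g. rearrange n (mix I y g) (select S)) \<in> measurable (data_space d N) (data_space d n)"
   by (rule measurable_compose[OF measurable_mix_right[OF y] measurable_rearrange]) (use sel True that in auto)
  thus ?thesis using True unfolding H_def[abs_def] by simp
 qed (simp add: H_def[abs_def])
 have mHK: "(%g. H (K g) g) \<in> borel_measurable (data_space d N)"
  by (rule measurable_compose_countable'[OF mH K]) (simp_all add: countable_finite)
 have HK: "H (K g) g = perm_avg n ?q (rearrange n (mix I y g) (select (K g)))" if "g \<in> space (data_space d N)" for g
  using Kc[OF that] by (simp add: H_def)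
 show "(%g. perm_avg n ?q (rearrange n (mix I y g) (select (K g)))) \<in> borel_measurable (data_space d N)"
  using mHK HK by (subst measurable_cong[of _ _ "%g. H (K g) g"]) auto
 \<comment> \<open>With the samples outside \<open>J\<close> frozen at \<open>g2\<close>, the
   selection is a constant set \<open>S\<close>, and the positions that \<open>select S\<close>
   takes from \<open>I\<close> form the corrupted part of the new dataset.\<close>
 have inner: "ennreal p <= (\<integral>\<^sup>+g1. H (K (mix J g1 g2)) (mix J g1 g2) \<partial>gaussian_data d N (%_. mu))"
  if g2: "g2 \<in> space (data_space d N)" for g2
 proof -
  define S where "S = K (mix J g2 g2)"
  have S: "n <= card S" "S <= J Un I" "card (S Int I) <= num_corrupt eps n" "S <= {..<N}"
   using Kc[OF mix_in_space[OF g2 g2]] I J by (auto simp: S_def)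
  define e where "e = select S"
  have e: "inj_on e {..<n}" "e ` {..<n} <= S" "e ` {..<n} <= {..<N}" using sel S by (auto simp: e_def)
  define I' where "I' = {i. i < n & e i \<in> I}"
  have "card I' <= card (S Int I)"
   using e by (intro card_inj_on_le[of e]) (auto simp: I'_def inj_on_def finite_subset[OF S(4)])
  hence cI': "card I' <= num_corrupt eps n" using S by linarith
  define y' where "y' = rearrange n y e"
  have y': "y' \<in> space (data_space d n)" unfolding y'_def by (rule rearrange_in_space[OF y e(3)])
  have m: "(%g. perm_avg n ?q (mix I' y' g)) \<in> borel_measurable (data_space d n)"
   by (rule measurable_compose[OF measurable_mix_right[OF y']]) measurable
  have "ennreal p <= (\<integral>\<^sup>+g. perm_avg n ?q (mix I' y' g) \<partial>gaussian_data d n (%_. mu))"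
   by (rule solves_mean_testing_ge[OF sol _ cI' y']) (auto simp: I'_def)
  also have "... = (\<integral>\<^sup>+g1. perm_avg n ?q (mix I' y' (\<lambda>i\<in>{..<n}. g1 (e i))) \<partial>gaussian_data d N (%_. mu))"
   by (rule nn_integral_gaussian_data_reindex[OF m e(1,3), symmetric])
  also have "... = (\<integral>\<^sup>+g1. H (K (mix J g1 g2)) (mix J g1 g2) \<partial>gaussian_data d N (%_. mu))"
  proof (rule nn_integral_cong)
   fix g1 assume "g1 \<in> space (gaussian_data d N (%_. mu))"
   hence g1: "g1 \<in> space (data_space d N)" by (simp add: space_gaussian_data)
   have "K (mix J g1 g2) = S" unfolding S_def by (rule indep[OF g1 g2 g2])
   moreover have "rearrange n (mix I y (mix J g1 g2)) e = mix I' y' (\<lambda>i\<in>{..<n}. g1 (e i))"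
   proof
    fix i
    show "rearrange n (mix I y (mix J g1 g2)) e i = mix I' y' (\<lambda>i\<in>{..<n}. g1 (e i)) i"
    proof (cases "i < n")
     case True
     hence "e i \<in> J Un I" using e S by blast
     thus ?thesis using True J by (auto simp: rearrange_def mix_def I'_def y'_def)
    qed (simp add: rearrange_def mix_def I'_def)
   qed
   ultimately show "perm_avg n ?q (mix I' y' (\<lambda>i\<in>{..<n}. g1 (e i))) = H (K (mix J g1 g2)) (mix J g1 g2)"
    using S(1) by (simp add: H_def e_def)
  qed
  finally show ?thesis .
 qed
 have "ennreal p <= (\<integral>\<^sup>+g2. ennreal p \<partial>gaussian_data d N (%_. mu))"
  by (simp add: prob_space.emeasure_space_1[OF prob_space_gaussian_data])
 also have "... <= (\<integral>\<^sup>+g2. \<integral>\<^sup>+g1. H (K (mix J g1 g2)) (mix J g1 g2) \<partial>gaussian_data d N (%_. mu) \<partial>gaussian_data d N (%_. mu))"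
  by (rule nn_integral_mono) (use inner in \<open>simp add: space_gaussian_data\<close>)
 also have "... = (\<integral>\<^sup>+g2. \<integral>\<^sup>+g1. H (K (mix (- J) g2 g1)) (mix (- J) g2 g1) \<partial>gaussian_data d N (%_. mu) \<partial>gaussian_data d N (%_. mu))"
 proof -
  have "mix J g1 g2 = mix (- J) g2 g1" for g1 g2 :: "nat => nat => real" by (auto simp: mix_def)
  thus ?thesis by simp
 qed
 also have "... = (\<integral>\<^sup>+g. H (K g) g \<partial>gaussian_data d N (%_. mu))"
  using nn_integral_gaussian_data_mix[OF mHK, of "- J" "%_. mu" "%_. mu"] by simp
 also have "... = (\<integral>\<^sup>+g. perm_avg n ?q (rearrange n (mix I y g) (select (K g))) \<partial>gaussian_data d N (%_. mu))"
  by (rule nn_integral_cong) (simp add: HK space_gaussian_data)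
 finally show "ennreal p <= (\<integral>\<^sup>+g. perm_avg n ?q (rearrange n (mix I y g) (select (K g))) \<partial>gaussian_data d N (%_. mu))" .
qed

text \<open>Transfers a guarantee from an ideal procedure with success \<open>q\<close> to the
  actual one with success \<open>s\<close>. The error terms are: \<delta>1 for coins that are bad
  outright, \<delta>2 for coins bad for the given data (\<open>lab\<close>), \<delta>3 for bad data,
  \<delta>4 for data bad for the given coin (\<open>fresh\<close>). The two joint events are kept
  apart since one is bounded with the data fixed and the other with the coin fixed.\<close>

lemma randomized_ge:
 fixes coin :: "'w pmf" and s :: "'w => 'a => real" and q :: "'w => 'a => ennreal"
 assumes fin: "finite (set_pmf coin)" and E: "prob_space E"
  and s: "\<And>w. w \<in> set_pmf coin ==> s w \<in> borel_measurable E" "\<And>w g. 0 <= s w g" "\<And>w g. s w g <= 1"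
  and q: "\<And>w. w \<in> set_pmf coin ==> w \<in> Good ==> q w \<in> borel_measurable E"
   "\<And>w. w \<in> set_pmf coin ==> w \<in> Good ==> ennreal p <= (\<integral>\<^sup>+g. q w g \<partial>E)" "\<And>w g. q w g <= 1"
  and NX: "NX \<in> sets E" "measure E NX <= \<delta>3"
  and fresh: "\<And>w. w \<in> set_pmf coin ==> fresh w \<in> sets E" "\<And>w. w \<in> set_pmf coin ==> measure E (fresh w) <= \<delta>4"
  and pt: "\<And>w g. w \<in> set_pmf coin ==> w \<in> Good ==> g \<in> space E ==> g \<notin> NX ==> g \<notin> fresh w ==> ~ lab w g ==> q w g <= ennreal (s w g)"
  and \<delta>1: "pprob coin {w. w \<notin> Good} <= \<delta>1"
  and \<delta>2: "\<And>g. g \<in> space E ==> g \<notin> NX ==> pprob coin {w. lab w g} <= \<delta>2"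
  and p: "p <= 1" "0 <= \<delta>2" "\<delta>1 + \<delta>2 + \<delta>3 + \<delta>4 <= \<delta>"
 shows "ennreal (p - \<delta>) <= (\<integral>\<^sup>+g. ennreal (measure_pmf.expectation coin (%w. s w g)) \<partial>E)"
proof -
 interpret prob_space E by (rule E)
 let ?S = "set_pmf coin" and ?P = "pmf coin"
 have ex: "measure_pmf.expectation coin (%w. f w) = (\<Sum>w\<in>?S. ?P w * f w)" for f :: "'w => real"
  by (subst integral_measure_pmf_real[OF fin]) (auto simp: mult.commute)
 have pr: "pprob coin {w. Q w} = (\<Sum>w\<in>?S. ?P w * of_bool (Q w))" for Q
 proof -
  have "pprob coin {w. Q w} = measure_pmf.expectation coin (indicator {w. Q w})" by simp
  also have "... = (\<Sum>w\<in>?S. ?P w * indicator {w. Q w} w)" by (rule ex)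
  finally show ?thesis by (simp add: indicator_def of_bool_def cong: sum.cong)
 qed
 have sumP: "(\<Sum>w\<in>?S. ?P w) = 1" using sum_pmf_eq_1[OF fin] by simp
 \<comment> \<open>On bad coins nothing is known about \<open>q\<close>, not even measurability; the
   default 0 there is paid for by \<delta>1.\<close>
 define r where "r w g = (if w \<in> Good then enn2real (q w g) else 0)" for w g
 have r: "0 <= r w g" "r w g <= 1" for w g
  using enn2real_mono[OF q(3)[of w g]] by (auto simp: r_def)
 have rm: "r w \<in> borel_measurable E" if "w \<in> ?S" for w
  unfolding r_def[abs_def] using q(1)[OF that] by (cases "w \<in> Good") auto
 have int: "integrable E f" if "f \<in> borel_measurable E" "\<And>g. 0 <= f g" "\<And>g. f g <= 1" for f :: "'a => real"
  using that by (intro integrable_const_bound[where B=1]) auto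
 have rp: "p <= expectation (r w)" if "w \<in> ?S" "w \<in> Good" for w
 proof -
  have "ennreal p <= (\<integral>\<^sup>+g. q w g \<partial>E)" by (rule q(2)[OF that])
  also have "... = (\<integral>\<^sup>+g. ennreal (r w g) \<partial>E)"
  proof (rule nn_integral_cong)
   fix g
   have "q w g < top" using q(3)[of w g] by (metis ennreal_one_less_top order_le_less_trans)
   thus "q w g = ennreal (r w g)" using that by (simp add: r_def ennreal_enn2real_if)
  qed
  also have "... = ennreal (expectation (r w))"
   by (rule nn_integral_eq_integral) (use int[OF rm[OF that(1)]] r in auto)
  finally show ?thesis using r by (simp add: ennreal_le_iff Bochner_Integration.integral_nonneg)
 qed
 let ?s = "%g. \<Sum>w\<in>?S. ?P w * s w g"
 have pw: "(\<Sum>w\<in>?S. ?P w * r w g) <= ?s g + indicator NX g + (\<Sum>w\<in>?S. ?P w * indicator (fresh w) g) + \<delta>2"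
  if g: "g \<in> space E" for g
 proof (cases "g \<in> NX")
  case True
  have "(\<Sum>w\<in>?S. ?P w * r w g) <= (\<Sum>w\<in>?S. ?P w * 1)" by (intro sum_mono mult_left_mono r) auto
  moreover have "0 <= ?s g" "0 <= (\<Sum>w\<in>?S. ?P w * indicator (fresh w) g)" by (auto intro!: sum_nonneg mult_nonneg_nonneg s)
  ultimately show ?thesis using True p sumP by simp
 next
  case False
  have "(\<Sum>w\<in>?S. ?P w * r w g) <= (\<Sum>w\<in>?S. ?P w * (s w g + indicator (fresh w) g + of_bool (lab w g)))"
  proof (intro sum_mono mult_left_mono)
   fix w assume w: "w \<in> ?S"
   show "r w g <= s w g + indicator (fresh w) g + of_bool (lab w g)"
   proof (cases "w \<in> Good & g \<notin> fresh w & ~ lab w g")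
    case True
    hence "q w g <= ennreal (s w g)" using pt w g False by blast
    hence "enn2real (q w g) <= s w g" using enn2real_mono[of "q w g" "ennreal (s w g)"] s(2)[of w g] by simp
    thus ?thesis using True by (simp add: r_def)
   next
    case F: False
    show ?thesis
    proof (cases "w \<in> Good")
     case True
     hence "1 <= indicator (fresh w) g + (of_bool (lab w g) :: real)" using F by (auto simp: indicator_def)
     thus ?thesis using r(2)[of w g] s(2)[of w g] by linarith
    next
     case False
     hence "r w g = 0" by (simp add: r_def)
     thus ?thesis using s(2)[of w g] by simp
    qed
   qed
  qed simp
  also have "... = ?s g + (\<Sum>w\<in>?S. ?P w * indicator (fresh w) g) + pprob coin {w. lab w g}"
   unfolding pr by (simp add: algebra_simps sum.distrib)
  finally show ?thesis using \<delta>2[OF g False] False by simp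
 qed
 have ms: "?s \<in> borel_measurable E" using s(1) by measurable
 have s01: "0 <= ?s g" "?s g <= 1" for g
 proof -
  show "0 <= ?s g" by (intro sum_nonneg mult_nonneg_nonneg s) auto
  have "?s g <= (\<Sum>w\<in>?S. ?P w * 1)" by (intro sum_mono mult_left_mono s) auto
  thus "?s g <= 1" using sumP by simp
 qed
 have ir: "integrable E (%g. ?P w * r w g)" if "w \<in> ?S" for w using int[OF rm[OF that]] r by simp
 have iF: "integrable E (%g. ?P w * indicator (fresh w) g)" if "w \<in> ?S" for w
  using fresh(1)[OF that] by (intro integrable_mult_right integrable_real_indicator) (auto simp: less_top[symmetric])
 have iN: "integrable E (indicator NX :: 'a => real)" using NX by (intro integrable_real_indicator) (auto simp: less_top[symmetric])
 have isum: "integrable E ?s" using int[OF ms] s01 by blast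
 have "expectation (%g. \<Sum>w\<in>?S. ?P w * r w g) <=
   expectation (%g. ?s g + indicator NX g + (\<Sum>w\<in>?S. ?P w * indicator (fresh w) g) + \<delta>2)"
  by (rule integral_mono) (use ir iF iN isum pw in \<open>auto intro!: Bochner_Integration.integrable_add Bochner_Integration.integrable_sum\<close>)
 also have "... = expectation ?s + measure E NX + (\<Sum>w\<in>?S. ?P w * measure E (fresh w)) + \<delta>2"
 proof -
  have "expectation (%g. ?s g + indicator NX g + (\<Sum>w\<in>?S. ?P w * indicator (fresh w) g) + \<delta>2) =
    expectation ?s + expectation (indicator NX) + expectation (%g. \<Sum>w\<in>?S. ?P w * indicator (fresh w) g) + \<delta>2"
   using isum iN iF by (simp add: Bochner_Integration.integrable_sum prob_space)
  also have "expectation (%g. \<Sum>w\<in>?S. ?P w * indicator (fresh w) g) = (\<Sum>w\<in>?S. ?P w * measure E (fresh w))"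
   using iF fresh(1) by (subst Bochner_Integration.integral_sum) (auto intro!: sum.cong simp: sets.Int_space_eq2)
  finally show ?thesis using NX by (simp add: sets.Int_space_eq2)
 qed
 also have "(\<Sum>w\<in>?S. ?P w * measure E (fresh w)) <= (\<Sum>w\<in>?S. ?P w * \<delta>4)" by (intro sum_mono mult_left_mono fresh) auto
 also have "... = \<delta>4" using sumP by (simp add: sum_distrib_right[symmetric])
 finally have up: "expectation (%g. \<Sum>w\<in>?S. ?P w * r w g) <= expectation ?s + \<delta>2 + \<delta>3 + \<delta>4" using NX by linarith
 have "expectation (%g. \<Sum>w\<in>?S. ?P w * r w g) = (\<Sum>w\<in>?S. ?P w * expectation (r w))"
  using ir by (subst Bochner_Integration.integral_sum) auto
 also have "... \<ge> (\<Sum>w\<in>?S. ?P w * (p - of_bool (w \<notin> Good)))"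
 proof (intro sum_mono mult_left_mono)
  fix w assume w: "w \<in> ?S"
  have "0 <= expectation (r w)" using r by (intro Bochner_Integration.integral_nonneg) auto
  thus "p - of_bool (w \<notin> Good) <= expectation (r w)" using rp[OF w] p by (cases "w \<in> Good") auto
 qed simp
 also have "(\<Sum>w\<in>?S. ?P w * (p - of_bool (w \<notin> Good))) = p - pprob coin {w. w \<notin> Good}"
  unfolding pr using sumP by (simp add: right_diff_distrib sum_subtractf sum_distrib_right[symmetric])
 finally have "p - \<delta> <= expectation ?s" using up \<delta>1 p by linarith
 hence "ennreal (p - \<delta>) <= ennreal (expectation ?s)" by (rule ennreal_leI)
 also have "... = (\<integral>\<^sup>+g. ennreal (?s g) \<partial>E)" by (rule nn_integral_eq_integral[symmetric]) (use isum s01 in auto)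
 finally show ?thesis by (simp only: ex)
qed

section \<open>Typical Gaussian data and fresh tests\<close>

lemma measurable_gaussian_coord: "j < d ==> (%x. x j - c) \<in> borel_measurable (gaussian d mu)"
 using borel_measurable_diff[OF measurable_point borel_measurable_const, of j d c]
 by (simp add: sets_gaussian cong: measurable_cong_sets)

lemma sets_gaussian_tail:
 "{x\<in>space (gaussian d mu). c < \<bar>dot d (%j. x j - mu j) v\<bar>} \<in> sets (gaussian d mu)"
 "{x\<in>space (gaussian d mu). c < \<bar>dot d (%j. x j - mu j) (%j. x j - mu j) - r\<bar>} \<in> sets (gaussian d mu)"
proof -
 have "(%x. dot d (%j. x j - mu j) v) \<in> borel_measurable (gaussian d mu)"
  "(%x. dot d (%j. x j - mu j) (%j. x j - mu j)) \<in> borel_measurable (gaussian d mu)"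
  by (intro measurable_dot measurable_gaussian_coord borel_measurable_const; assumption)+
 thus "{x\<in>space (gaussian d mu). c < \<bar>dot d (%j. x j - mu j) v\<bar>} \<in> sets (gaussian d mu)"
  "{x\<in>space (gaussian d mu). c < \<bar>dot d (%j. x j - mu j) (%j. x j - mu j) - r\<bar>} \<in> sets (gaussian d mu)"
  by (auto intro!: borel_measurable_less)
qed

lemma gaussian_linear_tails:
 assumes "finite V" "0 < t"
 shows "measure (gaussian d mu) {x\<in>space (gaussian d mu). \<exists>v\<in>V. t * norm2 d v < \<bar>dot d (%j. x j - mu j) v\<bar>} <= rcard V * (2 * exp (- (t\<^sup>2 / 2)))"
proof -
 interpret prob_space "gaussian d mu" by (rule prob_space_gaussian)
 have m: "{x\<in>space (gaussian d mu). t * norm2 d v < \<bar>dot d (%j. x j - mu j) v\<bar>} \<in> events" for v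
  by (rule sets_gaussian_tail)
 have "{x\<in>space (gaussian d mu). \<exists>v\<in>V. t * norm2 d v < \<bar>dot d (%j. x j - mu j) v\<bar>} =
   (\<Union>v\<in>V. {x\<in>space (gaussian d mu). t * norm2 d v < \<bar>dot d (%j. x j - mu j) v\<bar>})" by auto
 also have "prob ... <= (\<Sum>v\<in>V. prob {x\<in>space (gaussian d mu). t * norm2 d v < \<bar>dot d (%j. x j - mu j) v\<bar>})"
  using m by (intro finite_measure_subadditive_finite assms(1)) auto
 also have "... <= (\<Sum>v\<in>V. 2 * exp (- (t\<^sup>2 / 2)))" by (intro sum_mono gaussian_linear_tail assms(2))
 finally show ?thesis by simp
qed

definition centered :: "(nat => nat => real) => (nat => nat => real) => nat => nat => real" where
 "centered mu g i = (%j. g i j - mu i j)"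

text \<open>The behaviour of a typical Gaussian point towards all directions independent of it that
  matter here: the corrupted points, the means, and the noise of the other points.\<close>

definition regular_at :: "nat => nat => (nat => nat => real) => nat set => (nat => nat => real) => real => (nat => nat => real) => nat => bool" where
 "regular_at d N mu I y t g i \<longleftrightarrow>
   (\<forall>k\<in>I. \<bar>dot d (centered mu g i) (y k)\<bar> <= t * norm2 d (y k)) &
   (\<forall>k\<in>{..<N}. \<bar>dot d (centered mu g i) (mu k)\<bar> <= t * norm2 d (mu k)) &
   \<bar>dot d (centered mu g i) (centered mu g i) - d\<bar> <= t\<^sup>2 * sqrt d &
   (\<forall>k\<in>{..<N} - {i}. \<bar>dot d (centered mu g i) (centered mu g k)\<bar> <= t * norm2 d (centered mu g k))"

definition regular :: "nat => nat => (nat => nat => real) => nat set => (nat => nat => real) => real => (nat => nat => real) => bool" where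
 "regular d N mu I y t g \<longleftrightarrow> (\<forall>i<N. regular_at d N mu I y t g i)"

lemma measurable_centered: "i < N ==> j < d ==> (%g. centered mu g i j) \<in> borel_measurable (data_space d N)"
 unfolding centered_def by measurable

lemma measurable_regular_at:
 assumes "i < N" "I <= {..<N}"
 shows "Measurable.pred (data_space d N) (%g. regular_at d N mu I y t g i)"
proof -
 note measurable_centered[measurable]
 have 1: "(%g. dot d (centered mu g i) v) \<in> borel_measurable (data_space d N)" for v
  using assms by (intro measurable_dot) (auto intro: measurable_centered)
 have 2: "(%g. dot d (centered mu g k) (centered mu g l)) \<in> borel_measurable (data_space d N)" if "k < N" "l < N" for k l
  using that by (intro measurable_dot) (auto intro: measurable_centered)
 have [simp]: "finite I" using assms finite_subset by blast
 have a: "Measurable.pred (data_space d N) (%g. \<bar>dot d (centered mu g i) v\<bar> <= c)" for v c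
  unfolding pred_def by (rule borel_measurable_le) (use 1[of v] in auto)
 have b: "Measurable.pred (data_space d N) (%g. \<bar>dot d (centered mu g i) (centered mu g i) - d\<bar> <= c)" for c
  unfolding pred_def by (rule borel_measurable_le) (use 2[OF assms(1) assms(1)] in auto)
 have c: "Measurable.pred (data_space d N) (%g. \<bar>dot d (centered mu g i) (centered mu g k)\<bar> <= t * norm2 d (centered mu g k))"
  if "k \<in> {..<N} - {i}" for k
 proof -
  have k: "k < N" using that by auto
  show ?thesis unfolding pred_def norm2_eq_sqrt
   by (rule borel_measurable_le) (use 2[OF assms(1) k] 2[OF k k] in auto)
 qed
 show ?thesis unfolding regular_at_def
  by (intro pred_intros_logic pred_intros_finite a b c) auto
qed

text \<open>With all other points frozen, a point faces at most \<open>3 * N\<close> fixed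
  directions, so the one-dimensional tails and \<open>PiM_single_coordinate_le\<close>
  suffice.\<close>

lemma prob_not_regular:
 assumes "I <= {..<N}" "1 <= N" "1 <= d" "0 < t"
 shows "{g\<in>space (gaussian_data d N mu). ~ regular d N mu I y t g} \<in> sets (gaussian_data d N mu)"
  and "measure (gaussian_data d N mu) {g\<in>space (gaussian_data d N mu). ~ regular d N mu I y t g} <= 9 * (real N)\<^sup>2 * exp (- (t\<^sup>2 / 4))"
proof -
 let ?M = "gaussian_data d N mu"
 interpret prob_space ?M by (rule prob_space_gaussian_data)
 have fI: "finite I" "card I <= N" using assms(1) finite_subset card_mono[OF _ assms(1)] by auto
 define W where "W i = {g\<in>space ?M. ~ regular_at d N mu I y t g i}" for i
 have mW: "W i \<in> sets ?M" if "i < N" for i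
  unfolding W_def sets_gaussian_data space_gaussian_data using measurable_regular_at[OF that assms(1)] by measurable
 have U: "{g\<in>space ?M. ~ regular d N mu I y t g} = (\<Union>i\<in>{..<N}. W i)" by (auto simp: W_def regular_def)
 show "{g\<in>space ?M. ~ regular d N mu I y t g} \<in> sets ?M" unfolding U using mW by auto
 have each: "measure ?M (W i) <= 9 * real N * exp (- (t\<^sup>2 / 4))" if i: "i < N" for i
  unfolding gaussian_data_def
 proof (rule PiM_single_coordinate_le)
  show "W i \<in> sets (Pi\<^sub>M {..<N} (%i. gaussian d (mu i)))" using mW[OF i] by (simp add: gaussian_data_def)
  fix x assume x: "x \<in> space (Pi\<^sub>M {..<N} (%i. gaussian d (mu i)))"
  interpret Gs: prob_space "gaussian d (mu i)" by (rule prob_space_gaussian)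
  define V where "V = y ` I Un mu ` {..<N} Un (%k. centered mu x k) ` ({..<N} - {i})"
  have "card V <= card (y ` I Un mu ` {..<N}) + card ((%k. centered mu x k) ` ({..<N} - {i}))" unfolding V_def by (rule card_Un_le)
  also have "card (y ` I Un mu ` {..<N}) <= card (y ` I) + N" using card_Un_le[of "y ` I" "mu ` {..<N}"] card_image_le[of "{..<N}" mu] by simp
  also have "card (y ` I) <= N" using card_image_le[OF fI(1), of y] fI(2) by linarith
  also have "card ((%k. centered mu x k) ` ({..<N} - {i})) <= N" using card_image_le[of "{..<N} - {i}" "centered mu x"] i by simp
  finally have cV: "finite V" "rcard V <= 3 * real N" using fI assms(2) by (auto simp: V_def)
  let ?A = "{u\<in>space (gaussian d (mu i)). \<exists>v\<in>V. t * norm2 d v < \<bar>dot d (%j. u j - mu i j) v\<bar>}"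
  let ?B = "{u\<in>space (gaussian d (mu i)). t\<^sup>2 * sqrt d < \<bar>dot d (%j. u j - mu i j) (%j. u j - mu i j) - d\<bar>}"
  have mA: "?A \<in> sets (gaussian d (mu i))" "?B \<in> sets (gaussian d (mu i))"
  proof -
   have "?A = (\<Union>v\<in>V. {u\<in>space (gaussian d (mu i)). t * norm2 d v < \<bar>dot d (%j. u j - mu i j) v\<bar>})" by auto
   also have "... \<in> sets (gaussian d (mu i))" using cV by (intro sets.finite_UN sets_gaussian_tail)
   finally show "?A \<in> sets (gaussian d (mu i))" .
   show "?B \<in> sets (gaussian d (mu i))" by (rule sets_gaussian_tail)
  qed
  have "{u\<in>space (gaussian d (mu i)). x(i := u) \<in> W i} <= ?A Un ?B"
  proof
   fix u assume u: "u \<in> {u\<in>space (gaussian d (mu i)). x(i := u) \<in> W i}"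
   have ci: "centered mu (x(i := u)) i = (%j. u j - mu i j)" "k ~= i ==> centered mu (x(i := u)) k = centered mu x k" for k
    by (auto simp: centered_def)
   show "u \<in> ?A Un ?B"
   proof (rule ccontr)
    assume neg: "u \<notin> ?A Un ?B"
    hence "\<And>v. v \<in> V ==> \<bar>dot d (%j. u j - mu i j) v\<bar> <= t * norm2 d v"
     and "\<bar>dot d (%j. u j - mu i j) (%j. u j - mu i j) - d\<bar> <= t\<^sup>2 * sqrt d" using u by force+
    hence "regular_at d N mu I y t (x(i := u)) i"
     unfolding regular_at_def ci(1) using ci(2) by (auto simp: V_def)
    thus False using u by (simp add: W_def)
   qed
  qed
  hence "Gs.prob {u\<in>space (gaussian d (mu i)). x(i := u) \<in> W i} <= Gs.prob (?A Un ?B)"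
   by (rule Gs.finite_measure_mono[OF _ sets.Un[OF mA]])
  also have "... <= Gs.prob ?A + Gs.prob ?B" by (rule measure_Un_le[OF mA])
  also have "... <= rcard V * (2 * exp (- (t\<^sup>2 / 2))) + 2 * exp (1 / 4 - t\<^sup>2 / 4)"
   by (intro add_mono gaussian_linear_tails gaussian_norm_tail cV assms)
  also have "... <= 9 * real N * exp (- (t\<^sup>2 / 4))"
  proof -
   have "rcard V * (2 * exp (- (t\<^sup>2 / 2))) <= (3 * real N) * (2 * exp (- (t\<^sup>2 / 4)))"
    using cV by (intro mult_mono) auto
   moreover have "exp (1 / 4 - t\<^sup>2 / 4) <= 3 / 2 * exp (- (t\<^sup>2 / 4))"
   proof -
    have "exp (1 / 4 :: real) <= 1 + 1 / 4 + (1 / 4)\<^sup>2" by (rule exp_bound) auto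
    hence "exp (1 / 4 :: real) <= 3 / 2" by (simp add: power2_eq_square)
    hence "exp (1 / 4 :: real) * exp (- (t\<^sup>2 / 4)) <= 3 / 2 * exp (- (t\<^sup>2 / 4))" by (intro mult_right_mono) auto
    moreover have "exp (1 / 4 - t\<^sup>2 / 4) = exp (1 / 4) * exp (- (t\<^sup>2 / 4))" by (simp add: exp_add[symmetric])
    ultimately show ?thesis by simp
   qed
   moreover have "3 * exp (- (t\<^sup>2 / 4)) <= 3 * real N * exp (- (t\<^sup>2 / 4))" using assms(2) by simp
   ultimately show ?thesis by linarith
  qed
  finally show "measure (gaussian d (mu i)) {u\<in>space (gaussian d (mu i)). x(i := u) \<in> W i} <= 9 * real N * exp (- (t\<^sup>2 / 4))" .
 qed (use i in \<open>auto simp: prob_space_gaussian\<close>)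
 have "prob (\<Union>i\<in>{..<N}. W i) <= (\<Sum>i\<in>{..<N}. prob (W i))" using mW by (intro finite_measure_subadditive_finite) auto
 also have "... <= (\<Sum>i\<in>{..<N}. 9 * real N * exp (- (t\<^sup>2 / 4)))" by (intro sum_mono each) auto
 finally show "prob {g\<in>space ?M. ~ regular d N mu I y t g} <= 9 * (real N)\<^sup>2 * exp (- (t\<^sup>2 / 4))"
  unfolding U by (simp add: power2_eq_square)
qed

definition point_sum :: "(nat => nat => real) => nat set => nat => real" where
 "point_sum X f = (%j. \<Sum>k\<in>f. X k j)"

text \<open>The tests may depend on the data, but not on the points in \<open>J\<close>, and they
  contain none of these points. When a single point of \<open>J\<close> is resampled all test
  directions stay fixed, so a union bound over at most \<open>b\<close> of them is enough.\<close>

lemma prob_fresh_tests: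
 fixes I :: "nat set" and mu :: "nat => real"
 assumes J: "J <= {..<N}" and V: "V \<in> measurable (data_space d N) (count_space (Pow (Pow {..<N})))" and t: "0 < t"
  and indep: "\<And>g i u. g \<in> space (data_space d N) ==> i \<in> J ==> u \<in> space (point_space d) ==> V (g(i := u)) = V g"
  and avoid: "\<And>g f. g \<in> space (data_space d N) ==> f \<in> V g ==> f Int J = {}"
  and few: "\<And>g. g \<in> space (data_space d N) ==> rcard (V g) <= b" and y: "y \<in> space (data_space d N)"
 defines "bad \<equiv> {g\<in>space (gaussian_data d N (%_. mu)). \<exists>i\<in>J. \<exists>f\<in>V g. t * norm2 d (point_sum (mix I y g) f) < \<bar>dot d (centered (%_. mu) g i) (point_sum (mix I y g) f)\<bar>}"
 shows "bad \<in> sets (gaussian_data d N (%_. mu))" and "measure (gaussian_data d N (%_. mu)) bad <= real N * (b * (2 * exp (- (t\<^sup>2 / 2))))"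
proof -
 let ?M = "gaussian_data d N (%_. mu)"
 interpret prob_space ?M by (rule prob_space_gaussian_data)
 have fJ: "finite J" "card J <= N" using J finite_subset card_mono[OF _ J] by auto
 define Q where "Q i f g \<longleftrightarrow> t * norm2 d (point_sum (mix I y g) f) < \<bar>dot d (centered (%_. mu) g i) (point_sum (mix I y g) f)\<bar>" for i f g
 define W where "W i = {g\<in>space ?M. \<exists>f\<in>V g. Q i f g}" for i
 have VP: "V g \<in> Pow (Pow {..<N})" if "g \<in> space (data_space d N)" for g
  using measurable_space[OF V that] by simp
 have mX: "(%g. mix I y g k j) \<in> borel_measurable (data_space d N)" if "k < N" "j < d" for k j
  using measurable_compose[OF measurable_mix_right[OF y] measurable_data[OF that]] .
 have mQ: "Measurable.pred (data_space d N) (Q i f)" if "i < N" "f <= {..<N}" for i f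
 proof -
  have s: "(%g. point_sum (mix I y g) f j) \<in> borel_measurable (data_space d N)" if "j < d" for j
   unfolding point_sum_def using mX that \<open>f <= {..<N}\<close> by (intro borel_measurable_sum) auto
  have "(%g. dot d (centered (%_. mu) g i) (point_sum (mix I y g) f)) \<in> borel_measurable (data_space d N)"
   "(%g. dot d (point_sum (mix I y g) f) (point_sum (mix I y g) f)) \<in> borel_measurable (data_space d N)"
   using s measurable_centered \<open>i < N\<close> by (intro measurable_dot; auto)+
  thus ?thesis unfolding Q_def[abs_def] norm2_eq_sqrt by measurable
 qed
 have mW: "W i \<in> sets ?M" if i: "i \<in> J" for i
 proof -
  have "(%g. \<exists>f\<in>V g. Q i f g) \<in> measurable (data_space d N) (count_space UNIV)"
  proof (rule measurable_compose_countable'[where f="%S g. \<exists>f\<in>S. Q i f g" and g=V, OF _ V])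
   fix S assume "S \<in> Pow (Pow {..<N})"
   hence S: "finite S" "\<And>f. f \<in> S ==> f <= {..<N}" by (auto intro: finite_subset)
   show "Measurable.pred (data_space d N) (%g. \<exists>f\<in>S. Q i f g)"
    using S mQ i J by (intro pred_intros_finite) auto
  qed (simp add: countable_finite)
  thus ?thesis unfolding W_def sets_gaussian_data space_gaussian_data by measurable
 qed
 have bad: "bad = (\<Union>i\<in>J. W i)" by (auto simp: bad_def W_def Q_def)
 show "bad \<in> sets ?M" unfolding bad using mW fJ by auto
 have b0: "0 <= b * (2 * exp (- (t\<^sup>2 / 2)))"
 proof -
  have "0 <= rcard (V y)" by simp
  hence "0 <= b" using few[OF y] by linarith
  thus ?thesis by simp
 qed
 have each: "measure ?M (W i) <= b * (2 * exp (- (t\<^sup>2 / 2)))" if i: "i \<in> J" for i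
  unfolding gaussian_data_def
 proof (rule PiM_single_coordinate_le)
  show "W i \<in> sets (Pi\<^sub>M {..<N} (%i. gaussian d mu))" using mW[OF i] by (simp add: gaussian_data_def)
  show "i \<in> {..<N}" using i J by auto
  fix x assume "x \<in> space (Pi\<^sub>M {..<N} (%i. gaussian d mu))"
  hence x: "x \<in> space (data_space d N)" using space_gaussian_data[of d N "%_. mu"] by (simp add: gaussian_data_def)
  interpret Gs: prob_space "gaussian d mu" by (rule prob_space_gaussian)
  let ?V = "point_sum (mix I y x) ` V x"
  have fV: "finite (V x)" using VP[OF x] by (auto intro: finite_subset)
  let ?A = "{u\<in>space (gaussian d mu). \<exists>v\<in>?V. t * norm2 d v < \<bar>dot d (%j. u j - mu j) v\<bar>}"
  have mA: "?A \<in> sets (gaussian d mu)"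
  proof -
   have "?A = (\<Union>v\<in>?V. {u\<in>space (gaussian d mu). t * norm2 d v < \<bar>dot d (%j. u j - mu j) v\<bar>})" by auto
   also have "... \<in> sets (gaussian d mu)" using fV by (intro sets.finite_UN sets_gaussian_tail finite_imageI)
   finally show ?thesis .
  qed
  have "{u\<in>space (gaussian d mu). x(i := u) \<in> W i} <= ?A"
  proof
   fix u assume u: "u \<in> {u\<in>space (gaussian d mu). x(i := u) \<in> W i}"
   hence us: "u \<in> space (point_space d)" by (simp add: space_gaussian)
   from u obtain f where f: "f \<in> V (x(i := u))" "Q i f (x(i := u))" by (auto simp: W_def)
   have fV': "f \<in> V x" using f indep[OF x i us] by simp
   have "i \<notin> f" using avoid[OF x fV'] i by auto
   hence "point_sum (mix I y (x(i := u))) f = point_sum (mix I y x) f"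
    unfolding point_sum_def mix_def by (intro ext sum.cong) auto
   moreover have "centered (%_. mu) (x(i := u)) i = (%j. u j - mu j)" by (simp add: centered_def)
   ultimately show "u \<in> ?A" using f(2) fV' u unfolding Q_def by auto
  qed
  hence "Gs.prob {u\<in>space (gaussian d mu). x(i := u) \<in> W i} <= Gs.prob ?A"
   by (rule Gs.finite_measure_mono[OF _ mA])
  also have "... <= rcard ?V * (2 * exp (- (t\<^sup>2 / 2)))" using fV by (intro gaussian_linear_tails t) auto
  also have "... <= b * (2 * exp (- (t\<^sup>2 / 2)))"
   using few[OF x] card_image_le[OF fV, of "point_sum (mix I y x)"] by (intro mult_right_mono) auto
  finally show "measure (gaussian d mu) {u\<in>space (gaussian d mu). x(i := u) \<in> W i} <= b * (2 * exp (- (t\<^sup>2 / 2)))" .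
 qed (use b0 in \<open>auto simp: prob_space_gaussian\<close>)
 have "prob bad <= (\<Sum>i\<in>J. prob (W i))" unfolding bad using mW fJ by (intro finite_measure_subadditive_finite) auto
 also have "... <= (\<Sum>i\<in>J. b * (2 * exp (- (t\<^sup>2 / 2))))" by (intro sum_mono each)
 also have "... <= real N * (b * (2 * exp (- (t\<^sup>2 / 2))))" using fJ b0 by (simp add: mult_right_mono)
 finally show "prob bad <= real N * (b * (2 * exp (- (t\<^sup>2 / 2))))" .
qed

section \<open>Friendliness of selected points and the screening reduction\<close>

definition gram :: "nat => (nat => nat => real) => nat => nat => real" where
 "gram d X i j = dot d (X i) (X j)"

lemma dot_point_sum_right: "dot d u (point_sum X T) = (\<Sum>k\<in>T. dot d u (X k))"
proof -
 have "dot d u (point_sum X T) = (\<Sum>j<d. \<Sum>k\<in>T. u j * X k j)" by (simp add: dot_def point_sum_def sum_distrib_left)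
 also have "... = (\<Sum>k\<in>T. \<Sum>j<d. u j * X k j)" by (rule sum.swap)
 finally show ?thesis by (simp add: dot_def)
qed

lemma dot_point_sum: "dot d (point_sum X S) (point_sum X T) = pair_sum (gram d X) S T"
proof -
 have "dot d (point_sum X S) (point_sum X T) = (\<Sum>k\<in>T. dot d (point_sum X S) (X k))" by (rule dot_point_sum_right)
 also have "... = (\<Sum>k\<in>T. \<Sum>i\<in>S. dot d (X i) (X k))"
  by (intro sum.cong refl) (subst dot_commute, simp add: dot_point_sum_right dot_commute)
 also have "... = pair_sum (gram d X) S T" unfolding pair_sum_def gram_def by (rule sum.swap)
 finally show ?thesis .
qed

text \<open>Friendliness of a set of indices in a longer dataset, with \<open>M\<close> for
  \<epsilon>n. It is a property of the set, independent of the order in which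
  \<open>friendly_rearrange\<close> lists the points.\<close>

definition friendly_set :: "nat => real => real => (nat => nat => real) => nat set => bool" where
 "friendly_set d M \<kappa> X Z \<longleftrightarrow> correlation_le (gram d X) M Z (\<kappa> * max (sqrt (M * real d)) M) &
   (\<forall>i\<in>Z. \<forall>j\<in>Z. i ~= j --> \<bar>dot d (X i) (X j)\<bar> <= \<kappa> * sqrt (real d)) &
   (\<forall>i\<in>Z. \<bar>dot d (X i) (X i) - real d\<bar> <= \<kappa> * sqrt (real d))"

lemma friendly_rearrange:
 assumes Z: "friendly_set d (eps * real n) \<kappa> X Z" and e: "inj_on e {..<n}" "e ` {..<n} <= Z"
 shows "friendly d eps n \<kappa> (rearrange n X e)"
 unfolding friendly_def
proof (intro conjI allI impI)
 have ps: "(%j. \<Sum>i\<in>S. rearrange n X e i j) = point_sum X (e ` S)" if "S <= {..<n}" for S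
 proof
  fix j
  have "(\<Sum>i\<in>S. rearrange n X e i j) = (\<Sum>i\<in>S. X (e i) j)"
   by (rule sum.cong) (use that in \<open>auto simp: rearrange_def\<close>)
  also have "... = point_sum X (e ` S) j"
   unfolding point_sum_def by (subst sum.reindex[OF inj_on_subset[OF e(1) that]]) simp
  finally show "(\<Sum>i\<in>S. rearrange n X e i j) = point_sum X (e ` S) j" .
 qed
 fix S T assume "S <= {..<n} & T <= {..<n} & S Int T = {} & rcard S <= eps * real n & rcard T <= eps * real n"
 hence S: "S <= {..<n}" "T <= {..<n}" "S Int T = {}" "rcard S <= eps * real n" "rcard T <= eps * real n" by auto
 have c: "card (e ` S) = card S" "card (e ` T) = card T"
  using card_image[OF inj_on_subset[OF e(1) S(1)]] card_image[OF inj_on_subset[OF e(1) S(2)]] by auto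
 have dj: "e ` S Int e ` T = {}" using inj_on_image_Int[OF e(1) S(1,2)] S(3) by simp
 have sub: "e ` S <= Z" "e ` T <= Z" using image_mono[OF S(1), of e] image_mono[OF S(2), of e] e(2) by blast+
 have "\<bar>pair_sum (gram d X) (e ` S) (e ` T)\<bar> <= \<kappa> * max (sqrt (eps * real n * real d)) (eps * real n) * sqrt (rcard (e ` S) * rcard (e ` T))"
 proof -
  have "correlation_le (gram d X) (eps * real n) Z (\<kappa> * max (sqrt (eps * real n * real d)) (eps * real n))"
   using Z by (simp add: friendly_set_def)
  thus ?thesis using S(4,5) dj sub c by (metis correlation_le_def)
 qed
 thus "\<bar>dot d (%j. \<Sum>i\<in>S. rearrange n X e i j) (%j. \<Sum>i\<in>T. rearrange n X e i j)\<bar>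
   <= \<kappa> * sqrt (rcard S * rcard T) * max (sqrt (eps * real n * real d)) (eps * real n)"
  unfolding ps[OF S(1)] ps[OF S(2)] dot_point_sum c by (simp add: mult_ac)
next
 fix i j assume "i < n" "j < n" "i ~= j"
 hence "e i \<in> Z" "e j \<in> Z" "e i ~= e j" using e by (auto simp: inj_on_def)
 thus "\<bar>dot d (rearrange n X e i) (rearrange n X e j)\<bar> <= \<kappa> * sqrt (real d)"
  using Z \<open>i < n\<close> \<open>j < n\<close> by (simp add: rearrange_def friendly_set_def)
next
 fix i assume "i < n"
 hence "e i \<in> Z" using e by auto
 hence "\<bar>dot d (X (e i)) (X (e i)) - real d\<bar> <= \<kappa> * sqrt (real d)" using Z by (simp add: friendly_set_def)
 thus "(norm2 d (rearrange n X e i))\<^sup>2 \<in> {real d - \<kappa> * sqrt (real d)..real d + \<kappa> * sqrt (real d)}"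
  using \<open>i < n\<close> by (simp add: rearrange_def norm2_power2 abs_le_iff)
qed

text \<open>All selections depend on the data through finitely many yes-or-no questions. This
  reduces their measurability to that of the questions.\<close>

lemma measurable_Collect_finite:
 assumes "finite D" "\<And>a. a \<in> D ==> Measurable.pred M (P a)"
 shows "(%x. {a\<in>D. P a x}) \<in> measurable M (count_space (Pow D))"
proof -
 have "(%x. {a\<in>D. P a x}) -` {S} Int space M \<in> sets M" if S: "S \<in> Pow D" for S
 proof -
  have "(%x. {a\<in>D. P a x}) -` {S} Int space M = {x\<in>space M. \<forall>a\<in>D. P a x \<longleftrightarrow> a \<in> S}" using S by auto
  also have "... \<in> sets M"
  proof -
   have "Measurable.pred M (%x. P a x \<longleftrightarrow> a \<in> S)" if "a \<in> D" for a
    using assms(2)[OF that] by (intro pred_intros_logic) auto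
   hence "Measurable.pred M (%x. \<forall>a\<in>D. P a x \<longleftrightarrow> a \<in> S)" by (intro pred_intros_finite assms(1))
   thus ?thesis by (simp add: pred_def)
  qed
  finally show ?thesis .
 qed
 thus ?thesis using assms(1) by (subst measurable_count_space_eq2) auto
qed

lemma measurable_of_finite_info:
 assumes "T \<in> measurable M (count_space (Pow D))"
 shows "(%x. \<Phi> (T x)) \<in> measurable M (count_space UNIV)"
 by (rule measurable_compose[OF assms]) simp

text \<open>The reduction: a coin \<open>w\<close> and the data decide whether the data are visibly abnormal (then \<open>Alternative\<close> is
  output) and which indices to keep; the given algorithm is run on the first \<open>n\<close> kept points in random order.\<close>

definition screen :: "nat => ((nat => nat => real) => hypothesis pmf) => ('w => (nat => nat => real) => bool) =>
  ('w => (nat => nat => real) => nat set) => 'w => (nat => nat => real) => hypothesis pmf" where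
 "screen n A alarm kept w X = (if alarm w X \<or> card (kept w X) < n then return_pmf Alternative
   else bind_pmf (pmf_of_set (perms n)) (%\<sigma>. A (rearrange n (rearrange n X (select (kept w X))) \<sigma>)))"

lemma pmf_permuted:
 "pmf (bind_pmf (pmf_of_set (perms n)) (%\<sigma>. A (rearrange n X \<sigma>))) h = (\<Sum>\<sigma>\<in>perms n. 1 / card (perms n) * pmf (A (rearrange n X \<sigma>)) h)"
 by (simp add: pmf_bind integral_pmf_of_set[OF perms_nonempty finite_perms] sum_divide_distrib)

lemma measurable_screen:
 assumes A: "A \<in> algorithms d n" and alarm: "Measurable.pred (data_space d N) (alarm w)"
  and kept: "kept w \<in> measurable (data_space d N) (count_space (Pow {..<N}))"
 shows "(%X. pmf (screen n A alarm kept w X) h) \<in> borel_measurable (data_space d N)"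
proof -
 note alarm[measurable]
 have Am: "(%X. pmf (A X) h) \<in> borel_measurable (data_space d n)" using A by (simp add: algorithms_def)
 define H where "H K X = (if alarm w X \<or> card K < n then pmf (return_pmf Alternative) h
   else \<Sum>\<sigma>\<in>perms n. 1 / card (perms n) * pmf (A (rearrange n (rearrange n X (select K)) \<sigma>)) h)" for K X
 have mH: "H K \<in> borel_measurable (data_space d N)" if K: "K \<in> Pow {..<N}" for K
 proof (cases "card K < n")
  case False
  hence e: "select K ` {..<n} <= {..<N}" using select(2)[of K n] K finite_subset[of K "{..<N}"] by auto
  have "(%X. pmf (A (rearrange n (rearrange n X (select K)) \<sigma>)) h) \<in> borel_measurable (data_space d N)" if "\<sigma> \<in> perms n" for \<sigma>
   by (rule measurable_compose[OF measurable_rearrange[OF e] measurable_compose[OF measurable_rearrange Am]])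
    (use perms_image(1)[OF that] in simp)
  hence S: "(%X. \<Sum>\<sigma>\<in>perms n. 1 / card (perms n) * pmf (A (rearrange n (rearrange n X (select K)) \<sigma>)) h) \<in> borel_measurable (data_space d N)" (is "?S \<in> _")
   by (intro borel_measurable_sum borel_measurable_times borel_measurable_const)
  have "H K = (%X. if alarm w X then pmf (return_pmf Alternative) h else ?S X)"
   by (rule ext) (simp only: H_def False simp_thms)
  moreover have "(%X. if alarm w X then pmf (return_pmf Alternative) h else ?S X) \<in> borel_measurable (data_space d N)"
   by (rule measurable_If[OF borel_measurable_const S]) (use alarm in \<open>simp add: pred_def\<close>)
  ultimately show ?thesis by (simp only:)
 qed (simp add: H_def[abs_def])
 have "(%X. H (kept w X) X) \<in> borel_measurable (data_space d N)"
  by (rule measurable_compose_countable'[OF mH kept]) (simp_all add: countable_finite)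
 moreover have "pmf (screen n A alarm kept w X) h = H (kept w X) X" for X
  unfolding screen_def H_def by (simp only: pmf_permuted if_distrib[of "%M. pmf M h"] if_distribR)
 ultimately show ?thesis by simp
qed

lemma screening_algorithm:
 assumes A: "A \<in> algorithms d n" and fin: "finite (set_pmf coin)"
  and alarm: "\<And>w. w \<in> set_pmf coin ==> Measurable.pred (data_space d N) (alarm w)"
  and kept: "\<And>w. w \<in> set_pmf coin ==> kept w \<in> measurable (data_space d N) (count_space (Pow {..<N}))"
 shows "(%X. bind_pmf coin (%w. screen n A alarm kept w X)) \<in> algorithms d N"
proof -
 have "pmf (bind_pmf coin (%w. screen n A alarm kept w X)) h = (\<Sum>w\<in>set_pmf coin. pmf (screen n A alarm kept w X) h * pmf coin w)" for X h
  unfolding pmf_bind by (rule integral_measure_pmf_real[OF fin]) auto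
 moreover have "(%X. pmf (screen n A alarm kept w X) h) \<in> borel_measurable (data_space d N)" if "w \<in> set_pmf coin" for w h
  by (rule measurable_screen[where alarm=alarm and kept=kept and w=w, OF A alarm[OF that] kept[OF that]])
 ultimately show ?thesis unfolding algorithms_def by simp
qed

lemma perm_avg_le_1:
 assumes "\<And>X. F X <= 1"
 shows "perm_avg n F X <= 1"
proof -
 have "0 < card (perms n)" using finite_perms perms_nonempty by (simp add: card_gt_0_iff)
 moreover have "perm_avg n F X <= (\<Sum>\<sigma>\<in>perms n. ennreal (1 / card (perms n)) * 1)"
  unfolding perm_avg_def by (intro sum_mono mult_left_mono assms) auto
 ultimately show ?thesis by (simp add: ennreal_of_nat_eq_real_of_nat ennreal_mult[symmetric])
qed

text \<open>The interface for both screening regimes. The central obligation is \<open>pt\<close>: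
  outside the exceptional events, either an alarm is raised and is justified, or the actual
  selection \<open>kept\<close> coincides with an ideal one \<open>K\<close> that ignores the
  samples in \<open>J\<close>, and the selected points are friendly. Then
  \<open>selection_ge\<close> bounds the ideal success and \<open>randomized_ge\<close> transfers
  it.\<close>

lemma screening_ge:
 fixes coin :: "'w pmf"
 assumes sol: "solves_friendly d \<alpha> eps \<kappa> n p A" "eps <= 1" "admissible d \<alpha> mu h"
  and I: "I <= {..<N}" and y: "y \<in> space (data_space d N)" and fin: "finite (set_pmf coin)"
  and alarm: "\<And>w. w \<in> set_pmf coin ==> Measurable.pred (data_space d N) (alarm w)"
  and kept: "\<And>w. w \<in> set_pmf coin ==> kept w \<in> measurable (data_space d N) (count_space (Pow {..<N}))"
  and J: "\<And>w. w \<in> set_pmf coin ==> w \<in> Good ==> J w <= {..<N} - I"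
  and K: "\<And>w. w \<in> set_pmf coin ==> w \<in> Good ==> K w \<in> measurable (data_space d N) (count_space (Pow {..<N}))"
  and indep: "\<And>w g1 g1' g2. w \<in> set_pmf coin ==> w \<in> Good ==> g1 \<in> space (data_space d N) ==> g1' \<in> space (data_space d N) ==>
    g2 \<in> space (data_space d N) ==> K w (mix (J w) g1 g2) = K w (mix (J w) g1' g2)"
  and Kc: "\<And>w g. w \<in> set_pmf coin ==> w \<in> Good ==> g \<in> space (data_space d N) ==>
    n <= card (K w g) & K w g <= J w Un I & card (K w g Int I) <= num_corrupt eps n"
  and NX: "NX \<in> sets (gaussian_data d N (%_. mu))" "measure (gaussian_data d N (%_. mu)) NX <= \<delta>3"
  and fresh: "\<And>w. w \<in> set_pmf coin ==> fresh w \<in> sets (gaussian_data d N (%_. mu))"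
   "\<And>w. w \<in> set_pmf coin ==> measure (gaussian_data d N (%_. mu)) (fresh w) <= \<delta>4"
  and pt: "\<And>w g. w \<in> set_pmf coin ==> w \<in> Good ==> g \<in> space (data_space d N) ==> g \<notin> NX ==> g \<notin> fresh w ==> ~ lab w g ==>
    alarm w (mix I y g) & h = Alternative \<or>
    ~ alarm w (mix I y g) & kept w (mix I y g) = K w g & friendly_set d (eps * real n) \<kappa> (mix I y g) (K w g)"
  and \<delta>1: "pprob coin {w. w \<notin> Good} <= \<delta>1"
  and \<delta>2: "\<And>g. g \<in> space (data_space d N) ==> g \<notin> NX ==> pprob coin {w. lab w g} <= \<delta>2"
  and p: "p <= 1" "0 <= \<delta>2" "\<delta>1 + \<delta>2 + \<delta>3 + \<delta>4 <= \<delta>"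
 shows "ennreal (p - \<delta>) <= (\<integral>\<^sup>+g. ennreal (pmf (bind_pmf coin (%w. screen n A alarm kept w (mix I y g))) h) \<partial>gaussian_data d N (%_. mu))"
proof -
 let ?E = "gaussian_data d N (%_. mu)"
 let ?G = "friendly d eps n \<kappa>"
 let ?q = "%w g. perm_avg n (%X. ennreal (correct_mass ?G A h X)) (rearrange n (mix I y g) (select (K w g)))"
 have sol': "solves_mean_testing d \<alpha> eps n ?G p A" using sol(1) by (simp add: solves_friendly_def)
 hence A: "A \<in> algorithms d n" by (simp add: solves_mean_testing_def)
 have "ennreal (p - \<delta>) <= (\<integral>\<^sup>+g. ennreal (measure_pmf.expectation coin (%w. pmf (screen n A alarm kept w (mix I y g)) h)) \<partial>?E)"
 proof (rule randomized_ge[where q="?q" and Good=Good and NX=NX and fresh=fresh and lab=lab and ?\<delta>1.0=\<delta>1 and ?\<delta>2.0=\<delta>2 and ?\<delta>3.0=\<delta>3 and ?\<delta>4.0=\<delta>4])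
  show "prob_space ?E" by (rule prob_space_gaussian_data)
  show "(%g. pmf (screen n A alarm kept w (mix I y g)) h) \<in> borel_measurable ?E" if "w \<in> set_pmf coin" for w
   using measurable_compose[OF measurable_mix_right[OF y, of I] measurable_screen[where alarm=alarm and kept=kept and w=w and h=h, OF A alarm[OF that] kept[OF that]]]
   by (simp cong: measurable_cong_sets add: sets_gaussian_data)
  fix w assume w: "w \<in> set_pmf coin" "w \<in> Good"
  note sel = selection_ge[OF sol' measurable_friendly sol(2,3) I J[OF w] y K[OF w] indep[OF w] Kc[OF w]]
  show "?q w \<in> borel_measurable ?E" by (subst measurable_cong_sets[OF sets_gaussian_data refl]) (rule sel(1))
  show "ennreal p <= (\<integral>\<^sup>+g. ?q w g \<partial>?E)" by (rule sel(2))
 next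
  show "?q w g <= 1" for w g by (rule perm_avg_le_1) (simp add: correct_mass_bounds)
 next
  fix w g assume w: "w \<in> set_pmf coin" "w \<in> Good" and g: "g \<in> space ?E" "g \<notin> NX" "g \<notin> fresh w" "~ lab w g"
  have g': "g \<in> space (data_space d N)" using g(1) by (simp add: space_gaussian_data)
  let ?X = "mix I y g"
  from pt[OF w g' g(2-4)] show "?q w g <= ennreal (pmf (screen n A alarm kept w ?X) h)"
  proof
   assume "alarm w ?X & h = Alternative"
   hence "pmf (screen n A alarm kept w ?X) h = 1" by (simp add: screen_def)
   moreover have "?q w g <= 1" by (rule perm_avg_le_1) (simp add: correct_mass_bounds)
   ultimately show ?thesis by simp
  next
   assume r: "~ alarm w ?X & kept w ?X = K w g & friendly_set d (eps * real n) \<kappa> ?X (K w g)"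
   have c: "n <= card (K w g)" and "K w g <= {..<N}" using Kc[OF w g'] J[OF w] I by auto
   hence fK: "finite (K w g)" using finite_subset by blast
   have fr: "?G (rearrange n (rearrange n ?X (select (K w g))) \<sigma>)" if s: "\<sigma> \<in> perms n" for \<sigma>
   proof -
    have "rearrange n (rearrange n ?X (select (K w g))) \<sigma> = rearrange n ?X (select (K w g) \<circ> \<sigma>)"
     using perms_image(1)[OF s] by (auto simp: rearrange_def fun_eq_iff)
    moreover have "?G (rearrange n ?X (select (K w g) \<circ> \<sigma>))"
     using select[OF fK c] perms_image[OF s] r
     by (intro friendly_rearrange[where Z="K w g"]) (auto intro: comp_inj_on simp: image_comp[symmetric])
    ultimately show ?thesis by simp
   qed
   have "?q w g = (\<Sum>\<sigma>\<in>perms n. ennreal (1 / card (perms n) * pmf (A (rearrange n (rearrange n ?X (select (K w g))) \<sigma>)) h))"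
    unfolding perm_avg_def by (intro sum.cong refl) (simp add: correct_mass_def fr ennreal_mult[symmetric])
   also have "... = ennreal (\<Sum>\<sigma>\<in>perms n. 1 / card (perms n) * pmf (A (rearrange n (rearrange n ?X (select (K w g))) \<sigma>)) h)"
    by (rule sum_ennreal) auto
   also have "... = ennreal (pmf (screen n A alarm kept w ?X) h)"
    using r c unfolding screen_def by (simp add: pmf_permuted)
   finally show ?thesis by simp
  qed
 next
  show "pprob coin {w. lab w g} <= \<delta>2" if "g \<in> space ?E" "g \<notin> NX" for g
   using \<delta>2 that by (simp add: space_gaussian_data)
 qed (use fin NX fresh \<delta>1 p in \<open>auto simp: pmf_le_1\<close>)
 thus ?thesis by (simp add: pmf_bind)
qed

section \<open>Scales, and consequences of regularity\<close>

lemma dot_centered: "dot d (g i) v = dot d (centered mu g i) v + dot d (mu i) v"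
 by (simp add: dot_def centered_def sum.distrib[symmetric] algebra_simps)

text \<open>From \<open>ln 2 \<ge> 2 / 3\<close> the factor 10 in \<open>h\<close> gives
  \<open>h \<ge> 20 / 3\<close> and \<open>h\<^sup>2 \<ge> 60 * ln (n * d)\<close>, so that
  \<open>exp (- h\<^sup>2)\<close> beats every polynomial in \<open>n\<close> and \<open>d\<close>
  that occurs as the size of a union bound.\<close>

lemma scale_ge_6:
 assumes "2 <= n * d" "h = 10 * ln (real n * real d)"
 shows "6 <= h" "1 <= n" "1 <= d" "real n <= exp h" "real d <= exp h" "(real n * real d) ^ 60 * exp (- h\<^sup>2) <= 1" "exp h = (real n * real d) ^ 10"
proof -
 let ?x = "real n * real d"
 have x: "2 <= ?x" using assms(1) by (metis of_nat_le_iff of_nat_mult of_nat_numeral)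
 have nz: "n ~= 0" "d ~= 0" using assms(1) by (cases n; cases d; simp)+
 thus n: "1 <= n" "1 <= d" by auto
 have "ln 2 <= ln ?x" using x by simp
 hence l: "2 / 3 <= ln ?x" using ln2_ge_two_thirds by linarith
 thus h6: "6 <= h" using assms(2) by simp
 have ex: "exp (real k * ln ?x) = ?x ^ k" for k using x by (simp add: exp_of_nat_mult)
 show eh: "exp h = ?x ^ 10" using ex[of 10] assms(2) by simp
 have "?x ^ 1 <= ?x ^ 10" using x by (intro power_increasing) auto
 hence "?x <= exp h" unfolding eh by (simp only: power_one_right)
 moreover have "real n <= ?x" "real d <= ?x" using n by (auto simp: mult_le_cancel_left1 mult_le_cancel_right1)
 ultimately show "real n <= exp h" "real d <= exp h" by (blast intro: order_trans)+
 have "60 * ln ?x <= h\<^sup>2"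
 proof -
  have "60 * ln ?x <= 100 * (ln ?x * ln ?x)" using mult_right_mono[OF l, of "ln ?x"] l by linarith
  thus ?thesis using assms(2) by (simp add: power2_eq_square)
 qed
 hence "exp (60 * ln ?x) <= exp (h\<^sup>2)" by simp
 moreover have "exp (60 * ln ?x) = ?x ^ 60" using ex[of 60] by simp
 ultimately have "?x ^ 60 <= exp (h\<^sup>2)" by (simp only:)
 hence "?x ^ 60 * exp (- h\<^sup>2) <= exp (h\<^sup>2) * exp (- h\<^sup>2)" by (rule mult_right_mono) simp
 thus "?x ^ 60 * exp (- h\<^sup>2) <= 1" by (simp add: exp_add[symmetric])
qed

text \<open>Constants are absorbed by powers of \<open>h\<close>, each of which is worth a factor 6.
  The exponents in the estimates that follow are chosen with this in mind.\<close>

lemma pow_step: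
 fixes h s :: real
 assumes "6 <= h" "0 <= s"
 shows "6 * (h ^ k * s) <= h ^ Suc k * s" "0 <= h ^ k * s"
proof -
 show "0 <= h ^ k * s" using assms by simp
 hence "6 * (h ^ k * s) <= h * (h ^ k * s)" using assms by (intro mult_right_mono) auto
 thus "6 * (h ^ k * s) <= h ^ Suc k * s" by (simp add: mult_ac)
qed

lemma regular_noise_norm:
 assumes h: "6 <= h" and d: "1 <= d" and reg: "regular d N m I y (2 * h) g" and i: "i < N"
 shows "norm2 d (centered m g i) <= h\<^sup>2 * sqrt d"
proof -
 let ?s = "sqrt (real d)"
 have s: "1 <= ?s" "?s * ?s = d" using d by auto
 have "\<bar>dot d (centered m g i) (centered m g i) - d\<bar> <= (2 * h)\<^sup>2 * ?s"
  using reg i by (simp add: regular_def regular_at_def)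
 hence "dot d (centered m g i) (centered m g i) <= d + (2 * h)\<^sup>2 * ?s" by linarith
 also have "... <= d + 4 * h\<^sup>2 * d" using s(2) mult_right_mono[OF s(1), of ?s] h by (simp add: power_mult_distrib mult_left_mono)
 also have "... <= h ^ 4 * d"
  using pow_step[OF h, of "real d" 0] pow_step[OF h, of "real d" 1] pow_step[OF h, of "real d" 2] pow_step[OF h, of "real d" 3] by (simp add: eval_nat_numeral mult.assoc)
 also have "... = (h\<^sup>2 * ?s)\<^sup>2" using s by (simp add: power_mult_distrib power2_eq_square eval_nat_numeral)
 finally show ?thesis unfolding norm2_eq_sqrt using h by (intro real_le_lsqrt) auto
qed

text \<open>The squared norm of a genuine point is that of its noise plus that of the mean, up to a
  cross term. So a single genuine point of ordinary norm certifies a small mean.\<close>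

lemma regular_mean_le:
 assumes h: "6 <= h" and d: "1 <= d" and reg: "regular d N (%_. mu) I y (2 * h) g" and i: "i < N"
  and le: "dot d (g i) (g i) <= d + h ^ 4 * sqrt d"
 shows "dot d mu mu <= h ^ 5 * sqrt d"
proof -
 let ?s = "sqrt (real d)" and ?u = "centered (%_. mu) g i"
 have s: "1 <= ?s" using d by auto
 have u: "\<bar>dot d ?u mu\<bar> <= 2 * h * norm2 d mu" "\<bar>dot d ?u ?u - d\<bar> <= (2 * h)\<^sup>2 * ?s"
  using reg i by (auto simp: regular_def regular_at_def)
 have ex: "dot d (g i) (g i) = dot d ?u ?u + 2 * dot d ?u mu + dot d mu mu"
  by (subst dot_centered[of d g i _ "%_. mu"], subst (1 2) dot_commute, subst (1 2) dot_centered[of d g i _ "%_. mu"]) (simp add: dot_commute)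
 have am: "4 * h * norm2 d mu <= dot d mu mu / 2 + 8 * h\<^sup>2"
  using zero_le_power2[of "norm2 d mu - 4 * h"] by (simp add: norm2_power2[symmetric] power2_eq_square algebra_simps)
 have "8 * h\<^sup>2 <= 8 * h\<^sup>2 * ?s" using mult_left_mono[OF s, of "8 * h\<^sup>2"] by simp
 thus ?thesis using u ex am le pow_step[OF h, of ?s 2] pow_step[OF h, of ?s 3] pow_step[OF h, of ?s 4] s
  by (simp add: power_mult_distrib eval_nat_numeral abs_le_iff algebra_simps)
qed

text \<open>The third claim is the crucial one: a corrupted point of ordinary norm has nearly the
  same inner product with all genuine points, namely that with the mean. So its fate can be
  predicted without looking at genuine points.\<close>

lemma regular_good:
 assumes h: "6 <= h" and d: "1 <= d" and reg: "regular d N (%_. mu) I y (2 * h) g" and i: "i < N"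
  and mu: "dot d mu mu <= h ^ 5 * sqrt d"
 shows "\<bar>dot d (g i) (g i) - d\<bar> <= h ^ 6 * sqrt d"
  and "k < N ==> k ~= i ==> \<bar>dot d (g i) (g k)\<bar> <= h ^ 6 * sqrt d"
  and "k \<in> I ==> \<bar>dot d (y k) (y k) - d\<bar> <= h ^ 6 * sqrt d ==> \<bar>dot d (y k) (g i) - dot d (y k) mu\<bar> <= h ^ 5 * sqrt d"
proof -
 let ?s = "sqrt (real d)" and ?u = "centered (%_. mu) g"
 have s: "1 <= ?s" "?s * ?s = d" using d by auto
 have u: "\<bar>dot d (?u i) mu\<bar> <= 2 * h * norm2 d mu" "\<bar>dot d (?u i) (?u i) - d\<bar> <= (2 * h)\<^sup>2 * ?s" if "i < N" for i
  using reg that by (auto simp: regular_def regular_at_def)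
 have ex: "dot d (g i) (g k) = dot d (?u i) (?u k) + dot d (?u i) mu + dot d (?u k) mu + dot d mu mu" for i k
  by (subst dot_centered[of d g i _ "%_. mu"], subst (1 2) dot_commute, subst (1 2) dot_centered[of d g k _ "%_. mu"]) (simp add: dot_commute)
 have am: "4 * h * norm2 d mu <= dot d mu mu + 4 * h\<^sup>2"
  using zero_le_power2[of "norm2 d mu - 2 * h"] by (simp add: norm2_power2[symmetric] power2_eq_square algebra_simps)
 have h2: "4 * h\<^sup>2 <= 4 * h\<^sup>2 * ?s" using mult_left_mono[OF s(1), of "4 * h\<^sup>2"] by simp
 note ps = pow_step[OF h, of ?s 2] pow_step[OF h, of ?s 3] pow_step[OF h, of ?s 4] pow_step[OF h, of ?s 5]
 have mu0: "0 <= dot d mu mu" by (rule dot_self_nonneg)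
 show "\<bar>dot d (g i) (g i) - d\<bar> <= h ^ 6 * sqrt d"
  using u[OF i] ex[of i i] am h2 ps s mu mu0 by (simp add: power_mult_distrib eval_nat_numeral abs_le_iff algebra_simps)
 show "\<bar>dot d (g i) (g k)\<bar> <= h ^ 6 * sqrt d" if k: "k < N" "k ~= i"
 proof -
  have "\<bar>dot d (?u i) (?u k)\<bar> <= 2 * h * norm2 d (?u k)" using reg i k by (auto simp: regular_def regular_at_def)
  also have "... <= 2 * h * (h\<^sup>2 * ?s)" using regular_noise_norm[OF h d reg k(1)] h by (intro mult_left_mono) auto
  finally have "\<bar>dot d (?u i) (?u k)\<bar> <= 2 * h * (h\<^sup>2 * ?s)" .
  thus ?thesis
   using u(1)[OF i] u(1)[OF k(1)] ex[of i k] am h2 ps s mu mu0 by (simp add: power_mult_distrib eval_nat_numeral abs_le_iff algebra_simps)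
 qed
 show "\<bar>dot d (y k) (g i) - dot d (y k) mu\<bar> <= h ^ 5 * sqrt d" if k: "k \<in> I" "\<bar>dot d (y k) (y k) - d\<bar> <= h ^ 6 * sqrt d"
 proof -
  have "dot d (y k) (y k) <= d + h ^ 6 * ?s" using k(2) by linarith
  also have "... <= 1 * d + h ^ 6 * d" using mult_right_mono[OF s(1), of ?s] s(2) h by simp
  also have "... <= (2 * h ^ 3)\<^sup>2 * d"
  proof -
   have "(1::real) <= h ^ 6" using h by (intro one_le_power) auto
   hence "1 + h ^ 6 <= (2 * h ^ 3)\<^sup>2" by (simp add: power_mult_distrib power_mult[symmetric])
   thus ?thesis using mult_right_mono[of "1 + h ^ 6" "(2 * h ^ 3)\<^sup>2" "real d"] by (simp add: distrib_right)
  qed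
  also have "... = (2 * h ^ 3 * ?s)\<^sup>2" using s by (simp add: power_mult_distrib)
  finally have ny: "norm2 d (y k) <= 2 * h ^ 3 * ?s" unfolding norm2_eq_sqrt using h by (intro real_le_lsqrt) auto
  have "\<bar>dot d (?u i) (y k)\<bar> <= 2 * h * norm2 d (y k)" using reg i k by (auto simp: regular_def regular_at_def)
  also have "... <= 2 * h * (2 * h ^ 3 * ?s)" using ny h by (intro mult_left_mono) auto
  finally have "\<bar>dot d (?u i) (y k)\<bar> <= h ^ 5 * sqrt d" using ps by (simp add: eval_nat_numeral)
  moreover have "dot d (y k) (g i) - dot d (y k) mu = dot d (?u i) (y k)"
   using dot_centered[of d g i "y k" "%_. mu"] by (simp add: dot_commute)
  ultimately show ?thesis by simp
 qed
qed

lemma regular_null_norm: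
 assumes h: "6 <= h" and reg: "regular d N (%_ _. 0) I y (2 * h) g" and i: "i < N"
 shows "dot d (g i) (g i) <= d + h ^ 4 * sqrt d"
proof -
 have "centered (%_ _. 0) g i = g i" by (simp add: centered_def)
 hence "\<bar>dot d (g i) (g i) - d\<bar> <= (2 * h)\<^sup>2 * sqrt d" using reg i by (auto simp: regular_def regular_at_def)
 thus ?thesis using pow_step[OF h, of "sqrt d" 2] pow_step[OF h, of "sqrt d" 3]
  by (simp add: power_mult_distrib eval_nat_numeral abs_le_iff algebra_simps)
qed

definition heavy :: "nat => nat => real => (nat => nat => real) => nat set" where
 "heavy d N h X = {i\<in>{..<N}. real d + h ^ 4 * sqrt d < dot d (X i) (X i)}"

text \<open>There are more than \<open>m\<close> genuine points, so not all of them can be heavy,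
  and one that is not certifies a small mean.\<close>

lemma not_heavy_mean_le:
 assumes h: "6 <= h" and d: "1 <= d" and reg: "regular d N (%_. mu) I y (2 * h) g" and I: "I <= {..<N}" "card I <= m" "2 * m < N"
  and nh: "card (heavy d N h (mix I y g)) <= m"
 shows "dot d mu mu <= h ^ 5 * sqrt d"
proof -
 have "~ {..<N} - I <= heavy d N h (mix I y g)"
 proof
  assume "{..<N} - I <= heavy d N h (mix I y g)"
  hence "card ({..<N} - I) <= card (heavy d N h (mix I y g))" by (intro card_mono) (auto simp: heavy_def)
  moreover have "card ({..<N} - I) = N - card I" using I(1) by (subst card_Diff_subset) (auto intro: finite_subset)
  ultimately show False using nh I by linarith
 qed
 then obtain i where "i < N" "i \<notin> I" "i \<notin> heavy d N h (mix I y g)" by auto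
 thus ?thesis by (intro regular_mean_le[OF h d reg, of i]) (auto simp: heavy_def mix_def)
qed

lemma null_not_heavy:
 assumes h: "6 <= h" and reg: "regular d N (%_ _. 0) I y (2 * h) g" and I: "I <= {..<N}" "card I <= m"
 shows "card (heavy d N h (mix I y g)) <= m"
proof -
 have "i \<in> I" if "i \<in> heavy d N h (mix I y g)" for i
 proof (rule ccontr)
  assume "i \<notin> I"
  hence "real d + h ^ 4 * sqrt d < dot d (g i) (g i)" "i < N" using that by (auto simp: heavy_def mix_def)
  thus False using regular_null_norm[OF h reg, of i] by linarith
 qed
 hence "heavy d N h (mix I y g) <= I" by blast
 thus ?thesis using card_mono[of I "heavy d N h (mix I y g)"] I finite_subset[OF I(1)] by auto
qed

lemma measurable_dot_data: "i < N ==> j < N ==> (%X. dot d (X i) (X j)) \<in> borel_measurable (data_space d N)"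
 by (intro measurable_dot measurable_data) auto

lemma measurable_heavy: "heavy d N h \<in> measurable (data_space d N) (count_space (Pow {..<N}))"
proof -
 have "Measurable.pred (data_space d N) (%X. real d + h ^ 4 * sqrt d < dot d (X i) (X i))" if "i \<in> {..<N}" for i
  unfolding pred_def by (rule borel_measurable_less) (use measurable_dot_data[of i N i d] that in auto)
 from measurable_Collect_finite[of "{..<N}", OF _ this] show ?thesis unfolding heavy_def by simp
qed

lemma correlation_le_pairwise:
 assumes "\<And>i j. i \<in> Z ==> j \<in> Z ==> i ~= j ==> \<bar>G i j\<bar> <= B" and B: "0 <= B" "0 <= M" "M * B <= \<Lambda>"
 shows "correlation_le G M Z \<Lambda>"
 unfolding correlation_le_def
proof (intro allI impI)
 fix S T assume a: "S <= Z & T <= Z & S Int T = {} & rcard S <= M & rcard T <= M"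
 have "\<bar>pair_sum G S T\<bar> <= (\<Sum>i\<in>S. \<Sum>j\<in>T. \<bar>G i j\<bar>)"
  unfolding pair_sum_def by (rule order_trans[OF sum_abs]) (intro sum_mono sum_abs)
 also have "... <= (\<Sum>i\<in>S. \<Sum>j\<in>T. B)" using a by (intro sum_mono assms(1)) auto
 also have "... = sqrt (card S * card T) * sqrt (card S * card T) * B" by simp
 also have "... <= sqrt (card S * card T) * M * B"
 proof -
  have "rcard S * rcard T <= M * M" by (rule mult_mono) (use a B in auto)
  hence "sqrt (card S * card T) <= sqrt (M * M)" by (simp only: real_sqrt_le_iff of_nat_mult)
  hence "sqrt (card S * card T) <= M" using B by simp
  thus ?thesis using B by (intro mult_right_mono mult_left_mono) auto
 qed
 also have "... = (M * B) * sqrt (card S * card T)" by simp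
 also have "... <= \<Lambda> * sqrt (card S * card T)" using B by (intro mult_right_mono) auto
 finally show "\<bar>pair_sum G S T\<bar> <= \<Lambda> * sqrt (rcard S * rcard T)" by simp
qed

section \<open>Few corrupted points\<close>

definition norm_ok :: "nat => real => (nat => nat => real) => nat => bool" where
 "norm_ok d h X i \<longleftrightarrow> \<bar>dot d (X i) (X i) - d\<bar> <= h ^ 6 * sqrt d"

definition conflict :: "nat => real => (nat => nat => real) => nat => nat => bool" where
 "conflict d c X i j \<longleftrightarrow> c * sqrt d < \<bar>dot d (X i) (X j)\<bar>"

lemma measurable_norm_ok: "i < N ==> Measurable.pred (data_space d N) (%X. norm_ok d h X i)"
 unfolding norm_ok_def pred_def by (rule borel_measurable_le) (use measurable_dot_data[of i N i d] in auto)

lemma measurable_conflict: "i < N ==> j < N ==> Measurable.pred (data_space d N) (%X. conflict d c X i j)"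
 unfolding conflict_def pred_def by (rule borel_measurable_less) (use measurable_dot_data[of i N j d] in auto)

lemma conflict_commute: "conflict d c X i j = conflict d c X j i"
 by (simp add: conflict_def dot_commute)

text \<open>On typical data a genuine point conflicts with corrupted points only, hence with at most
  \<open>f\<close> points. A corrupted point that conflicts with all genuine ones is thrown out
  here.\<close>

definition few_conflicts :: "nat => nat => real => nat => real => (nat => nat => real) => nat set" where
 "few_conflicts d N h f c X = {i\<in>{..<N}. norm_ok d h X i & card {j\<in>{..<N} - {i}. conflict d c X i j} <= f}"

text \<open>On typical data the conflicts left after the first pass are among corrupted points only;
  both ends are removed, so no genuine point is lost.\<close>

definition conflict_free :: "nat => nat => real => nat => real => (nat => nat => real) => nat set" where
 "conflict_free d N h f c X = {i\<in>{..<N}. i \<in> few_conflicts d N h f c X & (\<forall>j\<in>{..<N}. j \<in> few_conflicts d N h f c X --> j ~= i --> ~ conflict d c X i j)}"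

lemma measurable_conflict_free: "conflict_free d N h f c \<in> measurable (data_space d N) (count_space (Pow {..<N}))"
proof -
 have 1: "Measurable.pred (data_space d N) (%X. card {j\<in>{..<N} - {i}. conflict d c X i j} <= f)" if "i \<in> {..<N}" for i
  by (rule measurable_of_finite_info[where \<Phi>="%S. card S <= f", OF measurable_Collect_finite]) (use that measurable_conflict in auto)
 have "few_conflicts d N h f c \<in> measurable (data_space d N) (count_space (Pow {..<N}))"
  unfolding few_conflicts_def[abs_def]
  by (intro measurable_Collect_finite pred_intros_logic 1) (use measurable_norm_ok in auto)
 hence 2: "Measurable.pred (data_space d N) (%X. i \<in> few_conflicts d N h f c X)" for i
  by (rule measurable_of_finite_info)
 show ?thesis unfolding conflict_free_def[abs_def]
  by (intro measurable_Collect_finite pred_intros_logic pred_intros_finite 2) (use measurable_conflict in auto)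
qed

text \<open>With few corrupted points the correlations are controlled pairwise. Whether an adversarial point conflicts with the
  genuine ones depends only on its inner product with the mean, unless that inner product is close to the threshold; the
  threshold is therefore drawn at random.\<close>

lemma solves_few_corrupt:
 assumes nd: "2 <= n * d" and hdef: "h = 10 * ln (real n * real d)" and eps: "0 < eps" "eps < 1"
  and small: "eps * real n <= h ^ 20" and half: "2 * num_corrupt eps n < n"
  and sol: "solves_friendly d \<alpha> eps (h ^ 2000) n p A" and p1: "p <= 1"
 shows "\<exists>B. solves_oblivious d \<alpha> (eps / 2) (2 * n) (p - 0.01) B"
proof -
 define N f where "N = 2 * n" and "f = num_corrupt eps n"
 have sc: "6 <= h" "1 <= n" "1 <= d" "(real n * real d) ^ 60 * exp (- h\<^sup>2) <= 1" using scale_ge_6[OF nd hdef] by auto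
 have s1: "1 <= sqrt (real d)" using sc by auto
 have fN: "num_corrupt (eps / 2) N = f" by (simp add: num_corrupt_def N_def f_def)
 have fle: "real f <= h ^ 20" using small eps sc unfolding f_def num_corrupt_def by (simp add: of_nat_nat) linarith
 \<comment> \<open>Each of the at most \<open>h ^ 20\<close> corrupted points spoils at most one
   threshold, so among 1000 times as many a spoilt one is drawn with probability at most
   1/1000.\<close>
 define Lv where "Lv = nat \<lceil>1000 * h ^ 20\<rceil>"
 have h20: "1 <= h ^ 20" using sc by (intro one_le_power) auto
 have Lv: "1000 * h ^ 20 <= real Lv" "real Lv <= 1000 * h ^ 20 + 1" using h20 unfolding Lv_def by linarith+
 hence Lv0: "0 < real Lv" using h20 by linarith
 \<comment> \<open>The spacing \<open>h ^ 6 * sqrt d\<close> exceeds the width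
   \<open>2 * h ^ 5 * sqrt d\<close> of the window in which the inner product with the mean does not
   decide a conflict.\<close>
 define thr where "thr l = h ^ 6 * (1 + real l)" for l :: nat
 define coin where "coin = pmf_of_set {1..Lv}"
 have set_coin: "set_pmf coin = {1..Lv}" unfolding coin_def using Lv0 by (intro set_pmf_of_set) auto
 define alarm where "alarm = (%(l::nat) X. f < card (heavy d N h X))"
 define kept where "kept = (%l. conflict_free d N h f (thr l))"
 have malarm: "Measurable.pred (data_space d N) (alarm l)" for l
  unfolding alarm_def by (rule measurable_of_finite_info[where \<Phi>="%S. f < card S", OF measurable_heavy])
 have mkept: "kept l \<in> measurable (data_space d N) (count_space (Pow {..<N}))" for l
  unfolding kept_def by (rule measurable_conflict_free)
 have A: "A \<in> algorithms d n" using sol by (simp add: solves_friendly_def solves_mean_testing_def)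
 have fincoin: "finite (set_pmf coin)" by (simp add: set_coin)
 have "solves_oblivious d \<alpha> (eps / 2) N (p - 0.01) (%X. bind_pmf coin (%w. screen n A alarm kept w X))"
 proof (rule solves_obliviousI)
  show "(%X. bind_pmf coin (%w. screen n A alarm kept w X)) \<in> algorithms d N"
   by (rule screening_algorithm[OF A fincoin malarm mkept])
  show "eps / 2 <= 1" using eps by simp
  fix mu hyp I y assume adm: "admissible d \<alpha> mu hyp" and I: "I <= {..<N}" "card I = num_corrupt (eps / 2) N" and y: "y \<in> space (data_space d N)"
  have cI: "card I = f" and fI: "finite I" using I fN finite_subset by auto
  define goods where "goods = {..<N} - I"
  have cgoods: "card goods = N - f" unfolding goods_def using I fI cI by (subst card_Diff_subset) auto
  hence cg: "n <= card goods" "f < card goods" using half by (auto simp: N_def f_def)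
  have fg: "finite goods" by (simp add: goods_def)
  define big where "big l i \<longleftrightarrow> thr l * sqrt d < \<bar>dot d (y i) mu\<bar>" for l i
  define ok where "ok l = {i\<in>I. norm_ok d h y i & ~ big l i}" for l
  \<comment> \<open>The selection that results on typical data, described without reference to the
    genuine samples.\<close>
  define K0 where "K0 l = goods Un {i\<in>ok l. \<forall>j\<in>ok l. j ~= i --> ~ conflict d (thr l) y i j}" for l
  define lab where "lab l \<longleftrightarrow> (\<exists>i\<in>I. \<bar>\<bar>dot d (y i) mu\<bar> - thr l * sqrt d\<bar> <= h ^ 5 * sqrt d)" for l
  define NX where "NX = {g\<in>space (gaussian_data d N (%_. mu)). ~ regular d N (%_. mu) I y (2 * h) g}"
  have K0N: "K0 l \<in> Pow {..<N}" for l using I by (auto simp: K0_def goods_def ok_def)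
  have labp: "pprob coin {l. lab l} <= 0.001"
  proof -
   define near where "near i = {l\<in>{1..Lv}. \<bar>\<bar>dot d (y i) mu\<bar> - thr l * sqrt d\<bar> <= h ^ 5 * sqrt d}" for i
   have c1: "card (near i) <= 1" for i
   proof -
    have "l <= l'" if "l \<in> near i" "l' \<in> near i" for l l'
    proof (rule ccontr)
     assume "~ l <= l'"
     hence "real l' + 1 <= real l" by linarith
     hence "h ^ 6 * (1 + (real l' + 1)) <= h ^ 6 * (1 + real l)" using sc by (intro mult_left_mono) auto
     hence "thr l' + h ^ 6 <= thr l" by (simp add: thr_def algebra_simps)
     hence "(thr l' + h ^ 6) * sqrt d <= thr l * sqrt d" using s1 by (intro mult_right_mono) auto
     hence a: "thr l' * sqrt d + h ^ 6 * sqrt d <= thr l * sqrt d" by (simp add: distrib_right)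
     have b: "6 * (h ^ 5 * sqrt d) <= h ^ 6 * sqrt d" "0 < h ^ 5 * sqrt d"
      using pow_step[OF sc(1), of "sqrt d" 5] s1 sc by (auto simp: eval_nat_numeral)
     show False using that a b unfolding near_def by (simp add: abs_le_iff)
    qed
    hence "\<forall>l\<in>near i. \<forall>l'\<in>near i. l = l'" by (simp add: eq_iff)
    thus ?thesis by (simp add: card_le_Suc0_iff_eq near_def)
   qed
   have "pprob coin {l. lab l} = card ({1..Lv} Int {l. lab l}) / Lv"
    unfolding coin_def using Lv0 by (subst measure_pmf_of_set) auto
   also have "{1..Lv} Int {l. lab l} = (\<Union>i\<in>I. near i)" by (auto simp: lab_def near_def)
   also have "rcard (\<Union>i\<in>I. near i) / Lv <= real f / Lv"
   proof -
    have "card (\<Union>i\<in>I. near i) <= (\<Sum>i\<in>I. card (near i))" by (rule card_UN_le[OF fI])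
    also have "... <= (\<Sum>i\<in>I. 1)" by (intro sum_mono c1)
    finally have "card (\<Union>i\<in>I. near i) <= f" using cI by simp
    thus ?thesis using Lv0 by (intro divide_right_mono) auto
   qed
   also have "... <= 0.001" using fle Lv(1) Lv0 by (simp add: divide_le_eq)
   finally show ?thesis .
  qed
  have N1: "1 <= N" using sc by (simp add: N_def)
  have NXp: "measure (gaussian_data d N (%_. mu)) NX <= 0.001"
  proof -
   have "measure (gaussian_data d N (%_. mu)) NX <= 9 * (real N)\<^sup>2 * exp (- ((2 * h)\<^sup>2 / 4))"
    unfolding NX_def by (rule prob_not_regular(2)[OF I(1) N1]) (use sc in auto)
   also have "... = 36 * (real n)\<^sup>2 * exp (- h\<^sup>2)" by (simp add: N_def power_mult_distrib)
   also have "... <= 0.001"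
   proof -
    let ?x = "real n * real d"
    have x: "2 <= ?x" using nd by (metis of_nat_le_iff of_nat_mult of_nat_numeral)
    have nx: "real n <= ?x" using sc by (auto simp: mult_le_cancel_left1)
    have "(2::real) ^ 58 <= ?x ^ 58" using x by (intro power_mono) auto
    hence "36000 * (real n)\<^sup>2 <= ?x ^ 58 * ?x\<^sup>2" using nx by (intro mult_mono power_mono) auto
    also have "... = ?x ^ 60" by (simp add: power_add[symmetric])
    finally have "36000 * (real n)\<^sup>2 * exp (- h\<^sup>2) <= ?x ^ 60 * exp (- h\<^sup>2)" by (intro mult_right_mono) auto
    hence "36000 * (real n)\<^sup>2 * exp (- h\<^sup>2) <= 1" using sc(4) by linarith
    thus ?thesis by simp
   qed
   finally show ?thesis .
  qed
  have two: "2 * f < N" using half by (simp add: N_def f_def)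
  show "ennreal (p - 0.01) <= (\<integral>\<^sup>+g. ennreal (pmf (bind_pmf coin (%w. screen n A alarm kept w (mix I y g))) hyp) \<partial>gaussian_data d N (%_. mu))"
  proof (rule screening_ge[OF sol _ adm I(1) y fincoin malarm mkept, where Good=UNIV and J="%_. goods" and K="%l _. K0 l" and NX=NX and ?\<delta>3.0="0.001"
     and fresh="%_. {}" and ?\<delta>4.0=0 and lab="%l _. lab l" and ?\<delta>2.0="0.001" and ?\<delta>1.0=0])
   show "eps <= 1" using eps by simp
   show "goods <= {..<N} - I" by (simp add: goods_def)
   show "(%_. K0 l) \<in> measurable (data_space d N) (count_space (Pow {..<N}))" for l
    using K0N by (intro measurable_const) simp
   show "n <= card (K0 l) & K0 l <= goods Un I & card (K0 l Int I) <= num_corrupt eps n" for l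
   proof (intro conjI)
    have "finite (K0 l)" using K0N[of l] finite_subset by auto
    hence "card goods <= card (K0 l)" by (intro card_mono) (auto simp: K0_def)
    thus "n <= card (K0 l)" using cg by linarith
    show "K0 l <= goods Un I" by (auto simp: K0_def ok_def)
    have "card (K0 l Int I) <= card I" by (intro card_mono fI) auto
    thus "card (K0 l Int I) <= num_corrupt eps n" using cI f_def by simp
   qed
   show "NX \<in> sets (gaussian_data d N (%_. mu))" unfolding NX_def by (rule prob_not_regular(1)[OF I(1) N1]) (use sc in auto)
   show "measure (gaussian_data d N (%_. mu)) NX <= 0.001" by (rule NXp)
   show "pprob coin {l. lab l} <= 0.001" by (rule labp)
   show "0 + 0.001 + 0.001 + 0 <= (0.01::real)" by simp
   fix l g assume l: "l \<in> set_pmf coin" and g: "g \<in> space (data_space d N)" "g \<notin> NX" and nl: "~ lab l"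
   let ?X = "mix I y g" and ?s = "sqrt (real d)"
   have reg: "regular d N (%_. mu) I y (2 * h) g" using g by (simp add: NX_def space_gaussian_data)
   have Xg: "?X i = g i" if "i \<in> goods" for i using that by (simp add: goods_def mix_def)
   have Xb: "?X i = y i" if "i \<in> I" for i using that by (simp add: mix_def)
   have l1: "1 <= l" "l <= Lv" using l set_coin by auto
   have thr: "h ^ 6 <= thr l" "thr l <= h ^ 31"
   proof -
    have h6: "0 <= h ^ 6" using sc by simp
    hence "h ^ 6 * 1 <= h ^ 6 * (1 + real l)" by (intro mult_left_mono) auto
    thus "h ^ 6 <= thr l" by (simp add: thr_def)
    have "1 + real l <= 1296 * h ^ 20" using l1 Lv(2) h20 by linarith
    also have "... <= h ^ 4 * h ^ 20"
    proof -
     have "(6::real) ^ 4 <= h ^ 4" using sc by (intro power_mono) auto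
     thus ?thesis using h20 by (intro mult_right_mono) auto
    qed
    also have "... = h ^ 24" by (simp add: power_add[symmetric])
    finally have "h ^ 6 * (1 + real l) <= h ^ 6 * h ^ 24" using h6 by (intro mult_left_mono) auto
    also have "... = h ^ 30" by (simp add: power_add[symmetric])
    also have "... <= h ^ 31" using sc by (intro power_increasing) auto
    finally show "thr l <= h ^ 31" by (simp add: thr_def)
   qed
   show "alarm l ?X & hyp = Alternative \<or> ~ alarm l ?X & kept l ?X = K0 l & friendly_set d (eps * real n) (h ^ 2000) ?X (K0 l)"
   proof (cases "alarm l ?X")
    case True
    have "hyp ~= Null"
    proof
     assume "hyp = Null"
     hence "mu = (%_. 0)" using adm by (simp add: admissible_def)
     hence "card (heavy d N h ?X) <= f" using null_not_heavy[OF sc(1), of d N I y g f] reg I(1) cI by simp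
     thus False using True by (simp add: alarm_def)
    qed
    thus ?thesis using True by (cases hyp) auto
   next
    case False
    have mu: "dot d mu mu <= h ^ 5 * ?s"
     by (rule not_heavy_mean_le[OF sc(1,3) reg I(1) _ two]) (use False cI in \<open>auto simp: alarm_def\<close>)
    have gN: "i < N" if "i \<in> goods" for i using that by (simp add: goods_def)
    have gnorm: "norm_ok d h ?X i" if "i \<in> goods" for i
     using regular_good(1)[OF sc(1,3) reg gN[OF that] mu] Xg[OF that] by (simp add: norm_ok_def)
    have thr_s: "h ^ 6 * ?s <= thr l * ?s" using thr s1 by (intro mult_right_mono) auto
    have gg: "~ conflict d (thr l) ?X i j" if "i \<in> goods" "j \<in> goods" "j ~= i" for i j
     using regular_good(2)[OF sc(1,3) reg gN[OF that(1)] mu gN[OF that(2)] that(3)] Xg[OF that(1)] Xg[OF that(2)] thr_s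
     by (simp add: conflict_def)
    have bg: "conflict d (thr l) ?X i j \<longleftrightarrow> big l i" if i: "i \<in> I" "norm_ok d h ?X i" and j: "j \<in> goods" for i j
    proof -
     have "\<bar>dot d (y i) (g j) - dot d (y i) mu\<bar> <= h ^ 5 * ?s"
      using regular_good(3)[OF sc(1,3) reg gN[OF j] mu i(1)] i(2) Xb[OF i(1)] by (simp add: norm_ok_def)
     moreover have "~ \<bar>\<bar>dot d (y i) mu\<bar> - thr l * ?s\<bar> <= h ^ 5 * ?s" using nl i(1) by (auto simp: lab_def)
     ultimately have "thr l * ?s < \<bar>dot d (y i) (g j)\<bar> \<longleftrightarrow> thr l * ?s < \<bar>dot d (y i) mu\<bar>" by linarith
     thus ?thesis by (simp add: conflict_def big_def Xb[OF i(1)] Xg[OF j])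
    qed
    have IN: "i < N" if "i \<in> I" for i using that I(1) by auto
    have few: "few_conflicts d N h f (thr l) ?X = goods Un ok l"
    proof (rule set_eqI)
     fix i
     consider "i \<in> goods" | "i \<in> I" | "~ i < N" by (auto simp: goods_def)
     thus "i \<in> few_conflicts d N h f (thr l) ?X \<longleftrightarrow> i \<in> goods Un ok l"
     proof cases
      case 1
      have "{j\<in>{..<N} - {i}. conflict d (thr l) ?X i j} <= I" using gg[OF 1] by (auto simp: goods_def)
      hence "card {j\<in>{..<N} - {i}. conflict d (thr l) ?X i j} <= f" using card_mono[OF fI] cI by auto
      thus ?thesis using 1 gnorm[OF 1] gN[OF 1] by (simp add: few_conflicts_def)
     next
      case 2
      have ig: "i \<notin> goods" using 2 by (simp add: goods_def)
      have no: "norm_ok d h ?X i \<longleftrightarrow> norm_ok d h y i" by (simp add: norm_ok_def Xb[OF 2])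
      show ?thesis
      proof (cases "norm_ok d h ?X i")
       case ni: True
       show ?thesis
       proof (cases "big l i")
        case True
        have "goods <= {j\<in>{..<N} - {i}. conflict d (thr l) ?X i j}" using bg[OF 2 ni] True gN ig by auto
        hence "card goods <= card {j\<in>{..<N} - {i}. conflict d (thr l) ?X i j}" by (intro card_mono) auto
        hence "~ card {j\<in>{..<N} - {i}. conflict d (thr l) ?X i j} <= f" using cg by linarith
        thus ?thesis using True ig by (simp add: few_conflicts_def ok_def)
       next
        case False
        have "{j\<in>{..<N} - {i}. conflict d (thr l) ?X i j} <= I" using bg[OF 2 ni] False by (auto simp: goods_def)
        hence "card {j\<in>{..<N} - {i}. conflict d (thr l) ?X i j} <= f" using card_mono[OF fI] cI by auto
        thus ?thesis using False 2 ni no IN[OF 2] by (simp add: few_conflicts_def ok_def)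
       qed
      qed (use 2 no ig in \<open>simp add: few_conflicts_def ok_def\<close>)
     qed (auto simp: few_conflicts_def goods_def ok_def dest: IN)
    qed
    have okI: "i \<in> I" "norm_ok d h ?X i" "~ big l i" if "i \<in> ok l" for i
     using that by (auto simp: ok_def norm_ok_def Xb)
    have okN: "i < N" if "i \<in> ok l" for i using IN okI(1)[OF that] by blast
    have gb: "~ conflict d (thr l) ?X i j" if "i \<in> ok l" "j \<in> goods" for i j
     using bg[OF okI(1,2)[OF that(1)] that(2)] okI(3)[OF that(1)] by simp
    have cfb: "conflict d (thr l) ?X i j \<longleftrightarrow> conflict d (thr l) y i j" if "i \<in> ok l" "j \<in> ok l" for i j
     using okI(1) that by (simp add: conflict_def Xb)
    have keq: "kept l ?X = K0 l"
    proof (rule set_eqI)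
     fix i
     consider "i \<in> goods" | "i \<in> ok l" "i \<notin> goods" | "i \<notin> goods Un ok l" by auto
     thus "i \<in> kept l ?X \<longleftrightarrow> i \<in> K0 l"
     proof cases
      case 1
      have "~ conflict d (thr l) ?X i j" if "j \<in> goods Un ok l" "j ~= i" for j
       using that gg[OF 1, of j] gb[of j i] 1 conflict_commute[of d "thr l" ?X i j] by auto
      thus ?thesis using 1 gN[OF 1] unfolding kept_def conflict_free_def few by (auto simp: K0_def)
     next
      case 2
      thus ?thesis using okN gN gb[OF 2(1)] cfb[OF 2(1)] unfolding kept_def conflict_free_def few by (auto simp: K0_def)
     next
      case 3
      thus ?thesis unfolding kept_def conflict_free_def few by (auto simp: K0_def)
     qed
    qed
    have "friendly_set d (eps * real n) (h ^ 2000) ?X (K0 l)"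
    proof -
     have KF: "i \<in> goods Un ok l" if "i \<in> K0 l" for i using that by (auto simp: K0_def)
     have K1: "\<bar>dot d (?X i) (?X j)\<bar> <= h ^ 31 * ?s" if "i \<in> K0 l" "j \<in> K0 l" "i ~= j" for i j
     proof -
      have "~ conflict d (thr l) ?X i j"
       using that KF[OF that(1)] KF[OF that(2)] unfolding keq[symmetric] kept_def conflict_free_def few by auto
      hence "\<bar>dot d (?X i) (?X j)\<bar> <= thr l * ?s" by (simp add: conflict_def)
      also have "... <= h ^ 31 * ?s" using thr s1 by (intro mult_right_mono) auto
      finally show ?thesis .
     qed
     have K2: "\<bar>dot d (?X i) (?X i) - d\<bar> <= h ^ 6 * ?s" if "i \<in> K0 l" for i
      using KF[OF that] gnorm[of i] okI(2)[of i] by (auto simp: norm_ok_def)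
     have hp: "h ^ k <= h ^ 2000" if "k <= 2000" for k using sc that by (intro power_increasing) auto
     have hps: "h ^ k * ?s <= h ^ 2000 * ?s" if "k <= 2000" for k using hp[OF that] s1 by (intro mult_right_mono) auto
     let ?M = "eps * real n"
     have M: "0 <= ?M" using eps by simp
     have "correlation_le (gram d ?X) ?M (K0 l) (h ^ 2000 * max (sqrt (?M * real d)) ?M)"
     proof (rule correlation_le_pairwise)
      show "\<bar>gram d ?X i j\<bar> <= h ^ 31 * ?s" if "i \<in> K0 l" "j \<in> K0 l" "i ~= j" for i j using K1[OF that] by (simp add: gram_def)
      show "0 <= h ^ 31 * ?s" using sc by simp
      \<comment> \<open>Here the corruption being small enters: the trivial bound from pairwise
        inner products, of order \<open>M * sqrt d\<close>, exceeds \<open>sqrt (M * d)\<close> by a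
        factor of at most \<open>h ^ 10\<close>.\<close>
      have "sqrt ?M <= h ^ 10" by (rule real_le_lsqrt) (use small sc in \<open>simp_all add: power_mult[symmetric]\<close>)
      hence "sqrt ?M * (sqrt (?M * real d) * h ^ 31) <= h ^ 10 * (sqrt (?M * real d) * h ^ 31)"
       using sc M by (intro mult_right_mono) auto
      moreover have "?M * (h ^ 31 * ?s) = sqrt ?M * (sqrt (?M * real d) * h ^ 31)"
      proof -
       have "?M = sqrt ?M * sqrt ?M" using M by simp
       thus ?thesis by (metis (no_types, lifting) mult.assoc mult.commute real_sqrt_mult)
      qed
      moreover have "h ^ 10 * (sqrt (?M * real d) * h ^ 31) = h ^ 41 * sqrt (?M * real d)" by (simp add: power_add[symmetric])
      moreover have "h ^ 41 * sqrt (?M * real d) <= h ^ 2000 * max (sqrt (?M * real d)) ?M"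
       using hp[of 41] sc M by (intro mult_mono) auto
      ultimately show "?M * (h ^ 31 * ?s) <= h ^ 2000 * max (sqrt (?M * real d)) ?M" by linarith
     qed (rule M)
     moreover have "\<bar>dot d (?X i) (?X j)\<bar> <= h ^ 2000 * ?s" if "i \<in> K0 l" "j \<in> K0 l" "i ~= j" for i j
      by (rule order_trans[OF K1[OF that] hps]) simp
     moreover have "\<bar>dot d (?X i) (?X i) - d\<bar> <= h ^ 2000 * ?s" if "i \<in> K0 l" for i
      by (rule order_trans[OF K2[OF that] hps]) simp
     ultimately show ?thesis unfolding friendly_set_def by blast
    qed
    thus ?thesis using False keq by blast
   qed
  qed (use p1 in auto)
 qed
 thus ?thesis unfolding N_def by blast
qed

section \<open>Correlations of sums of Gaussian points\<close>

lemma nn_integral_exp_point_sum: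
 assumes S: "S <= {..<N}"
 shows "(\<integral>\<^sup>+g. ennreal (exp (dot d (point_sum (centered m g) S) w)) \<partial>gaussian_data d N m) = ennreal (exp (rcard S * dot d w w / 2))"
proof -
 interpret product_sigma_finite "%i. gaussian d (m i)"
  by (intro product_sigma_finite.intro prob_space_imp_sigma_finite prob_space_gaussian)
 define f where "f i x = ennreal (if i \<in> S then exp (dot d (%j. x j - m i j) w) else 1)" for i x
 have fS: "finite S" using S finite_subset by blast
 have eq: "ennreal (exp (dot d (point_sum (centered m g) S) w)) = (\<Prod>i<N. f i (g i))" for g
 proof -
  have "dot d (point_sum (centered m g) S) w = (\<Sum>i\<in>S. dot d (%j. g i j - m i j) w)"
   by (subst dot_commute, subst dot_point_sum_right) (simp add: dot_commute centered_def)
  hence "exp (dot d (point_sum (centered m g) S) w) = (\<Prod>i\<in>S. exp (dot d (%j. g i j - m i j) w))" by (simp add: exp_sum fS)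
  also have "... = (\<Prod>i\<in>{..<N} Int S. exp (dot d (%j. g i j - m i j) w))" using S by (simp add: Int_absorb1)
  also have "... = (\<Prod>i<N. if i \<in> S then exp (dot d (%j. g i j - m i j) w) else 1)" by (rule prod.inter_restrict) simp
  finally show ?thesis unfolding f_def by (simp add: prod_ennreal)
 qed
 have mf: "f i \<in> borel_measurable (gaussian d (m i))" for i
 proof -
  have "(%x. dot d (%j. x j - m i j) w) \<in> borel_measurable (gaussian d (m i))"
   by (intro measurable_dot measurable_gaussian_coord borel_measurable_const)
  thus ?thesis unfolding f_def[abs_def] by (cases "i \<in> S") auto
 qed
 have "(\<integral>\<^sup>+g. ennreal (exp (dot d (point_sum (centered m g) S) w)) \<partial>gaussian_data d N m) = (\<Prod>i<N. integral\<^sup>N (gaussian d (m i)) (f i))"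
  unfolding eq gaussian_data_def by (rule product_nn_integral_prod) (use mf in auto)
 also have "... = (\<Prod>i<N. ennreal (if i \<in> S then exp (dot d w w / 2) else 1))"
 proof (rule prod.cong[OF refl])
  fix i assume "i \<in> {..<N}"
  show "integral\<^sup>N (gaussian d (m i)) (f i) = ennreal (if i \<in> S then exp (dot d w w / 2) else 1)"
   unfolding f_def[abs_def] using gaussian_exp_dot[of d "m i" w] prob_space.emeasure_space_1[OF prob_space_gaussian[of d "m i"]]
   by (cases "i \<in> S") auto
 qed
 also have "... = ennreal (\<Prod>i<N. if i \<in> S then exp (dot d w w / 2) else 1)" by (rule prod_ennreal) auto
 also have "(\<Prod>i<N. if i \<in> S then exp (dot d w w / 2) else 1) = (\<Prod>i\<in>{..<N} Int S. exp (dot d w w / 2))" by (rule prod.inter_restrict[symmetric]) simp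
 also have "... = exp (rcard S * dot d w w / 2)" using S by (simp add: Int_absorb1 exp_of_nat_mult[symmetric])
 finally show ?thesis .
qed

lemma measurable_point_sum: "S <= {..<N} ==> j < d ==> (%g. point_sum (centered m g) S j) \<in> borel_measurable (data_space d N)"
 unfolding point_sum_def by (intro borel_measurable_sum measurable_centered) auto

text \<open>Linearisation by an auxiliary standard Gaussian vector \<open>x\<close>: the exponential
  of \<open>a\<close> times the squared norm of \<open>u\<close> is the expectation of
  \<open>exp (sqrt (2 * a) * dot d u x)\<close>. After exchanging the integrals the data enter
  linearly.\<close>

lemma nn_integral_exp_square_point_sum:
 assumes S: "S <= {..<N}" and a: "0 <= a" "a * rcard S <= 1 / 4"
 shows "(\<integral>\<^sup>+g. ennreal (exp (a * dot d (point_sum (centered m g) S) (point_sum (centered m g) S))) \<partial>gaussian_data d N m)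
  <= ennreal (exp (2 * real d * (a * rcard S)))"
proof -
 let ?E = "gaussian_data d N m" and ?Z = "gaussian d (%_. 0)"
 let ?U = "%g. point_sum (centered m g) S"
 interpret P: pair_sigma_finite ?E ?Z
  by (intro pair_sigma_finite.intro prob_space_imp_sigma_finite prob_space_gaussian_data prob_space_gaussian)
 define r where "r = sqrt (2 * a)"
 have r: "r * r = 2 * a" using a by (simp add: r_def)
 have meas: "(%z. ennreal (exp (r * dot d (?U (fst z)) (snd z)))) \<in> borel_measurable (?E \<Otimes>\<^sub>M ?Z)"
 proof -
  have "(%z. dot d (?U (fst z)) (snd z)) \<in> borel_measurable (?E \<Otimes>\<^sub>M ?Z)"
  proof (rule measurable_dot)
   fix j assume j: "j < d"
   have "(%g. ?U g j) \<in> borel_measurable ?E"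
    using measurable_point_sum[OF S j] by (subst measurable_cong_sets[OF sets_gaussian_data refl])
   thus "(%z. ?U (fst z) j) \<in> borel_measurable (?E \<Otimes>\<^sub>M ?Z)" by (rule measurable_compose[OF measurable_fst])
   have "(%x. x j) \<in> borel_measurable ?Z" using measurable_gaussian_coord[OF j, of 0] by simp
   thus "(%z. snd z j) \<in> borel_measurable (?E \<Otimes>\<^sub>M ?Z)" by (rule measurable_compose[OF measurable_snd])
  qed
  thus ?thesis by simp
 qed
 have "(\<integral>\<^sup>+g. ennreal (exp (a * dot d (?U g) (?U g))) \<partial>?E) = (\<integral>\<^sup>+g. \<integral>\<^sup>+x. ennreal (exp (r * dot d (?U g) x)) \<partial>?Z \<partial>?E)"
 proof (rule nn_integral_cong)
  fix g
  have "(\<integral>\<^sup>+x. ennreal (exp (r * dot d (?U g) x)) \<partial>?Z) = (\<integral>\<^sup>+x. ennreal (exp (dot d (%j. x j - 0) (%j. r * ?U g j))) \<partial>?Z)"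
   by (simp add: dot_scale dot_commute)
  also have "... = ennreal (exp (dot d (%j. r * ?U g j) (%j. r * ?U g j) / 2))" by (rule gaussian_exp_dot)
  also have "dot d (%j. r * ?U g j) (%j. r * ?U g j) / 2 = a * dot d (?U g) (?U g)"
   using r by (simp add: dot_scale mult.assoc[symmetric])
  finally show "ennreal (exp (a * dot d (?U g) (?U g))) = (\<integral>\<^sup>+x. ennreal (exp (r * dot d (?U g) x)) \<partial>?Z)" by simp
 qed
 also have "... = (\<integral>\<^sup>+x. \<integral>\<^sup>+g. ennreal (exp (r * dot d (?U g) x)) \<partial>?E \<partial>?Z)"
  using P.Fubini[OF meas] by simp
 also have "... = (\<integral>\<^sup>+x. ennreal (exp ((a * rcard S) * dot d (%j. x j - 0) (%j. x j - 0))) \<partial>?Z)"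
 proof (rule nn_integral_cong)
  fix x
  have "(\<integral>\<^sup>+g. ennreal (exp (r * dot d (?U g) x)) \<partial>?E) = (\<integral>\<^sup>+g. ennreal (exp (dot d (?U g) (%j. r * x j))) \<partial>?E)"
   by (simp add: dot_scale)
  also have "... = ennreal (exp (rcard S * dot d (%j. r * x j) (%j. r * x j) / 2))" by (rule nn_integral_exp_point_sum[OF S])
  also have "dot d (%j. r * x j) (%j. r * x j) = 2 * a * dot d x x" using r by (simp add: dot_scale mult.assoc[symmetric])
  finally show "(\<integral>\<^sup>+g. ennreal (exp (r * dot d (?U g) x)) \<partial>?E) = ennreal (exp ((a * rcard S) * dot d (%j. x j - 0) (%j. x j - 0)))"
   by (simp add: mult_ac)
 qed
 also have "... <= ennreal (exp (real d * (a * rcard S + 4 * (a * rcard S)\<^sup>2)))"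
  by (rule gaussian_exp_square_le) (use a in auto)
 also have "... <= ennreal (exp (2 * real d * (a * rcard S)))"
 proof -
  let ?b = "a * rcard S"
  have b: "0 <= ?b" using a by simp
  have "?b * (4 * ?b) <= ?b * 1" using a b by (intro mult_left_mono) auto
  hence "?b + 4 * ?b\<^sup>2 <= 2 * ?b" by (simp add: power2_eq_square mult_ac)
  hence "real d * (?b + 4 * ?b\<^sup>2) <= real d * (2 * ?b)" by (rule mult_left_mono) simp
  thus ?thesis by (intro ennreal_leI) (simp add: mult_ac)
 qed
 finally show ?thesis .
qed

text \<open>With the points of \<open>T\<close> frozen, the exponent is linear in the points of
  \<open>S\<close>. Integrating these leaves the exponential of a squared norm.\<close>

lemma nn_integral_exp_bilinear:
 assumes ST: "S <= {..<N}" "T <= {..<N}" "S Int T = {}" and l: "l\<^sup>2 * (rcard S * rcard T) <= 1 / 2"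
 shows "(\<integral>\<^sup>+g. ennreal (exp (l * dot d (point_sum (centered m g) S) (point_sum (centered m g) T))) \<partial>gaussian_data d N m)
  <= ennreal (exp (l\<^sup>2 * (rcard S * rcard T) * real d))"
proof -
 let ?E = "gaussian_data d N m" and ?U = "%g. point_sum (centered m g)"
 let ?F = "%g. ennreal (exp (l * dot d (?U g S) (?U g T)))"
 have "(%g. dot d (?U g S) (?U g T)) \<in> borel_measurable (data_space d N)"
  by (rule measurable_dot) (use measurable_point_sum ST in auto)
 hence mF: "?F \<in> borel_measurable (data_space d N)" by simp
 have "(\<integral>\<^sup>+g. ?F g \<partial>?E) = (\<integral>\<^sup>+g1. \<integral>\<^sup>+g2. ?F (mix T g1 g2) \<partial>?E \<partial>?E)"
  using nn_integral_gaussian_data_mix[OF mF, of T m m] by simp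
 also have "... = (\<integral>\<^sup>+g1. ennreal (exp ((l\<^sup>2 * rcard S / 2) * dot d (?U g1 T) (?U g1 T))) \<partial>?E)"
 proof (rule nn_integral_cong)
  fix g1
  have "?U (mix T g1 g2) S = ?U g2 S" "?U (mix T g1 g2) T = ?U g1 T" for g2
   unfolding point_sum_def centered_def mix_def using ST(3) by (auto intro!: ext sum.cong)
  hence "(\<integral>\<^sup>+g2. ?F (mix T g1 g2) \<partial>?E) = (\<integral>\<^sup>+g2. ennreal (exp (dot d (?U g2 S) (%j. l * ?U g1 T j))) \<partial>?E)"
   by (simp add: dot_scale)
  also have "... = ennreal (exp (rcard S * dot d (%j. l * ?U g1 T j) (%j. l * ?U g1 T j) / 2))"
   by (rule nn_integral_exp_point_sum[OF ST(1)])
  finally show "(\<integral>\<^sup>+g2. ?F (mix T g1 g2) \<partial>?E) = ennreal (exp ((l\<^sup>2 * rcard S / 2) * dot d (?U g1 T) (?U g1 T)))"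
   by (simp add: dot_scale power2_eq_square mult_ac)
 qed
 also have "... <= ennreal (exp (2 * real d * ((l\<^sup>2 * rcard S / 2) * rcard T)))"
 proof (rule nn_integral_exp_square_point_sum[OF ST(2)])
  have "(l\<^sup>2 * rcard S / 2) * rcard T = (l\<^sup>2 * (rcard S * rcard T)) / 2" by simp
  thus "(l\<^sup>2 * rcard S / 2) * rcard T <= 1 / 4" using l by linarith
 qed simp
 finally show ?thesis by (simp add: mult_ac)
qed

lemma sum_exp_card_nonempty_le:
 fixes \<beta> :: real
 assumes "finite P" "rcard P * exp (- \<beta>) <= 1" "0 <= \<beta>"
 shows "(\<Sum>f\<in>Pow P - {{}}. exp (- (2 * \<beta> * rcard f))) <= 3 * exp (- \<beta>)"
proof -
 have "(\<Sum>f\<in>Pow P - {{}}. exp (- (2 * \<beta> * rcard f))) <= (\<Sum>f\<in>Pow P - {{}}. exp (- \<beta>) * exp (- (\<beta> * rcard f)))"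
 proof (rule sum_mono)
  fix f assume "f \<in> Pow P - {{}}"
  hence "1 <= card f" using assms(1) finite_subset[of f P] by (auto simp: Suc_le_eq card_gt_0_iff)
  hence "\<beta> * 1 <= \<beta> * rcard f" using assms(3) by (intro mult_left_mono) auto
  thus "exp (- (2 * \<beta> * rcard f)) <= exp (- \<beta>) * exp (- (\<beta> * rcard f))"
   by (simp add: exp_add[symmetric])
 qed
 also have "... <= (\<Sum>f\<in>Pow P. exp (- \<beta>) * exp (- (\<beta> * rcard f)))"
  using assms(1) by (intro sum_mono2) auto
 also have "... = exp (- \<beta>) * (\<Sum>f\<in>Pow P. exp (- (\<beta> * rcard f)))" by (simp add: sum_distrib_left)
 also have "... <= exp (- \<beta>) * 3" by (intro mult_left_mono sum_exp_card_le assms) auto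
 finally show ?thesis by simp
qed

lemma sum_cartesian_mult:
 fixes c :: real
 shows "(\<Sum>z\<in>P \<times> Q. c * (a (fst z) * b (snd z))) = c * ((\<Sum>x\<in>P. a x) * (\<Sum>y\<in>Q. b y))"
proof -
 have "c * ((\<Sum>x\<in>P. a x) * (\<Sum>y\<in>Q. b y)) = c * (\<Sum>x\<in>P. \<Sum>y\<in>Q. a x * b y)" by (simp only: sum_product)
 also have "... = (\<Sum>x\<in>P. \<Sum>y\<in>Q. c * (a x * b y))" by (simp only: sum_distrib_left)
 also have "... = (\<Sum>z\<in>P \<times> Q. c * (a (fst z) * b (snd z)))" by (subst sum.cartesian_product) (auto intro!: sum.cong)
 finally show ?thesis by (rule sym)
qed

text \<open>Chernoff bound with exponent \<open>\<sigma> / sqrt (card S * card T)\<close> and a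
  union bound over all pairs. The best \<sigma> is of the order of the smaller of 1 and
  \<open>sqrt (K / d)\<close>; this is the origin of the maximum of \<open>sqrt (K * d)\<close> and
  \<open>K\<close> in the level.\<close>

lemma prob_correlated:
 fixes m :: "nat => nat => real"
 assumes K: "0 < K" and d: "1 <= d" and \<beta>: "1 / 2 <= \<beta>" "real N * exp (- \<beta>) <= 1"
 defines "\<Lambda> \<equiv> 10 * \<beta> * max (sqrt (K * real d)) K"
 defines "bad \<equiv> {g\<in>space (gaussian_data d N m). ~ correlation_le (gram d (centered m g)) K {..<N} \<Lambda>}"
 shows "bad \<in> sets (gaussian_data d N m)" "measure (gaussian_data d N m) bad <= 18 * exp (- (2 * \<beta>))"
proof -
 let ?E = "gaussian_data d N m" and ?U = "%g. point_sum (centered m g)"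
 interpret prob_space ?E by (rule prob_space_gaussian_data)
 let ?mx = "max (sqrt (K * real d)) K"
 define Ix where "Ix = {(S, T). S \<in> Pow {..<N} - {{}} & T \<in> Pow {..<N} - {{}} & S Int T = {} & rcard S <= K & rcard T <= K}"
 have fIx: "finite Ix" by (rule finite_subset[of _ "Pow {..<N} \<times> Pow {..<N}"]) (auto simp: Ix_def)
 define W where "W z = {g\<in>space ?E. \<Lambda> * sqrt (rcard (fst z) * rcard (snd z)) < \<bar>dot d (?U g (fst z)) (?U g (snd z))\<bar>}" for z
 have md: "(%g. dot d (?U g S) (?U g T)) \<in> borel_measurable ?E" if "S <= {..<N}" "T <= {..<N}" for S T
  by (subst measurable_cong_sets[OF sets_gaussian_data refl], rule measurable_dot) (use measurable_point_sum that in auto)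
 have mW: "W z \<in> sets ?E" if "z \<in> Ix" for z
 proof -
  have z: "fst z <= {..<N}" "snd z <= {..<N}" using that by (auto simp: Ix_def)
  show ?thesis unfolding W_def by (rule borel_measurable_less[OF borel_measurable_const borel_measurable_abs[OF md[OF z]]])
 qed
 have bad: "bad = (\<Union>z\<in>Ix. W z)"
 proof (rule set_eqI)
  fix g
  have "(~ correlation_le (gram d (centered m g)) K {..<N} \<Lambda>) \<longleftrightarrow>
   (\<exists>S T. S <= {..<N} & T <= {..<N} & S Int T = {} & rcard S <= K & rcard T <= K &
     \<Lambda> * sqrt (rcard S * rcard T) < \<bar>dot d (?U g S) (?U g T)\<bar>)"
   unfolding correlation_le_def dot_point_sum[symmetric] by (auto simp: not_le)
  also have "... \<longleftrightarrow> (\<exists>z\<in>Ix. \<Lambda> * sqrt (rcard (fst z) * rcard (snd z)) < \<bar>dot d (?U g (fst z)) (?U g (snd z))\<bar>)"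
  proof -
   have ne: "S ~= {}" "T ~= {}" if "\<Lambda> * sqrt (rcard S * rcard T) < \<bar>dot d (?U g S) (?U g T)\<bar>" for S T
    using that by (auto simp: dot_point_sum)
   show ?thesis (is "?l \<longleftrightarrow> ?r")
   proof
    assume ?l
    then obtain S T where ST: "S <= {..<N}" "T <= {..<N}" "S Int T = {}" "rcard S <= K" "rcard T <= K"
     and gt: "\<Lambda> * sqrt (rcard S * rcard T) < \<bar>dot d (?U g S) (?U g T)\<bar>" by (elim exE conjE)
    have "(S, T) \<in> Ix" unfolding Ix_def using ST ne[OF gt] by simp
    thus ?r by (rule bexI[rotated]) (simp add: gt)
   next
    assume ?r
    then obtain z where z: "z \<in> Ix" and gt: "\<Lambda> * sqrt (rcard (fst z) * rcard (snd z)) < \<bar>dot d (?U g (fst z)) (?U g (snd z))\<bar>" by (rule bexE)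
    show ?l by (intro exI[of _ "fst z"] exI[of _ "snd z"] conjI gt) (use z in \<open>simp_all add: Ix_def split_beta\<close>)
   qed
  qed
  finally show "g \<in> bad \<longleftrightarrow> g \<in> (\<Union>z\<in>Ix. W z)" unfolding bad_def W_def by auto
 qed
 show "bad \<in> sets ?E" unfolding bad by (rule sets.finite_UN[OF fIx mW])
 have each: "prob (W z) <= 2 * (exp (- (2 * \<beta> * rcard (fst z))) * exp (- (2 * \<beta> * rcard (snd z))))" if z: "z \<in> Ix" for z
 proof -
  obtain S T where zST: "z = (S, T)" by (cases z)
  have ST: "S <= {..<N}" "T <= {..<N}" "S Int T = {}" "S ~= {}" "T ~= {}" "rcard S <= K" "rcard T <= K"
   using z by (auto simp: Ix_def zST)
  have pos: "0 < rcard S" "0 < rcard T" using ST finite_subset[OF ST(1)] finite_subset[OF ST(2)] by (auto simp: card_gt_0_iff)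
  define c where "c = sqrt (rcard S * rcard T)"
  have c: "0 < c" "c\<^sup>2 = rcard S * rcard T" using pos by (auto simp: c_def)
  \<comment> \<open>The first bound on \<open>\<sigma>\<^sup>2\<close> keeps the exponential moment
    under control, the second keeps it below the entropy of the union bound, and the last condition
    makes the tail beat that entropy.\<close>
  obtain \<sigma> where \<sigma>: "0 < \<sigma>" "\<sigma>\<^sup>2 <= 1 / 2" "\<sigma>\<^sup>2 * real d <= K / 4" "K / 2 <= \<sigma> * ?mx"
  proof (cases "K <= real d")
   case True
   define \<sigma> where "\<sigma> = sqrt (K / real d) / 2"
   have dp: "0 < real d" using d by simp
   have s2: "\<sigma>\<^sup>2 = K / real d / 4" using K dp by (simp add: \<sigma>_def power_divide)
   have "\<sigma> * sqrt (K * real d) = sqrt (K / real d * (K * real d)) / 2" by (simp add: \<sigma>_def real_sqrt_mult[symmetric] del: real_sqrt_mult)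
   also have "K / real d * (K * real d) = K\<^sup>2" using dp by (simp add: power2_eq_square)
   finally have "\<sigma> * sqrt (K * real d) = K / 2" using K by simp
   moreover have "\<sigma> * sqrt (K * real d) <= \<sigma> * ?mx" using K by (intro mult_left_mono) (auto simp: \<sigma>_def)
   moreover have "K / real d <= 1" using True dp by simp
   ultimately show ?thesis using that[of \<sigma>] K dp s2 by (simp add: \<sigma>_def)
  next
   case False
   thus ?thesis using that[of "1 / 2"] by (simp add: power2_eq_square)
  qed
  have side: "prob {g\<in>space ?E. \<sigma> * (\<Lambda> * c) / c <= l * dot d (?U g S) (?U g T)} <= exp (- (2 * \<beta> * rcard S)) * exp (- (2 * \<beta> * rcard T))"
   if l: "l\<^sup>2 = (\<sigma> / c)\<^sup>2" for l
  proof -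
   have l2: "l\<^sup>2 * (rcard S * rcard T) = \<sigma>\<^sup>2" using l c pos by (simp add: power_divide)
   have "prob {g\<in>space ?E. \<sigma> * (\<Lambda> * c) / c <= l * dot d (?U g S) (?U g T)} <= exp (\<sigma>\<^sup>2 * real d) * exp (- (\<sigma> * (\<Lambda> * c) / c))"
   proof (rule chernoff_bound[OF prob_space_gaussian_data])
    show "(%g. l * dot d (?U g S) (?U g T)) \<in> borel_measurable ?E" by (rule borel_measurable_times[OF borel_measurable_const md[OF ST(1,2)]])
    have "l\<^sup>2 * (rcard S * rcard T) <= 1 / 2" using l2 \<sigma>(2) by simp
    from nn_integral_exp_bilinear[OF ST(1-3) this, of d m]
    show "(\<integral>\<^sup>+g. ennreal (exp (l * dot d (?U g S) (?U g T))) \<partial>?E) <= ennreal (exp (\<sigma>\<^sup>2 * real d))" by (simp only: l2)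
   qed simp
   also have "... = exp (\<sigma>\<^sup>2 * real d - \<sigma> * \<Lambda>)" using c by (simp add: exp_add[symmetric])
   also have "... <= exp (- (2 * \<beta> * rcard S) - 2 * \<beta> * rcard T)"
   proof -
    have "10 * \<beta> * (K / 2) <= 10 * \<beta> * (\<sigma> * ?mx)" using \<sigma>(4) \<beta> by (intro mult_left_mono) auto
    hence "5 * (\<beta> * K) <= \<sigma> * \<Lambda>" by (simp add: \<Lambda>_def mult_ac)
    moreover have "1 / 2 * K <= \<beta> * K" using \<beta> K by (intro mult_right_mono) auto
    moreover have "\<beta> * rcard S <= \<beta> * K" "\<beta> * rcard T <= \<beta> * K" using ST \<beta> by (auto intro!: mult_left_mono)
    ultimately have "\<sigma>\<^sup>2 * real d - \<sigma> * \<Lambda> <= - (2 * \<beta> * rcard S) - 2 * \<beta> * rcard T" using \<sigma>(3) K by linarith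
    thus ?thesis by (simp only: exp_le_cancel_iff)
   qed
   also have "... = exp (- (2 * \<beta> * rcard S)) * exp (- (2 * \<beta> * rcard T))" by (simp add: exp_add[symmetric])
   finally show ?thesis .
  qed
  have ms: "{g\<in>space ?E. \<sigma> * (\<Lambda> * c) / c <= l * dot d (?U g S) (?U g T)} \<in> sets ?E" for l
   by (rule borel_measurable_le[OF borel_measurable_const borel_measurable_times[OF borel_measurable_const md[OF ST(1,2)]]])
  have "W z <= {g\<in>space ?E. \<sigma> * (\<Lambda> * c) / c <= (\<sigma> / c) * dot d (?U g S) (?U g T)} \<union>
     {g\<in>space ?E. \<sigma> * (\<Lambda> * c) / c <= (- (\<sigma> / c)) * dot d (?U g S) (?U g T)}"
  proof
   fix g assume "g \<in> W z"
   hence g: "g \<in> space ?E" "\<Lambda> * c < \<bar>dot d (?U g S) (?U g T)\<bar>" by (auto simp: W_def zST c_def)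
   have sc: "0 <= \<sigma> / c" using \<sigma> c by simp
   show "g \<in> {g\<in>space ?E. \<sigma> * (\<Lambda> * c) / c <= (\<sigma> / c) * dot d (?U g S) (?U g T)} \<union>
     {g\<in>space ?E. \<sigma> * (\<Lambda> * c) / c <= (- (\<sigma> / c)) * dot d (?U g S) (?U g T)}"
   proof (cases "0 <= dot d (?U g S) (?U g T)")
    case True
    hence "(\<sigma> / c) * (\<Lambda> * c) <= (\<sigma> / c) * dot d (?U g S) (?U g T)" using g sc by (intro mult_left_mono) auto
    thus ?thesis using g(1) by simp
   next
    case False
    hence "(\<sigma> / c) * (\<Lambda> * c) <= (\<sigma> / c) * (- dot d (?U g S) (?U g T))" using g sc by (intro mult_left_mono) auto
    thus ?thesis using g(1) by simp
   qed
  qed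
  hence "prob (W z) <= prob ({g\<in>space ?E. \<sigma> * (\<Lambda> * c) / c <= (\<sigma> / c) * dot d (?U g S) (?U g T)} \<union>
     {g\<in>space ?E. \<sigma> * (\<Lambda> * c) / c <= (- (\<sigma> / c)) * dot d (?U g S) (?U g T)})"
   by (rule finite_measure_mono[OF _ sets.Un[OF ms ms]])
  also have "... <= prob {g\<in>space ?E. \<sigma> * (\<Lambda> * c) / c <= (\<sigma> / c) * dot d (?U g S) (?U g T)} +
     prob {g\<in>space ?E. \<sigma> * (\<Lambda> * c) / c <= (- (\<sigma> / c)) * dot d (?U g S) (?U g T)}"
   by (rule measure_Un_le[OF ms ms])
  finally show ?thesis using side[of "\<sigma> / c"] side[of "- (\<sigma> / c)"] by (simp add: zST)
 qed
 let ?P = "Pow {..<N} - {{}}" and ?e = "%S. exp (- (2 * \<beta> * rcard S))"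
 have "prob bad <= (\<Sum>z\<in>Ix. prob (W z))" unfolding bad using mW fIx by (intro finite_measure_subadditive_finite) auto
 also have "... <= (\<Sum>z\<in>Ix. 2 * (?e (fst z) * ?e (snd z)))" by (intro sum_mono each)
 also have "... <= (\<Sum>z\<in>?P \<times> ?P. 2 * (?e (fst z) * ?e (snd z)))" by (intro sum_mono2) (auto simp: Ix_def)
 also have "... = 2 * ((\<Sum>S\<in>?P. ?e S) * (\<Sum>T\<in>?P. ?e T))"
  by (rule sum_cartesian_mult)
 also have "... <= 2 * ((3 * exp (- \<beta>)) * (3 * exp (- \<beta>)))"
  using \<beta> by (intro mult_left_mono mult_mono sum_exp_card_nonempty_le sum_nonneg) auto
 also have "... = 18 * exp (- (2 * \<beta>))" by (simp add: exp_add[symmetric])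
 finally show "prob bad <= 18 * exp (- (2 * \<beta>))" .
qed

section \<open>At least half of the points corrupted\<close>

text \<open>Le Cam's argument with a single law: data with mean \<open>mu\<close> on
  \<open>I0\<close> and mean 0 elsewhere arise under either hypothesis, from an adversary who
  samples from the other one. On friendly data the two correct answers exclude each other, so
  \<open>2 * p\<close> exceeds 1 by at most the probability of the exceptional set
  \<open>E\<close>.\<close>

lemma mixture_unfriendly_ge:
 assumes sol: "solves_friendly d \<alpha> eps \<kappa> n p A" "eps <= 1" and mu: "\<alpha> <= norm2 d mu"
  and I0: "I0 <= {..<n}" "card I0 <= num_corrupt eps n" "card ({..<n} - I0) <= num_corrupt eps n"
  and E: "E \<in> sets (gaussian_data d n (%i. if i \<in> I0 then mu else (%_. 0)))"
   "\<And>g. g \<in> space (data_space d n) ==> g \<notin> E ==> friendly_set d (eps * real n) \<kappa> g {..<n}"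
  and p: "0 <= p"
 shows "2 * p <= 1 + measure (gaussian_data d n (%i. if i \<in> I0 then mu else (%_. 0))) E"
proof -
 let ?G = "friendly d eps n \<kappa>"
 define D where "D = gaussian_data d n (%i. if i \<in> I0 then mu else (%_. 0))"
 interpret D: prob_space D unfolding D_def by (rule prob_space_gaussian_data)
 have sol': "solves_mean_testing d \<alpha> eps n ?G p A" using sol(1) by (simp add: solves_friendly_def)
 hence A: "A \<in> algorithms d n" by (simp add: solves_mean_testing_def)
 let ?q = "%hh X. ennreal (correct_mass ?G A hh X)"
 have q: "?q hh \<in> borel_measurable (data_space d n)" for hh
  using measurable_correct_mass[OF A measurable_friendly] by measurable
 have pm: "perm_avg n (?q hh) \<in> borel_measurable (data_space d n)" for hh by (rule measurable_perm_avg[OF q])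
 have ge: "ennreal p <= (\<integral>\<^sup>+g. perm_avg n (?q hh) g \<partial>D)"
  if adm: "admissible d \<alpha> m2 hh" and I: "I <= {..<n}" "card I <= num_corrupt eps n"
   and D: "D = gaussian_data d n (%i. if i \<in> I then m1 else m2)" for I m1 m2 hh
 proof -
  have "ennreal p = (\<integral>\<^sup>+g1. ennreal p \<partial>gaussian_data d n (%_. m1))"
   by (simp add: prob_space.emeasure_space_1[OF prob_space_gaussian_data])
  also have "... <= (\<integral>\<^sup>+g1. \<integral>\<^sup>+g2. perm_avg n (?q hh) (mix I g1 g2) \<partial>gaussian_data d n (%_. m2) \<partial>gaussian_data d n (%_. m1))"
  proof (rule nn_integral_mono)
   fix g1 assume "g1 \<in> space (gaussian_data d n (%_. m1))"
   hence g1: "g1 \<in> space (data_space d n)" by (simp add: space_gaussian_data)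
   show "ennreal p <= (\<integral>\<^sup>+g2. perm_avg n (?q hh) (mix I g1 g2) \<partial>gaussian_data d n (%_. m2))"
    by (rule solves_mean_testing_ge[OF sol' measurable_friendly sol(2) adm I g1])
  qed
  also have "... = (\<integral>\<^sup>+g. perm_avg n (?q hh) g \<partial>D)"
   unfolding D by (rule nn_integral_gaussian_data_mix[OF pm, symmetric])
  finally show ?thesis .
 qed
 have geN: "ennreal p <= (\<integral>\<^sup>+g. perm_avg n (?q Null) g \<partial>D)"
  by (rule ge[OF _ I0(1,2) D_def]) (simp add: admissible_def)
 \<comment> \<open>The same law, read with the complement of \<open>I0\<close> as the corrupted
   positions.\<close>
 have DA: "D = gaussian_data d n (%i. if i \<in> {..<n} - I0 then %_. 0 else mu)"
  unfolding D_def gaussian_data_def by (rule PiM_cong) auto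
 have geA: "ennreal p <= (\<integral>\<^sup>+g. perm_avg n (?q Alternative) g \<partial>D)"
  by (rule ge[OF _ Diff_subset I0(3) DA]) (use mu in \<open>simp add: admissible_def\<close>)
 have pw: "perm_avg n (?q Null) g + perm_avg n (?q Alternative) g <= 1 + indicator E g" if g: "g \<in> space D" for g
 proof (cases "g \<in> E")
  case True
  have le: "perm_avg n (?q hh) g <= 1" for hh by (rule perm_avg_le_1) (simp add: correct_mass_bounds)
  show ?thesis using True add_mono[OF le[of Null] le[of Alternative]] by simp
 next
  case False
  have fs: "friendly_set d (eps * real n) \<kappa> g {..<n}" using E(2)[OF _ False] g by (simp add: D_def space_gaussian_data)
  have "?q Null (rearrange n g \<sigma>) + ?q Alternative (rearrange n g \<sigma>) = 1" if s: "\<sigma> \<in> perms n" for \<sigma>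
  proof -
   have "?G (rearrange n g \<sigma>)" by (rule friendly_rearrange[OF fs]) (use perms_image[OF s] in auto)
   moreover have "pmf (A X) Null + pmf (A X) Alternative = 1" for X
   proof -
    have U: "UNIV = {Null, Alternative}" using hypothesis.exhaust by auto
    have "sum (pmf (A X)) {Null, Alternative} = 1" by (rule sum_pmf_eq_1) (simp, simp add: U[symmetric])
    thus ?thesis by simp
   qed
   ultimately show ?thesis by (simp add: correct_mass_def ennreal_plus[symmetric] del: ennreal_plus)
  qed
  hence "perm_avg n (?q Null) g + perm_avg n (?q Alternative) g = (\<Sum>\<sigma>\<in>perms n. ennreal (1 / card (perms n)) * 1)"
   unfolding perm_avg_def sum.distrib[symmetric] distrib_left[symmetric] by (intro sum.cong refl) simp
  also have "... = perm_avg n (%_. 1) g" by (simp add: perm_avg_def)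
  also have "... <= 1" by (rule perm_avg_le_1) simp
  finally show ?thesis using False by simp
 qed
 have "ennreal (2 * p) = ennreal p + ennreal p" using p by (simp add: ennreal_plus[symmetric] del: ennreal_plus)
 also have "... <= (\<integral>\<^sup>+g. perm_avg n (?q Null) g \<partial>D) + (\<integral>\<^sup>+g. perm_avg n (?q Alternative) g \<partial>D)" by (intro add_mono geN geA)
 also have "... = (\<integral>\<^sup>+g. perm_avg n (?q Null) g + perm_avg n (?q Alternative) g \<partial>D)"
 proof -
  have "perm_avg n (?q hh) \<in> borel_measurable D" for hh
   unfolding D_def by (subst measurable_cong_sets[OF sets_gaussian_data refl]) (rule pm)
  from nn_integral_add[OF this this] show ?thesis by (rule sym)
 qed
 also have "... <= (\<integral>\<^sup>+g. 1 + indicator E g \<partial>D)" by (intro nn_integral_mono pw)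
 also have "... = 1 + emeasure D E" using E(1) by (subst nn_integral_add) (auto simp: D_def[symmetric] D.emeasure_space_1)
 also have "... = ennreal (1 + measure D E)" by (simp add: D.emeasure_eq_measure ennreal_plus)
 finally have "2 * p <= 1 + measure D E" by (subst (asm) ennreal_le_iff) auto
 thus ?thesis by (simp only: D_def)
qed

text \<open>Otherwise the mixture with a mean of norm \<alpha> would be friendly except with
  probability 0.2, whence \<open>p <= 0.6\<close>. The means contribute about
  \<open>card S * card T * \<alpha>\<^sup>2\<close> to a correlation. For sets of at most
  \<open>M <= n\<close> points this stays within the friendly level, up to powers of
  \<open>h\<close>, as long as \<open>\<alpha>\<^sup>2\<close> is at most of order
  \<open>sqrt (d / n) + 1\<close>.\<close>

lemma no_small_mean:
 assumes nd: "2 <= n * d" and hdef: "h = 10 * ln (real n * real d)" and eps: "0 < eps" "eps < 1"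
  and half: "n <= 2 * num_corrupt eps n"
  and sol: "solves_friendly d \<alpha> eps (h ^ 2000) n p A" and p: "2 / 3 < p" and \<alpha>: "0 < \<alpha>"
 shows "h ^ 14 * (sqrt (real d / real n) + 1) <= \<alpha>\<^sup>2"
proof (rule ccontr)
 assume "~ ?thesis"
 hence small: "\<alpha>\<^sup>2 <= h ^ 14 * (sqrt (real d / real n) + 1)" by simp
 let ?s = "sqrt (real d)"
 define M where "M = eps * real n"
 define f where "f = num_corrupt eps n"
 define mu where "mu = (%j::nat. if j = 0 then \<alpha> else 0)"
 define m where "m i = (if i < f then mu else (%_. 0))" for i :: nat
 note sc = scale_ge_6[OF nd hdef]
 have s1: "1 <= ?s" "?s * ?s = d" using sc(3) by auto
 have dm: "dot d mu mu = \<alpha>\<^sup>2" using sc(3) by (simp add: dot_def mu_def if_distrib sum.If_cases power2_eq_square cong: if_cong)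
 hence nm: "norm2 d mu = \<alpha>" using \<alpha> by (simp add: norm2_eq_sqrt)
 have nmm: "norm2 d (m i) <= \<alpha>" for i using nm \<alpha> by (auto simp: m_def norm2_eq_sqrt dot_def)
 have fn: "f <= n" using num_corrupt_le[of eps n] eps by (simp add: f_def)
 have M: "0 < M" "M <= real n" using eps sc(2) by (auto simp: M_def)
 let ?mx = "max (sqrt (M * real d)) M"
 define E2 where "E2 = {g\<in>space (gaussian_data d n m). ~ correlation_le (gram d (centered m g)) M {..<n} (10 * h * ?mx)}"
 define R1 where "R1 = {g\<in>space (gaussian_data d n m). ~ regular d n m {} (%_ _. 0) (2 * h) g}"
 have ne: "real n * exp (- h) <= 1" using sc(4) by (simp add: exp_minus field_simps)
 have R1: "R1 \<in> sets (gaussian_data d n m)" "measure (gaussian_data d n m) R1 <= 9 * (real n)\<^sup>2 * exp (- ((2 * h)\<^sup>2 / 4))"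
  unfolding R1_def by (rule prob_not_regular; use sc in simp)+
 have E2: "E2 \<in> sets (gaussian_data d n m)" "measure (gaussian_data d n m) E2 <= 18 * exp (- (2 * h))"
  unfolding E2_def by (rule prob_correlated; use sc M ne in simp)+
 let ?x = "real n * real d"
 have x: "2 <= ?x" using nd by (metis of_nat_le_iff of_nat_mult of_nat_numeral)
 have pE2: "18 * exp (- (2 * h)) <= 0.1"
 proof -
  have "(2::real) ^ 10 <= ?x ^ 10" using x by (intro power_mono) auto
  hence "1024 <= exp h" using sc(7) by simp
  hence "1024 * 1024 <= exp h * exp h" by (intro mult_mono) auto
  hence "1024 * 1024 <= exp (2 * h)" by (simp add: exp_add[symmetric])
  thus ?thesis by (simp add: exp_minus field_simps)
 qed
 have pR1: "9 * (real n)\<^sup>2 * exp (- ((2 * h)\<^sup>2 / 4)) <= 0.1"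
 proof -
  have nx: "real n <= ?x" using sc(2,3) by (auto simp: mult_le_cancel_left1)
  have "(2::real) ^ 58 <= ?x ^ 58" using x by (intro power_mono) auto
  hence "90 * (real n)\<^sup>2 <= ?x ^ 58 * ?x\<^sup>2" using nx by (intro mult_mono power_mono) auto
  also have "... = ?x ^ 60" by (simp add: power_add[symmetric])
  finally have "90 * (real n)\<^sup>2 * exp (- h\<^sup>2) <= ?x ^ 60 * exp (- h\<^sup>2)" by (intro mult_right_mono) auto
  hence "90 * (real n)\<^sup>2 * exp (- h\<^sup>2) <= 1" using sc(6) by linarith
  thus ?thesis by (simp add: power_mult_distrib)
 qed
 have meq: "m = (%i. if i \<in> {..<f} then mu else (%_. 0))" by (auto simp: m_def)
 have "2 * p <= 1 + measure (gaussian_data d n (%i. if i \<in> {..<f} then mu else (%_. 0))) (R1 Un E2)"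
 proof (rule mixture_unfriendly_ge[OF sol])
  show "eps <= 1" using eps by simp
  show "\<alpha> <= norm2 d mu" using nm by simp
  show "{..<f} <= {..<n}" using fn by auto
  show "card {..<f} <= num_corrupt eps n" by (simp add: f_def)
  have "{..<n} - {..<f} = {f..<n}" by auto
  thus "card ({..<n} - {..<f}) <= num_corrupt eps n" using half by (simp add: f_def)
  show "R1 Un E2 \<in> sets (gaussian_data d n (%i. if i \<in> {..<f} then mu else (%_. 0)))" unfolding meq[symmetric] using R1 E2 by auto
  show "0 <= p" using p by simp
  fix g assume g: "g \<in> space (data_space d n)" "g \<notin> R1 Un E2"
  let ?u = "centered m g"
  have reg: "regular d n m {} (%_ _. 0) (2 * h) g" and cor: "correlation_le (gram d ?u) M {..<n} (10 * h * ?mx)"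
   using g by (auto simp: R1_def E2_def space_gaussian_data)
  have h0: "0 <= h" using sc(1) by simp
  have um: "\<bar>dot d (?u i) (m k)\<bar> <= 2 * h * \<alpha>" if "i < n" "k < n" for i k
  proof -
   have "\<bar>dot d (?u i) (m k)\<bar> <= 2 * h * norm2 d (m k)" using reg that by (auto simp: regular_def regular_at_def)
   also have "... <= 2 * h * \<alpha>" using nmm h0 by (intro mult_left_mono) auto
   finally show ?thesis .
  qed
  have mm: "\<bar>dot d (m i) (m k)\<bar> <= \<alpha>\<^sup>2" for i k
  proof -
   have "\<bar>dot d (m i) (m k)\<bar> <= norm2 d (m i) * norm2 d (m k)" by (rule dot_Cauchy_Schwarz)
   also have "... <= \<alpha> * \<alpha>" using nmm \<alpha> by (intro mult_mono) (auto simp: norm2_nonneg)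
   finally show ?thesis by (simp add: power2_eq_square)
  qed
  have am: "4 * h * \<alpha> <= \<alpha>\<^sup>2 + 4 * h\<^sup>2" using zero_le_power2[of "\<alpha> - 2 * h"] by (simp add: power2_eq_square algebra_simps)
  have ex: "gram d g i k = gram d ?u i k + (dot d (?u i) (m k) + dot d (?u k) (m i) + dot d (m i) (m k))" for i k
   unfolding gram_def
   by (subst dot_centered[of d g i _ m], subst (1 2) dot_commute, subst (1 2) dot_centered[of d g k _ m]) (simp add: dot_commute)
  have rest: "\<bar>dot d (?u i) (m k) + dot d (?u k) (m i) + dot d (m i) (m k)\<bar> <= 2 * \<alpha>\<^sup>2 + 4 * h\<^sup>2" if "i < n" "k < n" for i k
   using um[OF that] um[OF that(2,1)] mm[of i k] am by linarith
  have h2: "4 * h\<^sup>2 <= h ^ 4" using pow_step[OF sc(1), of 1 2] pow_step[OF sc(1), of 1 3] zero_le_power2[of h] by (simp add: eval_nat_numeral)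
  have al: "2 * \<alpha>\<^sup>2 + 4 * h\<^sup>2 <= 3 * h ^ 14 * (sqrt (real d / real n) + 1)"
  proof -
   have "h ^ 4 <= h ^ 14" using sc(1) by (intro power_increasing) auto
   also have "... <= h ^ 14 * (sqrt (real d / real n) + 1)" using h0 by (simp add: mult_le_cancel_left1)
   finally show ?thesis using small h2 by linarith
  qed
  have d1: "sqrt (real d / real n) + 1 <= 2 * ?s"
  proof -
   have "real d / real n <= real d" using sc(2) by (simp add: divide_le_eq mult_le_cancel_left1)
   hence "sqrt (real d / real n) <= ?s" by (rule real_sqrt_le_mono)
   thus ?thesis using s1 by linarith
  qed
  have al2: "2 * \<alpha>\<^sup>2 + 4 * h\<^sup>2 <= 6 * (h ^ 14 * ?s)"
  proof -
   have "3 * h ^ 14 * (sqrt (real d / real n) + 1) <= 3 * h ^ 14 * (2 * ?s)" by (rule mult_left_mono[OF d1]) (use h0 in simp)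
   thus ?thesis using al by linarith
  qed
  have hp: "h ^ k <= h ^ 2000" if "k <= 2000" for k using sc(1) that by (intro power_increasing) auto
  have fin6: "6 * (h ^ 14 * ?s) + 4 * (h ^ 3 * ?s) <= h ^ 2000 * ?s"
  proof -
   have "h ^ 3 * ?s <= h ^ 15 * ?s" using sc(1) s1 by (intro mult_right_mono power_increasing) auto
   moreover have "h ^ 16 * ?s <= h ^ 2000 * ?s" using hp[of 16] s1 by (intro mult_right_mono) auto
   moreover have "0 <= h ^ 15 * ?s" using h0 by simp
   moreover have "6 * (h ^ 14 * ?s) <= h ^ 15 * ?s" "6 * (h ^ 15 * ?s) <= h ^ 16 * ?s"
    using pow_step(1)[OF sc(1), of ?s 14] pow_step(1)[OF sc(1), of ?s 15] by simp_all
   ultimately show ?thesis by linarith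
  qed
  show "friendly_set d (eps * real n) (h ^ 2000) g {..<n}"
   unfolding friendly_set_def M_def[symmetric]
  proof (intro conjI ballI impI)
   fix i k assume ik: "i \<in> {..<n}" "k \<in> {..<n}" "i ~= k"
   have "\<bar>dot d (?u i) (?u k)\<bar> <= 2 * h * norm2 d (?u k)" using reg ik by (auto simp: regular_def regular_at_def)
   also have "... <= 2 * h * (h\<^sup>2 * ?s)" using regular_noise_norm[OF sc(1,3) reg, of k] ik h0 by (intro mult_left_mono) auto
   finally have "\<bar>gram d ?u i k\<bar> <= 4 * (h ^ 3 * ?s)" using pow_step(2)[OF sc(1), of ?s 3] s1 by (simp add: gram_def eval_nat_numeral)
   thus "\<bar>dot d (g i) (g k)\<bar> <= h ^ 2000 * ?s"
    using rest[of i k] ik ex[of i k] al2 fin6 unfolding gram_def lessThan_iff by linarith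
  next
   fix i assume i: "i \<in> {..<n}"
   have "\<bar>dot d (?u i) (?u i) - d\<bar> <= (2 * h)\<^sup>2 * ?s" using reg i by (auto simp: regular_def regular_at_def)
   also have "... <= 4 * (h ^ 3 * ?s)"
   proof -
    have "6 * (h ^ 2 * ?s) <= h ^ 3 * ?s" "0 <= h ^ 2 * ?s" using pow_step[OF sc(1), of ?s 2] by simp_all
    moreover have "(2 * h)\<^sup>2 * ?s = 4 * (h ^ 2 * ?s)" by (simp add: power_mult_distrib)
    ultimately show ?thesis by linarith
   qed
   finally have "\<bar>gram d ?u i i - d\<bar> <= 4 * (h ^ 3 * ?s)" by (simp add: gram_def)
   thus "\<bar>dot d (g i) (g i) - d\<bar> <= h ^ 2000 * ?s"
    using rest[of i i] i ex[of i i] al2 fin6 unfolding gram_def lessThan_iff by linarith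
  next
   show "correlation_le (gram d g) M {..<n} (h ^ 2000 * ?mx)" unfolding correlation_le_def
   proof (intro allI impI)
    fix S T assume "S <= {..<n} & T <= {..<n} & S Int T = {} & rcard S <= M & rcard T <= M"
    hence ST: "S <= {..<n}" "T <= {..<n}" "S Int T = {}" "rcard S <= M" "rcard T <= M" by auto
    define c where "c = sqrt (rcard S * rcard T)"
    have c: "0 <= c" "c * c = rcard S * rcard T" "c <= M"
    proof -
     have "rcard S * rcard T <= M * M" by (rule mult_mono) (use ST M in auto)
     hence "c <= sqrt (M * M)" unfolding c_def by (simp only: real_sqrt_le_iff)
     thus "c <= M" using M by simp
    qed (auto simp: c_def)
    let ?t = "%i k. dot d (?u i) (m k) + dot d (?u k) (m i) + dot d (m i) (m k)"
    have "pair_sum (gram d g) S T = pair_sum (gram d ?u) S T + (\<Sum>i\<in>S. \<Sum>k\<in>T. ?t i k)"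
    proof -
     have "pair_sum (gram d g) S T = (\<Sum>i\<in>S. \<Sum>k\<in>T. gram d ?u i k + ?t i k)"
      unfolding pair_sum_def by (intro sum.cong refl ex)
     thus ?thesis by (simp only: sum.distrib pair_sum_def)
    qed
    moreover have "\<bar>pair_sum (gram d ?u) S T\<bar> <= 10 * h * ?mx * c" unfolding c_def by (rule correlation_leD[OF cor ST])
    moreover have "\<bar>\<Sum>i\<in>S. \<Sum>k\<in>T. ?t i k\<bar> <= 6 * h ^ 14 * ?mx * c"
    proof -
     have "\<bar>\<Sum>i\<in>S. \<Sum>k\<in>T. ?t i k\<bar> <= (\<Sum>i\<in>S. \<Sum>k\<in>T. \<bar>?t i k\<bar>)"
      by (rule order_trans[OF sum_abs]) (intro sum_mono sum_abs)
     also have "... <= (\<Sum>i\<in>S. \<Sum>k\<in>T. 3 * h ^ 14 * (sqrt (real d / real n) + 1))"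
      using ST rest al by (intro sum_mono) (meson lessThan_iff order_trans subsetD)
     also have "... = c * c * (3 * h ^ 14 * (sqrt (real d / real n) + 1))" using c by simp
     also have "... <= c * M * (3 * h ^ 14 * (sqrt (real d / real n) + 1))"
      using c h0 by (intro mult_right_mono mult_left_mono) auto
     also have "... = 3 * h ^ 14 * c * (M * (sqrt (real d / real n) + 1))" by simp
     also have "... <= 3 * h ^ 14 * c * (2 * ?mx)"
     proof (rule mult_left_mono)
      have "M * sqrt (real d / real n) = sqrt (M\<^sup>2 * (real d / real n))" using M(1) by (simp only: real_sqrt_mult real_sqrt_abs abs_of_pos)
      also have "... <= sqrt (M * real d)"
      proof (rule real_sqrt_le_mono)
       have "M * (M * real d) <= real n * (M * real d)" using M by (intro mult_right_mono) auto
       thus "M\<^sup>2 * (real d / real n) <= M * real d" using sc(2) by (simp add: divide_le_eq power2_eq_square mult_ac)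
      qed
      finally show "M * (sqrt (real d / real n) + 1) <= 2 * ?mx" by (simp add: distrib_left)
     qed (use h0 c in simp)
     finally show ?thesis by (simp add: mult_ac)
    qed
    moreover have "10 * h * ?mx * c + 6 * h ^ 14 * ?mx * c <= h ^ 2000 * ?mx * c"
    proof -
     have "h ^ 1 <= h ^ 14" using sc(1) by (intro power_increasing) auto
     moreover have "6 * h ^ 14 <= h ^ 15" "6 * h ^ 15 <= h ^ 16" using pow_step(1)[OF sc(1), of 1 14] pow_step(1)[OF sc(1), of 1 15] by simp_all
     moreover have "h ^ 16 <= h ^ 2000" by (rule hp) simp
     ultimately have "10 * h + 6 * h ^ 14 <= h ^ 2000" using zero_le_power[OF h0, of 14] unfolding power_one_right by linarith
     hence "(10 * h + 6 * h ^ 14) * (?mx * c) <= h ^ 2000 * (?mx * c)" using c M by (intro mult_right_mono) auto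
     thus ?thesis by (simp add: algebra_simps)
    qed
    ultimately show "\<bar>pair_sum (gram d g) S T\<bar> <= h ^ 2000 * ?mx * sqrt (rcard S * rcard T)"
     unfolding c_def[symmetric] by linarith
   qed
  qed
 qed
 also have "measure (gaussian_data d n (%i. if i \<in> {..<f} then mu else (%_. 0))) (R1 Un E2) <= 0.2"
  unfolding meq[symmetric] using measure_Un_le[OF R1(1) E2(1)] R1(2) E2(2) pE2 pR1 by simp
 finally show False using p by simp
qed

lemma norm2_triangle: "norm2 d (%j. a j + b j) <= norm2 d a + norm2 d b"
 unfolding norm2_def by (rule L2_set_triangle_ineq)

lemma norm2_minus_le: "norm2 d b <= norm2 d (%j. a j + b j) + norm2 d a"
proof -
 have "norm2 d b = norm2 d (%j. (a j + b j) + - a j)" by simp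
 also have "... <= norm2 d (%j. a j + b j) + norm2 d (%j. - a j)" by (rule norm2_triangle)
 also have "norm2 d (%j. - a j) = norm2 d a" by (simp add: norm2_def L2_set_def)
 finally show ?thesis .
qed

lemma norm2_scale: "norm2 d (%j. c * a j) = \<bar>c\<bar> * norm2 d a"
 by (simp add: norm2_eq_sqrt dot_scale mult.assoc[symmetric] real_sqrt_mult)

lemma dot_add_right: "dot d u (%j. a j + b j) = dot d u a + dot d u b"
 by (simp add: dot_def sum.distrib distrib_left)

lemma prob_linear_sum:
 fixes m :: "nat => nat => real" and v :: "nat => real" and d :: nat
 assumes K: "K <= {..<N}" and c: "0 < c"
 defines "W \<equiv> {g\<in>space (gaussian_data d N m). c * rcard K * norm2 d v < \<bar>dot d (point_sum (centered m g) K) v\<bar>}"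
 shows "W \<in> sets (gaussian_data d N m)" "measure (gaussian_data d N m) W <= 2 * exp (- (c\<^sup>2 / 2 * rcard K))"
proof -
 let ?E = "gaussian_data d N m" and ?U = "%g. point_sum (centered m g) K"
 interpret prob_space ?E by (rule prob_space_gaussian_data)
 have md: "(%g. dot d (?U g) v) \<in> borel_measurable ?E"
  by (subst measurable_cong_sets[OF sets_gaussian_data refl], rule measurable_dot) (use measurable_point_sum K in auto)
 show "W \<in> sets ?E" unfolding W_def by (rule borel_measurable_less[OF borel_measurable_const borel_measurable_abs[OF md]])
 show "prob W <= 2 * exp (- (c\<^sup>2 / 2 * rcard K))"
 proof (cases "norm2 d v = 0")
  case True
  have "\<bar>dot d u v\<bar> = 0" for u using dot_Cauchy_Schwarz[of d u v] True by simp
  hence "W = {}" using True by (auto simp: W_def)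
  thus ?thesis by simp
 next
  case False
  define r where "r = norm2 d v"
  have r: "0 < r" "dot d v v = r\<^sup>2" using False norm2_nonneg[of d v] by (auto simp: r_def norm2_power2)
  let ?k = "rcard K"
  have side: "prob {g\<in>space ?E. c\<^sup>2 * ?k <= l * dot d (?U g) v} <= exp (- (c\<^sup>2 / 2 * ?k))" if l: "l\<^sup>2 = (c / r)\<^sup>2" for l
  proof -
   have e: "?k * dot d (%j. l * v j) (%j. l * v j) / 2 = c\<^sup>2 / 2 * ?k"
    using l r by (simp add: dot_scale power2_eq_square[symmetric] mult.assoc[symmetric] power_divide)
   have "prob {g\<in>space ?E. c\<^sup>2 * ?k <= l * dot d (?U g) v} <= exp (c\<^sup>2 / 2 * ?k) * exp (- (c\<^sup>2 * ?k))"
   proof (rule chernoff_bound[OF prob_space_gaussian_data])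
    show "(%g. l * dot d (?U g) v) \<in> borel_measurable ?E" by (rule borel_measurable_times[OF borel_measurable_const md])
    show "(\<integral>\<^sup>+g. ennreal (exp (l * dot d (?U g) v)) \<partial>?E) <= ennreal (exp (c\<^sup>2 / 2 * ?k))"
     using nn_integral_exp_point_sum[OF K, of d m "%j. l * v j"] unfolding e by (simp add: dot_scale(1))
   qed simp
   also have "... = exp (- (c\<^sup>2 / 2 * ?k))" by (simp add: exp_add[symmetric])
   finally show ?thesis .
  qed
  have ms: "{g\<in>space ?E. c\<^sup>2 * ?k <= l * dot d (?U g) v} \<in> sets ?E" for l
   by (rule borel_measurable_le[OF borel_measurable_const borel_measurable_times[OF borel_measurable_const md]])
  have "W <= {g\<in>space ?E. c\<^sup>2 * ?k <= (c / r) * dot d (?U g) v} Un {g\<in>space ?E. c\<^sup>2 * ?k <= (- (c / r)) * dot d (?U g) v}"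
  proof
   fix g assume "g \<in> W"
   hence g: "g \<in> space ?E" "c * ?k * r < \<bar>dot d (?U g) v\<bar>" by (auto simp: W_def r_def)
   have cr: "0 <= c / r" "(c / r) * (c * ?k * r) = c\<^sup>2 * ?k" using c r by (auto simp: power2_eq_square)
   have "(c / r) * (c * ?k * r) <= (c / r) * \<bar>dot d (?U g) v\<bar>" using g cr(1) by (intro mult_left_mono) auto
   hence "c\<^sup>2 * ?k <= (c / r) * dot d (?U g) v \<or> c\<^sup>2 * ?k <= (- (c / r)) * dot d (?U g) v" using cr by (auto simp: abs_if split: if_splits)
   thus "g \<in> {g\<in>space ?E. c\<^sup>2 * ?k <= (c / r) * dot d (?U g) v} Un {g\<in>space ?E. c\<^sup>2 * ?k <= (- (c / r)) * dot d (?U g) v}" using g(1) by auto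
  qed
  hence "prob W <= prob ({g\<in>space ?E. c\<^sup>2 * ?k <= (c / r) * dot d (?U g) v} Un {g\<in>space ?E. c\<^sup>2 * ?k <= (- (c / r)) * dot d (?U g) v})"
   by (rule finite_measure_mono[OF _ sets.Un[OF ms ms]])
  also have "... <= prob {g\<in>space ?E. c\<^sup>2 * ?k <= (c / r) * dot d (?U g) v} + prob {g\<in>space ?E. c\<^sup>2 * ?k <= (- (c / r)) * dot d (?U g) v}"
   by (rule measure_Un_le[OF ms ms])
  finally show ?thesis using side[of "c / r"] side[of "- (c / r)"] by simp
 qed
qed

text \<open>\<open>K\<close> stands for the genuine part of a candidate subset and \<open>C\<close>
  for the corrupted points missing from it. Because \<open>card C <= card K\<close>, a tail
  exponential in \<open>card K\<close> pays for the choice of both.\<close>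

lemma prob_linear_sums:
 fixes I :: "nat set" and y m :: "nat => nat => real" and d :: nat
 assumes I: "I <= {..<N}" and c: "0 < c" "6 * \<beta> <= c\<^sup>2" and \<beta>: "0 <= \<beta>" "real N * exp (- \<beta>) <= 1"
 defines "bad \<equiv> {g\<in>space (gaussian_data d N m). \<exists>K\<in>Pow {..<N} - {{}}. \<exists>C\<in>Pow I. card C <= card K &
   c * rcard K * norm2 d (point_sum y (I - C)) < \<bar>dot d (point_sum (centered m g) K) (point_sum y (I - C))\<bar>}"
 shows "bad \<in> sets (gaussian_data d N m)" "measure (gaussian_data d N m) bad <= 18 * exp (- \<beta>)"
proof -
 let ?E = "gaussian_data d N m"
 interpret prob_space ?E by (rule prob_space_gaussian_data)
 define W where "W z = {g\<in>space ?E. c * rcard (fst z) * norm2 d (point_sum y (I - snd z)) < \<bar>dot d (point_sum (centered m g) (fst z)) (point_sum y (I - snd z))\<bar>}" for z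
 have fI: "finite I" "card I <= N" using I finite_subset card_mono[OF _ I] by auto
 define Ix where "Ix = {z \<in> (Pow {..<N} - {{}}) \<times> Pow I. card (snd z) <= card (fst z)}"
 have fIx: "finite Ix" unfolding Ix_def using fI by auto
 have mW: "W z \<in> sets ?E" if "z \<in> Ix" for z unfolding W_def by (rule prob_linear_sum(1)) (use that c in \<open>auto simp: Ix_def\<close>)
 have bad: "bad = (\<Union>z\<in>Ix. W z)"
 proof (intro set_eqI iffI)
  fix g assume "g \<in> bad"
  then obtain K C where KC: "K \<in> Pow {..<N} - {{}}" "C \<in> Pow I" "card C <= card K"
   and g: "g \<in> space ?E" "c * rcard K * norm2 d (point_sum y (I - C)) < \<bar>dot d (point_sum (centered m g) K) (point_sum y (I - C))\<bar>"
   unfolding bad_def by (elim CollectE conjE bexE)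
  have "(K, C) \<in> Ix" unfolding Ix_def using KC by simp
  moreover have "g \<in> W (K, C)" unfolding W_def using g by simp
  ultimately show "g \<in> (\<Union>z\<in>Ix. W z)" by (rule UN_I)
 next
  fix g assume "g \<in> (\<Union>z\<in>Ix. W z)"
  then obtain z where z: "z \<in> Ix" "g \<in> W z" by (rule UN_E)
  show "g \<in> bad" unfolding bad_def
   by (intro CollectI conjI bexI[of _ "fst z"] bexI[of _ "snd z"]) (use z in \<open>auto simp: W_def Ix_def\<close>)
 qed
 show "bad \<in> sets ?E" unfolding bad by (rule sets.finite_UN[OF fIx mW])
 have each: "prob (W z) <= 2 * (exp (- (2 * \<beta> * rcard (fst z))) * exp (- (\<beta> * rcard (snd z))))" if z: "z \<in> Ix" for z
 proof -
  have "prob (W z) <= 2 * exp (- (c\<^sup>2 / 2 * rcard (fst z)))" unfolding W_def by (rule prob_linear_sum(2)) (use z c in \<open>auto simp: Ix_def\<close>)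
  also have "... <= 2 * exp (- (2 * \<beta> * rcard (fst z)) - \<beta> * rcard (snd z))"
  proof -
   have "3 * \<beta> * rcard (fst z) <= c\<^sup>2 / 2 * rcard (fst z)" using c by (intro mult_right_mono) auto
   moreover have "\<beta> * rcard (snd z) <= \<beta> * rcard (fst z)" using z \<beta> by (intro mult_left_mono) (auto simp: Ix_def)
   ultimately show ?thesis by simp
  qed
  finally show ?thesis by (simp add: exp_add[symmetric])
 qed
 let ?P = "Pow {..<N} - {{}}"
 have "prob bad <= (\<Sum>z\<in>Ix. prob (W z))" unfolding bad using mW fIx by (intro finite_measure_subadditive_finite) auto
 also have "... <= (\<Sum>z\<in>Ix. 2 * (exp (- (2 * \<beta> * rcard (fst z))) * exp (- (\<beta> * rcard (snd z)))))" by (intro sum_mono each)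
 also have "... <= (\<Sum>z\<in>?P \<times> Pow I. 2 * (exp (- (2 * \<beta> * rcard (fst z))) * exp (- (\<beta> * rcard (snd z)))))"
  using fI by (intro sum_mono2) (auto simp: Ix_def)
 also have "... = 2 * ((\<Sum>S\<in>?P. exp (- (2 * \<beta> * rcard S))) * (\<Sum>T\<in>Pow I. exp (- (\<beta> * rcard T))))"
  by (rule sum_cartesian_mult)
 also have "... <= 2 * ((3 * exp (- \<beta>)) * 3)"
 proof (intro mult_left_mono mult_mono sum_exp_card_nonempty_le sum_exp_card_le sum_nonneg)
  have "rcard I * exp (- \<beta>) <= real N * exp (- \<beta>)" using fI by (intro mult_right_mono) auto
  thus "rcard I * exp (- \<beta>) <= 1" using \<beta> by linarith
 qed (use \<beta> fI in auto)
 finally show "prob bad <= 18 * exp (- \<beta>)" by simp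
qed

text \<open>The term \<open>L\<close> is there to dominate the interaction of the noise vectors
  among themselves, which by \<open>noise_sum_bounds\<close> has this order up to powers of
  \<open>h\<close>.\<close>

definition aligned :: "nat => nat => nat => real => real => (nat => nat => real) => bool" where
 "aligned d N s t L X \<longleftrightarrow> (\<exists>S\<in>{S\<in>Pow {..<N}. card S = s}. \<forall>i\<in>S.
   t * (norm2 d (point_sum X (S - {i})) + L) <= dot d (X i) (point_sum X (S - {i})))"

lemma measurable_aligned: "Measurable.pred (data_space d N) (aligned d N s t L)"
proof -
 have ps: "(%X. point_sum X S j) \<in> borel_measurable (data_space d N)" if "S <= {..<N}" "j < d" for S j
  unfolding point_sum_def by (intro borel_measurable_sum measurable_data) (use that in auto)
 have "Measurable.pred (data_space d N) (%X. t * (norm2 d (point_sum X (S - {i})) + L) <= dot d (X i) (point_sum X (S - {i})))"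
  if "S <= {..<N}" "i \<in> S" for S i
 proof -
  have "(%X. dot d (X i) (point_sum X (S - {i}))) \<in> borel_measurable (data_space d N)"
   "(%X. dot d (point_sum X (S - {i})) (point_sum X (S - {i}))) \<in> borel_measurable (data_space d N)"
   by (rule measurable_dot; use that ps[of "S - {i}"] measurable_data[of i N] in auto)+
  thus ?thesis unfolding pred_def norm2_eq_sqrt by (intro borel_measurable_le) auto
 qed
 thus ?thesis unfolding aligned_def[abs_def]
  by (intro pred_intros_finite) (auto intro: finite_subset)
qed

lemma noise_sum_bounds:
 assumes h: "6 <= h" and d: "1 <= d" and reg: "regular d N m I y (2 * h) g"
  and cor: "correlation_le (gram d (centered m g)) (real N) {..<N} (10 * h * max (sqrt (real N * real d)) (real N))"
  and S: "S <= {..<N}"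
 defines "L \<equiv> sqrt (real N * real d) + real N"
 shows "norm2 d (point_sum (centered m g) S) <= h\<^sup>2 * L"
  and "(\<Sum>i\<in>S. dot d (centered m g i) (point_sum (centered m g) (S - {i}))) <= rcard S * (20 * h * L)"
proof -
 let ?u = "centered m g" and ?Lm = "10 * h * max (sqrt (real N * real d)) (real N)"
 have fS: "finite S" "card S <= N" using S finite_subset card_mono[OF _ S] by auto
 have L: "0 <= L" "real N <= L" "sqrt (real N * real d) <= L" by (auto simp: L_def)
 have Lm: "0 <= ?Lm" "?Lm <= 10 * h * L" using h L by auto
 have s1: "1 <= sqrt (real d)" "sqrt (real d) * sqrt (real d) = d" using d by auto
 have "pair_sum (gram d ?u) S S <= rcard S * (h ^ 3 * d + 2 * ?Lm)"
 proof (rule pair_sum_self_le[OF fS(1) S _ _ cor Lm(1)])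
  show "rcard S <= real N" using fS by simp
  fix i assume "i \<in> S"
  hence "\<bar>dot d (?u i) (?u i) - d\<bar> <= (2 * h)\<^sup>2 * sqrt d" using reg S by (auto simp: regular_def regular_at_def)
  moreover have "(2 * h)\<^sup>2 * sqrt d <= (2 * h)\<^sup>2 * real d"
   using mult_right_mono[OF s1(1), of "sqrt d"] s1(2) by (intro mult_left_mono) auto
  moreover have "real d + 4 * (h\<^sup>2 * real d) <= h ^ 3 * real d"
   using pow_step[OF h, of "real d" 0] pow_step[OF h, of "real d" 1] pow_step[OF h, of "real d" 2] by (simp add: eval_nat_numeral)
  ultimately show "gram d ?u i i <= h ^ 3 * real d" by (simp add: gram_def power_mult_distrib)
 qed
 also have "... <= real N * (h ^ 3 * d + 2 * ?Lm)" using fS Lm h by (intro mult_right_mono) auto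
 also have "... <= h ^ 3 * (real N * real d) + 20 * h * (real N * L)"
 proof -
  have "real N * (2 * ?Lm) <= real N * (2 * (10 * h * L))" using Lm(2) by (intro mult_left_mono[OF _ of_nat_0_le_iff]) linarith
  thus ?thesis by (simp add: algebra_simps)
 qed
 also have "... <= h ^ 3 * L\<^sup>2 + 20 * h * L\<^sup>2"
 proof -
  have "real N * real d = (sqrt (real N * real d))\<^sup>2" by simp
  also have "... <= L\<^sup>2" using L by (intro power_mono) auto
  finally have "real N * real d <= L\<^sup>2" .
  moreover have "real N * L <= L\<^sup>2" using L by (simp add: power2_eq_square mult_right_mono)
  ultimately show ?thesis using h by (intro add_mono mult_left_mono) auto
 qed
 also have "... <= h ^ 4 * L\<^sup>2"
  using pow_step[OF h, of "L\<^sup>2" 1] pow_step[OF h, of "L\<^sup>2" 2] pow_step[OF h, of "L\<^sup>2" 3] by (simp add: eval_nat_numeral)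
 also have "... = (h\<^sup>2 * L)\<^sup>2" by (simp add: power_mult_distrib power_mult[symmetric])
 finally show "norm2 d (point_sum ?u S) <= h\<^sup>2 * L" unfolding norm2_eq_sqrt dot_point_sum using h L by (intro real_le_lsqrt) auto
 \<comment> \<open>The Gram matrix without its diagonal, so that \<open>pair_sum_self_le\<close>
   applies with \<open>D = 0\<close>.\<close>
 define G where "G i j = (if i = j then 0 else gram d ?u i j)" for i j
 have cG: "correlation_le G (real N) {..<N} ?Lm"
  unfolding correlation_le_def
 proof (intro allI impI)
  fix S T assume a: "S <= {..<N} & T <= {..<N} & S Int T = {} & rcard S <= real N & rcard T <= real N"
  hence "pair_sum G S T = pair_sum (gram d ?u) S T" unfolding pair_sum_def G_def by (intro sum.cong refl) auto
  thus "\<bar>pair_sum G S T\<bar> <= ?Lm * sqrt (rcard S * rcard T)" using correlation_leD[OF cor, of S T] a by simp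
 qed
 have "(\<Sum>i\<in>S. dot d (?u i) (point_sum ?u (S - {i}))) = pair_sum G S S"
  unfolding pair_sum_def
 proof (rule sum.cong[OF refl])
  fix i assume i: "i \<in> S"
  have "dot d (?u i) (point_sum ?u (S - {i})) = (\<Sum>j\<in>S - {i}. G i j)"
   unfolding dot_point_sum_right by (intro sum.cong) (auto simp: G_def gram_def)
  also have "... = (\<Sum>j\<in>S. G i j)" using i fS by (intro sum.mono_neutral_left) (auto simp: G_def)
  finally show "dot d (?u i) (point_sum ?u (S - {i})) = (\<Sum>j\<in>S. G i j)" .
 qed
 also have "... <= rcard S * (0 + 2 * ?Lm)"
  by (rule pair_sum_self_le[OF fS(1) S _ _ cG Lm(1)]) (use fS in \<open>auto simp: G_def\<close>)
 also have "... <= rcard S * (20 * h * L)" using Lm(2) by (intro mult_left_mono[OF _ of_nat_0_le_iff]) linarith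
 finally show "(\<Sum>i\<in>S. dot d (?u i) (point_sum ?u (S - {i}))) <= rcard S * (20 * h * L)" .
qed

lemma scale_tails:
 assumes nd: "2 <= n * d" and hdef: "h = 10 * ln (real n * real d)"
 shows "real (4 * n) * exp (- h) <= 1" "11 * (real (4 * n))\<^sup>2 * exp (- h\<^sup>2) <= 0.001" "36 * exp (- (2 * h)) <= 0.001"
proof -
 note sc = scale_ge_6[OF nd hdef]
 let ?x = "real n * real d"
 have x: "2 <= ?x" using nd by (metis of_nat_le_iff of_nat_mult of_nat_numeral)
 have nx: "real n <= ?x" using sc(2,3) by (auto simp: mult_le_cancel_left1)
 have "(2::real) ^ 9 <= ?x ^ 9" using x by (intro power_mono) auto
 hence "4 * real n <= ?x ^ 9 * ?x" using nx by (intro mult_mono) auto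
 also have "... = exp h" unfolding sc(7) by (simp add: power_Suc2[symmetric])
 finally have "real (4 * n) <= exp h" by simp
 thus "real (4 * n) * exp (- h) <= 1" by (simp add: exp_minus field_simps)
 have "(2::real) ^ 10 <= ?x ^ 10" using x by (intro power_mono) auto
 hence "1024 <= exp h" using sc(7) by simp
 hence "1024 * 1024 <= exp h * exp h" by (intro mult_mono) auto
 hence "1024 * 1024 <= exp (2 * h)" by (simp add: exp_add[symmetric])
 thus "36 * exp (- (2 * h)) <= 0.001" by (simp add: exp_minus field_simps)
 have "(2::real) ^ 58 <= ?x ^ 58" using x by (intro power_mono) auto
 hence "176000 * (real n)\<^sup>2 <= ?x ^ 58 * ?x\<^sup>2" using nx by (intro mult_mono power_mono) auto
 also have "... = ?x ^ 60" by (simp add: power_add[symmetric])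
 finally have "176000 * (real n)\<^sup>2 * exp (- h\<^sup>2) <= ?x ^ 60 * exp (- h\<^sup>2)" by (intro mult_right_mono) auto
 hence "176000 * (real n)\<^sup>2 * exp (- h\<^sup>2) <= 1" using sc(6) by linarith
 thus "11 * (real (4 * n))\<^sup>2 * exp (- h\<^sup>2) <= 0.001" by (simp add: power_mult_distrib)
qed

lemma pow_dominates:
 fixes h c :: real
 assumes "6 <= h" "c <= 6 ^ a" "a + j <= k"
 shows "c * h ^ j <= h ^ k"
proof -
 have "(6::real) ^ a <= h ^ a" using assms(1) by (intro power_mono) auto
 hence "c * h ^ j <= h ^ a * h ^ j" using assms by (intro mult_right_mono) auto
 also have "... = h ^ (a + j)" by (simp add: power_add)
 also have "... <= h ^ k" using assms by (intro power_increasing) auto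
 finally show ?thesis .
qed

text \<open>The corrupted points are a minority, so the subset contains more genuine points than it misses corrupted ones. This
  makes the union bound over all such subsets affordable.\<close>

lemma null_not_aligned:
 assumes h: "6 <= h" and d: "1 <= d" and N: "1 <= N" and I: "I <= {..<N}" "2 * card I < N"
  and reg: "regular d N (%_ _. 0) I y (2 * h) g"
  and cor: "correlation_le (gram d (centered (%_ _. 0) g)) (real N) {..<N} (10 * h * max (sqrt (real N * real d)) (real N))"
  and lin: "\<And>K C. K <= {..<N} ==> K ~= {} ==> C <= I ==> card C <= card K ==>
    \<bar>dot d (point_sum (centered (%_ _. 0) g) K) (point_sum y (I - C))\<bar> <= 2 * h * rcard K * norm2 d (point_sum y (I - C))"
 shows "~ aligned d N (N - card I) (h ^ 5) (sqrt (real N * real d) + real N) (mix I y g)"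
proof
 let ?X = "mix I y g" and ?u = "centered (%_ _. 0) g"
 define L where "L = sqrt (real N * real d) + real N"
 have L: "0 < L" using N unfolding L_def by (intro add_nonneg_pos) auto
 assume "aligned d N (N - card I) (h ^ 5) (sqrt (real N * real d) + real N) ?X"
 then obtain S where S: "S <= {..<N}" "card S = N - card I"
  and al: "\<And>i. i \<in> S ==> h ^ 5 * (norm2 d (point_sum ?X (S - {i})) + L) <= dot d (?X i) (point_sum ?X (S - {i}))"
  unfolding aligned_def L_def[symmetric] by auto
 have fin: "finite S" "finite I" using S I finite_subset by auto
 define K where "K = S - I"
 define Y where "Y = point_sum y (S Int I)"
 have cS: "card S = card K + card (S Int I)" unfolding K_def using card_Diff_subset_Int[of S I] fin card_mono[of S "S Int I"] by simp
 have cI: "card I = card (I - S) + card (S Int I)" using card_Diff_subset_Int[of I S] fin card_mono[of I "S Int I"] by (simp add: Int_commute)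
 have "card (I - S) < card K" using cS cI S(2) I(2) by linarith
 hence kc: "card (I - S) <= card K" and K0: "0 < card K" by auto
 have Kne: "K ~= {}" using K0 by auto
 have KN: "K <= {..<N}" using S by (auto simp: K_def)
 have II: "I - (I - S) = S Int I" by auto
 let ?W = "%i. point_sum ?X (S - {i})"
 have W: "?W i = (%j. point_sum ?u (K - {i}) j + Y j)" if "i \<in> K" for i
 proof
  fix j
  have "S - {i} = (K - {i}) Un (S Int I)" "(K - {i}) Int (S Int I) = {}" using that by (auto simp: K_def)
  hence "?W i j = (\<Sum>k\<in>K - {i}. ?X k j) + (\<Sum>k\<in>S Int I. ?X k j)"
   unfolding point_sum_def using fin by (simp add: sum.union_disjoint K_def)
  also have "(\<Sum>k\<in>K - {i}. ?X k j) = point_sum ?u (K - {i}) j"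
   unfolding point_sum_def by (intro sum.cong refl) (auto simp: K_def mix_def centered_def)
  also have "(\<Sum>k\<in>S Int I. ?X k j) = Y j" unfolding Y_def point_sum_def by (intro sum.cong refl) (auto simp: mix_def)
  finally show "?W i j = point_sum ?u (K - {i}) j + Y j" .
 qed
 have Xu: "?X i = ?u i" if "i \<in> K" for i using that by (auto simp: K_def mix_def centered_def)
 have bd: "norm2 d (point_sum ?u (K - {i})) <= h\<^sup>2 * L" for i
  using noise_sum_bounds(1)[OF h d reg cor, of "K - {i}"] KN by (auto simp: L_def)
 define a where "a = (\<Sum>i\<in>K. norm2 d (?W i))"
 have a0: "0 <= a" unfolding a_def by (intro sum_nonneg norm2_nonneg)
 let ?k = "rcard K"
 have kY: "?k * norm2 d Y <= a + ?k * (h\<^sup>2 * L)"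
 proof -
  have "norm2 d Y <= norm2 d (?W i) + h\<^sup>2 * L" if "i \<in> K" for i
   using norm2_minus_le[of d Y "point_sum ?u (K - {i})"] bd[of i] unfolding W[OF that] by linarith
  hence "(\<Sum>i\<in>K. norm2 d Y) <= (\<Sum>i\<in>K. norm2 d (?W i) + h\<^sup>2 * L)" by (rule sum_mono)
  thus ?thesis by (simp add: a_def sum.distrib)
 qed
 \<comment> \<open>Alignment is summed over the genuine points of the subset only. Its corrupted
   part \<open>Y\<close> is a fixed vector, towards which the sum of their noise is small by
   \<open>lin\<close>.\<close>
 have "h ^ 5 * (a + ?k * L) = (\<Sum>i\<in>K. h ^ 5 * (norm2 d (?W i) + L))"
  by (simp add: a_def sum.distrib sum_distrib_left distrib_left)
 also have "... <= (\<Sum>i\<in>K. dot d (?X i) (?W i))" by (intro sum_mono al) (auto simp: K_def)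
 also have "... = (\<Sum>i\<in>K. dot d (?u i) (point_sum ?u (K - {i})) + dot d (?u i) Y)"
 proof (rule sum.cong[OF refl])
  fix i assume i: "i \<in> K"
  show "dot d (?X i) (?W i) = dot d (?u i) (point_sum ?u (K - {i})) + dot d (?u i) Y"
   unfolding W[OF i] Xu[OF i] by (rule dot_add_right)
 qed
 also have "... = (\<Sum>i\<in>K. dot d (?u i) (point_sum ?u (K - {i}))) + dot d (point_sum ?u K) Y"
  by (simp add: sum.distrib dot_commute[of d _ Y] dot_point_sum_right)
 also have "... <= ?k * (20 * h * L) + 2 * h * (a + ?k * (h\<^sup>2 * L))"
 proof -
  have "(\<Sum>i\<in>K. dot d (?u i) (point_sum ?u (K - {i}))) <= ?k * (20 * h * L)"
   using noise_sum_bounds(2)[OF h d reg cor KN] by (simp add: L_def)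
  moreover have "\<bar>dot d (point_sum ?u K) Y\<bar> <= 2 * h * ?k * norm2 d Y"
   using lin[OF KN Kne _ kc] unfolding II Y_def by blast
  moreover have "2 * h * (?k * norm2 d Y) <= 2 * h * (a + ?k * (h\<^sup>2 * L))" using kY h by (intro mult_left_mono) auto
  ultimately show ?thesis by (simp add: mult.assoc)
 qed
 finally have fin: "h ^ 5 * (a + ?k * L) <= ?k * (20 * h * L) + 2 * h * (a + ?k * (h\<^sup>2 * L))" .
 define b where "b = ?k * L"
 have b: "0 < b" using K0 L by (simp add: b_def)
 have f: "h ^ 5 * a + h ^ 5 * b <= 20 * (h * b) + 2 * (h * a) + 2 * (h ^ 3 * b)"
  using fin by (simp add: b_def algebra_simps eval_nat_numeral)
 have "2 * (h * a) <= h ^ 5 * a"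
  using pow_step[OF h a0, of 1] pow_step[OF h a0, of 2] pow_step[OF h a0, of 3] pow_step[OF h a0, of 4] by (simp add: eval_nat_numeral)
 moreover have "20 * (h * b) + 2 * (h ^ 3 * b) < h ^ 5 * b"
 proof -
  have "20 * h ^ 1 <= h ^ 4" by (rule pow_dominates[OF h, of _ 2]) auto
  moreover have "2 * h ^ 3 <= h ^ 4" by (rule pow_dominates[OF h, of _ 1]) auto
  moreover have "6 * h ^ 4 <= h ^ 5" by (rule pow_dominates[OF h, of _ 1]) auto
  moreover have "0 < h ^ 4" using h by simp
  ultimately have "20 * h + 2 * h ^ 3 < h ^ 5" unfolding power_one_right by linarith
  hence "(20 * h + 2 * h ^ 3) * b < h ^ 5 * b" using b by (rule mult_strict_right_mono)
  thus ?thesis by (simp only: distrib_right mult.assoc)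
 qed
 ultimately show False using f by linarith
qed

text \<open>The witness is the genuine sample itself. For each of its points the sum of the
  \<open>r\<close> others is about \<open>r\<close> times \<open>mu\<close>, and the inner product
  of the point with it is about \<open>r\<close> times the squared norm of \<open>mu\<close>;
  everything else is noise of lower order.\<close>

lemma alternative_aligned:
 assumes h: "6 <= h" and d: "1 <= d" and N: "1 <= N" and I: "I <= {..<N}" "2 * card I < N" "even N"
  and reg: "regular d N (%_. mu) I y (2 * h) g"
  and cor: "correlation_le (gram d (centered (%_. mu) g)) (real N) {..<N} (10 * h * max (sqrt (real N * real d)) (real N))"
  and mu: "h ^ 14 * (sqrt (real d / real N) + 1) <= (norm2 d mu)\<^sup>2"
  and fresh: "\<And>i. i \<in> {..<N} - I ==> \<bar>dot d (centered (%_. mu) g i) (point_sum (mix I y g) ({..<N} - I - {i}))\<bar>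
    <= 2 * h * norm2 d (point_sum (mix I y g) ({..<N} - I - {i}))"
 shows "aligned d N (N - card I) (h ^ 5) (sqrt (real N * real d) + real N) (mix I y g)"
proof -
 let ?X = "mix I y g" and ?u = "centered (%_. mu) g" and ?S = "{..<N} - I"
 define L where "L = sqrt (real N * real d) + real N"
 have L: "0 <= L" unfolding L_def by simp
 have cS: "card ?S = N - card I" using I(1) by (subst card_Diff_subset) (auto intro: finite_subset)
 define \<nu> where "\<nu> = norm2 d mu"
 have \<nu>0: "0 <= \<nu>" by (simp add: \<nu>_def norm2_nonneg)
 have h0: "0 <= h" using h by simp
 have \<nu>h: "h ^ 7 <= \<nu>"
 proof -
  have "h ^ 14 * 1 <= h ^ 14 * (sqrt (real d / real N) + 1)" using h0 by (intro mult_left_mono) auto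
  hence "(h ^ 7)\<^sup>2 <= \<nu>\<^sup>2" using mu by (simp add: \<nu>_def power_mult[symmetric])
  thus ?thesis using \<nu>0 by (rule power2_le_imp_le)
 qed
 have "h ^ 5 * (norm2 d (point_sum ?X (?S - {i})) + L) <= dot d (?X i) (point_sum ?X (?S - {i}))" if i: "i \<in> ?S" for i
 proof -
  let ?T = "?S - {i}"
  define r where "r = rcard ?T"
  have "card ?T = N - card I - 1" using i cS by simp
  \<comment> \<open>Parity matters: for even \<open>N\<close> the strict inequality gives
    \<open>2 * card I <= N - 2\<close>, so even after removing the point \<open>i\<close> at least
    half of all points are genuine.\<close>
  moreover have "N <= 2 * (N - card I - 1)" using I(2,3) by presburger
  ultimately have r: "real N <= 2 * r" unfolding r_def by linarith
  have r0: "0 <= r" by (simp add: r_def)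
  let ?W = "point_sum ?X ?T" and ?U = "point_sum ?u ?T"
  have W: "?W = (%j. ?U j + r * mu j)"
  proof
   fix j
   have "?W j = (\<Sum>k\<in>?T. ?u k j + mu j)" unfolding point_sum_def by (intro sum.cong refl) (auto simp: mix_def centered_def)
   thus "?W j = ?U j + r * mu j" by (simp add: sum.distrib point_sum_def r_def)
  qed
  have U: "norm2 d ?U <= h\<^sup>2 * L" using noise_sum_bounds(1)[OF h d reg cor, of ?T] by (auto simp: L_def)
  have nW: "norm2 d ?W <= h\<^sup>2 * L + r * \<nu>"
   using norm2_triangle[of d ?U "%j. r * mu j"] U r0 unfolding W by (simp add: norm2_scale \<nu>_def)
  have "\<bar>dot d mu ?U\<bar> <= (\<Sum>k\<in>?T. 2 * h * \<nu>)"
   unfolding dot_point_sum_right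
  proof (rule order_trans[OF sum_abs sum_mono])
   fix k assume k: "k \<in> ?T"
   thus "\<bar>dot d mu (?u k)\<bar> <= 2 * h * \<nu>"
    using reg i by (subst dot_commute) (auto simp: regular_def regular_at_def \<nu>_def)
  qed
  hence mU: "\<bar>dot d mu ?U\<bar> <= 2 * h * (r * \<nu>)" by (simp add: r_def mult_ac)
  have Xi: "dot d (?X i) ?W = dot d (?u i) ?W + dot d mu ?W"
   using dot_centered[of d g i ?W "%_. mu"] i by (simp add: mix_def)
  have mW: "dot d mu ?W = dot d mu ?U + r * \<nu>\<^sup>2" unfolding W dot_add_right by (simp add: dot_scale \<nu>_def norm2_power2)
  have uW: "\<bar>dot d (?u i) ?W\<bar> <= 2 * h * norm2 d ?W" using fresh[OF i] .
  have big: "h ^ 14 * L <= 2 * (r * \<nu>\<^sup>2)"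
  proof -
   have "real N * sqrt (real d / real N) = sqrt ((real N)\<^sup>2 * (real d / real N))" by (simp only: real_sqrt_mult real_sqrt_abs abs_of_nat)
   also have "(real N)\<^sup>2 * (real d / real N) = real N * real d" using N by (simp add: power2_eq_square)
   finally have "L = real N * (sqrt (real d / real N) + 1)" by (simp add: L_def distrib_left)
   hence "h ^ 14 * L = real N * (h ^ 14 * (sqrt (real d / real N) + 1))" by simp
   also have "... <= (2 * r) * \<nu>\<^sup>2" using r mu h0 by (intro mult_mono) (auto simp: \<nu>_def)
   finally show ?thesis by simp
  qed
  define q where "q = r * \<nu>"
  have q0: "0 <= q" using r0 \<nu>0 by (simp add: q_def)
  have q1: "h ^ 7 * q <= r * \<nu>\<^sup>2"
   using mult_right_mono[OF \<nu>h q0] by (simp add: q_def power2_eq_square mult_ac)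
  have c: "(h ^ 5 + 2 * h) * norm2 d ?W <= (h ^ 5 + 2 * h) * (h\<^sup>2 * L + q)" using nW h0 by (intro mult_left_mono) (auto simp: q_def)
  have "(h ^ 5 + 2 * h) * (h\<^sup>2 * L + q) + h ^ 5 * L + 2 * h * q <= r * \<nu>\<^sup>2"
  proof -
   have e: "(h ^ 5 + 2 * h) * (h\<^sup>2 * L + q) + h ^ 5 * L + 2 * h * q = h ^ 7 * L + 2 * (h ^ 3 * L) + h ^ 5 * L + h ^ 5 * q + 4 * (h * q)"
    by (simp add: algebra_simps eval_nat_numeral)
   note l = pow_step[OF h L]
   have m: "h ^ j * L <= h ^ k * L" if "j <= k" for j k using L h that by (intro mult_right_mono power_increasing) auto
   have "4 * (h ^ 7 * L) <= h ^ 8 * L" using l[of 7] by (simp add: eval_nat_numeral)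
   moreover have "6 * (h ^ 8 * L) <= h ^ 14 * L" using l(1)[of 8] m[of 9 14] by (simp add: eval_nat_numeral)
   moreover have "h ^ 3 * L <= h ^ 7 * L" "h ^ 5 * L <= h ^ 7 * L" by (rule m, simp)+
   moreover have "h ^ 5 * q + 4 * (h * q) <= h ^ 7 * q / 3"
    using pow_step[OF h q0, of 1] pow_step[OF h q0, of 2] pow_step[OF h q0, of 3] pow_step[OF h q0, of 4] pow_step[OF h q0, of 5] pow_step[OF h q0, of 6]
    by (simp add: eval_nat_numeral)
   ultimately show ?thesis unfolding e using big q1 mult_nonneg_nonneg[OF r0 zero_le_power2[of \<nu>]] by linarith
  qed
  thus ?thesis using c uW mU Xi mW by (simp add: q_def algebra_simps abs_le_iff)
 qed
 thus ?thesis unfolding aligned_def L_def[symmetric] by (intro bexI[of _ ?S]) (use cS in auto)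
qed

text \<open>Since \<epsilon> < 1, contamination at rate \<epsilon>/2 leaves a strict majority of
  genuine points; the sample size \<open>4 * n\<close> is even, as
  \<open>alternative_aligned\<close> requires.\<close>

lemma solves_large_mean:
 assumes nd: "2 <= n * d" and hdef: "h = 10 * ln (real n * real d)" and eps: "0 < eps" "eps < 1"
  and large: "h ^ 14 * (sqrt (real d / real n) + 1) <= \<alpha>\<^sup>2" and \<alpha>: "0 < \<alpha>" and p1: "p <= 1"
 shows "\<exists>B. solves_oblivious d \<alpha> (eps / 2) (4 * n) (p - 0.01) B"
proof -
 define N where "N = 4 * n"
 define L where "L = sqrt (real N * real d) + real N"
 define s where "s = N - num_corrupt (eps / 2) N"
 define B where "B X = return_pmf (if aligned d N s (h ^ 5) L X then Alternative else Null)" for X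
 note sc = scale_ge_6[OF nd hdef]
 have N1: "1 <= N" using sc(2) by (simp add: N_def)
 have two: "2 * num_corrupt (eps / 2) N < N"
 proof -
  have "real_of_int \<lfloor>eps / 2 * real N\<rfloor> <= eps / 2 * real N" by (rule of_int_floor_le)
  moreover have "eps / 2 * real N < real N / 2" using eps N1 by simp
  moreover have "0 <= eps / 2 * real N" using eps by simp
  ultimately have "real (num_corrupt (eps / 2) N) < real N / 2" unfolding num_corrupt_def by (simp add: of_nat_nat)
  thus ?thesis by linarith
 qed
 note tl = scale_tails[OF nd hdef, folded N_def]
 have Ne: "real N * exp (- h) <= 1" "real N * exp (- (2 * h)) <= 1"
 proof -
  show a: "real N * exp (- h) <= 1" by (rule tl(1))
  have "real N * exp (- (2 * h)) <= real N * exp (- h)" using sc(1) by (intro mult_left_mono) auto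
  thus "real N * exp (- (2 * h)) <= 1" using a by linarith
 qed
 note e2h = tl(3) and eh2 = tl(2)
 have "solves_oblivious d \<alpha> (eps / 2) N (p - 0.01) B"
 proof (rule solves_obliviousI)
  have m: "Measurable.pred (data_space d N) (aligned d N s (h ^ 5) L)" by (rule measurable_aligned)
  show "B \<in> algorithms d N" unfolding algorithms_def
  proof (intro CollectI allI)
   fix hh
   have "(%X. if aligned d N s (h ^ 5) L X then pmf (return_pmf Alternative) hh else pmf (return_pmf Null) hh) \<in> borel_measurable (data_space d N)"
    by (rule measurable_If) (use m in \<open>auto simp: pred_def\<close>)
   thus "(%X. pmf (B X) hh) \<in> borel_measurable (data_space d N)"
    unfolding B_def by (simp only: if_distrib[of "%z. pmf (return_pmf z) hh"])
  qed
  show "eps / 2 <= 1" using eps by simp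
  fix mu hyp I y assume adm: "admissible d \<alpha> mu hyp" and I: "I <= {..<N}" "card I = num_corrupt (eps / 2) N" and y: "y \<in> space (data_space d N)"
  let ?E = "gaussian_data d N (%_. mu)"
  interpret prob_space ?E by (rule prob_space_gaussian_data)
  have sI: "s = N - card I" and tI: "2 * card I < N" using I(2) two by (auto simp: s_def)
  let ?u = "centered (%_. mu)"
  define E1 where "E1 = {g\<in>space ?E. ~ regular d N (%_. mu) I y (2 * h) g}"
  define E2 where "E2 = {g\<in>space ?E. ~ correlation_le (gram d (?u g)) (real N) {..<N} (10 * h * max (sqrt (real N * real d)) (real N))}"
  define E3 where "E3 = {g\<in>space ?E. \<exists>K\<in>Pow {..<N} - {{}}. \<exists>C\<in>Pow I. card C <= card K &
   2 * h * rcard K * norm2 d (point_sum y (I - C)) < \<bar>dot d (point_sum (?u g) K) (point_sum y (I - C))\<bar>}"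
  \<comment> \<open>The sum of the other genuine points is random but does not involve point
    \<open>i\<close>, so it is a single fresh test for that point.\<close>
  define F where "F i = {g\<in>space ?E. \<exists>i'\<in>{i}. \<exists>f\<in>{{..<N} - I - {i}}. 2 * h * norm2 d (point_sum (mix I y g) f) < \<bar>dot d (?u g i') (point_sum (mix I y g) f)\<bar>}" for i
  have E1: "E1 \<in> sets ?E" "prob E1 <= 9 * (real N)\<^sup>2 * exp (- ((2 * h)\<^sup>2 / 4))"
   unfolding E1_def by (rule prob_not_regular; use sc N1 I in simp)+
  have E2: "E2 \<in> sets ?E" "prob E2 <= 18 * exp (- (2 * h))"
   unfolding E2_def by (rule prob_correlated; use sc N1 Ne in simp)+
  have h6: "6 * (2 * h) <= (2 * h)\<^sup>2" using sc(1) mult_right_mono[of 6 h h] by (simp add: power2_eq_square)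
  have E3: "E3 \<in> sets ?E" "prob E3 <= 18 * exp (- (2 * h))"
   unfolding E3_def by (rule prob_linear_sums[OF I(1) _ h6]; use sc Ne in simp)+
  have F: "F i \<in> sets ?E" "prob (F i) <= real N * (1 * (2 * exp (- ((2 * h)\<^sup>2 / 2))))" if i: "i \<in> {..<N} - I" for i
  proof -
   have V: "(%_::nat => nat => real. {{..<N} - I - {i}}) \<in> measurable (data_space d N) (count_space (Pow (Pow {..<N})))" by (rule measurable_const) auto
   have J: "{i} <= {..<N}" and t: "0 < 2 * h" using i sc(1) by auto
   show "F i \<in> sets ?E" unfolding F_def by (rule prob_fresh_tests(1)[where b=1, OF J V t]) (use y in auto)
   show "prob (F i) <= real N * (1 * (2 * exp (- ((2 * h)\<^sup>2 / 2))))" unfolding F_def by (rule prob_fresh_tests(2)[OF J V t]) (use y in auto)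
  qed
  define E where "E = E1 Un E2 Un E3 Un (\<Union>i\<in>{..<N} - I. F i)"
  have mF: "(\<Union>i\<in>{..<N} - I. F i) \<in> sets ?E" using F(1) by auto
  have mE: "E \<in> sets ?E" unfolding E_def using E1 E2 E3 mF by auto
  have pE: "prob E <= 0.01"
  proof -
   have "prob (\<Union>i\<in>{..<N} - I. F i) <= (\<Sum>i\<in>{..<N} - I. prob (F i))" using F(1) by (intro finite_measure_subadditive_finite) auto
   also have "... <= (\<Sum>i\<in>{..<N} - I. real N * (1 * (2 * exp (- ((2 * h)\<^sup>2 / 2)))))" by (intro sum_mono F(2))
   also have "... <= real N * (real N * (1 * (2 * exp (- ((2 * h)\<^sup>2 / 2)))))"
   proof -
    have "card ({..<N} - I) <= N" using card_mono[of "{..<N}" "{..<N} - I"] by auto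
    thus ?thesis by (simp add: mult_right_mono)
   qed
   also have "... <= 2 * (real N)\<^sup>2 * exp (- h\<^sup>2)"
    by (simp add: power2_eq_square mult_left_mono mult.assoc[symmetric] power_mult_distrib)
   finally have f: "prob (\<Union>i\<in>{..<N} - I. F i) <= 2 * (real N)\<^sup>2 * exp (- h\<^sup>2)" .
   have "prob E <= prob E1 + prob E2 + prob E3 + prob (\<Union>i\<in>{..<N} - I. F i)"
    unfolding E_def using measure_Un_le[of "E1 Un E2 Un E3" ?E "\<Union>i\<in>{..<N} - I. F i"] measure_Un_le[of "E1 Un E2" ?E E3] measure_Un_le[of E1 ?E E2] E1 E2 E3 mF by auto
   also have "... <= 11 * (real N)\<^sup>2 * exp (- h\<^sup>2) + 36 * exp (- (2 * h))"
    using E1(2) E2(2) E3(2) f by (simp add: power_mult_distrib)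
   finally show ?thesis using eh2 e2h by simp
  qed
  have ok: "pmf (B (mix I y g)) hyp = 1" if g: "g \<in> space ?E" "g \<notin> E" for g
  proof -
   have reg: "regular d N (%_. mu) I y (2 * h) g"
    and cor: "correlation_le (gram d (?u g)) (real N) {..<N} (10 * h * max (sqrt (real N * real d)) (real N))"
    using g by (auto simp: E_def E1_def E2_def)
   consider "mu = (%_. 0)" "hyp = Null" | "\<alpha> <= norm2 d mu" "hyp = Alternative" using adm by (auto simp: admissible_def)
   thus ?thesis
   proof cases
    case 1
    have "~ aligned d N (N - card I) (h ^ 5) (sqrt (real N * real d) + real N) (mix I y g)"
    proof (rule null_not_aligned[OF sc(1,3) N1 I(1) tI])
     fix K C assume "K <= {..<N}" "K ~= {}" "C <= I" "card C <= card K"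
     thus "\<bar>dot d (point_sum (centered (%_ _. 0) g) K) (point_sum y (I - C))\<bar> <= 2 * h * rcard K * norm2 d (point_sum y (I - C))"
      using g unfolding E_def E3_def 1 by (auto simp: not_less)
    qed (use reg cor 1 in auto)
    thus ?thesis using 1 by (simp add: B_def sI L_def)
   next
    case 2
    have "aligned d N (N - card I) (h ^ 5) (sqrt (real N * real d) + real N) (mix I y g)"
    proof (rule alternative_aligned[OF sc(1,3) N1 I(1) tI _ reg cor])
     show "even N" by (simp add: N_def)
     have "real d / real N <= real d / real n" using sc(2) by (intro divide_left_mono) (auto simp: N_def)
     hence "sqrt (real d / real N) + 1 <= sqrt (real d / real n) + 1" by (simp only: add_le_cancel_right real_sqrt_le_iff)
     hence "h ^ 14 * (sqrt (real d / real N) + 1) <= h ^ 14 * (sqrt (real d / real n) + 1)" using sc(1) by (intro mult_left_mono) auto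
     also have "... <= \<alpha>\<^sup>2" by (rule large)
     also have "... <= (norm2 d mu)\<^sup>2" using 2 \<alpha> by (intro power_mono) auto
     finally show "h ^ 14 * (sqrt (real d / real N) + 1) <= (norm2 d mu)\<^sup>2" .
     fix i assume "i \<in> {..<N} - I"
     thus "\<bar>dot d (?u g i) (point_sum (mix I y g) ({..<N} - I - {i}))\<bar> <= 2 * h * norm2 d (point_sum (mix I y g) ({..<N} - I - {i}))"
      using g unfolding E_def F_def by (auto simp: not_less)
    qed
    thus ?thesis using 2 by (simp add: B_def sI L_def)
   qed
  qed
  have "ennreal (p - 0.01) <= ennreal (prob (space ?E - E))" using pE p1 by (intro ennreal_leI) (simp add: prob_compl[OF mE])
  also have "... = (\<integral>\<^sup>+g. indicator (space ?E - E) g \<partial>?E)" using mE by (simp add: emeasure_eq_measure)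
  also have "... <= (\<integral>\<^sup>+g. ennreal (pmf (B (mix I y g)) hyp) \<partial>?E)"
   by (rule nn_integral_mono) (use ok in \<open>auto simp: indicator_def\<close>)
  finally show "ennreal (p - 0.01) <= (\<integral>\<^sup>+g. ennreal (pmf (B (mix I y g)) hyp) \<partial>?E)" .
 qed
 thus ?thesis unfolding N_def by blast
qed

section \<open>Many corrupted points\<close>

lemma prob_random_subset_deviation:
 assumes A: "finite A" "S <= A" and q: "0 <= q" "q <= 1" and t: "0 < t"
 shows "pprob (random_subset q A) {b. t <= \<bar>rcard (S Int b) - q * rcard S\<bar>} <= q * rcard S / t\<^sup>2"
proof -
 let ?w = "%y. of_bool (y \<in> S) :: real"
 have fS: "finite S" using A finite_subset by blast
 have c: "(\<Sum>y\<in>b. ?w y) = rcard (S Int b)" if "b <= A" for b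
  using finite_subset[OF that A(1)] by (simp add: sum.If_cases of_bool_def Int_commute)
 have cA: "(\<Sum>y\<in>A. ?w y) = rcard S" using c[of A] A(2) by (simp add: Int_absorb2)
 have "pprob (random_subset q A) {b. t <= \<bar>rcard (S Int b) - q * rcard S\<bar>}
   = subset_avg q A (%b. of_bool (t <= \<bar>rcard (S Int b) - q * rcard S\<bar>))" by (rule prob_random_subset[OF A(1) q])
 also have "... <= subset_avg q A (%b. ((\<Sum>y\<in>b. ?w y) - q * (\<Sum>y\<in>A. ?w y))\<^sup>2 / t\<^sup>2)"
 proof (rule subset_avg_prob_le[OF q])
  fix b assume b: "b <= A" and "t <= \<bar>rcard (S Int b) - q * rcard S\<bar>"
  hence "t\<^sup>2 <= \<bar>rcard (S Int b) - q * rcard S\<bar>\<^sup>2" using t by (intro power_mono) auto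
  thus "1 <= ((\<Sum>y\<in>b. ?w y) - q * (\<Sum>y\<in>A. ?w y))\<^sup>2 / t\<^sup>2" using t c[OF b] cA by simp
 qed simp
 also have "... = q * (1 - q) * (\<Sum>y\<in>A. (?w y)\<^sup>2) / t\<^sup>2"
  unfolding subset_avg_divide by (simp only: subset_avg_variance[OF A(1)])
 also have "(\<Sum>y\<in>A. (?w y)\<^sup>2) = rcard S"
 proof -
  have "(\<Sum>y\<in>A. (?w y)\<^sup>2) = (\<Sum>y\<in>A. ?w y)" by (intro sum.cong) auto
  thus ?thesis using cA by simp
 qed
 also have "q * (1 - q) * rcard S / t\<^sup>2 <= q * rcard S / t\<^sup>2"
 proof -
  have "q * (1 - q) <= q * 1" using q by (intro mult_left_mono) auto
  hence "q * (1 - q) * rcard S <= q * rcard S" using mult_right_mono[of "q * (1 - q)" q "rcard S"] by simp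
  thus ?thesis by (rule divide_right_mono) simp
 qed
 finally show ?thesis .
qed

lemma prob_replicate_exists_le:
 assumes "pprob p {x. Q x} <= a" "0 <= a"
 shows "pprob (replicate_pmf k p) {xs. \<exists>x\<in>set xs. Q x} <= real k * a"
proof (induction k)
 case (Suc k)
 have "pprob (replicate_pmf (Suc k) p) {xs. \<exists>x\<in>set xs. Q x} <= a + real k * a"
 proof (rule prob_replicate_Suc_le[where G="%x. ~ Q x"])
  show "pprob (replicate_pmf k p) {xs. \<exists>z\<in>set (x # xs). Q z} <= real k * a" if "~ Q x" for x
   using that Suc by simp
 qed (use assms in auto)
 thus ?case by (simp add: algebra_simps)
qed simp

lemma prob_pair_fst: "pprob (pair_pmf p q) {w. Q (fst w)} = pprob p {x. Q x}"
 using measure_map_pmf[of fst "pair_pmf p q" "{x. Q x}"] by (simp add: map_fst_pair_pmf vimage_def)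

lemma prob_pair_snd: "pprob (pair_pmf p q) {w. Q (snd w)} = pprob q {x. Q x}"
 using measure_map_pmf[of snd "pair_pmf p q" "{x. Q x}"] by (simp add: map_snd_pair_pmf vimage_def)

lemma prob_pair_le:
 assumes "\<And>x. x \<in> set_pmf p ==> pprob q {z. Q x z} <= c" "0 <= c"
 shows "pprob (pair_pmf p q) {w. Q (fst w) (snd w)} <= c"
proof -
 have "pprob (bind_pmf p (%x. map_pmf (Pair x) q)) {w. Q (fst w) (snd w)} <= 0 + c"
 proof (rule prob_bind_le[where G="%_. True"])
  fix x assume "x \<in> set_pmf p"
  thus "pprob (map_pmf (Pair x) q) {w. Q (fst w) (snd w)} <= c"
   using assms(1) by (simp add: vimage_def)
 qed (use assms in auto)
 moreover have "bind_pmf p (%x. map_pmf (Pair x) q) = pair_pmf p q" by (simp add: pair_pmf_def map_pmf_def)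
 ultimately show ?thesis by simp
qed

lemma measurable_info_pair:
 assumes f: "f \<in> measurable M (count_space A)" and g: "g \<in> measurable M (count_space B)" and c: "countable A"
 shows "(%x. (f x, g x)) \<in> measurable M (count_space (A \<times> B))"
proof (rule measurable_compose_countable'[OF _ f c])
 fix a assume "a \<in> A"
 thus "(%x. (a, g x)) \<in> measurable M (count_space (A \<times> B))"
  by (intro measurable_compose[OF g]) auto
qed

lemma measurable_of_info:
 assumes "f \<in> measurable M (count_space A)" "\<And>a. a \<in> A ==> \<Phi> a \<in> B"
 shows "(%x. \<Phi> (f x)) \<in> measurable M (count_space B)"
 by (rule measurable_compose[OF assms(1)]) (use assms(2) in auto)

definition prefilter :: "nat => nat => real => nat set => (nat => nat => real) => nat set" where
 "prefilter d N h P X = {i\<in>{..<N}. i \<notin> P & norm_ok d h X i & 2 * card {j\<in>P. conflict d (h ^ 6) X i j} < card P}"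

definition cleaned :: "nat => nat => real => nat set => (nat => nat => real) => nat set" where
 "cleaned d N h P X = {i\<in>{..<N}. i \<in> prefilter d N h P X & (\<forall>j\<in>{..<N}. j \<in> prefilter d N h P X --> j ~= i --> ~ conflict d (h ^ 7) X i j)}"

text \<open>What \<open>cleaned\<close> returns on typical data, expressed without looking at genuine samples outside the reference set \<open>P\<close>.\<close>

definition cleaned_ideal :: "nat => nat => real => nat set => nat set => (nat => nat => real) => nat set" where
 "cleaned_ideal d N h I P X = {i\<in>{..<N}. i \<notin> P & (i \<notin> I \<or> i \<in> prefilter d N h P X &
   (\<forall>j\<in>{..<N}. j \<in> I Int prefilter d N h P X --> j ~= i --> ~ conflict d (h ^ 7) X i j))}"

lemma measurable_prefilter:
 assumes P: "P <= {..<N}"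
 shows "prefilter d N h P \<in> measurable (data_space d N) (count_space (Pow {..<N}))"
proof -
 have fP: "finite P" using P finite_subset by blast
 have 1: "Measurable.pred (data_space d N) (%X. 2 * card {j\<in>P. conflict d (h ^ 6) X i j} < card P)" if "i \<in> {..<N}" for i
  by (rule measurable_of_finite_info[where \<Phi>="%S. 2 * card S < card P", OF measurable_Collect_finite[OF fP]])
   (rule measurable_conflict, use that P in auto)
 show ?thesis unfolding prefilter_def[abs_def]
  by (intro measurable_Collect_finite pred_intros_logic 1) (use measurable_norm_ok in auto)
qed

lemma measurable_cleaned:
 assumes P: "P <= {..<N}"
 shows "cleaned d N h P \<in> measurable (data_space d N) (count_space (Pow {..<N}))"
  and "cleaned_ideal d N h I P \<in> measurable (data_space d N) (count_space (Pow {..<N}))"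
proof -
 have 2: "Measurable.pred (data_space d N) (%X. i \<in> prefilter d N h P X)" for i
  by (rule measurable_of_finite_info[OF measurable_prefilter[OF P]])
 have 3: "Measurable.pred (data_space d N) (%X. i \<in> I Int prefilter d N h P X)" for i
  by (rule measurable_of_finite_info[OF measurable_prefilter[OF P]])
 show "cleaned d N h P \<in> measurable (data_space d N) (count_space (Pow {..<N}))"
  unfolding cleaned_def[abs_def]
  by (intro measurable_Collect_finite pred_intros_logic pred_intros_finite 2) (use measurable_conflict in auto)
 show "cleaned_ideal d N h I P \<in> measurable (data_space d N) (count_space (Pow {..<N}))"
  unfolding cleaned_ideal_def[abs_def]
  by (intro measurable_Collect_finite pred_intros_logic pred_intros_finite 2 3) (use measurable_conflict in auto)
qed

lemma measurable_exceeds: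
 assumes "i < N" "f <= {..<N}"
 shows "Measurable.pred (data_space d N) (%X. exceeds c (gram d X) i f)"
proof -
 have a: "(%X. \<Sum>j\<in>f. gram d X i j) \<in> borel_measurable (data_space d N)"
  unfolding gram_def by (intro borel_measurable_sum measurable_dot_data) (use assms in auto)
 have b: "(%X. pair_sum (gram d X) f f) \<in> borel_measurable (data_space d N)"
  unfolding gram_def pair_sum_def by (intro borel_measurable_sum measurable_dot_data) (use assms in auto)
 have "(%X. c * sqrt (pair_sum (gram d X) f f)) \<in> borel_measurable (data_space d N)"
  by (rule borel_measurable_times[OF borel_measurable_const measurable_compose[OF b borel_measurable_sqrt]])
 thus ?thesis unfolding exceeds_def pred_def by (rule borel_measurable_less[OF _ borel_measurable_abs[OF a]])
qed

text \<open>All comparisons that the filter can make, as one function of the data with finitely many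
  values. The filter factors through it, which gives measurability.\<close>

definition exceeding :: "nat => nat => real => (nat => nat => real) => (nat \<times> nat set) set" where
 "exceeding d N c X = {z\<in>{..<N} \<times> Pow {..<N}. exceeds c (gram d X) (fst z) (snd z)}"

lemma measurable_exceeding:
 "exceeding d N c \<in> measurable (data_space d N) (count_space (Pow ({..<N} \<times> Pow {..<N})))"
 unfolding exceeding_def[abs_def] by (rule measurable_Collect_finite) (auto intro: measurable_exceeds)

lemma exceeds_iff_dot: "exceeds c (gram d X) i f \<longleftrightarrow> c * norm2 d (point_sum X f) < \<bar>dot d (X i) (point_sum X f)\<bar>"
proof -
 have "norm2 d (point_sum X f) = sqrt (pair_sum (gram d X) f f)" by (simp only: norm2_eq_sqrt dot_point_sum)
 moreover have "dot d (X i) (point_sum X f) = (\<Sum>j\<in>f. gram d X i j)" by (simp add: dot_point_sum_right gram_def)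
 ultimately show ?thesis by (simp only: exceeds_def)
qed

definition coin_union :: "'a set list list => 'a set" where
 "coin_union css = \<Union>(\<Union>(set ` set css))"

definition filter_tests :: "nat => real => real => real => real => nat set list list => (nat => nat => real) => nat set => nat set set" where
 "filter_tests d h \<rho> \<delta> c css X Z = snd (run (exceeds (5 * h) (gram d X)) \<rho> \<delta> c css (Z, {}))"

lemma filter_tests_eq:
 assumes css: "\<forall>cs\<in>set css. cs ~= [] & (\<forall>b\<in>set cs. b <= {..<N})"
 shows "filter_tests d h \<rho> \<delta> c css X Z = snd (run (%i f. (i, f) \<in> exceeding d N (5 * h) X) \<rho> \<delta> c css (Z, {}))"
 unfolding filter_tests_def by (rule run_local[where C="{..<N}"]) (use css in \<open>auto simp: exceeding_def\<close>)

lemma filter_tests_local: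
 assumes css: "\<forall>cs\<in>set css. cs ~= []" "finite (coin_union css)"
  and X: "\<And>i. i \<in> coin_union css ==> X i = X' i" and Z: "Z Int coin_union css = Z' Int coin_union css"
 shows "filter_tests d h \<rho> \<delta> c css X Z = filter_tests d h \<rho> \<delta> c css X' Z'"
 unfolding filter_tests_def
proof (rule run_local[where C="coin_union css"])
 show "\<forall>cs\<in>set css. cs ~= [] & (\<forall>b\<in>set cs. b <= coin_union css)" using css by (auto simp: coin_union_def)
 fix i f assume i: "i \<in> coin_union css" "f <= coin_union css"
 have "gram d X a b = gram d X' a b" if "a \<in> coin_union css" "b \<in> coin_union css" for a b using X that by (simp add: gram_def)
 hence "(\<Sum>j\<in>f. gram d X i j) = (\<Sum>j\<in>f. gram d X' i j)" "pair_sum (gram d X) f f = pair_sum (gram d X') f f"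
  unfolding pair_sum_def using i by (auto intro!: sum.cong dest: subsetD)
 thus "exceeds (5 * h) (gram d X) i f = exceeds (5 * h) (gram d X') i f" by (simp add: exceeds_def)
qed (use css Z in auto)

lemma filter_tests_bounds:
 assumes css: "\<forall>cs\<in>set css. length cs = Suc R & (\<forall>b\<in>set cs. b <= {..<N})" and c: "1 <= c * \<rho>" "0 <= \<delta>" "0 <= \<rho>"
 shows "f \<in> filter_tests d h \<rho> \<delta> c css X Z ==> f <= coin_union css"
  and "finite (filter_tests d h \<rho> \<delta> c css X Z)" "card (filter_tests d h \<rho> \<delta> c css X Z) <= length css * (R * N)"
proof -
 have r: "finite (snd (run (exceeds (5 * h) (gram d X)) \<rho> \<delta> c css (Z, {}))) &
   snd (run (exceeds (5 * h) (gram d X)) \<rho> \<delta> c css (Z, {})) <= {} Un (Pow (\<Union>(\<Union>(set ` set css))) - {{}}) &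
   card (snd (run (exceeds (5 * h) (gram d X)) \<rho> \<delta> c css (Z, {}))) <= 0 + length css * (R * N)"
  using run_tests[of "{..<N}" css R c \<rho> \<delta> "(Z, {})" "exceeds (5 * h) (gram d X)"] css c by simp
 thus "f \<in> filter_tests d h \<rho> \<delta> c css X Z ==> f <= coin_union css"
  unfolding filter_tests_def coin_union_def by auto
 show "finite (filter_tests d h \<rho> \<delta> c css X Z)" "card (filter_tests d h \<rho> \<delta> c css X Z) <= length css * (R * N)"
  using r by (simp_all add: filter_tests_def)
qed

lemma measurable_filter_tests:
 assumes css: "\<forall>cs\<in>set css. length cs = Suc R & (\<forall>b\<in>set cs. b <= {..<N})" and c: "1 <= c * \<rho>" "0 <= \<delta>" "0 <= \<rho>"
  and Z: "Z \<in> measurable (data_space d N) (count_space (Pow {..<N}))"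
 shows "(%X. filter_tests d h \<rho> \<delta> c css X (Z X)) \<in> measurable (data_space d N) (count_space (Pow (Pow {..<N})))"
proof -
 have css': "\<forall>cs\<in>set css. cs ~= [] & (\<forall>b\<in>set cs. b <= {..<N})" using css by auto
 have "(%X. (%(S, E). snd (run (%i f. (i, f) \<in> E) \<rho> \<delta> c css (S, {})) Int Pow {..<N}) (Z X, exceeding d N (5 * h) X))
   \<in> measurable (data_space d N) (count_space (Pow (Pow {..<N})))"
  by (rule measurable_of_info[OF measurable_info_pair[OF Z measurable_exceeding]]) (auto simp: countable_finite)
 moreover have "filter_tests d h \<rho> \<delta> c css X (Z X) = filter_tests d h \<rho> \<delta> c css X (Z X) Int Pow {..<N}" for X
 proof -
  have "coin_union css <= {..<N}" using css by (auto simp: coin_union_def)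
  thus ?thesis using filter_tests_bounds(1)[OF css c] by blast
 qed
 ultimately show ?thesis unfolding filter_tests_eq[OF css'] by simp
qed

lemma cleaned_eq_ideal:
 assumes h: "6 <= h" and d: "1 <= d" and reg: "regular d N (%_. mu) I y (2 * h) g" and mu: "dot d mu mu <= h ^ 5 * sqrt d"
  and I: "I <= {..<N}" and P: "P <= {..<N}" and maj: "card (P Int I) < card (P - I)"
 defines "X \<equiv> mix I y g"
 shows "cleaned d N h P X = cleaned_ideal d N h I P X"
  and "i \<in> cleaned_ideal d N h I P X ==> norm_ok d h X i"
  and "i \<in> cleaned_ideal d N h I P X ==> j \<in> cleaned_ideal d N h I P X ==> i ~= j ==> \<bar>dot d (X i) (X j)\<bar> <= h ^ 7 * sqrt d"
proof -
 let ?s = "sqrt (real d)"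
 have s0: "0 <= ?s" by simp
 have h67: "h ^ 6 * ?s + 2 * (h ^ 5 * ?s) <= h ^ 7 * ?s" "0 <= h ^ 5 * ?s"
  using pow_step[OF h s0, of 5] pow_step[OF h s0, of 6] by (auto simp: eval_nat_numeral)
 have fP: "finite P" using P finite_subset by blast
 have cP: "card P = card (P Int I) + card (P - I)" using card_Diff_subset_Int[of P I] fP card_mono[of P "P Int I"] by simp
 have Xg: "X i = g i" if "i \<notin> I" for i using that by (simp add: X_def mix_def)
 have Xb: "X i = y i" if "i \<in> I" for i using that by (simp add: X_def mix_def)
 have gg: "\<bar>dot d (X i) (X j)\<bar> <= h ^ 6 * ?s" if "i < N" "j < N" "i \<notin> I" "j \<notin> I" "i ~= j" for i j
  using regular_good(2)[OF h d reg that(1) mu that(2)] that by (simp add: Xg)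
 have goodpre: "i \<in> prefilter d N h P X" if i: "i < N" "i \<notin> I" "i \<notin> P" for i
 proof -
  have "norm_ok d h X i" using regular_good(1)[OF h d reg i(1) mu] i by (simp add: norm_ok_def Xg)
  moreover have "{j\<in>P. conflict d (h ^ 6) X i j} <= P Int I"
  proof
   fix j assume j: "j \<in> {j\<in>P. conflict d (h ^ 6) X i j}"
   have "~ (j < N & j \<notin> I & i ~= j)" using gg[OF i(1) _ i(2), of j] j by (auto simp: conflict_def)
   thus "j \<in> P Int I" using j P i(3) by auto
  qed
  hence "card {j\<in>P. conflict d (h ^ 6) X i j} <= card (P Int I)" using fP by (intro card_mono) auto
  ultimately show ?thesis using i cP maj by (simp add: prefilter_def)
 qed
 have badgood: "\<bar>dot d (X i) (X k)\<bar> <= h ^ 7 * ?s" if i: "i \<in> I" "i \<in> prefilter d N h P X" and k: "k < N" "k \<notin> I" for i k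
 proof -
  have no: "\<bar>dot d (y i) (y i) - d\<bar> <= h ^ 6 * sqrt d" and few: "2 * card {j\<in>P. conflict d (h ^ 6) X i j} < card P"
   using i by (auto simp: prefilter_def norm_ok_def Xb)
  have "~ P - I <= {j\<in>P. conflict d (h ^ 6) X i j}"
  proof
   assume "P - I <= {j\<in>P. conflict d (h ^ 6) X i j}"
   hence "card (P - I) <= card {j\<in>P. conflict d (h ^ 6) X i j}" using fP by (intro card_mono) auto
   thus False using few cP maj by linarith
  qed
  then obtain j where j: "j \<in> P" "j \<notin> I" "~ conflict d (h ^ 6) X i j" by auto
  hence jN: "j < N" using P by auto
  have "\<bar>dot d (y i) (g j)\<bar> <= h ^ 6 * ?s" using j i by (simp add: conflict_def Xb Xg)
  moreover have "\<bar>dot d (y i) (g j) - dot d (y i) mu\<bar> <= h ^ 5 * ?s" by (rule regular_good(3)[OF h d reg jN mu i(1) no])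
  moreover have "\<bar>dot d (y i) (g k) - dot d (y i) mu\<bar> <= h ^ 5 * ?s" by (rule regular_good(3)[OF h d reg k(1) mu i(1) no])
  ultimately have "\<bar>dot d (y i) (g k)\<bar> <= h ^ 7 * ?s" using h67 by linarith
  thus ?thesis using i k by (simp add: Xb Xg)
 qed
 have pre: "i < N" "i \<notin> P" "norm_ok d h X i" if "i \<in> prefilter d N h P X" for i using that by (auto simp: prefilter_def)
 have nc: "~ conflict d (h ^ 7) X i j" if "i \<in> prefilter d N h P X" "j \<in> prefilter d N h P X" "i ~= j" "i \<notin> I \<or> j \<notin> I" for i j
 proof -
  have "\<bar>dot d (X i) (X j)\<bar> <= h ^ 7 * ?s"
  proof (cases "i \<in> I")
   case True
   thus ?thesis using badgood[of i j] that pre(1)[of j] by blast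
  next
   case False
   show ?thesis
   proof (cases "j \<in> I")
    case True
    thus ?thesis using badgood[of j i] that pre(1)[of i] False by (simp add: dot_commute)
   next
    case F: False
    hence "\<bar>dot d (X i) (X j)\<bar> <= h ^ 6 * ?s" by (intro gg) (use that pre(1) False in auto)
    thus ?thesis using h67 by linarith
   qed
  qed
  thus ?thesis by (simp add: conflict_def)
 qed
 show eq: "cleaned d N h P X = cleaned_ideal d N h I P X"
 proof (rule set_eqI)
  fix i
  show "i \<in> cleaned d N h P X \<longleftrightarrow> i \<in> cleaned_ideal d N h I P X"
  proof (cases "i \<in> I")
   case True
   thus ?thesis unfolding cleaned_def cleaned_ideal_def using pre(2)[of i] nc[of i] by auto
  next
   case False
   thus ?thesis unfolding cleaned_def cleaned_ideal_def using pre(2)[of i] nc[of i] goodpre[of i] by auto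
  qed
 qed
 show "norm_ok d h X i" if "i \<in> cleaned_ideal d N h I P X" for i
  using that pre(3)[of i] unfolding eq[symmetric] cleaned_def by auto
 show "\<bar>dot d (X i) (X j)\<bar> <= h ^ 7 * ?s" if "i \<in> cleaned_ideal d N h I P X" "j \<in> cleaned_ideal d N h I P X" "i ~= j" for i j
 proof -
  have "~ conflict d (h ^ 7) X i j" using that unfolding eq[symmetric] cleaned_def by auto
  thus ?thesis by (simp add: conflict_def)
 qed
qed

lemma cleaned_ideal_local:
 assumes X: "\<And>i. i \<in> I Un P ==> X i = X' i"
 shows "cleaned_ideal d N h I P X = cleaned_ideal d N h I P X'"
proof -
 have cf: "conflict d c X i j = conflict d c X' i j" if "i \<in> I" "j \<in> I Un P" for i j c using X[of i] X[of j] that by (simp add: conflict_def)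
 have pf: "i \<in> prefilter d N h P X \<longleftrightarrow> i \<in> prefilter d N h P X'" if i: "i \<in> I" for i
 proof -
  have "{j\<in>P. conflict d (h ^ 6) X i j} = {j\<in>P. conflict d (h ^ 6) X' i j}" using cf[OF i] by auto
  moreover have "norm_ok d h X i = norm_ok d h X' i" using X[of i] i by (simp add: norm_ok_def)
  ultimately show ?thesis by (simp add: prefilter_def)
 qed
 show ?thesis unfolding cleaned_ideal_def using pf cf by (intro Collect_cong) auto
qed

text \<open>Up to slack the constants force one another. \<open>1 / h ^ 10\<close> is the sampling
  rate \<rho>, and \<beta> is \<open>h\<close>; \<open>c0 = h ^ 17\<close> must dominate
  \<open>R\<^sup>2 * \<beta> / \<rho>\<close>, the thinning rate \<open>q = 1 / h ^ 16\<close> must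
  lie below \<open>\<rho> / \<beta>\<close>, and \<open>\<nu> = 1 / h ^ 68\<close> below
  \<open>\<rho> * q\<^sup>2 / c0\<close>. The level \<Theta> then has to be large enough for the
  inequalities in which it occurs; \<open>h ^ 150\<close> suffices and is far below
  \<open>h ^ 2000\<close>.\<close>

lemma amplification_parameters:
 assumes h: "6 <= h" and d: "1 <= d" and M: "1 <= M" and N: "real N * exp (- h) <= 1" "real N < 2 ^ R" and R: "1 <= R" "real R <= 2 * h"
 shows "amplification (gram d X) {..<N} M (h ^ 7 * real d) (h ^ 7 * sqrt d) (5 * h) (1 / h ^ 16) (1 / h ^ 10) h (h ^ 17) (1 / h ^ 68)
   (h ^ 150 * max (sqrt (M * real d)) M) R"
proof -
 define mx where "mx = max (sqrt (M * real d)) M"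
 define T where "T = M * real d"
 have h0: "0 < h" using h by simp
 have hk: "0 < h ^ k" for k using h0 by simp
 have T: "0 < T" using M d by (simp add: T_def)
 have mx: "0 < mx" "M <= mx" "sqrt T <= mx" using M by (auto simp: mx_def T_def)
 have mx2: "T <= mx\<^sup>2"
 proof -
  have "(sqrt T)\<^sup>2 <= mx\<^sup>2" using mx T by (intro power_mono) auto
  thus ?thesis using T by simp
 qed
 have B2: "(h ^ 7 * sqrt d)\<^sup>2 = h ^ 14 * d" by (simp add: power_mult_distrib power_mult[symmetric])
 have \<Theta>2: "(h ^ 150 * mx)\<^sup>2 = h ^ 300 * mx\<^sup>2" by (simp add: power_mult_distrib power_mult[symmetric])
 have hd: "1 / h ^ j * h ^ k = h ^ (k - j)" if "j <= k" for j k using h0 that by (simp add: power_diff)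
 have hq: "1 / h ^ j = h ^ (k - j) * (1 / h ^ k)" if "j <= k" for j k using h0 that by (simp add: power_diff)
 note pd = pow_dominates[OF h]
 show ?thesis unfolding mx_def[symmetric]
 proof (unfold_locales)
  show "gram d X i j = gram d X j i" for i j by (simp add: gram_def dot_commute)
  show "1 / h ^ 10 <= 1" "1 / h ^ 16 <= 1" using h by (auto simp: divide_le_eq_1 one_le_power)
  show "rcard {..<N} * exp (- h) <= 1" "rcard {..<N} < 2 ^ R" using N by auto
  show "16 * (16 * real R * h) * real R / (1 / h ^ 10) <= h ^ 17"
  proof -
   have "real R * real R <= (2 * h) * (2 * h)" using R by (intro mult_mono) auto
   hence "256 * h ^ 11 * (real R * real R) <= 256 * h ^ 11 * ((2 * h) * (2 * h))" using hk[of 11] by (intro mult_left_mono) auto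
   also have "... = 1024 * h ^ 13" by (simp add: eval_nat_numeral)
   also have "... <= h ^ 17" by (rule pd[of _ 4]) auto
   finally show ?thesis by (simp add: eval_nat_numeral mult_ac)
  qed
  show "128 * (h ^ 7 * sqrt (real d))\<^sup>2 * M <= 1 / h ^ 16 * (h ^ 150 * mx)\<^sup>2"
  proof -
   have "128 * h ^ 14 * T <= h ^ 284 * mx\<^sup>2"
    by (rule mult_mono[OF pd[of _ 3] mx2]) (use T hk in \<open>auto intro: less_imp_le\<close>)
   moreover have "1 / h ^ 16 * (h ^ 300 * mx\<^sup>2) = h ^ 284 * mx\<^sup>2" using hd[of 16 300] by (simp only: mult.assoc[symmetric]) simp
   ultimately show ?thesis unfolding B2 \<Theta>2 by (simp add: T_def mult_ac)
  qed
  show "1024 * (1 / h ^ 16) * h <= 1 / h ^ 10"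
  proof -
   have "1024 * h ^ 1 <= h ^ 6" by (rule pd[of _ 4]) auto
   hence "1024 * h ^ 1 * (1 / h ^ 16) <= h ^ 6 * (1 / h ^ 16)" using h0 by (intro mult_right_mono) auto
   thus ?thesis using hq[of 10 16] by (simp add: mult_ac)
  qed
  show "512 * h / (1 / h ^ 10) <= h ^ 150 * mx / (h ^ 7 * sqrt (real d))"
  proof -
   have "sqrt (real d) <= sqrt T" using M by (intro real_sqrt_le_mono) (simp add: T_def mult_le_cancel_right1)
   hence sd: "sqrt (real d) <= mx" using mx by linarith
   have "512 * h ^ 18 * sqrt (real d) <= h ^ 150 * mx"
    by (rule mult_mono[OF pd[of _ 4] sd]) (use hk in \<open>auto intro: less_imp_le\<close>)
   hence "512 * h ^ 11 * (h ^ 7 * sqrt (real d)) <= h ^ 150 * mx" by (simp add: eval_nat_numeral mult_ac)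
   moreover have "0 < h ^ 7 * sqrt (real d)" using hk[of 7] d by simp
   ultimately have "512 * h ^ 11 <= h ^ 150 * mx / (h ^ 7 * sqrt (real d))" by (simp only: pos_le_divide_eq)
   moreover have "512 * h / (1 / h ^ 10) = 512 * h ^ 11" by (simp add: eval_nat_numeral)
   ultimately show ?thesis by simp
  qed
  show "2048 * M * (32 * (h ^ 7 * sqrt (real d))\<^sup>2 + 64 * (5 * h)\<^sup>2 * (h ^ 7 * real d)) <= 1 / h ^ 68 * (h ^ 150 * mx)\<^sup>2"
  proof -
   have "65536 * h ^ 14 <= h ^ 21" by (rule pd[of _ 7]) auto
   moreover have "3276800 * h ^ 9 <= h ^ 21" by (rule pd[of _ 9]) auto
   moreover have "2 * h ^ 21 <= h ^ 232" by (rule pd[of _ 1]) auto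
   ultimately have "65536 * h ^ 14 + 3276800 * h ^ 9 <= h ^ 232" by linarith
   hence "(65536 * h ^ 14 + 3276800 * h ^ 9) * T <= h ^ 232 * mx\<^sup>2"
    by (rule mult_mono[OF _ mx2]) (use T hk in \<open>auto intro: less_imp_le\<close>)
   moreover have "1 / h ^ 68 * (h ^ 300 * mx\<^sup>2) = h ^ 232 * mx\<^sup>2" using hd[of 68 300] by (simp only: mult.assoc[symmetric]) simp
   moreover have "2048 * M * (32 * (h ^ 14 * real d) + 64 * (5 * h)\<^sup>2 * (h ^ 7 * real d)) = (65536 * h ^ 14 + 3276800 * h ^ 9) * T"
    by (simp add: T_def power_mult_distrib algebra_simps eval_nat_numeral)
   ultimately show ?thesis unfolding B2 \<Theta>2 by linarith
  qed
  show "262144 * M * (5 * h)\<^sup>2 <= 1 / h ^ 68 * (h ^ 150 * mx)"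
  proof -
   have "6553600 * h ^ 2 * M <= h ^ 82 * mx"
    by (rule mult_mono[OF pd[of _ 9] mx(2)]) (use M hk in \<open>auto intro: less_imp_le\<close>)
   moreover have "1 / h ^ 68 * (h ^ 150 * mx) = h ^ 82 * mx" using hd[of 68 150] by (simp only: mult.assoc[symmetric]) simp
   ultimately show ?thesis by (simp add: power_mult_distrib mult_ac)
  qed
  show "128 * (1 / h ^ 68) <= 1 / h ^ 10"
  proof -
   have "128 * h ^ 0 <= h ^ 58" by (rule pd[of _ 3]) auto
   hence "128 * (1 / h ^ 68) <= h ^ 58 * (1 / h ^ 68)" using h0 by (intro mult_right_mono) auto
   thus ?thesis using hq[of 10 68] by simp
  qed
  have q42: "1 / h ^ 10 * (1 / h ^ 16)\<^sup>2 = 1 / h ^ 42" by (simp add: power_divide power_mult[symmetric] power_add[symmetric])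
  show "1048576 * (2 * h ^ 17) * (1 / h ^ 68) <= 1 / h ^ 10 * (1 / h ^ 16)\<^sup>2"
  proof -
   have "2097152 * h ^ 17 <= h ^ 26" by (rule pd[of _ 9]) auto
   hence "2097152 * h ^ 17 * (1 / h ^ 68) <= h ^ 26 * (1 / h ^ 68)" using h0 by (intro mult_right_mono) auto
   thus ?thesis unfolding q42 using hq[of 42 68] by simp
  qed
  show "131072 * (2 * h ^ 17) <= 1 / h ^ 10 * (1 / h ^ 16)\<^sup>2 * ((h ^ 150 * mx)\<^sup>2 / ((h ^ 7 * sqrt (real d))\<^sup>2 * M))"
  proof -
   have "h ^ 286 * (h ^ 14 * T) <= h ^ 300 * mx\<^sup>2"
    using mult_left_mono[OF mx2, of "h ^ 300"] hk[of 300] by (simp add: mult.assoc[symmetric] power_add[symmetric])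
   hence "h ^ 286 <= h ^ 300 * mx\<^sup>2 / (h ^ 14 * T)" using T hk[of 14] by (simp only: pos_le_divide_eq mult_pos_pos)
   hence "1 / h ^ 42 * h ^ 286 <= 1 / h ^ 42 * (h ^ 300 * mx\<^sup>2 / (h ^ 14 * T))" using h0 by (intro mult_left_mono) auto
   moreover have "262144 * h ^ 17 <= h ^ 244" by (rule pd[of _ 7]) auto
   ultimately have "262144 * h ^ 17 <= 1 / h ^ 42 * (h ^ 300 * mx\<^sup>2 / (h ^ 14 * T))" using hd[of 42 286] by simp
   moreover have "h ^ 14 * real d * M = h ^ 14 * T" by (simp add: T_def)
   moreover have "131072 * (2 * h ^ 17) = 262144 * h ^ 17" by simp
   ultimately show ?thesis by (simp only: q42 B2 \<Theta>2)
  qed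
 qed (use h0 h d M mx hk R in auto)
qed

lemma card_coin_union_le:
 assumes "length css = k" "\<forall>cs\<in>set css. length cs = l & (\<forall>b\<in>set cs. finite b & rcard b <= t)" "0 <= t"
 shows "rcard (coin_union css) <= real k * (real l * t)"
proof -
 have inner: "rcard (\<Union>b\<in>set cs. b) <= real l * t" if "cs \<in> set css" for cs
 proof -
  have "rcard (\<Union>b\<in>set cs. b) <= (\<Sum>b\<in>set cs. rcard b)"
   using card_UN_le[of "set cs" "%b. b"] by (metis List.finite_set of_nat_le_iff of_nat_sum)
  also have "... <= (\<Sum>b\<in>set cs. t)" using assms(2) that by (intro sum_mono) auto
  also have "... <= real l * t" using card_length[of cs] assms that by (simp add: mult_right_mono)
  finally show ?thesis .
 qed
 have "coin_union css = (\<Union>cs\<in>set css. \<Union>b\<in>set cs. b)" by (auto simp: coin_union_def)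
 hence "rcard (coin_union css) <= (\<Sum>cs\<in>set css. rcard (\<Union>b\<in>set cs. b))"
  using card_UN_le[of "set css" "%cs. \<Union>b\<in>set cs. b"] by (metis List.finite_set of_nat_le_iff of_nat_sum)
 also have "... <= (\<Sum>cs\<in>set css. real l * t)" by (intro sum_mono inner)
 also have "... <= real k * (real l * t)" using card_length[of css] assms(1,3) by (simp add: mult_right_mono)
 finally show ?thesis .
qed

lemma correlation_le_subset:
 assumes "correlation_le G M Z \<Lambda>" "Z' <= Z" "\<Lambda> <= \<Lambda>'"
 shows "correlation_le G M Z' \<Lambda>'"
 unfolding correlation_le_def
proof (intro allI impI)
 fix S T assume a: "S <= Z' & T <= Z' & S Int T = {} & rcard S <= M & rcard T <= M"
 hence "\<bar>pair_sum G S T\<bar> <= \<Lambda> * sqrt (rcard S * rcard T)"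
  by (intro correlation_leD[OF assms(1)]) (use assms(2) in auto)
 also have "... <= \<Lambda>' * sqrt (rcard S * rcard T)" using assms(3) by (intro mult_right_mono) auto
 finally show "\<bar>pair_sum G S T\<bar> <= \<Lambda>' * sqrt (rcard S * rcard T)" .
qed

text \<open>The reference set for the vote, the pools and samples of the filter, and the set of
  points eligible for the final selection.\<close>

type_synonym coins = "nat set \<times> nat set list list \<times> nat set"

definition filter_coin :: "nat => nat => real => coins pmf" where
 "filter_coin N R \<rho> = pair_pmf (random_subset \<rho> {..<N})
   (pair_pmf (replicate_pmf R (replicate_pmf (Suc R) (random_subset \<rho> {..<N}))) (random_subset (2 / 5) {..<N}))"

lemma set_filter_coin:
 assumes "w \<in> set_pmf (filter_coin N R \<rho>)"
 shows "fst w <= {..<N}" "snd (snd w) <= {..<N}" "length (fst (snd w)) = R"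
  "\<forall>cs\<in>set (fst (snd w)). length cs = Suc R & (\<forall>b\<in>set cs. b <= {..<N})"
proof -
 have a: "fst w \<in> set_pmf (random_subset \<rho> {..<N})" "snd (snd w) \<in> set_pmf (random_subset (2 / 5) {..<N})"
  "fst (snd w) \<in> set_pmf (replicate_pmf R (replicate_pmf (Suc R) (random_subset \<rho> {..<N})))"
  using assms unfolding filter_coin_def by (auto simp del: replicate_pmf.simps)
 show "fst w <= {..<N}" "snd (snd w) <= {..<N}" using a(1,2) set_random_subset[of _ "{..<N}"] by auto
 have b: "length (fst (snd w)) = R" "set (fst (snd w)) <= set_pmf (replicate_pmf (Suc R) (random_subset \<rho> {..<N}))"
  using a(3) unfolding set_replicate_pmf by (auto simp del: replicate_pmf.simps)
 show "length (fst (snd w)) = R" by (rule b(1))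
 show "\<forall>cs\<in>set (fst (snd w)). length cs = Suc R & (\<forall>b\<in>set cs. b <= {..<N})"
 proof
  fix cs assume "cs \<in> set (fst (snd w))"
  hence "cs \<in> set_pmf (replicate_pmf (Suc R) (random_subset \<rho> {..<N}))" using b(2) by blast
  hence "length cs = Suc R" "set cs <= set_pmf (random_subset \<rho> {..<N})" unfolding set_replicate_pmf by auto
  thus "length cs = Suc R & (\<forall>b\<in>set cs. b <= {..<N})" using set_random_subset[of \<rho> "{..<N}"] by blast
 qed
qed

lemma finite_filter_coin: "finite (set_pmf (filter_coin N R \<rho>))"
proof -
 have f: "finite (set_pmf (random_subset q {..<N}))" for q by (rule finite_subset[OF set_random_subset]) simp
 have r: "finite (set_pmf (replicate_pmf k p))" if "finite (set_pmf p)" for k and p :: "'a pmf"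
  unfolding set_replicate_pmf by (rule finite_subset[OF _ finite_lists_length_eq[OF that, of k]]) auto
 show ?thesis unfolding filter_coin_def by (simp add: f r del: replicate_pmf.simps)
qed

text \<open>Eligible genuine points outside all sacrificed sets. On typical data without an alarm
  every one of them is kept.\<close>

definition fresh_goods :: "nat => nat set => coins => nat set" where
 "fresh_goods N I w = {i\<in>{..<N}. i \<notin> I & i \<in> snd (snd w) & i \<notin> fst w & i \<notin> coin_union (fst (snd w))}"

text \<open>Chebyshev's inequality suffices. Of at most \<open>2 * M\<close> corrupted points about
  \<open>4 / 5 * M\<close> are eligible; with a deviation below \<open>M / 5\<close> they number
  less than \<open>M\<close>, hence at most \<open>f\<close>. Of at least \<open>3 * n\<close>
  genuine points about \<open>6 / 5 * n\<close> are eligible; a deviation of \<open>n / 10\<close>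
  and a loss of at most \<open>n / 10\<close> sacrificed points still leave
  \<open>n\<close>.\<close>

lemma prob_bad_coins:
 assumes h: "6 <= h" and n: "h ^ 20 <= M" "M <= real n" and R: "real R <= 2 * h"
  and I: "I <= {..<4 * n}" "card I <= n" "rcard I <= 2 * M" and f: "M < real f + 1"
 defines "\<rho> \<equiv> 1 / h ^ 10"
 shows "pprob (filter_coin (4 * n) R \<rho>)
   {w. ~ (card (I Int snd (snd w)) <= f & n <= card (fresh_goods (4 * n) I w) & card (fst w Int I) < card (fst w - I))} <= 0.003"
proof -
 let ?A = "{..<4 * n}" and ?coin = "filter_coin (4 * n) R \<rho>"
 let ?G = "?A - I"
 have h0: "0 < h" using h by simp
 note pd = pow_dominates[OF h]
 have hk: "1 <= h ^ k" for k using h by (intro one_le_power) auto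
 have \<rho>: "0 < \<rho>" "\<rho> <= 1" unfolding \<rho>_def using h0 hk[of 10] by auto
 define v where "v = \<rho> * real n"
 have v: "h ^ 10 <= v" "0 < v"
 proof -
  have "h ^ 10 * h ^ 10 <= real n" using n by (simp add: power_add[symmetric])
  thus "h ^ 10 <= v" unfolding v_def \<rho>_def using h0 by (simp add: pos_le_divide_eq)
  thus "0 < v" using hk[of 10] by linarith
 qed
 have big: "6 ^ 20 <= real n" "6 ^ 20 <= M" "6 ^ 10 <= v" "0 < M" "0 < real n"
 proof -
  have "(6::real) ^ 20 <= h ^ 20" by (rule power_mono) (use h in auto)
  moreover have "(6::real) ^ 10 <= h ^ 10" by (rule power_mono) (use h in auto)
  ultimately show "6 ^ 20 <= real n" "6 ^ 20 <= M" "6 ^ 10 <= v" using n v by linarith+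
  thus "0 < M" "0 < real n" by (auto intro: less_le_trans[rotated])
 qed
 have cG: "card ?G = 4 * n - card I" using I(1) by (subst card_Diff_subset) (auto intro: finite_subset)
 hence cG': "3 * real n <= rcard ?G" "rcard ?G <= 4 * real n" using I(2) by auto
 define E1 where "E1 L \<longleftrightarrow> M / 5 <= \<bar>rcard (I Int L) - 2 / 5 * rcard I\<bar>" for L
 define E2 where "E2 L \<longleftrightarrow> real n / 10 <= \<bar>rcard (?G Int L) - 2 / 5 * rcard ?G\<bar>" for L
 define E3 where "E3 P \<longleftrightarrow> 4 * v <= \<bar>rcard (?A Int P) - \<rho> * rcard ?A\<bar>" for P
 define E4 where "E4 P \<longleftrightarrow> v / 2 <= \<bar>rcard (I Int P) - \<rho> * rcard I\<bar>" for P
 define E5 where "E5 P \<longleftrightarrow> v / 2 <= \<bar>rcard (?G Int P) - \<rho> * rcard ?G\<bar>" for P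
 have p1: "pprob (random_subset (2 / 5) ?A) {L. E1 L} <= 0.0005"
 proof -
  have "pprob (random_subset (2 / 5) ?A) {L. E1 L} <= 2 / 5 * rcard I / (M / 5)\<^sup>2"
   unfolding E1_def by (rule prob_random_subset_deviation) (use I big in auto)
  also have "... <= 2 / 5 * (2 * M) / (M / 5)\<^sup>2" using I by (intro divide_right_mono mult_left_mono) auto
  also have "... = 20 / M" using big by (simp add: power2_eq_square field_simps)
  also have "... <= 0.0005" using big by (simp add: divide_le_eq)
  finally show ?thesis .
 qed
 have p2: "pprob (random_subset (2 / 5) ?A) {L. E2 L} <= 0.0005"
 proof -
  have "pprob (random_subset (2 / 5) ?A) {L. E2 L} <= 2 / 5 * rcard ?G / (real n / 10)\<^sup>2"
   unfolding E2_def by (rule prob_random_subset_deviation) (use big in auto)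
  also have "... <= 2 / 5 * (4 * real n) / (real n / 10)\<^sup>2" using cG' by (intro divide_right_mono mult_left_mono) auto
  also have "... = 160 / real n" using big by (simp add: power2_eq_square field_simps)
  also have "... <= 0.0005" using big by (simp add: divide_le_eq)
  finally show ?thesis .
 qed
 have dev: "pprob (random_subset \<rho> ?A) {P. t <= \<bar>rcard (S Int P) - \<rho> * rcard S\<bar>} <= 16 / v"
  if S: "S <= ?A" and t: "v / 2 <= t" for S t
 proof -
  have t0: "0 < t" using t v by linarith
  have "pprob (random_subset \<rho> ?A) {P. t <= \<bar>rcard (S Int P) - \<rho> * rcard S\<bar>} <= \<rho> * rcard S / t\<^sup>2"
   by (rule prob_random_subset_deviation) (use S \<rho> t0 in auto)
  also have "... <= \<rho> * (4 * real n) / (v / 2)\<^sup>2"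
  proof (rule frac_le)
   have "card S <= 4 * n" using card_mono[OF _ S] by simp
   hence "rcard S <= 4 * real n" by linarith
   thus "\<rho> * rcard S <= \<rho> * (4 * real n)" using \<rho> by (intro mult_left_mono) auto
   show "(v / 2)\<^sup>2 <= t\<^sup>2" using t v by (intro power_mono) auto
  qed (use \<rho> v in auto)
  also have "... = 16 / v" using v by (simp add: v_def[symmetric] power2_eq_square field_simps)
  finally show ?thesis .
 qed
 have p3: "pprob (random_subset \<rho> ?A) {P. E3 P} <= 16 / v" unfolding E3_def by (rule dev) (use v in auto)
 have p4: "pprob (random_subset \<rho> ?A) {P. E4 P} <= 16 / v" unfolding E4_def by (rule dev) (use v I in auto)
 have p5: "pprob (random_subset \<rho> ?A) {P. E5 P} <= 16 / v" unfolding E5_def by (rule dev) (use v in auto)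
 have v16: "16 / v <= 0.0005" using big v by (simp add: divide_le_eq)
 have RR: "real R * real (Suc R) <= h ^ 3"
 proof -
  have "real R * real (Suc R) <= (2 * h) * (3 * h)" using R h by (intro mult_mono) auto
  also have "... = 6 * h ^ 2" by (simp add: power2_eq_square)
  also have "... <= h ^ 3" by (rule pd[of _ 1]) auto
  finally show ?thesis .
 qed
 have p6: "pprob (replicate_pmf R (replicate_pmf (Suc R) (random_subset \<rho> ?A))) {css. \<exists>cs\<in>set css. \<exists>b\<in>set cs. E3 b} <= 0.0005"
 proof -
  have "pprob (replicate_pmf (Suc R) (random_subset \<rho> ?A)) {cs. \<exists>b\<in>set cs. E3 b} <= real (Suc R) * (16 / v)"
   by (rule prob_replicate_exists_le[OF p3]) (use v in auto)
  hence "pprob (replicate_pmf R (replicate_pmf (Suc R) (random_subset \<rho> ?A))) {css. \<exists>cs\<in>set css. \<exists>b\<in>set cs. E3 b} <= real R * (real (Suc R) * (16 / v))"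
   by (rule prob_replicate_exists_le) (use v in auto)
  also have "... = (real R * real (Suc R)) * (16 / v)" by simp
  also have "... <= h ^ 3 * (16 / h ^ 10)"
   using RR v h0 by (intro mult_mono divide_left_mono) auto
  also have "... = 16 / h ^ 7" using h0 by (simp add: field_simps power_add[symmetric])
  also have "... <= 0.0005"
  proof -
   have "(6::real) ^ 7 <= h ^ 7" using h by (intro power_mono) auto
   thus ?thesis using h0 by (simp add: divide_le_eq)
  qed
  finally show ?thesis .
 qed
 have incl: "~ (card (I Int snd (snd w)) <= f & n <= card (fresh_goods (4 * n) I w) & card (fst w Int I) < card (fst w - I)) ==>
   E1 (snd (snd w)) \<or> E2 (snd (snd w)) \<or> E3 (fst w) \<or> E4 (fst w) \<or> E5 (fst w) \<or> (\<exists>cs\<in>set (fst (snd w)). \<exists>b\<in>set cs. E3 b)"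
  if w: "w \<in> set_pmf ?coin" for w
 proof (rule ccontr)
  let ?P = "fst w" and ?css = "fst (snd w)" and ?L = "snd (snd w)"
  note sw = set_filter_coin[OF w]
  assume bad: "~ (card (I Int ?L) <= f & n <= card (fresh_goods (4 * n) I w) & card (?P Int I) < card (?P - I))"
   and neg: "~ (E1 ?L \<or> E2 ?L \<or> E3 ?P \<or> E4 ?P \<or> E5 ?P \<or> (\<exists>cs\<in>set ?css. \<exists>b\<in>set cs. E3 b))"
  have nE: "~ E4 ?P" "~ E5 ?P" "~ E2 ?L" using neg by blast+
  have g1: "card (I Int ?L) <= f"
  proof -
   have "\<bar>rcard (I Int ?L) - 2 / 5 * rcard I\<bar> < M / 5" using neg by (simp add: E1_def)
   hence "rcard (I Int ?L) < M" using I(3) by linarith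
   thus ?thesis using f by linarith
  qed
  have small: "rcard b <= 8 * v" if "b <= ?A" "~ E3 b" for b
  proof -
   have "?A Int b = b" using that by auto
   hence "\<bar>rcard b - 4 * v\<bar> < 4 * v" using that(2) by (simp add: E3_def v_def algebra_simps)
   thus ?thesis by linarith
  qed
  have g3: "card (?P Int I) < card (?P - I)"
  proof -
   have "rcard (I Int ?P) < \<rho> * rcard I + v / 2" using nE(1) unfolding E4_def by linarith
   moreover have "\<rho> * rcard I <= v" unfolding v_def using I(2) \<rho> by (intro mult_left_mono) auto
   moreover have "\<rho> * rcard ?G - v / 2 < rcard (?G Int ?P)" using nE(2) unfolding E5_def by linarith
   moreover have "\<rho> * (3 * real n) <= \<rho> * rcard ?G" using cG' \<rho> by (intro mult_left_mono) auto
   moreover have "?G Int ?P = ?P - I" using sw(1) by auto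
   ultimately have "rcard (I Int ?P) < rcard (?P - I)" using v by (simp add: v_def)
   thus ?thesis by (simp add: Int_commute)
  qed
  have g2: "n <= card (fresh_goods (4 * n) I w)"
  proof -
   have sub: "?G Int ?L <= fresh_goods (4 * n) I w Un (?P Un coin_union ?css)" by (auto simp: fresh_goods_def)
   have finC: "coin_union ?css <= ?A" using sw(4) by (auto simp: coin_union_def)
   have fin: "finite (fresh_goods (4 * n) I w)" "finite ?P" "finite (coin_union ?css)"
    using sw(1) finC by (auto simp: fresh_goods_def intro: finite_subset)
   have "card (?G Int ?L) <= card (fresh_goods (4 * n) I w Un (?P Un coin_union ?css))" using sub fin by (intro card_mono) auto
   also have "... <= card (fresh_goods (4 * n) I w) + card (?P Un coin_union ?css)" by (rule card_Un_le)
   also have "card (?P Un coin_union ?css) <= card ?P + card (coin_union ?css)" by (rule card_Un_le)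
   finally have c: "rcard (?G Int ?L) <= real (card (fresh_goods (4 * n) I w)) + (rcard ?P + rcard (coin_union ?css))" by linarith
   have "rcard ?P <= 8 * v" by (rule small) (use sw neg in auto)
   moreover have "rcard (coin_union ?css) <= real R * (real (Suc R) * (8 * v))"
   proof (rule card_coin_union_le[OF sw(3)])
    show "\<forall>cs\<in>set ?css. length cs = Suc R & (\<forall>b\<in>set cs. finite b & rcard b <= 8 * v)"
    proof (intro ballI conjI)
     fix cs assume cs: "cs \<in> set ?css"
     thus "length cs = Suc R" using sw(4) by blast
     fix b assume b: "b \<in> set cs"
     have bA: "b <= ?A" using sw(4) cs b by blast
     thus "finite b" using finite_subset by blast
     show "rcard b <= 8 * v" by (rule small[OF bA]) (use neg cs b in blast)
    qed
   qed (use v in simp)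
   moreover have "real R * (real (Suc R) * (8 * v)) <= h ^ 3 * (8 * v)" using mult_right_mono[OF RR, of "8 * v"] v by (simp add: mult.assoc)
   moreover have "8 * v + h ^ 3 * (8 * v) <= real n / 10"
   proof -
    have "160 * h ^ 3 <= h ^ 10" by (rule pd[of _ 3]) auto
    hence "160 * h ^ 3 * real n <= h ^ 10 * real n" by (rule mult_right_mono) simp
    hence "160 * h ^ 3 * v <= real n" unfolding v_def \<rho>_def using h0 by (simp add: divide_le_eq mult_ac)
    moreover have "1 * v <= h ^ 3 * v" using hk[of 3] v by (intro mult_right_mono) auto
    ultimately show ?thesis by linarith
   qed
   moreover have "2 / 5 * rcard ?G - real n / 10 < rcard (?G Int ?L)" using nE(3) unfolding E2_def by linarith
   ultimately have "real n <= real (card (fresh_goods (4 * n) I w))" using c cG'(1) by linarith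
   thus ?thesis by simp
  qed
  show False using bad g1 g2 g3 by blast
 qed
 let ?pr = "pprob ?coin"
 have q1: "?pr {w. E1 (snd (snd w))} <= 0.0005" "?pr {w. E2 (snd (snd w))} <= 0.0005"
  unfolding filter_coin_def
  using p1 p2 prob_pair_snd[of "random_subset \<rho> ?A" "pair_pmf (replicate_pmf R (replicate_pmf (Suc R) (random_subset \<rho> ?A))) (random_subset (2 / 5) ?A)" "%z. E1 (snd z)"]
   prob_pair_snd[of "random_subset \<rho> ?A" "pair_pmf (replicate_pmf R (replicate_pmf (Suc R) (random_subset \<rho> ?A))) (random_subset (2 / 5) ?A)" "%z. E2 (snd z)"]
   prob_pair_snd[of "replicate_pmf R (replicate_pmf (Suc R) (random_subset \<rho> ?A))" "random_subset (2 / 5) ?A" E1]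
   prob_pair_snd[of "replicate_pmf R (replicate_pmf (Suc R) (random_subset \<rho> ?A))" "random_subset (2 / 5) ?A" E2] by simp_all
 have q3: "?pr {w. E3 (fst w)} <= 0.0005" "?pr {w. E4 (fst w)} <= 0.0005" "?pr {w. E5 (fst w)} <= 0.0005"
  unfolding filter_coin_def prob_pair_fst using p3 p4 p5 v16 by linarith+
 have q6: "?pr {w. \<exists>cs\<in>set (fst (snd w)). \<exists>b\<in>set cs. E3 b} <= 0.0005"
  unfolding filter_coin_def
  using p6 prob_pair_snd[of "random_subset \<rho> ?A" "pair_pmf (replicate_pmf R (replicate_pmf (Suc R) (random_subset \<rho> ?A))) (random_subset (2 / 5) ?A)" "%z. \<exists>cs\<in>set (fst z). \<exists>b\<in>set cs. E3 b"]
   prob_pair_fst[of "replicate_pmf R (replicate_pmf (Suc R) (random_subset \<rho> ?A))" "random_subset (2 / 5) ?A" "%css. \<exists>cs\<in>set css. \<exists>b\<in>set cs. E3 b"] by simp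
 have "?pr {w. ~ (card (I Int snd (snd w)) <= f & n <= card (fresh_goods (4 * n) I w) & card (fst w Int I) < card (fst w - I))}
   <= ?pr ({w. E1 (snd (snd w))} Un {w. E2 (snd (snd w))} Un {w. E3 (fst w)} Un {w. E4 (fst w)} Un {w. E5 (fst w)} Un {w. \<exists>cs\<in>set (fst (snd w)). \<exists>b\<in>set cs. E3 b})"
  by (rule measure_pmf.finite_measure_mono_AE) (use incl in \<open>auto simp: AE_measure_pmf_iff\<close>)
 also have "... <= ?pr {w. E1 (snd (snd w))} + ?pr {w. E2 (snd (snd w))} + ?pr {w. E3 (fst w)} + ?pr {w. E4 (fst w)} + ?pr {w. E5 (fst w)} + ?pr {w. \<exists>cs\<in>set (fst (snd w)). \<exists>b\<in>set cs. E3 b}"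
  by (intro order_trans[OF measure_Un_le] add_mono order_refl) auto
 also have "... <= 0.003" using q1 q3 q6 by simp
 finally show ?thesis .
qed

definition coin_tests :: "nat => real => nat => coins => (nat => nat => real) => nat set => nat set set" where
 "coin_tests d h R w X Z = filter_tests d h (1 / h ^ 10) (h ^ 17 / real R) (h ^ 17) (fst (snd w)) X Z"

definition surviving_points :: "nat => nat => real => nat => coins => (nat => nat => real) => nat set" where
 "surviving_points d N h R w X = {i\<in>{..<N}. i \<in> snd (snd w) & i \<notin> coin_union (fst (snd w)) & i \<in> cleaned d N h (fst w) X &
   (\<forall>f\<in>coin_tests d h R w X (cleaned d N h (fst w) X). (i, f) \<notin> exceeding d N (5 * h) X)}"

text \<open>Heavy points reveal a mean of large norm; the second disjunct reveals a mean aligned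
  with a test direction, which makes many fresh points exceed it. The level \<open>2 * h\<close> is
  lower than the level \<open>5 * h\<close> that decides survival, and this gap makes the fresh
  points unanimous when there is no alarm.\<close>

definition mean_alarm :: "nat => nat => real => nat => nat => nat => coins => (nat => nat => real) => bool" where
 "mean_alarm d N h R m n w X \<longleftrightarrow> m < card (heavy d N h X) \<or>
   (\<exists>f\<in>coin_tests d h R w X (cleaned d N h (fst w) X).
    n <= card {i\<in>{..<N}. i \<in> snd (snd w) & i \<notin> coin_union (fst (snd w)) & i \<in> cleaned d N h (fst w) X & (i, f) \<in> exceeding d N (2 * h) X})"

text \<open>Fresh points are kept unconditionally, and the decisions on corrupted points read no
  fresh point; so this selection is oblivious in the sense of \<open>selection_ge\<close>.\<close>

definition surviving_ideal :: "nat => nat => real => nat => nat set => coins => (nat => nat => real) => nat set" where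
 "surviving_ideal d N h R I w X = fresh_goods N I w Un {i\<in>{..<N}. i \<in> I & i \<in> snd (snd w) & i \<notin> coin_union (fst (snd w)) &
   i \<in> cleaned_ideal d N h I (fst w) X &
   (\<forall>f\<in>coin_tests d h R w X (cleaned_ideal d N h I (fst w) X). (i, f) \<notin> exceeding d N (5 * h) X)}"

lemma coin_tests_facts:
 assumes h: "6 <= h" and w: "w \<in> set_pmf (filter_coin N R \<rho>)"
 shows "f \<in> coin_tests d h R w X Z ==> f <= coin_union (fst (snd w))"
  and "card (coin_tests d h R w X Z) <= R * (R * N)"
  and "ZZ \<in> measurable (data_space d N) (count_space (Pow {..<N})) ==>
   (%X. coin_tests d h R w X (ZZ X)) \<in> measurable (data_space d N) (count_space (Pow (Pow {..<N})))"
proof -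
 have h0: "0 < h" using h by simp
 have hk: "1 <= h ^ k" for k using h by (intro one_le_power) auto
 have "h ^ 17 * (1 / h ^ 10) = h ^ 7" using h0 by (simp add: field_simps power_add[symmetric])
 hence c: "1 <= h ^ 17 * (1 / h ^ 10)" "0 <= h ^ 17 / real R" "0 <= 1 / h ^ 10" using hk[of 7] h0 by auto
 note sw = set_filter_coin[OF w]
 show "f \<in> coin_tests d h R w X Z ==> f <= coin_union (fst (snd w))"
  unfolding coin_tests_def by (rule filter_tests_bounds(1)[OF sw(4) c])
 show "card (coin_tests d h R w X Z) <= R * (R * N)"
  using filter_tests_bounds(3)[OF sw(4) c, of d h X Z] sw(3) by (simp add: coin_tests_def)
 show "ZZ \<in> measurable (data_space d N) (count_space (Pow {..<N})) ==>
   (%X. coin_tests d h R w X (ZZ X)) \<in> measurable (data_space d N) (count_space (Pow (Pow {..<N})))"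
  unfolding coin_tests_def by (rule measurable_filter_tests[OF sw(4) c])
qed

lemma measurable_surviving:
 assumes h: "6 <= h" and w: "w \<in> set_pmf (filter_coin N R \<rho>)"
 shows "surviving_points d N h R w \<in> measurable (data_space d N) (count_space (Pow {..<N}))"
  and "surviving_ideal d N h R I w \<in> measurable (data_space d N) (count_space (Pow {..<N}))"
  and "Measurable.pred (data_space d N) (mean_alarm d N h R m n w)"
proof -
 note sw = set_filter_coin[OF w]
 let ?M = "data_space d N"
 note mc = measurable_cleaned(1)[OF sw(1), of d h] and mi = measurable_cleaned(2)[OF sw(1), of d h I]
 note tc = coin_tests_facts(3)[OF h w mc] and ti = coin_tests_facts(3)[OF h w mi]
 note e5 = measurable_exceeding[of d N "5 * h"] and e2 = measurable_exceeding[of d N "2 * h"]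
 have cP: "countable (Pow {..<N})" "countable (Pow (Pow {..<N}))" "countable (Pow ({..<N} \<times> Pow {..<N}))" by (auto simp: countable_finite)
 have "(%X. (%(Z, W, E). {i\<in>{..<N}. i \<in> snd (snd w) & i \<notin> coin_union (fst (snd w)) & i \<in> Z & (\<forall>f\<in>W. (i, f) \<notin> E)})
   (cleaned d N h (fst w) X, coin_tests d h R w X (cleaned d N h (fst w) X), exceeding d N (5 * h) X)) \<in> measurable ?M (count_space (Pow {..<N}))"
  by (rule measurable_of_info[OF measurable_info_pair[OF mc measurable_info_pair[OF tc e5 cP(2)] cP(1)]]) auto
 thus "surviving_points d N h R w \<in> measurable ?M (count_space (Pow {..<N}))" unfolding surviving_points_def[abs_def] by simp
 have "(%X. (%(Z, W, E). fresh_goods N I w Un {i\<in>{..<N}. i \<in> I & i \<in> snd (snd w) & i \<notin> coin_union (fst (snd w)) & i \<in> Z & (\<forall>f\<in>W. (i, f) \<notin> E)})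
   (cleaned_ideal d N h I (fst w) X, coin_tests d h R w X (cleaned_ideal d N h I (fst w) X), exceeding d N (5 * h) X)) \<in> measurable ?M (count_space (Pow {..<N}))"
  by (rule measurable_of_info[OF measurable_info_pair[OF mi measurable_info_pair[OF ti e5 cP(2)] cP(1)]]) (auto simp: fresh_goods_def)
 thus "surviving_ideal d N h R I w \<in> measurable ?M (count_space (Pow {..<N}))" unfolding surviving_ideal_def[abs_def] by simp
 have "(%X. (%(H, Z, W, E). m < card H \<or> (\<exists>f\<in>W. n <= card {i\<in>{..<N}. i \<in> snd (snd w) & i \<notin> coin_union (fst (snd w)) & i \<in> Z & (i, f) \<in> E}))
   (heavy d N h X, cleaned d N h (fst w) X, coin_tests d h R w X (cleaned d N h (fst w) X), exceeding d N (2 * h) X)) \<in> measurable ?M (count_space UNIV)"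
  by (rule measurable_of_info[OF measurable_info_pair[OF measurable_heavy measurable_info_pair[OF mc measurable_info_pair[OF tc e2 cP(2)] cP(1)] cP(1)]]) auto
 thus "Measurable.pred ?M (mean_alarm d N h R m n w)" unfolding mean_alarm_def[abs_def] by simp
qed

lemma ideal_local:
 assumes h: "6 <= h" and w: "w \<in> set_pmf (filter_coin N R \<rho>)"
  and X: "\<And>i. i \<in> I Un fst w Un coin_union (fst (snd w)) ==> X i = X' i"
 shows "coin_tests d h R w X (cleaned_ideal d N h I (fst w) X) = coin_tests d h R w X' (cleaned_ideal d N h I (fst w) X')"
  and "surviving_ideal d N h R I w X = surviving_ideal d N h R I w X'"
proof -
 note sw = set_filter_coin[OF w]
 have Z: "cleaned_ideal d N h I (fst w) X = cleaned_ideal d N h I (fst w) X'" by (rule cleaned_ideal_local) (use X in auto)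
 have "coin_union (fst (snd w)) <= {..<N}" using sw(4) by (auto simp: coin_union_def)
 hence fin: "finite (coin_union (fst (snd w)))" using finite_subset by blast
 show W: "coin_tests d h R w X (cleaned_ideal d N h I (fst w) X) = coin_tests d h R w X' (cleaned_ideal d N h I (fst w) X')"
  unfolding coin_tests_def Z by (rule filter_tests_local) (use sw(4) fin X in auto)
 have E: "(i, f) \<in> exceeding d N (5 * h) X \<longleftrightarrow> (i, f) \<in> exceeding d N (5 * h) X'"
  if "i \<in> I" "f \<in> coin_tests d h R w X' (cleaned_ideal d N h I (fst w) X')" for i f
 proof -
  have f: "f <= coin_union (fst (snd w))" by (rule coin_tests_facts(1)[OF h w that(2)])
  have "point_sum X f = point_sum X' f" unfolding point_sum_def using X f by (intro ext sum.cong refl) auto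
  moreover have "X i = X' i" using X that by auto
  ultimately show ?thesis by (simp add: exceeding_def exceeds_iff_dot)
 qed
 show "surviving_ideal d N h R I w X = surviving_ideal d N h R I w X'"
  unfolding surviving_ideal_def Z W[unfolded Z] using E by auto
qed

text \<open>On typical data the two runs agree: if no alarm is raised, then for every test some genuine sample passes it with
  room to spare, so the mean has a small inner product with the test direction and all genuine samples pass.\<close>

lemma typical_screening:
 assumes h: "6 <= h" and d: "1 <= d" and w: "w \<in> set_pmf (filter_coin N R \<rho>)"
  and I: "I <= {..<N}" "card I <= m" "2 * m < N"
  and good: "n <= card (fresh_goods N I w)" "card (I Int snd (snd w)) < n" "card (fst w Int I) < card (fst w - I)"
  and reg: "regular d N (%_. mu) I y (2 * h) g"
 defines "X \<equiv> mix I y g" and "Zi \<equiv> cleaned_ideal d N h I (fst w) (mix I y g)"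
 assumes fresh: "\<And>i f. i \<in> fresh_goods N I w ==> f \<in> coin_tests d h R w X Zi ==> \<bar>dot d (centered (%_. mu) g i) (point_sum X f)\<bar> <= h * norm2 d (point_sum X f)"
 shows "mu = (%_. 0) ==> ~ mean_alarm d N h R m n w X"
  and "~ mean_alarm d N h R m n w X ==> surviving_points d N h R w X = surviving_ideal d N h R I w X"
  and "~ mean_alarm d N h R m n w X ==> surviving_ideal d N h R I w X <= {i\<in>Zi - coin_union (fst (snd w)). \<forall>f\<in>coin_tests d h R w X Zi. ~ exceeds (5 * h) (gram d X) i f}"
  and "~ mean_alarm d N h R m n w X ==> dot d mu mu <= h ^ 5 * sqrt d"
proof -
 note sw = set_filter_coin[OF w]
 have CN: "coin_union (fst (snd w)) <= {..<N}" using sw(4) by (auto simp: coin_union_def)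
 have Zi': "cleaned_ideal d N h I (fst w) X = Zi" by (simp add: X_def Zi_def)
 have ceq: "cleaned d N h (fst w) X = Zi" if "dot d mu mu <= h ^ 5 * sqrt d"
  unfolding X_def Zi_def by (rule cleaned_eq_ideal(1)[OF h d reg that I(1) sw(1) good(3)])
 have FZ: "i \<in> Zi" "i < N" "i \<notin> I" "i \<in> snd (snd w)" "i \<notin> coin_union (fst (snd w))" if "i \<in> fresh_goods N I w" for i
  using that by (auto simp: fresh_goods_def Zi_def cleaned_ideal_def)
 have Xd: "dot d (X i) v = dot d (centered (%_. mu) g i) v + dot d mu v" if "i \<in> fresh_goods N I w" for i v
  using dot_centered[of d g i v "%_. mu"] FZ(3)[OF that] by (simp add: X_def mix_def)
 have ex: "(i, f) \<in> exceeding d N c X \<longleftrightarrow> c * norm2 d (point_sum X f) < \<bar>dot d (X i) (point_sum X f)\<bar>"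
  if "i < N" "f \<in> coin_tests d h R w X Zi" for i f c
  using that coin_tests_facts(1)[OF h w that(2)] CN by (auto simp: exceeding_def exceeds_iff_dot)
 have fin: "finite (I Int snd (snd w))" using I(1) finite_subset by blast
 show "~ mean_alarm d N h R m n w X" if mu: "mu = (%_. 0)"
 proof -
  have m0: "dot d mu mu <= h ^ 5 * sqrt d" using mu h by (simp add: dot_def)
  have "card (heavy d N h X) <= m" unfolding X_def by (rule null_not_heavy[OF h _ I(1,2)]) (use reg mu in simp)
  moreover have "~ n <= card {i\<in>{..<N}. i \<in> snd (snd w) & i \<notin> coin_union (fst (snd w)) & i \<in> Zi & (i, f) \<in> exceeding d N (2 * h) X}" (is "~ n <= card ?S")
   if f: "f \<in> coin_tests d h R w X Zi" for f
  proof -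
   have "?S <= I Int snd (snd w)"
   proof
    fix i assume i: "i \<in> ?S"
    show "i \<in> I Int snd (snd w)"
    proof (rule ccontr)
     assume "i \<notin> I Int snd (snd w)"
     hence iF: "i \<in> fresh_goods N I w" using i by (auto simp: fresh_goods_def Zi_def cleaned_ideal_def)
     have "dot d mu (point_sum X f) = 0" using mu by (simp add: dot_def)
     hence "\<bar>dot d (X i) (point_sum X f)\<bar> <= h * norm2 d (point_sum X f)" using fresh[OF iF f] Xd[OF iF] by simp
     moreover have "2 * h * norm2 d (point_sum X f) < \<bar>dot d (X i) (point_sum X f)\<bar>" using ex[of i f "2 * h"] i f by simp
     moreover have "0 <= h * norm2 d (point_sum X f)" using h norm2_nonneg[of d "point_sum X f"] by simp
     ultimately show False by linarith
    qed
   qed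
   hence "card ?S <= card (I Int snd (snd w))" by (intro card_mono fin)
   thus ?thesis using good(2) by linarith
  qed
  ultimately show ?thesis unfolding mean_alarm_def ceq[OF m0] by auto
 qed
 assume na: "~ mean_alarm d N h R m n w X"
 show m0: "dot d mu mu <= h ^ 5 * sqrt d"
  by (rule not_heavy_mean_le[OF h d reg I]) (use na in \<open>auto simp: mean_alarm_def X_def\<close>)
 have pass: "(i, f) \<notin> exceeding d N (5 * h) X" if i: "i \<in> fresh_goods N I w" and f: "f \<in> coin_tests d h R w X Zi" for i f
 proof -
  let ?v = "point_sum X f"
  let ?S = "{i\<in>{..<N}. i \<in> snd (snd w) & i \<notin> coin_union (fst (snd w)) & i \<in> Zi & (i, f) \<in> exceeding d N (2 * h) X}"
  have "card ?S < n" using na f unfolding mean_alarm_def ceq[OF m0] by auto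
  \<comment> \<open>Some fresh \<open>j\<close> stays below level \<open>2 * h\<close>. Noise
    accounts for at most \<open>h\<close>, so the mean is below \<open>3 * h\<close> and every fresh
    point below \<open>4 * h\<close>, hence below the discarding level \<open>5 * h\<close>.\<close>
  hence "~ fresh_goods N I w <= ?S" using card_mono[of ?S "fresh_goods N I w"] good(1) by auto
  then obtain j where j: "j \<in> fresh_goods N I w" "j \<notin> ?S" by auto
  hence "\<bar>dot d (X j) ?v\<bar> <= 2 * h * norm2 d ?v" using ex[OF FZ(2)[OF j(1)] f, of "2 * h"] FZ[OF j(1)] by auto
  hence "\<bar>dot d mu ?v\<bar> <= 3 * h * norm2 d ?v" using Xd[OF j(1), of ?v] fresh[OF j(1) f] by linarith
  hence "\<bar>dot d (X i) ?v\<bar> <= 4 * h * norm2 d ?v" using Xd[OF i, of ?v] fresh[OF i f] by linarith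
  moreover have "0 <= h * norm2 d ?v" using h norm2_nonneg[of d ?v] by simp
  ultimately show ?thesis using ex[OF FZ(2)[OF i] f, of "5 * h"] by auto
 qed
 have ZP: "i \<in> Zi ==> i < N & i \<notin> fst w" for i by (auto simp: Zi_def cleaned_ideal_def)
 show "surviving_points d N h R w X = surviving_ideal d N h R I w X"
 proof (rule set_eqI)
  fix i
  show "i \<in> surviving_points d N h R w X \<longleftrightarrow> i \<in> surviving_ideal d N h R I w X"
  proof (cases "i \<in> fresh_goods N I w")
   case True
   thus ?thesis unfolding surviving_points_def surviving_ideal_def ceq[OF m0] using FZ[OF True] pass[OF True] by simp
  next
   case False
   have "i \<in> I" if "i < N" "i \<in> snd (snd w)" "i \<notin> coin_union (fst (snd w))" "i \<in> Zi"
    using that False ZP[of i] by (auto simp: fresh_goods_def)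
   thus ?thesis unfolding surviving_points_def surviving_ideal_def ceq[OF m0] Zi' using False by blast
  qed
 qed
 show "surviving_ideal d N h R I w X <= {i\<in>Zi - coin_union (fst (snd w)). \<forall>f\<in>coin_tests d h R w X Zi. ~ exceeds (5 * h) (gram d X) i f}"
 proof
  fix i assume i: "i \<in> surviving_ideal d N h R I w X"
  have p: "i < N" "i \<in> Zi" "i \<notin> coin_union (fst (snd w))" "\<And>f. f \<in> coin_tests d h R w X Zi ==> (i, f) \<notin> exceeding d N (5 * h) X"
   using i FZ[of i] pass[of i] unfolding surviving_ideal_def Zi' by auto
  have "~ exceeds (5 * h) (gram d X) i f" if f: "f \<in> coin_tests d h R w X Zi" for f
   using p(4)[OF f] ex[OF p(1) f, of "5 * h"] by (simp add: exceeds_iff_dot)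
  thus "i \<in> {i\<in>Zi - coin_union (fst (snd w)). \<forall>f\<in>coin_tests d h R w X Zi. ~ exceeds (5 * h) (gram d X) i f}" using p by auto
 qed
qed

lemma solves_many_corrupt:
 assumes nd: "2 <= n * d" and hdef: "h = 10 * ln (real n * real d)" and eps: "0 < eps" "eps < 1"
  and big: "h ^ 20 < eps * real n" and half: "2 * num_corrupt eps n < n"
  and sol: "solves_friendly d \<alpha> eps (h ^ 2000) n p A" and p1: "p <= 1"
 shows "\<exists>B. solves_oblivious d \<alpha> (eps / 2) (4 * n) (p - 0.01) B"
proof -
 define N f M m where "N = 4 * n" and "f = num_corrupt eps n" and "M = eps * real n" and "m = num_corrupt (eps / 2) (4 * n)"
 \<comment> \<open>\<open>R\<close> is both the number of rounds with one pool and the number of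
   pools: \<open>N < 2 ^ R\<close> lets \<open>m\<close> drop below 1 in the former, and lets the
   correlation level descend from the trivial bound in the latter.\<close>
 define R where "R = nat \<lceil>h\<rceil>"
 note sc = scale_ge_6[OF nd hdef]
 note tl = scale_tails[OF nd hdef, folded N_def]
 note pd = pow_dominates[OF sc(1)]
 let ?x = "real n * real d" and ?s = "sqrt (real d)"
 have x: "2 <= ?x" using nd by (metis of_nat_le_iff of_nat_mult of_nat_numeral)
 have nx: "real n <= ?x" using sc(2,3) by (auto simp: mult_le_cancel_left1)
 have h0: "0 < h" using sc(1) by simp
 have hk: "1 <= h ^ k" for k using sc(1) by (intro one_le_power) auto
 have s1: "1 <= ?s" using sc(3) by auto
 have Rh: "1 <= R" "h <= real R" "real R <= 2 * h" using sc(1) unfolding R_def by linarith+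
 have M: "h ^ 20 <= M" "M <= real n" "1 <= M" "0 <= M"
 proof -
  show a: "h ^ 20 <= M" using big by (simp add: M_def)
  show "M <= real n" using mult_right_mono[of eps 1 "real n"] eps by (simp add: M_def)
  show "1 <= M" "0 <= M" using a hk[of 20] by linarith+
 qed
 have fM: "M < real f + 1"
 proof -
  have "eps * real n < real_of_int \<lfloor>eps * real n\<rfloor> + 1" by linarith
  moreover have "0 <= \<lfloor>eps * real n\<rfloor>" using eps by simp
  ultimately show ?thesis unfolding M_def f_def num_corrupt_def by (simp add: of_nat_nat)
 qed
 have m2: "real m <= 2 * M"
 proof -
  have "real_of_int \<lfloor>eps / 2 * real (4 * n)\<rfloor> <= eps / 2 * real (4 * n)" by linarith
  moreover have "0 <= \<lfloor>eps / 2 * real (4 * n)\<rfloor>" using eps by simp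
  ultimately show ?thesis unfolding M_def m_def num_corrupt_def by (simp add: of_nat_nat)
 qed
 have mn: "m <= n"
 proof -
  have "2 * real f + 1 <= real n" using half by (simp add: f_def)
  hence "real m < real n + 1" using m2 fM by linarith
  thus ?thesis by linarith
 qed
 have fn: "f < n" using half by (simp add: f_def)
 have N1: "1 <= N" and mN: "2 * m < N" using mn sc(2) by (auto simp: N_def)
 have N2: "real N < 2 ^ R"
 proof -
  have "(2/3) * h <= ln 2 * h" using ln2_ge_two_thirds h0 by (intro mult_right_mono) auto
  also have "... <= ln 2 * real R" using Rh by (intro mult_left_mono) auto
  finally have "exp ((2/3) * h) <= exp (ln 2 * real R)" by simp
  also have "... = 2 ^ R" by (simp add: exp_of_nat2_mult)
  finally have a: "exp ((2/3) * h) <= 2 ^ R" .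
  have "6 * ln ?x <= (2/3) * h" using hdef x by (simp add: ln_ge_zero)
  hence "exp (6 * ln ?x) <= exp ((2/3) * h)" by simp
  moreover have "exp (6 * ln ?x) = ?x ^ 6" using x exp_of_nat_mult[of 6 "ln ?x"] by simp
  ultimately have b: "?x ^ 6 <= 2 ^ R" using a by linarith
  have "(2::real) ^ 5 <= ?x ^ 5" by (rule power_mono) (use x in auto)
  hence "32 * ?x <= ?x ^ 5 * ?x" using x by (intro mult_right_mono) auto
  also have "... = ?x ^ 6" by (simp add: power_Suc2[symmetric])
  finally show ?thesis using b nx x unfolding N_def by simp
 qed
 define coin where "coin = filter_coin N R (1 / h ^ 10)"
 define alarm where "alarm = mean_alarm d N h R m n"
 define kept where "kept = surviving_points d N h R"
 have setc: "w \<in> set_pmf (filter_coin N R (1 / h ^ 10))" if "w \<in> set_pmf coin" for w using that by (simp add: coin_def)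
 have fincoin: "finite (set_pmf coin)" unfolding coin_def by (rule finite_filter_coin)
 have malarm: "Measurable.pred (data_space d N) (alarm w)" if "w \<in> set_pmf coin" for w
  unfolding alarm_def by (rule measurable_surviving(3)[OF sc(1) setc[OF that]])
 have mkept: "kept w \<in> measurable (data_space d N) (count_space (Pow {..<N}))" if "w \<in> set_pmf coin" for w
  unfolding kept_def by (rule measurable_surviving(1)[OF sc(1) setc[OF that]])
 have A: "A \<in> algorithms d n" using sol by (simp add: solves_friendly_def solves_mean_testing_def)
 have "solves_oblivious d \<alpha> (eps / 2) N (p - 0.01) (%X. bind_pmf coin (%w. screen n A alarm kept w X))"
 proof (rule solves_obliviousI)
  show "(%X. bind_pmf coin (%w. screen n A alarm kept w X)) \<in> algorithms d N"
   by (rule screening_algorithm[OF A fincoin malarm mkept])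
  show "eps / 2 <= 1" using eps by simp
  fix mu hyp I y assume adm: "admissible d \<alpha> mu hyp" and I: "I <= {..<N}" "card I = num_corrupt (eps / 2) N" and y: "y \<in> space (data_space d N)"
  have cI: "card I = m" using I by (simp add: m_def N_def)
  let ?E = "gaussian_data d N (%_. mu)"
  define Good where "Good = {w. card (I Int snd (snd w)) <= f & n <= card (fresh_goods N I w) & card (fst w Int I) < card (fst w - I)}"
  define Zi where "Zi w g = cleaned_ideal d N h I (fst w) (mix I y g)" for w :: coins and g
  define Wi where "Wi w g = coin_tests d h R w (mix I y g) (Zi w g)" for w g
  define K where "K w g = surviving_ideal d N h R I w (mix I y g)" for w g
  define NX where "NX = {g\<in>space ?E. ~ regular d N (%_. mu) I y (2 * h) g}"
  define fresh where "fresh w = {g\<in>space ?E. \<exists>i\<in>fresh_goods N I w. \<exists>f\<in>Wi w g. h * norm2 d (point_sum (mix I y g) f) < \<bar>dot d (centered (%_. mu) g i) (point_sum (mix I y g) f)\<bar>}" for w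
  define mx where "mx = max (sqrt (M * real d)) M"
  define fin where "fin w g = fst (run (exceeds (5 * h) (gram d (mix I y g))) (1 / h ^ 10) (h ^ 17 / real R) (h ^ 17) (fst (snd w)) (Zi w g, {}))" for w g
  \<comment> \<open>The initial level \<open>M * (h ^ 7 * sqrt d)\<close> is the trivial bound after
    cleaning, halved \<open>R\<close> times. \<open>gram_bounded\<close> is a conjunct because the
    probability of \<open>lab\<close> must be small for all data outside \<open>NX\<close>, while
    the cleaned points are known to be bounded only when no alarm is raised.\<close>
  define lab where "lab w g \<longleftrightarrow> gram_bounded (gram d (mix I y g)) (h ^ 7 * real d) (h ^ 7 * ?s) (Zi w g) &
    ~ correlation_le (gram d (mix I y g)) M (fin w g) (max (M * (h ^ 7 * ?s) / 2 ^ R) (h ^ 150 * mx))" for w g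
  have mxM: "M <= mx" "sqrt (M * real d) <= mx" "0 < mx" using M by (auto simp: mx_def)
  have freshN: "fresh_goods N I w <= {..<N} - I" for w by (auto simp: fresh_goods_def)
  have agree: "mix I y g i = mix I y g' i" if "\<And>i. i \<notin> fresh_goods N I w ==> g i = g' i" "i \<in> I Un fst w Un coin_union (fst (snd w))" for g g' i and w :: coins
   using that(1)[of i] that(2) by (auto simp: mix_def fresh_goods_def)
  show "ennreal (p - 0.01) <= (\<integral>\<^sup>+g. ennreal (pmf (bind_pmf coin (%w. screen n A alarm kept w (mix I y g))) hyp) \<partial>?E)"
  proof (rule screening_ge[OF sol _ adm I(1) y fincoin malarm mkept, where Good=Good and J="fresh_goods N I" and K=K and NX=NX and ?\<delta>3.0="0.001"
     and fresh=fresh and ?\<delta>4.0="0.001" and lab=lab and ?\<delta>2.0="0.001" and ?\<delta>1.0="0.003"])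
   show "eps <= 1" using eps by simp
   show "fresh_goods N I w <= {..<N} - I" for w by (rule freshN)
   show "K w \<in> measurable (data_space d N) (count_space (Pow {..<N}))" if w: "w \<in> set_pmf coin" for w
    unfolding K_def[abs_def] by (rule measurable_compose[OF measurable_mix_right[OF y] measurable_surviving(2)[OF sc(1) setc[OF w]]])
   show "K w (mix (fresh_goods N I w) g1 g2) = K w (mix (fresh_goods N I w) g1' g2)" if w: "w \<in> set_pmf coin" for w g1 g1' g2
    unfolding K_def by (rule ideal_local(2)[OF sc(1) setc[OF w]]) (rule agree[where w=w], auto simp: mix_def)
   show "n <= card (K w g) & K w g <= fresh_goods N I w Un I & card (K w g Int I) <= num_corrupt eps n" if w: "w \<in> Good" for w g
   proof (intro conjI)
    have Ks: "K w g <= {..<N}" by (auto simp: K_def surviving_ideal_def fresh_goods_def)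
    have "card (fresh_goods N I w) <= card (K w g)"
     by (rule card_mono[OF finite_subset[OF Ks]]) (auto simp: K_def surviving_ideal_def)
    thus "n <= card (K w g)" using w by (simp add: Good_def)
    show "K w g <= fresh_goods N I w Un I" by (auto simp: K_def surviving_ideal_def)
    have "K w g Int I <= I Int snd (snd w)" by (auto simp: K_def surviving_ideal_def fresh_goods_def)
    hence "card (K w g Int I) <= card (I Int snd (snd w))" by (rule card_mono[rotated]) (use I(1) finite_subset in blast)
    thus "card (K w g Int I) <= num_corrupt eps n" using w by (simp add: Good_def f_def)
   qed
   show "NX \<in> sets ?E" unfolding NX_def by (rule prob_not_regular(1)[OF I(1) N1]) (use sc in auto)
   have "measure ?E NX <= 9 * (real N)\<^sup>2 * exp (- ((2 * h)\<^sup>2 / 4))"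
    unfolding NX_def by (rule prob_not_regular(2)[OF I(1) N1]) (use sc in auto)
   also have "exp (- ((2 * h)\<^sup>2 / 4)) = exp (- h\<^sup>2)" by (simp add: power_mult_distrib)
   also have "9 * (real N)\<^sup>2 * exp (- h\<^sup>2) <= 11 * (real N)\<^sup>2 * exp (- h\<^sup>2)" by (intro mult_right_mono) auto
   also note tl(2)
   finally show "measure ?E NX <= 0.001" .
   show "pprob coin {w. w \<notin> Good} <= 0.003"
    using prob_bad_coins[OF sc(1) M(1,2) Rh(3), of I f] I(1) mn m2 cI fM unfolding coin_def Good_def N_def by simp
   show "0.003 + 0.001 + 0.001 + 0.001 <= (0.01::real)" by simp
  next
   fix w assume w: "w \<in> set_pmf coin"
   have V: "(%g. Wi w g) \<in> measurable (data_space d N) (count_space (Pow (Pow {..<N})))"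
    unfolding Wi_def[abs_def] Zi_def
    by (rule measurable_compose[OF measurable_mix_right[OF y] coin_tests_facts(3)[OF sc(1) setc[OF w] measurable_cleaned(2)[OF set_filter_coin(1)[OF setc[OF w]]]]])
   have loc: "Wi w (g(i := u)) = Wi w g" if "i \<in> fresh_goods N I w" for g i u
    unfolding Wi_def Zi_def by (rule ideal_local(1)[OF sc(1) setc[OF w]]) (rule agree[where w=w], use that in auto)
   have av: "f Int fresh_goods N I w = {}" if "f \<in> Wi w g" for f g
    using coin_tests_facts(1)[OF sc(1) setc[OF w], of f d] that unfolding Wi_def fresh_goods_def by auto
   have few: "rcard (Wi w g) <= real (R * (R * N))" for g
    using coin_tests_facts(2)[OF sc(1) setc[OF w], of d "mix I y g" "Zi w g"] unfolding Wi_def by linarith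
   have JN: "fresh_goods N I w <= {..<N}" using freshN[of w] by blast
   note pf = prob_fresh_tests[OF JN V h0 loc av few y]
   show "fresh w \<in> sets ?E" unfolding fresh_def by (rule pf(1)) auto
   have "measure ?E (fresh w) <= real N * (real (R * (R * N)) * (2 * exp (- (h\<^sup>2 / 2))))" unfolding fresh_def by (rule pf(2)) auto
   also have "... = 32 * (real n)\<^sup>2 * (real R * real R) * exp (- (h\<^sup>2 / 2))" by (simp add: N_def power2_eq_square)
   also have "... <= 0.001"
   proof -
    have "real R * real R <= (2 * h) * (2 * h)" using Rh by (intro mult_mono) auto
    also have "... = 4 * h ^ 2" by (simp add: power2_eq_square)
    also have "... <= h ^ 20" by (rule pd[of _ 1]) auto
    also have "... <= ?x" using M nx by linarith
    finally have RR: "real R * real R <= ?x" .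
    have nn: "(real n)\<^sup>2 <= ?x\<^sup>2" using nx by (intro power_mono) auto
    have "(real n)\<^sup>2 * (real R * real R) <= ?x\<^sup>2 * ?x" by (rule mult_mono[OF nn RR]) auto
    also have "... = ?x ^ 3" by (simp add: power3_eq_cube power2_eq_square)
    finally have "32000 * ((real n)\<^sup>2 * (real R * real R)) <= 32000 * ?x ^ 3" by simp
    also have "... <= ?x ^ 27 * ?x ^ 3"
    proof (rule mult_right_mono)
     have "(2::real) ^ 27 <= ?x ^ 27" by (rule power_mono) (use x in auto)
     thus "32000 <= ?x ^ 27" by simp
    qed (use x in simp)
    also have "... = ?x ^ 30" by (simp only: power_add[symmetric]) simp
    finally have a: "32000 * ((real n)\<^sup>2 * (real R * real R)) <= ?x ^ 30" .
    \<comment> \<open>Fresh tests are taken at threshold \<open>h\<close>, so the available factor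
      is only the square root of the one bounded in \<open>scale_ge_6\<close>.\<close>
    have "(?x ^ 30 * exp (- (h\<^sup>2 / 2)))\<^sup>2 = ?x ^ 60 * exp (- h\<^sup>2)"
     by (simp only: power_mult_distrib power_mult[symmetric] exp_double[symmetric]) simp
    hence "(?x ^ 30 * exp (- (h\<^sup>2 / 2)))\<^sup>2 <= 1\<^sup>2" using sc(6) by simp
    hence b: "?x ^ 30 * exp (- (h\<^sup>2 / 2)) <= 1" by (rule power2_le_imp_le) simp
    have "32000 * ((real n)\<^sup>2 * (real R * real R)) * exp (- (h\<^sup>2 / 2)) <= ?x ^ 30 * exp (- (h\<^sup>2 / 2))" using a by (rule mult_right_mono) simp
    hence "32000 * ((real n)\<^sup>2 * (real R * real R)) * exp (- (h\<^sup>2 / 2)) <= 1" using b by linarith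
    thus ?thesis by simp
   qed
   finally show "measure ?E (fresh w) <= 0.001" .
  next
   fix g assume g: "g \<in> space (data_space d N)"
   let ?G = "gram d (mix I y g)"
   interpret am: amplification ?G "{..<N}" M "h ^ 7 * real d" "h ^ 7 * ?s" "5 * h" "1 / h ^ 16" "1 / h ^ 10" h "h ^ 17" "1 / h ^ 68" "h ^ 150 * mx" R
    unfolding mx_def by (rule amplification_parameters[OF sc(1,3) M(3) tl(1) N2 Rh(1,3)])
   let ?e = "real R * (6 * exp (- h) + real R * (12 * exp (- h)))"
   have "pprob coin {w. lab w g} <= ?e"
   proof -
    define Q where "Q P z \<longleftrightarrow> lab (P, z) g" for P z
    have "pprob coin {w. Q (fst w) (snd w)} <= ?e"
     unfolding coin_def filter_coin_def
    proof (rule prob_pair_le)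
     fix P assume P: "P \<in> set_pmf (random_subset (1 / h ^ 10) {..<N})"
     let ?Z = "cleaned_ideal d N h I P (mix I y g)"
     let ?css = "replicate_pmf R (replicate_pmf (Suc R) (random_subset (1 / h ^ 10) {..<N}))"
     show "pprob (pair_pmf ?css (random_subset (2 / 5) {..<N})) {z. Q P z} <= ?e"
     proof (cases "gram_bounded ?G (h ^ 7 * real d) (h ^ 7 * ?s) ?Z")
      case True
      have "correlation_le ?G M ?Z (M * (h ^ 7 * ?s))"
       by (rule correlation_le_pairwise[where B="h ^ 7 * ?s"]) (use True h0 M in \<open>auto simp: gram_bounded_def\<close>)
      moreover have "?Z <= {..<N}" by (auto simp: cleaned_ideal_def)
      moreover define T where "T css \<longleftrightarrow> ~ correlation_le ?G M (fst (run (exceeds (5 * h) ?G) (1 / h ^ 10) (h ^ 17 / real R) (h ^ 17) css (?Z, {})))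
        (max (M * (h ^ 7 * ?s) / 2 ^ R) (h ^ 150 * mx))" for css
      ultimately have r: "pprob ?css {css. T css} <= ?e" unfolding T_def by (intro am.run_prob True)
      have "{z. Q P z} = {z. T (fst z)}"
       using True by (simp add: Q_def lab_def fin_def Zi_def T_def)
      thus ?thesis using r by (simp only: prob_pair_fst)
     next
      case False
      hence "~ Q P z" for z by (simp add: Q_def lab_def Zi_def)
      thus ?thesis by simp
     qed
    qed simp
    thus ?thesis by (simp add: Q_def)
   qed
   also have "?e <= 0.001"
   proof -
    have "real R * (6 + 12 * real R) <= (2 * h) * (h + 12 * (2 * h))" using Rh sc(1) by (intro mult_mono add_mono mult_left_mono) auto
    also have "... = 50 * h ^ 2" by (simp add: power2_eq_square)
    finally have "1000 * (real R * (6 + 12 * real R)) <= 50000 * h ^ 2" by simp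
    also have "... <= h ^ 20" by (rule pd[of _ 7]) auto
    also have "... <= exp h" using M sc(4) by linarith
    finally have "1000 * (real R * (6 + 12 * real R)) * exp (- h) <= exp h * exp (- h)" by (rule mult_right_mono) simp
    hence "1000 * (real R * (6 + 12 * real R)) * exp (- h) <= 1" by (simp add: exp_add[symmetric])
    moreover have "1000 * ?e = 1000 * (real R * (6 + 12 * real R)) * exp (- h)" by (simp add: algebra_simps)
    ultimately have "1000 * ?e <= 1" by (simp only:)
    hence "?e <= 1 / 1000" by linarith
    also have "... <= 0.001" by simp
    finally show ?thesis .
   qed
   finally show "pprob coin {w. lab w g} <= 0.001" .
  next
   fix w g assume w: "w \<in> set_pmf coin" "w \<in> Good" and g: "g \<in> space (data_space d N)" "g \<notin> NX" "g \<notin> fresh w" and nl: "~ lab w g"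
   let ?X = "mix I y g"
   note sw = set_filter_coin[OF setc[OF w(1)]]
   have reg: "regular d N (%_. mu) I y (2 * h) g" using g by (simp add: NX_def space_gaussian_data)
   have good: "n <= card (fresh_goods N I w)" "card (I Int snd (snd w)) < n" "card (fst w Int I) < card (fst w - I)"
    using w(2) fn by (auto simp: Good_def)
   have fr: "\<bar>dot d (centered (%_. mu) g i) (point_sum ?X f)\<bar> <= h * norm2 d (point_sum ?X f)"
    if "i \<in> fresh_goods N I w" "f \<in> coin_tests d h R w ?X (cleaned_ideal d N h I (fst w) ?X)" for i f
   proof (rule ccontr)
    assume "~ ?thesis"
    hence "g \<in> fresh w" unfolding fresh_def Wi_def Zi_def space_gaussian_data using that g(1) by (auto simp: not_le)
    thus False using g(3) by simp
   qed
   have ty1: "~ mean_alarm d N h R m n w ?X" if "mu = (%_. 0)"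
    by (rule typical_screening(1)[OF sc(1,3) setc[OF w(1)] I(1) eq_refl[OF cI] mN good reg fr]) ((assumption | rule that)+)
   have ty2: "surviving_points d N h R w ?X = surviving_ideal d N h R I w ?X" if "~ mean_alarm d N h R m n w ?X"
    by (rule typical_screening(2)[OF sc(1,3) setc[OF w(1)] I(1) eq_refl[OF cI] mN good reg fr]) ((assumption | rule that)+)
   have ty3: "surviving_ideal d N h R I w ?X <= {i\<in>cleaned_ideal d N h I (fst w) ?X - coin_union (fst (snd w)).
     \<forall>f\<in>coin_tests d h R w ?X (cleaned_ideal d N h I (fst w) ?X). ~ exceeds (5 * h) (gram d ?X) i f}" if "~ mean_alarm d N h R m n w ?X"
    by (rule typical_screening(3)[OF sc(1,3) setc[OF w(1)] I(1) eq_refl[OF cI] mN good reg fr]) ((assumption | rule that)+)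
   have ty4: "dot d mu mu <= h ^ 5 * sqrt d" if "~ mean_alarm d N h R m n w ?X"
    by (rule typical_screening(4)[OF sc(1,3) setc[OF w(1)] I(1) eq_refl[OF cI] mN good reg fr]) ((assumption | rule that)+)
   show "alarm w ?X & hyp = Alternative \<or> ~ alarm w ?X & kept w ?X = K w g & friendly_set d (eps * real n) (h ^ 2000) ?X (K w g)"
   proof (cases "alarm w ?X")
    case True
    have "hyp ~= Null"
    proof
     assume "hyp = Null"
     hence "mu = (%_. 0)" using adm by (simp add: admissible_def)
     thus False using ty1 True by (simp add: alarm_def)
    qed
    thus ?thesis using True by (cases hyp) auto
   next
    case False
    hence na: "~ mean_alarm d N h R m n w ?X" by (simp add: alarm_def)
    have keq: "kept w ?X = K w g" unfolding kept_def K_def by (rule ty2[OF na])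
    note mu = ty4[OF na]
    note cl = cleaned_eq_ideal[OF sc(1,3) reg mu I(1) sw(1) good(3), folded Zi_def]
    have nrm: "\<bar>dot d (?X i) (?X i) - d\<bar> <= h ^ 6 * ?s" if "i \<in> Zi w g" for i using cl(2)[OF that] by (simp add: norm_ok_def)
    have sd: "?s <= real d" using s1 mult_right_mono[OF s1, of ?s] by simp
    have gb: "gram_bounded (gram d ?X) (h ^ 7 * real d) (h ^ 7 * ?s) (Zi w g)"
     unfolding gram_bounded_def
    proof (intro conjI allI impI ballI)
     show "0 <= pair_sum (gram d ?X) S S" for S unfolding dot_point_sum[symmetric] by (rule dot_self_nonneg)
     fix i assume i: "i \<in> Zi w g"
     show "0 <= gram d ?X i i" by (simp add: gram_def dot_self_nonneg)
     have "h ^ 6 * ?s <= h ^ 6 * real d" using sd h0 by (intro mult_left_mono) auto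
     moreover have "6 * (h ^ 6 * real d) <= h ^ 7 * real d" using pow_step(1)[OF sc(1), of "real d" 6] by simp
     moreover have "1 * real d <= h ^ 6 * real d" using hk[of 6] by (intro mult_right_mono) auto
     ultimately show "gram d ?X i i <= h ^ 7 * real d" using nrm[OF i] unfolding gram_def by linarith
     show "\<bar>gram d ?X i j\<bar> <= h ^ 7 * ?s" if "j \<in> Zi w g" "i ~= j" for j using cl(3)[OF i that] by (simp add: gram_def)
    qed
    hence cor: "correlation_le (gram d ?X) M (fin w g) (max (M * (h ^ 7 * ?s) / 2 ^ R) (h ^ 150 * mx))" using nl by (simp add: lab_def)
    have finw: "fin w g = {i\<in>Zi w g - coin_union (fst (snd w)). \<forall>f\<in>Wi w g. ~ exceeds (5 * h) (gram d ?X) i f}"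
    proof -
     have "surviving (exceeds (5 * h) (gram d ?X)) (Zi w g, {})" by (simp add: surviving_def)
     moreover have "\<forall>cs\<in>set (fst (snd w)). cs ~= []" using sw(4) by auto
     ultimately show ?thesis
      using run_surviving[of "exceeds (5 * h) (gram d ?X)" "(Zi w g, {})" "fst (snd w)" "1 / h ^ 10" "h ^ 17 / real R" "h ^ 17"]
      unfolding fin_def Wi_def coin_tests_def filter_tests_def coin_union_def by simp
    qed
    have KF: "K w g <= fin w g" unfolding finw K_def Wi_def Zi_def by (rule ty3[OF na])
    hence KZ: "i \<in> Zi w g" if "i \<in> K w g" for i using that finw by auto
    have hp: "h ^ k <= h ^ 2000" if "k <= 2000" for k using sc(1) that by (intro power_increasing) auto
    have hps: "h ^ k * ?s <= h ^ 2000 * ?s" if "k <= 2000" for k using hp[OF that] s1 by (intro mult_right_mono) auto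
    have "correlation_le (gram d ?X) M (K w g) (h ^ 2000 * mx)"
    proof (rule correlation_le_subset[OF cor KF])
     have t150: "h ^ 150 * mx <= h ^ 2000 * mx" using hp[of 150] mxM by (intro mult_right_mono) auto
     have "M * (h ^ 7 * ?s) / 2 ^ R <= h ^ 7 * ?s"
     proof -
      have "M <= 2 ^ R" using M(2) N2 unfolding N_def by linarith
      hence "M * (h ^ 7 * ?s) <= 2 ^ R * (h ^ 7 * ?s)" using h0 by (intro mult_right_mono) auto
      thus ?thesis by (simp add: divide_le_eq mult_ac)
     qed
     also have "... <= h ^ 150 * mx"
     proof (rule mult_mono)
      show "h ^ 7 <= h ^ 150" using sc(1) by (intro power_increasing) auto
      have "?s <= sqrt (M * real d)" using M(3) by (intro real_sqrt_le_mono) (simp add: mult_le_cancel_right1)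
      thus "?s <= mx" using mxM by linarith
     qed (use h0 in auto)
     finally show "max (M * (h ^ 7 * ?s) / 2 ^ R) (h ^ 150 * mx) <= h ^ 2000 * mx" using t150 by simp
    qed
    moreover have "\<bar>dot d (?X i) (?X j)\<bar> <= h ^ 2000 * ?s" if "i \<in> K w g" "j \<in> K w g" "i ~= j" for i j
     by (rule order_trans[OF cl(3)[OF KZ[OF that(1)] KZ[OF that(2)] that(3)] hps]) simp
    moreover have "\<bar>dot d (?X i) (?X i) - d\<bar> <= h ^ 2000 * ?s" if "i \<in> K w g" for i
     by (rule order_trans[OF nrm[OF KZ[OF that]] hps]) simp
    ultimately have "friendly_set d (eps * real n) (h ^ 2000) ?X (K w g)"
     unfolding friendly_set_def M_def[symmetric] mx_def[symmetric] by blast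
    thus ?thesis using False keq by blast
   qed
  qed (use p1 in auto)
 qed
 thus ?thesis unfolding N_def by blast
qed

section \<open>Combination of the regimes\<close>

text \<open>Any single instance shows this; here the mean is zero and no position is
  corrupted.\<close>

lemma solves_friendly_prob_le_1:
 assumes "solves_friendly d \<alpha> eps \<kappa> n p A" "eps <= 1"
 shows "p <= 1"
proof -
 let ?G = "friendly d eps n \<kappa>"
 have s: "solves_mean_testing d \<alpha> eps n ?G p A" using assms(1) by (simp add: solves_friendly_def)
 define y :: "nat => nat => real" where "y = (\<lambda>i\<in>{..<n}. \<lambda>j\<in>{..<d}. 0)"
 have y: "y \<in> space (data_space d n)" by (auto simp: y_def space_data_space point_space_def space_PiM)
 have "ennreal p <= (\<integral>\<^sup>+g. perm_avg n (%X. ennreal (correct_mass ?G A Null X)) (mix {} y g) \<partial>gaussian_data d n (%_ _. 0))"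
  by (rule solves_mean_testing_ge[OF s measurable_friendly assms(2) _ _ _ y]) (auto simp: admissible_def)
 also have "... <= (\<integral>\<^sup>+g. 1 \<partial>gaussian_data d n (%_ _. 0))"
  by (intro nn_integral_mono perm_avg_le_1) (simp add: correct_mass_bounds)
 also have "... = 1" by (simp add: prob_space.emeasure_space_1[OF prob_space_gaussian_data])
 finally show ?thesis by simp
qed

theorem theorem3p2:
  shows "\<exists>Q :: real poly. \<forall>(d :: nat) (n :: nat) (\<alpha> :: real) (\<epsilon> :: real) (p :: real).
    2 \<le> n * d \<longrightarrow> 0 < \<alpha> \<longrightarrow> 0 < \<epsilon> \<longrightarrow> \<epsilon> < 1 \<longrightarrow> 2 / 3 < p \<longrightarrow>
    real n \<le> (1.1 :: real) ^ d \<longrightarrow>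
    (\<exists>A. solves_friendly d \<alpha> \<epsilon> ((10 * ln (real n * real d)) ^ 2000) n p A) \<longrightarrow>
    (\<exists>N B. real N \<le> real n * poly Q (ln (real n * real d)) \<and>
           solves_oblivious d \<alpha> (\<epsilon> / 2) N (p - 0.01) B)"
proof (rule exI[of _ "[:4:]"], intro allI impI)
 fix d n :: nat and \<alpha> eps p :: real
 assume nd: "2 <= n * d" and \<alpha>: "0 < \<alpha>" and eps: "0 < eps" "eps < 1" and p: "2 / 3 < p"
  and "\<exists>A. solves_friendly d \<alpha> eps ((10 * ln (real n * real d)) ^ 2000) n p A"
 define h where "h = 10 * ln (real n * real d)"
 obtain A where sol: "solves_friendly d \<alpha> eps (h ^ 2000) n p A"
  using \<open>\<exists>A. solves_friendly d \<alpha> eps ((10 * ln (real n * real d)) ^ 2000) n p A\<close> unfolding h_def by (rule exE)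
 have p1: "p <= 1" by (rule solves_friendly_prob_le_1[OF sol]) (use eps in simp)
 have "\<exists>k\<le>4. \<exists>B. solves_oblivious d \<alpha> (eps / 2) (k * n) (p - 0.01) B"
 proof (cases "n <= 2 * num_corrupt eps n")
  case True
  show ?thesis by (rule exI[of _ 4], rule conjI[OF order_refl])
    (rule solves_large_mean[OF nd h_def eps no_small_mean[OF nd h_def eps True sol p \<alpha>] \<alpha> p1])
 next
  case False
  hence half: "2 * num_corrupt eps n < n" by simp
  show ?thesis
  proof (cases "eps * real n <= h ^ 20")
   case True
   show ?thesis by (rule exI[of _ 2], rule conjI[OF _ solves_few_corrupt[OF nd h_def eps True half sol p1]]) simp
  next
   case False
   hence big: "h ^ 20 < eps * real n" by simp
   show ?thesis by (rule exI[of _ 4], rule conjI[OF order_refl]) (rule solves_many_corrupt[OF nd h_def eps big half sol p1])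
  qed
 qed
 then obtain k B where k: "k <= 4" and B: "solves_oblivious d \<alpha> (eps / 2) (k * n) (p - 0.01) B" by blast
 have "real k * real n <= 4 * real n" using k by (intro mult_right_mono) auto
 hence "real (k * n) <= real n * poly [:4:] (ln (real n * real d))" by (simp add: mult.commute)
 thus "\<exists>N B. real N <= real n * poly [:4:] (ln (real n * real d)) & solves_oblivious d \<alpha> (eps / 2) N (p - 0.01) B"
  using B by blast
qed

end
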